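(* Let $H=(h_1,\dots,h_m)$ be a positive marking of a rotational datum, let $I\subset\{1,\dots,m\}$ be an active support, and let $Y=\sum_{\ell\in I}t_\ell E_\ell(H)$ with $t_\ell>0$ for all $\ell\in I$. Let $A=A_{H,Y}\subset\mathbb Z^I$ be the signed exponent configuration; by the marker-cancellation criterion, for $i<j$ in $I$ and $\varepsilon,\delta\in\{\pm1\}$, $\varepsilon e_i+\delta e_j\in A$ if and only if $\{i,j\}$ is an edge of $\Gamma_H$ and $h_j/\lambda_j(h_j)\neq\varepsilon\delta\,h_i/\lambda_i(h_i)$. Put $L_A=\operatorname{span}_{\mathbb Z}(A)$. After complexification and projection to joint eigenspaces, the angular map $F_Y=\mu_H|_{T_Y}$ takes the Laurent monomial form $$(s_\ell)_{\ell\in I}\longmapsto\bigl(a_\alpha(H,Y)\,s^\alpha\bigr)_{\alpha\in A},\qquad s_\ell=e^{\sqrt{-1}\,\theta_\ell},$$ where each $a_\alpha(H,Y)$, $\alpha=\varepsilon e_i+\delta e_j$, is nonzero and lies in $\mathfrak b_{\mathbb C}\wedge L_i^\varepsilon\wedge L_j^\delta$, these summands being distinct for distinct $\alpha$. Moreover: (a) At every point of $T_Y$, $\operatorname{rank}_{\mathbb R}dF_Y=\dim_{\mathbb Q}\operatorname{span}_{\mathbb Q}A=\operatorname{rank}L_A$. (b) Identifying $T_Y$ with $\mathbb T^I$ by the angles $\theta$, the fibres of $F_Y$ are the cosets of $K_A$, and $F_Y$ factors through a smooth embedding $\mathbb T^I/K_A\hookrightarrow X_H\otimes_{\mathbb R}\mathbb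 C$ whose image is a translate (in the monomial coordinates) of a compact torus of dimension $\operatorname{rank}L_A$. The component group of $K_A$ is Pontryagin dual to $L_A^{\mathrm{sat}}/L_A$, where $L_A^{\mathrm{sat}}=(\operatorname{span}_{\mathbb Q}A)\cap\mathbb Z^I$. (c) The joint Newton polytope of the coordinate collection of $F_Y$ is $\operatorname{Newt}(F_Y)=\operatorname{conv}(A)$. (d) Let $M_A$ be the $|I|\times|A|$ integer matrix whose columns are the vectors of $A$ and let $\Lambda_A=\ker_{\mathbb Z}M_A=\{c\in\mathbb Z^A:\sum_\alpha c_\alpha\alpha=0\}$. In scalar eigencoordinates, with coefficients $a_\alpha\in\mathbb C^*$, the Zariski closure in $(\mathbb C^* )^A$ of $F_Y(T_Y)$ is the translated subtorus $$X_A=\{y\in(\mathbb C^* )^A:y^c=a^c\ \ \forall c\in\Lambda_A\},\qquad y^c=\prod_\alpha y_\alpha^{c_\alpha},\quad a^c=\prod_\alpha a_\alpha^{c_\alpha};$$ equivalently, $X_A$ is cut out by the Laurent binomials $\prod_{c_\alpha>0}y_\alpha^{c_\alpha}-\bigl(\prod_\alpha a_\alpha^{c_\alpha}\bigr)\prod_{c_\alpha<0}y_\alpha^{-c_\alpha}$, $c\in\Lambda_A$. (e) These invariants are computed by Smith normal form: if $U,W$ are unimodular integer matrices with $UM_AW=\operatorname{diag}(d_1,\dots,d_q,0,\dots,0)$, with $d_1,\dots,d_q$ positive integers and $d_1\mid\cdots\mid d_q$, then $q=\operatorname{rank}L_A$, $L_A^{\mathrm{sat}}/L_A\cong\bigoplus_{j=1}^q\mathbb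 Z/d_j\mathbb Z$, $K_A\cong\mathbb T^{|I|-q}\times\prod_{j=1}^q\mathbb Z/d_j\mathbb Z$ (noncanonically), the last $|A|-q$ columns of $W$ form a $\mathbb Z$-basis of $\Lambda_A$, and the corresponding $|A|-q$ binomials generate the defining ideal of $X_A$ in the Laurent polynomial ring $\mathbb C[y_\alpha^{\pm1}:\alpha\in A]$.
   Context: Rotational datum: a finite-dimensional real abelian Lie algebra $\mathfrak b$; an orthogonal direct sum $V=\bigoplus_{\ell=1}^m P_\ell$ of oriented Euclidean two-planes; nonzero weights $\lambda_\ell\in\mathfrak b^*$. $J_\ell$ is the positive quarter-turn on $P_\ell$, $(e_\ell,f_\ell)=(e_\ell,J_\ell e_\ell)$ an oriented orthonormal basis of $P_\ell$, $\Omega_\ell=e_\ell\wedge f_\ell$. (In $\mathbb Z^I$ the symbols $e_i$ denote standard basis vectors.) Let $\mathfrak g=\mathfrak b\oplus V\oplus\mathfrak b^*$ with bracket $[b,b']=0$, $[b,u]=\rho(b)u$ where $\rho(b)|_{P_\ell}=\lambda_\ell(b)J_\ell$, $[u,v]=\beta(u,v)\in\mathfrak b^*$ with $\beta(u,v)(b)=\langle\rho(b)u,v\rangle$, and $\mathfrak b^*$ central. A positive marking is $H=(h_\ell)\in\mathfrak b^m$ with $\lambda_\ell(h_\ell)>0$ for all $\ell$. Put $S_H=\bigoplus_\ell h_\ell\wedge P_\ell\subset\Lambda^2\mathfrak g$, $E_\ell(H)=2\lambda_\ell(h_\ell)h_\ell\wedge\Omega_\ell$, $X_H=\bigoplus_{i<j}\mathfrak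 b\wedge P_i\wedge P_j\subset\Lambda^3\mathfrak g$. For $r=\sum_\ell h_\ell\wedge u_\ell\in S_H$ the Schouten square splits as $[r,r]=\Phi_H(r)+\mu_H(r)$ with $\Phi_H(r)=\sum_\ell\|u_\ell\|^2E_\ell(H)$ and $\mu_H(r)=2\sum_{i<j}(\lambda_j(h_i)h_j\wedge u_i\wedge J_ju_j-\lambda_i(h_j)h_i\wedge J_iu_i\wedge u_j)\in X_H$. For $Y$ as in the claim, $T_Y=\Phi_H^{-1}(Y)$ is the set of $r$ with $u_\ell=\sqrt{t_\ell}(\cos\theta_\ell e_\ell+\sin\theta_\ell f_\ell)$ for $\ell\in I$ and $u_\ell=0$ for $\ell\notin I$; it is identified with $\mathbb T^I$, $\mathbb T=\mathbb R/2\pi\mathbb Z$, via $\theta$. $\Gamma_H$ is the graph on $\{1,\dots,m\}$ in which $\{i,j\}$, $i\ne j$, is an edge iff $\lambda_j(h_i)\ne0$ or $\lambda_i(h_j)\neq0$. Complexify: $P_{\ell,\mathbb C}=L_\ell^+\oplus L_\ell^-$ with $J_\ell=\varepsilon\sqrt{-1}$ on $L_\ell^\varepsilon$, with eigenvectors $v_\ell^\pm=(e_\ell\mp\sqrt{-1}f_\ell)/\sqrt2$ and coordinates $z_\ell^\pm$. The component of $\mu_H$ in $\mathfrak b_{\mathbb C}\wedge L_i^\varepsilon\wedge L_j^\delta$ ($i<j$) is $c_{ij}^{\varepsilon\delta}(H)z_i^\varepsilon z_j^\delta$ (times $v_i^\varepsilon\wedge v_j^\delta$), where $c_{ij}^{\varepsilon\delta}(H)=2\sqrt{-1}\bigl(\delta\lambda_j(h_i)h_j-\varepsilon\lambda_i(h_j)h_i\bigr)\in\mathfrak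 b_{\mathbb C}$. $A_{H,Y}=\{\varepsilon e_i+\delta e_j\in\mathbb Z^I: i<j,\ i,j\in I,\ \varepsilon,\delta\in\{\pm1\},\ c_{ij}^{\varepsilon\delta}(H)\ne0\}$; $K_A=\{\theta\in\mathbb T^I:e^{\sqrt{-1}\langle\alpha,\theta\rangle}=1\ \forall\alpha\in A_{H,Y}\}$. If $A_{H,Y}=\varnothing$, then $\operatorname{rank}L_A=0$, $K_A=\mathbb T^I$, $\operatorname{conv}(A)=\varnothing$. The joint Newton polytope of a collection of Laurent monomials is the convex hull of the union of their exponent supports. Scalar eigencoordinates: for each $\alpha=\varepsilon e_i+\delta e_j\in A$ one fixes a nonzero vector spanning the complex line through $c_{ij}^{\varepsilon\delta}(H)\wedge v_i^\varepsilon\wedge v_j^\delta$; $y_\alpha$ is the coordinate along it and $a_\alpha\in\mathbb C^*$ the resulting scalar coefficient of $s^\alpha$. *)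

theory Defs
  imports
    "HOL-Analysis.Analysis"
    "HOL-Library.Poly_Mapping"
    "HOL-Algebra.Product_Groups"
    "HOL-Algebra.Ideal"
    "Jordan_Normal_Form.Determinant"
begin

no_notation vec_index (infixl "$" 100)

section \<open>Exterior powers and complexification\<close>

type_synonym 'g dual = "'g \<Rightarrow>\<^sub>L real"

lift_definition eval_at :: "'g::real_normed_vector \<Rightarrow> 'g dual dual" is "\<lambda>x \<phi>. blinfun_apply \<phi> x"
  by (rule blinfun.bounded_linear_left)

lift_definition tensor :: "'g::real_normed_vector dual \<Rightarrow> 'w::real_normed_vector \<Rightarrow> 'g \<Rightarrow>\<^sub>L 'w"
  is "\<lambda>f w x. f x *\<^sub>R w"
  by (rule bounded_linear_scaleR_const)

text \<open>
  For finite-dimensional \<open>'g\<close>, the tensor powers of \<open>'g\<close> are the multilinear forms on the dual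
  space, and the exterior powers are the antisymmetric tensors among them.  Applied to functionals
  \<open>\<phi>\<close>, \<open>\<psi>\<close>, \<open>\<chi>\<close>, the tensor \<open>wedge3 x y z\<close> is the determinant of the
  matrix of values of \<open>\<phi>\<close>, \<open>\<psi>\<close>, \<open>\<chi>\<close> at \<open>x\<close>, \<open>y\<close>, \<open>z\<close>.
\<close>

type_synonym 'g tensor2 = "'g dual \<Rightarrow>\<^sub>L 'g dual \<Rightarrow>\<^sub>L real"
type_synonym 'g tensor3 = "'g dual \<Rightarrow>\<^sub>L 'g tensor2"

definition tensor2 :: "'g::real_normed_vector \<Rightarrow> 'g \<Rightarrow> 'g tensor2" where
  "tensor2 x y = tensor (eval_at x) (eval_at y)"

definition tensor3 :: "'g::real_normed_vector \<Rightarrow> 'g \<Rightarrow> 'g \<Rightarrow> 'g tensor3" where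
  "tensor3 x y z = tensor (eval_at x) (tensor2 y z)"

definition wedge2 :: "'g::real_normed_vector \<Rightarrow> 'g \<Rightarrow> 'g tensor2" where
  "wedge2 x y = tensor2 x y - tensor2 y x"

definition wedge3 :: "'g::real_normed_vector \<Rightarrow> 'g \<Rightarrow> 'g \<Rightarrow> 'g tensor3" where
  "wedge3 x y z = tensor3 x y z + tensor3 y z x + tensor3 z x y
                - tensor3 y x z - tensor3 x z y - tensor3 z y x"

text \<open>The complexification of a real vector space: \<open>(x, y)\<close> stands for \<open>x + \<i> y\<close>.\<close>

type_synonym 'w cplx = "'w \<times> 'w"

definition cscale :: "complex \<Rightarrow> 'w::real_vector cplx \<Rightarrow> 'w cplx" where
  "cscale c p = (Re c *\<^sub>R fst p - Im c *\<^sub>R snd p, Re c *\<^sub>R snd p + Im c *\<^sub>R fst p)"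

interpretation cplx: vector_space "cscale :: complex \<Rightarrow> 'w::real_vector cplx \<Rightarrow> 'w cplx"
  by unfold_locales
    (auto simp: cscale_def prod_eq_iff algebra_simps)

text \<open>The complex-trilinear extension of \<^const>\<open>wedge3\<close>.\<close>

definition cwedge3 :: "'g::real_normed_vector cplx \<Rightarrow> 'g cplx \<Rightarrow> 'g cplx \<Rightarrow> 'g tensor3 cplx" where
  "cwedge3 x y z =
    (wedge3 (fst x) (fst y) (fst z) - wedge3 (fst x) (snd y) (snd z)
      - wedge3 (snd x) (fst y) (snd z) - wedge3 (snd x) (snd y) (fst z),
     wedge3 (snd x) (fst y) (fst z) + wedge3 (fst x) (snd y) (fst z)
      + wedge3 (fst x) (fst y) (snd z) - wedge3 (snd x) (snd y) (snd z))"


section \<open>Rotational data\<close>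

text \<open>
  The index set \<open>{1, \<dots>, m}\<close> is a finite linearly ordered type \<open>'l\<close>.  The abelian Lie
  algebra is \<open>'b\<close> (only its vector space structure and topology matter, not the inner product of
  the type class).  An orientation of a Euclidean plane \<open>P l\<close> is given by its positive
  quarter-turn \<open>J l\<close>, whose values off \<open>P l\<close> are irrelevant.
\<close>

definition quarter_turn :: "'v::euclidean_space set \<Rightarrow> ('v \<Rightarrow> 'v) \<Rightarrow> bool" where
  "quarter_turn S j \<longleftrightarrow>
     (\<forall>u\<in>S. j u \<in> S \<and> norm (j u) = norm u \<and> u \<bullet> j u = 0) \<and>
     (\<forall>u\<in>S. \<forall>v\<in>S. j (u + v) = j u + j v) \<and>
     (\<forall>c. \<forall>u\<in>S. j (c *\<^sub>R u) = c *\<^sub>R j u)"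

definition rotational_datum ::
  "('l \<Rightarrow> 'v::euclidean_space set) \<Rightarrow> ('l \<Rightarrow> 'v \<Rightarrow> 'v) \<Rightarrow> ('l \<Rightarrow> 'b::euclidean_space dual) \<Rightarrow> bool" where
  "rotational_datum P J lam \<longleftrightarrow>
     (\<forall>l. subspace (P l) \<and> dim (P l) = 2 \<and> quarter_turn (P l) (J l)) \<and>
     (\<forall>i j. i \<noteq> j \<longrightarrow> (\<forall>u\<in>P i. \<forall>v\<in>P j. u \<bullet> v = 0)) \<and>
     span (\<Union>l. P l) = UNIV \<and>
     (\<forall>l. lam l \<noteq> 0)"

definition unit_frame :: "('l \<Rightarrow> 'v::euclidean_space set) \<Rightarrow> ('l \<Rightarrow> 'v) \<Rightarrow> bool" where
  "unit_frame P e \<longleftrightarrow> (\<forall>l. e l \<in> P l \<and> norm (e l) = 1)"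

definition positive_marking :: "('l \<Rightarrow> 'b::euclidean_space dual) \<Rightarrow> ('l \<Rightarrow> 'b) \<Rightarrow> bool" where
  "positive_marking lam h \<longleftrightarrow> (\<forall>l. lam l (h l) > 0)"

type_synonym ('b, 'v) lie = "'b \<times> 'v \<times> 'b dual"

definition in_b :: "'b::euclidean_space \<Rightarrow> ('b, 'v::euclidean_space) lie" where
  "in_b b = (b, 0, 0)"

definition in_v :: "'v::euclidean_space \<Rightarrow> ('b::euclidean_space, 'v) lie" where
  "in_v u = (0, u, 0)"

text \<open>The rotation action; \<open>e\<close> is used only to write out the components of \<open>u\<close> in the planes.\<close>

definition plane_part :: "('l \<Rightarrow> 'v::euclidean_space \<Rightarrow> 'v) \<Rightarrow> ('l \<Rightarrow> 'v) \<Rightarrow> 'l \<Rightarrow> 'v \<Rightarrow> 'v" where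
  "plane_part J e l u = (u \<bullet> e l) *\<^sub>R e l + (u \<bullet> J l (e l)) *\<^sub>R J l (e l)"

definition rho :: "('l::finite \<Rightarrow> 'v::euclidean_space \<Rightarrow> 'v) \<Rightarrow> ('l \<Rightarrow> 'v) \<Rightarrow>
    ('l \<Rightarrow> 'b::euclidean_space dual) \<Rightarrow> 'b \<Rightarrow> 'v \<Rightarrow> 'v" where
  "rho J e lam b u = (\<Sum>l\<in>UNIV. lam l b *\<^sub>R J l (plane_part J e l u))"

definition lie_bracket :: "('l::finite \<Rightarrow> 'v::euclidean_space \<Rightarrow> 'v) \<Rightarrow> ('l \<Rightarrow> 'v) \<Rightarrow>
    ('l \<Rightarrow> 'b::euclidean_space dual) \<Rightarrow> ('b, 'v) lie \<Rightarrow> ('b, 'v) lie \<Rightarrow> ('b, 'v) lie" where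
  "lie_bracket J e lam x y = (case (x, y) of ((b, u, _), (b', u', _)) \<Rightarrow>
     (0, rho J e lam b u' - rho J e lam b' u, Blinfun (\<lambda>c. rho J e lam c u \<bullet> u')))"

text \<open>The Schouten bracket of \<open>x \<and> y\<close> with \<open>z \<and> w\<close>.\<close>

definition schouten where
  "schouten J e lam x y z w =
     wedge3 (lie_bracket J e lam x z) y w - wedge3 (lie_bracket J e lam x w) y z
   - wedge3 (lie_bracket J e lam y z) x w + wedge3 (lie_bracket J e lam y w) x z"

definition marked_bivector :: "('l::finite \<Rightarrow> 'b::euclidean_space) \<Rightarrow> ('l \<Rightarrow> 'v::euclidean_space) \<Rightarrow>
    ('b, 'v) lie tensor2" where
  "marked_bivector h u = (\<Sum>l\<in>UNIV. wedge2 (in_b (h l)) (in_v (u l)))"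

definition S_space :: "('l::finite \<Rightarrow> 'v::euclidean_space set) \<Rightarrow> ('l \<Rightarrow> 'b::euclidean_space) \<Rightarrow>
    ('b, 'v) lie tensor2 set" where
  "S_space P h = {marked_bivector h u | u. \<forall>l. u l \<in> P l}"

text \<open>The \<open>u\<^sub>l\<close> in \<open>r = \<Sum>\<^sub>l h\<^sub>l \<and> u\<^sub>l\<close>; unique, since a positive marking has no zero entry.\<close>

definition components :: "('l::finite \<Rightarrow> 'v::euclidean_space set) \<Rightarrow> ('l \<Rightarrow> 'b::euclidean_space) \<Rightarrow>
    ('b, 'v) lie tensor2 \<Rightarrow> 'l \<Rightarrow> 'v" where
  "components P h r = (THE u. (\<forall>l. u l \<in> P l) \<and> r = marked_bivector h u)"

definition E_vec :: "('l \<Rightarrow> 'v::euclidean_space \<Rightarrow> 'v) \<Rightarrow> ('l \<Rightarrow> 'b::euclidean_space dual) \<Rightarrow> ('l \<Rightarrow> 'v) \<Rightarrow>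
    ('l \<Rightarrow> 'b) \<Rightarrow> 'l \<Rightarrow> ('b, 'v) lie tensor3" where
  "E_vec J lam e h l =
     (2 * lam l (h l)) *\<^sub>R wedge3 (in_b (h l)) (in_v (e l)) (in_v (J l (e l)))"

definition Phi_of :: "('l::finite \<Rightarrow> 'v::euclidean_space \<Rightarrow> 'v) \<Rightarrow> ('l \<Rightarrow> 'b::euclidean_space dual) \<Rightarrow>
    ('l \<Rightarrow> 'v) \<Rightarrow> ('l \<Rightarrow> 'b) \<Rightarrow> ('l \<Rightarrow> 'v) \<Rightarrow> ('b, 'v) lie tensor3" where
  "Phi_of J lam e h u = (\<Sum>l\<in>UNIV. (norm (u l))\<^sup>2 *\<^sub>R E_vec J lam e h l)"

definition mu_of :: "('l::{finite,linorder} \<Rightarrow> 'v::euclidean_space \<Rightarrow> 'v) \<Rightarrow>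
    ('l \<Rightarrow> 'b::euclidean_space dual) \<Rightarrow> ('l \<Rightarrow> 'b) \<Rightarrow> ('l \<Rightarrow> 'v) \<Rightarrow> ('b, 'v) lie tensor3" where
  "mu_of J lam h u = 2 *\<^sub>R (\<Sum>(i, j)\<in>{(i, j). i < j}.
      lam j (h i) *\<^sub>R wedge3 (in_b (h j)) (in_v (u i)) (in_v (J j (u j)))
    - lam i (h j) *\<^sub>R wedge3 (in_b (h i)) (in_v (J i (u i))) (in_v (u j)))"

definition Phi where
  "Phi P J lam e h r = Phi_of J lam e h (components P h r)"

definition mu where
  "mu P J lam h r = mu_of J lam h (components P h r)"

lemma eval_at_simps:
  "eval_at (x + y) = eval_at x + eval_at y" "eval_at (c *\<^sub>R x) = c *\<^sub>R eval_at x"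
  by (rule blinfun_eqI, simp add: eval_at.rep_eq blinfun.bilinear_simps)+

lemma tensor_simps:
  "tensor (f + g) w = tensor f w + tensor g w" "tensor f (w + w') = tensor f w + tensor f w'"
  "tensor (c *\<^sub>R f) w = c *\<^sub>R tensor f w" "tensor f (c *\<^sub>R w) = c *\<^sub>R tensor f w"
  by (rule blinfun_eqI, simp add: tensor.rep_eq blinfun.bilinear_simps algebra_simps)+

lemma wedge3_add:
  "wedge3 (x + x') y z = wedge3 x y z + wedge3 x' y z"
  "wedge3 x (y + y') z = wedge3 x y z + wedge3 x y' z"
  "wedge3 x y (z + z') = wedge3 x y z + wedge3 x y z'"
  by (simp_all add: wedge3_def tensor3_def tensor2_def eval_at_simps tensor_simps)

lemma wedge3_scale:
  "wedge3 (c *\<^sub>R x) y z = c *\<^sub>R wedge3 x y z"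
  "wedge3 x (c *\<^sub>R y) z = c *\<^sub>R wedge3 x y z"
  "wedge3 x y (c *\<^sub>R z) = c *\<^sub>R wedge3 x y z"
  by (simp_all add: wedge3_def tensor3_def tensor2_def eval_at_simps tensor_simps algebra_simps)

lemma wedge3_swap:
  "wedge3 y x z = - wedge3 x y z" "wedge3 x z y = - wedge3 x y z"
  by (simp_all add: wedge3_def)

lemma wedge3_same: "wedge3 x y y = 0"
  by (simp add: wedge3_def)

lemma wedge3_zero: "wedge3 0 y z = 0"
  using wedge3_scale(1)[of 0 0 y z] by simp

lemma plane_part_simps:
  assumes "rotational_datum P J lam" "unit_frame P e"
  shows "u \<in> P l \<Longrightarrow> plane_part J e l u = u"
    and "u \<in> P k \<Longrightarrow> k \<noteq> l \<Longrightarrow> plane_part J e l u = 0"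
proof -
  have sub: "subspace (P l)" and dim: "dim (P l) = 2" and q: "quarter_turn (P l) (J l)"
    and orth: "\<And>i j u v. i \<noteq> j \<Longrightarrow> u \<in> P i \<Longrightarrow> v \<in> P j \<Longrightarrow> u \<bullet> v = 0"
    using assms(1) by (auto simp: rotational_datum_def)
  have e: "e l \<in> P l" "norm (e l) = 1"
    using assms(2) by (auto simp: unit_frame_def)
  define f where "f = J l (e l)"
  have f: "f \<in> P l" "norm f = 1" "e l \<bullet> f = 0"
    using q e by (auto simp: quarter_turn_def f_def)
  have ee: "e l \<bullet> e l = 1" "f \<bullet> f = 1"
    using e f by (simp_all add: norm_eq_1)
  show "plane_part J e l u = 0" if "u \<in> P k" "k \<noteq> l"
    using orth[OF that(2) that(1) e(1)] orth[OF that(2) that(1) f(1)]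
    by (simp add: plane_part_def f_def)
  show "plane_part J e l u = u" if "u \<in> P l"
  proof (rule ccontr)
    assume neq: "plane_part J e l u \<noteq> u"
    define d where "d = u - plane_part J e l u"
    have d: "d \<noteq> 0" "d \<in> P l"
      using neq that e f sub
      by (auto simp: d_def plane_part_def f_def intro!: subspace_diff subspace_add subspace_scale)
    have de: "d \<bullet> e l = 0" "d \<bullet> f = 0"
      using ee f(3) by (simp_all add: d_def plane_part_def f_def[symmetric] inner_diff_left
          inner_add_left inner_diff_right inner_add_right inner_commute)
    have "pairwise Linear_Algebra.orthogonal {d, e l, f}"
      using de f(3) by (auto simp: pairwise_insert Linear_Algebra.orthogonal_def inner_commute)
    moreover have "0 \<notin> {d, e l, f}"
      using d ee by auto
    ultimately have "independent {d, e l, f}"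
      by (rule pairwise_orthogonal_independent)
    then have "card {d, e l, f} \<le> dim (P l)"
      using d(2) e(1) f(1) by (intro independent_card_le_dim) auto
    moreover have "card {d, e l, f} = 3"
    proof -
      have "d \<noteq> e l" "d \<noteq> f" "e l \<noteq> f"
        using de f(3) ee by (metis inner_eq_zero_iff zero_neq_one)+
      then show ?thesis by simp
    qed
    ultimately show False
      using dim by simp
  qed
qed

lemma J_zero: "rotational_datum P J lam \<Longrightarrow> J l 0 = 0"
proof -
  assume "rotational_datum P J lam"
  then have "0 \<in> P l" "\<forall>u\<in>P l. norm (J l u) = norm u"
    by (auto simp: rotational_datum_def quarter_turn_def subspace_0)
  then have "norm (J l 0) = norm (0 :: 'b)"
    by blast
  then show "J l 0 = 0"
    by simp
qed

lemma rho_plane: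
  assumes "rotational_datum P J lam" "unit_frame P e" "u \<in> P l"
  shows "rho J e lam b u = lam l b *\<^sub>R J l u"
proof -
  have "rho J e lam b u = (\<Sum>k\<in>UNIV. if k = l then lam l b *\<^sub>R J l u else 0)"
    unfolding rho_def
    using plane_part_simps[OF assms(1,2)] assms(3) J_zero[OF assms(1)]
    by (intro sum.cong) auto
  then show ?thesis
    by simp
qed

text \<open>
  The Schouten square of \<open>r = \<Sum>\<^sub>l h\<^sub>l \<and> u\<^sub>l\<close> splits as \<open>\<Phi>\<^sub>H(r) + \<mu>\<^sub>H(r)\<close>.
\<close>

lemma schouten_square:
  fixes P :: "'l::{finite,linorder} \<Rightarrow> 'v::euclidean_space set"
    and lam :: "'l \<Rightarrow> 'b::euclidean_space dual"
  assumes datum: "rotational_datum P J lam" and frame: "unit_frame P e" and u: "\<And>l. u l \<in> P l"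
  shows "(\<Sum>k\<in>UNIV. \<Sum>l\<in>UNIV. schouten J e lam (in_b (h k)) (in_v (u k)) (in_b (h l)) (in_v (u l)))
       = Phi_of J lam e h u + mu_of J lam h u"
proof -
  note J0 = J_zero[OF datum] and rho = rho_plane[OF datum frame u]
  have sub: "\<And>l. subspace (P l)" and q: "\<And>l. quarter_turn (P l) (J l)"
    and orth: "\<And>i j u v. i \<noteq> j \<Longrightarrow> u \<in> P i \<Longrightarrow> v \<in> P j \<Longrightarrow> u \<bullet> v = 0"
    using datum by (auto simp: rotational_datum_def)
  have e: "\<And>l. e l \<in> P l" "\<And>l. norm (e l) = 1"
    using frame by (auto simp: unit_frame_def)
  have J: "\<And>l u. u \<in> P l \<Longrightarrow> J l u \<in> P l \<and> norm (J l u) = norm u \<and> u \<bullet> J l u = 0"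
    and Jadd: "\<And>l u v. u \<in> P l \<Longrightarrow> v \<in> P l \<Longrightarrow> J l (u + v) = J l u + J l v"
    and Jscale: "\<And>l u c. u \<in> P l \<Longrightarrow> J l (c *\<^sub>R u) = c *\<^sub>R J l u"
    using q by (auto simp: quarter_turn_def)
  define W where "W k x y = wedge3 (in_b (h k)) (in_v x) (in_v y)" for k and x y :: 'v
  have rho0: "rho J e lam c 0 = 0" for c
    by (simp add: rho_def plane_part_def J0)
  have in_v_scale: "in_v (c *\<^sub>R x) = c *\<^sub>R in_v x" for c and x :: 'v
    by (simp add: in_v_def)
  have in_v_add: "in_v (x + y) = in_v x + in_v y" for x y :: 'v
    by (simp add: in_v_def)
  have zero_fun: "Blinfun (\<lambda>c. 0) = (0 :: 'b dual)"
    by (simp add: zero_blinfun.abs_eq)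
  have b1: "lie_bracket J e lam (in_b (h k)) (in_b (h l)) = 0" for k l
    by (simp add: lie_bracket_def in_b_def rho0 zero_prod_def zero_fun)
  have b2: "lie_bracket J e lam (in_b (h k)) (in_v (u l)) = lam l (h k) *\<^sub>R in_v (J l (u l))" for k l
    by (simp add: lie_bracket_def in_b_def in_v_def rho0 rho zero_fun)
  have b3: "lie_bracket J e lam (in_v (u k)) (in_b (h l)) = (- lam k (h l)) *\<^sub>R in_v (J k (u k))" for k l
    by (simp add: lie_bracket_def in_b_def in_v_def rho0 rho zero_fun)
  have b4: "lie_bracket J e lam (in_v (u k)) (in_v (u l)) = 0" for k l
  proof -
    have "J k (u k) \<bullet> u l = 0"
      using J[OF u[of k]] orth[of k l "J k (u k)" "u l"] u
      by (cases "k = l") (auto simp: inner_commute)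
    then show ?thesis
      by (simp add: lie_bracket_def in_v_def rho0 rho zero_fun zero_prod_def)
  qed
  define G where "G k l = lam l (h k) *\<^sub>R W l (u k) (J l (u l))
    - lam k (h l) *\<^sub>R W k (J k (u k)) (u l)" for k l
  have rot: "wedge3 x y z = - wedge3 z y x" for x y z :: "('b, 'v) lie"
    by (simp add: wedge3_def)
  have sch: "schouten J e lam (in_b (h k)) (in_v (u k)) (in_b (h l)) (in_v (u l)) = G k l" for k l
    unfolding schouten_def b1 b2 b3 b4 wedge3_zero wedge3_scale G_def W_def
    by (simp add: rot[of "in_v (J l (u l))"] wedge3_swap(1)[of "in_v (J k (u k))"])
  have W_swap: "W k y x = - W k x y" for k x y
    unfolding W_def by (rule wedge3_swap(2))
  have sym: "G l k = G k l" for k l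
    by (simp add: G_def W_swap[of l "J l (u l)"] W_swap[of k "u l"])
  have diag: "G l l = (norm (u l))\<^sup>2 *\<^sub>R E_vec J lam e h l" for l
  proof -
    define a b f where "a = u l \<bullet> e l" and "b = u l \<bullet> J l (e l)" and "f = J l (e l)"
    have f: "f \<in> P l" "norm f = 1" "e l \<bullet> f = 0"
      using J[OF e(1)] e(2) by (auto simp: f_def)
    have ul: "u l = a *\<^sub>R e l + b *\<^sub>R f"
      using plane_part_simps(1)[OF datum frame u, of l] by (simp add: plane_part_def a_def b_def f_def)
    have "(e l + f) \<bullet> J l (e l + f) = 0"
      using J e(1) f(1) sub by (simp add: subspace_add)
    then have "e l \<bullet> J l f + f \<bullet> f = 0"
      using f(3) J[OF f(1)] Jadd[OF e(1) f(1)]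
      by (auto simp: inner_add_left inner_add_right f_def[symmetric])
    then have "J l f \<bullet> e l = -1" "J l f \<bullet> f = 0"
      using f(2) J[OF f(1)] by (auto simp: norm_eq_1 inner_commute)
    then have Jf: "J l f = - e l"
      using plane_part_simps(1)[OF datum frame, of "J l f" l] J[OF f(1)]
      by (simp add: plane_part_def f_def[symmetric])
    have Jul: "J l (u l) = a *\<^sub>R f - b *\<^sub>R e l"
      using e(1) f(1) sub Jf unfolding ul
      by (simp add: Jadd Jscale subspace_scale f_def[symmetric])
    have nrm: "(norm (u l))\<^sup>2 = a\<^sup>2 + b\<^sup>2"
      using f(2,3) e(2)[of l] unfolding ul power2_norm_eq_inner
      by (simp add: inner_add_left inner_add_right norm_eq_1 inner_commute power2_eq_square)
    have "W l (a *\<^sub>R e l + b *\<^sub>R f) (a *\<^sub>R f + (- b) *\<^sub>R e l) = (a\<^sup>2 + b\<^sup>2) *\<^sub>R W l (e l) f"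
      unfolding W_def in_v_add in_v_scale wedge3_add wedge3_scale wedge3_same
        wedge3_swap(2)[of _ "in_v (e l)" "in_v f"]
      by (simp add: algebra_simps power2_eq_square)
    then have "W l (u l) (J l (u l)) = (norm (u l))\<^sup>2 *\<^sub>R W l (e l) f"
      by (simp add: nrm Jul) (simp add: ul)
    then show ?thesis
      by (simp add: G_def W_swap[of l "J l (u l)" "u l"] E_vec_def f_def[symmetric] W_def[symmetric]
          scaleR_2[symmetric])
  qed
  have "(\<Sum>k\<in>UNIV. \<Sum>l\<in>UNIV. G k l) = (\<Sum>(k, l)\<in>UNIV. G k l)"
    by (simp add: sum.cartesian_product)
  also have "(UNIV :: ('l \<times> 'l) set) = ({(k, l). k = l} \<union> {(k, l). k < l}) \<union> {(k, l). l < k}"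
    by auto
  also have "(\<Sum>(k, l)\<in>({(k, l). k = l} \<union> {(k, l). k < l}) \<union> {(k, l). l < k}. G k l)
      = (\<Sum>(k, l)\<in>{(k, l). k = l}. G k l) + (\<Sum>(k, l)\<in>{(k, l). k < l}. G k l)
        + (\<Sum>(k, l)\<in>{(k, l). l < k}. G k l)"
  proof -
    have "(\<Sum>x\<in>{(k, l). k = l} \<union> {(k, l). k < l}. case_prod G x)
        = (\<Sum>x\<in>{(k, l). k = l}. case_prod G x) + (\<Sum>x\<in>{(k, l). k < l}. case_prod G x)"
      by (rule sum.union_disjoint) auto
    moreover have "(\<Sum>x\<in>({(k, l). k = l} \<union> {(k, l). k < l}) \<union> {(k, l). l < k}. case_prod G x)
        = (\<Sum>x\<in>{(k, l). k = l} \<union> {(k, l). k < l}. case_prod G x)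
          + (\<Sum>x\<in>{(k, l). l < k}. case_prod G x)"
      by (rule sum.union_disjoint) auto
    ultimately show ?thesis
      by metis
  qed
  also have "(\<Sum>(k, l)\<in>{(k, l). l < k}. G k l) = (\<Sum>(k, l)\<in>{(k, l). k < l}. G k l)"
    by (rule sum.reindex_bij_witness[of _ prod.swap prod.swap]) (auto simp: sym)
  also have "(\<Sum>(k, l)\<in>{(k, l). k = l}. G k l) = Phi_of J lam e h u"
    unfolding Phi_of_def
    by (rule sum.reindex_bij_witness[of _ "\<lambda>l. (l, l)" fst]) (auto simp: diag)
  finally show ?thesis
    unfolding sch mu_of_def G_def[symmetric] W_def[symmetric] by (simp add: scaleR_2 add.assoc)
qed

definition X_space :: "('l::linorder \<Rightarrow> 'v::euclidean_space set) \<Rightarrow> ('b::euclidean_space, 'v) lie tensor3 set" where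
  "X_space P = span {wedge3 (in_b b) (in_v u) (in_v v) | b u v. \<exists>i j. i < j \<and> u \<in> P i \<and> v \<in> P j}"

definition T_space where
  "T_space P J lam e h Y = {r \<in> S_space P h. Phi P J lam e h r = Y}"

definition angle_point :: "('l::finite \<Rightarrow> 'v::euclidean_space \<Rightarrow> 'v) \<Rightarrow> ('l \<Rightarrow> 'v) \<Rightarrow>
    ('l \<Rightarrow> 'b::euclidean_space) \<Rightarrow> 'l set \<Rightarrow> ('l \<Rightarrow> real) \<Rightarrow> real^'l \<Rightarrow> ('b, 'v) lie tensor2" where
  "angle_point J e h I t \<theta> = marked_bivector h (\<lambda>l.
     if l \<in> I
     then sqrt (t l) *\<^sub>R (cos (\<theta> $ l) *\<^sub>R e l + sin (\<theta> $ l) *\<^sub>R J l (e l))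
     else 0)"


section \<open>Marker graph, joint eigenspaces, exponents\<close>

definition marker_graph :: "('l \<Rightarrow> 'b::euclidean_space dual) \<Rightarrow> ('l \<Rightarrow> 'b) \<Rightarrow> 'l set set" where
  "marker_graph lam h = {{i, j} | i j. i \<noteq> j \<and> (lam j (h i) \<noteq> 0 \<or> lam i (h j) \<noteq> 0)}"

definition eigenline :: "('l \<Rightarrow> 'v::euclidean_space set) \<Rightarrow> ('l \<Rightarrow> 'v \<Rightarrow> 'v) \<Rightarrow> 'l \<Rightarrow> int \<Rightarrow> 'v cplx set" where
  "eigenline P J l \<epsilon> = {z \<in> P l \<times> P l. (J l (fst z), J l (snd z)) = cscale (of_int \<epsilon> * \<i>) z}"

definition eigenvec :: "('l \<Rightarrow> 'v::euclidean_space \<Rightarrow> 'v) \<Rightarrow> ('l \<Rightarrow> 'v) \<Rightarrow> 'l \<Rightarrow> int \<Rightarrow> 'v cplx" where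
  "eigenvec J e l \<epsilon> = cscale (1 / sqrt 2) (e l, - of_int \<epsilon> *\<^sub>R J l (e l))"

definition c_coeff :: "('l \<Rightarrow> 'b::euclidean_space dual) \<Rightarrow> ('l \<Rightarrow> 'b) \<Rightarrow>
    'l \<Rightarrow> int \<Rightarrow> 'l \<Rightarrow> int \<Rightarrow> 'b cplx" where
  "c_coeff lam h i \<epsilon> j \<delta> =
     cscale (2 * \<i>) ((of_int \<delta> * lam j (h i)) *\<^sub>R h j - (of_int \<epsilon> * lam i (h j)) *\<^sub>R h i, 0)"

definition eigen_summand :: "('l \<Rightarrow> 'v::euclidean_space set) \<Rightarrow> ('l \<Rightarrow> 'v \<Rightarrow> 'v) \<Rightarrow>
    'l \<Rightarrow> int \<Rightarrow> 'l \<Rightarrow> int \<Rightarrow> ('b::euclidean_space, 'v) lie tensor3 cplx set" where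
  "eigen_summand P J i \<epsilon> j \<delta> = cplx.span
     {cwedge3 (map_prod in_b in_b b) (map_prod in_v in_v x) (map_prod in_v in_v y) | b x y.
       x \<in> eigenline P J i \<epsilon> \<and> y \<in> eigenline P J j \<delta>}"

text \<open>The sum of the subspaces \<open>W q\<close>, \<open>q \<in> Q\<close>, is direct.\<close>

definition direct_family :: "'q set \<Rightarrow> ('q \<Rightarrow> 'w::ab_group_add set) \<Rightarrow> bool" where
  "direct_family Q W \<longleftrightarrow> (\<forall>x. (\<forall>q\<in>Q. x q \<in> W q) \<and> (\<Sum>q\<in>Q. x q) = 0 \<longrightarrow> (\<forall>q\<in>Q. x q = 0))"

text \<open>\<open>(i, \<epsilon>, j, \<delta>)\<close> stands for the signed pair with exponent \<open>\<epsilon> e\<^sub>i + \<delta> e\<^sub>j\<close>.\<close>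

definition signed_pairs :: "'l::linorder set \<Rightarrow> ('l \<times> int \<times> 'l \<times> int) set" where
  "signed_pairs I = {(i, \<epsilon>, j, \<delta>). i \<in> I \<and> j \<in> I \<and> i < j \<and> \<epsilon> \<in> {1, -1} \<and> \<delta> \<in> {1, -1}}"

definition pair_exp :: "'l::finite \<Rightarrow> int \<Rightarrow> 'l \<Rightarrow> int \<Rightarrow> int^'l" where
  "pair_exp i \<epsilon> j \<delta> = axis i \<epsilon> + axis j \<delta>"

definition exponents :: "('l::{finite,linorder} \<Rightarrow> 'b::euclidean_space dual) \<Rightarrow> ('l \<Rightarrow> 'b) \<Rightarrow>
    'l set \<Rightarrow> (int^('l::{finite,linorder})) set" where
  "exponents lam h I = {pair_exp i \<epsilon> j \<delta> | i \<epsilon> j \<delta>.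
     (i, \<epsilon>, j, \<delta>) \<in> signed_pairs I \<and> c_coeff lam h i \<epsilon> j \<delta> \<noteq> 0}"

text \<open>A choice of a vector spanning the line of \<open>c\<^sub>i\<^sub>j \<and> v\<^sub>i \<and> v\<^sub>j\<close>, for every exponent.\<close>

definition scalar_frame where
  "scalar_frame J lam e h I w \<longleftrightarrow> (\<forall>(i, \<epsilon>, j, \<delta>)\<in>signed_pairs I.
     c_coeff lam h i \<epsilon> j \<delta> \<noteq> 0 \<longrightarrow>
     (\<exists>z. z \<noteq> 0 \<and> w (pair_exp i \<epsilon> j \<delta>) =
        cscale z (cwedge3 (map_prod in_b in_b (c_coeff lam h i \<epsilon> j \<delta>))
          (map_prod in_v in_v (eigenvec J e i \<epsilon>)) (map_prod in_v in_v (eigenvec J e j \<delta>)))))"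

definition cast_vec :: "int^'l \<Rightarrow> 'a::ring_1^'l" where
  "cast_vec \<alpha> = (\<chi> l. of_int (\<alpha> $ l))"

definition Zpow :: "'l::finite set \<Rightarrow> (int^'l) set" where
  "Zpow I = {\<alpha>. \<forall>l. l \<notin> I \<longrightarrow> \<alpha> $ l = 0}"

definition s_power :: "'l::finite set \<Rightarrow> ('l \<Rightarrow> complex) \<Rightarrow> int^'l \<Rightarrow> complex" where
  "s_power I s \<alpha> = (\<Prod>l\<in>I. s l powi (\<alpha> $ l))"

definition L_lattice :: "(int^'l) set \<Rightarrow> (int^'l) set" where
  "L_lattice A = Modules.module.span (*s) A"

definition L_sat :: "'l::finite set \<Rightarrow> (int^'l) set \<Rightarrow> (int^'l) set" where
  "L_sat I A = {\<alpha> \<in> Zpow I. cast_vec \<alpha> \<in> vec.span (cast_vec ` A :: (rat^'l) set)}"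

definition zrank :: "(int^'l) set \<Rightarrow> nat" where
  "zrank L = Max {card B | B. B \<subseteq> L \<and> finite B \<and> \<not> Modules.module.dependent (*s) B}"

definition additive_group :: "'a::ab_group_add set \<Rightarrow> 'a monoid" where
  "additive_group S = \<lparr>carrier = S, monoid.mult = (+), one = 0\<rparr>"


section \<open>Tori and topological groups\<close>

definition quotient_topology :: "'a topology \<Rightarrow> ('a \<Rightarrow> 'b) \<Rightarrow> 'b topology" where
  "quotient_topology X f =
     topology (\<lambda>U. U \<subseteq> f ` topspace X \<and> openin X {x \<in> topspace X. f x \<in> U})"

lemma openin_quotient_topology:
  "openin (quotient_topology X f) U \<longleftrightarrow> U \<subseteq> f ` topspace X \<and> openin X {x \<in> topspace X. f x \<in> U}"
proof -
  have "istopology (\<lambda>U. U \<subseteq> f ` topspace X \<and> openin X {x \<in> topspace X. f x \<in> U})"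
    unfolding istopology_def
  proof (intro conjI allI impI)
    fix S T
    assume "S \<subseteq> f ` topspace X \<and> openin X {x \<in> topspace X. f x \<in> S}"
      and "T \<subseteq> f ` topspace X \<and> openin X {x \<in> topspace X. f x \<in> T}"
    moreover have "{x \<in> topspace X. f x \<in> S \<inter> T}
        = {x \<in> topspace X. f x \<in> S} \<inter> {x \<in> topspace X. f x \<in> T}"
      by blast
    ultimately show "S \<inter> T \<subseteq> f ` topspace X" "openin X {x \<in> topspace X. f x \<in> S \<inter> T}"
      by auto
  next
    fix K
    assume *: "\<forall>S\<in>K. S \<subseteq> f ` topspace X \<and> openin X {x \<in> topspace X. f x \<in> S}"
    then show "\<Union>K \<subseteq> f ` topspace X"
      by blast
    have "{x \<in> topspace X. f x \<in> \<Union>K} = (\<Union>S\<in>K. {x \<in> topspace X. f x \<in> S})"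
      by blast
    with * show "openin X {x \<in> topspace X. f x \<in> \<Union>K}"
      by auto
  qed
  then show ?thesis
    by (simp add: quotient_topology_def)
qed

lemma quotient_map_quotient_topology: "quotient_map X (quotient_topology X f) f"
proof -
  have "topspace (quotient_topology X f) = f ` topspace X"
  proof
    show "topspace (quotient_topology X f) \<subseteq> f ` topspace X"
      by (metis openin_quotient_topology openin_topspace)
    have "{x \<in> topspace X. f x \<in> f ` topspace X} = topspace X"
      by blast
    then have "openin (quotient_topology X f) (f ` topspace X)"
      by (simp add: openin_quotient_topology)
    then show "f ` topspace X \<subseteq> topspace (quotient_topology X f)"
      by (rule openin_subset)
  qed
  then show ?thesis
    by (auto simp: quotient_map_def openin_quotient_topology)
qed

definition periods :: "real set" where
  "periods = {2 * pi * of_int k | k. True}"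

definition circle_group :: "real set monoid" where
  "circle_group = additive_group UNIV Mod periods"

definition circle_class :: "real \<Rightarrow> real set" where
  "circle_class x = periods #>\<^bsub>additive_group UNIV\<^esub> x"

definition circle_topology :: "real set topology" where
  "circle_topology = quotient_topology euclideanreal circle_class"

definition torus :: "'i set \<Rightarrow> ('i \<Rightarrow> real set) monoid" where
  "torus I = product_group I (\<lambda>_. circle_group)"

definition torus_topology :: "'i set \<Rightarrow> ('i \<Rightarrow> real set) topology" where
  "torus_topology I = product_topology (\<lambda>_. circle_topology) I"

definition torus_class :: "'l::finite set \<Rightarrow> real^'l \<Rightarrow> 'l \<Rightarrow> real set" where
  "torus_class I \<theta> = (\<lambda>l\<in>I. circle_class (\<theta> $ l))"

text \<open>A function of the angles, regarded as a function on the torus.\<close>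

definition on_torus :: "'l::finite set \<Rightarrow> (real^'l \<Rightarrow> 'a) \<Rightarrow> ('l \<Rightarrow> real set) \<Rightarrow> 'a" where
  "on_torus I g x = g (SOME \<theta>. torus_class I \<theta> = x)"

definition K_group :: "'l::finite set \<Rightarrow> (int^'l) set \<Rightarrow> ('l \<Rightarrow> real set) set" where
  "K_group I A = torus_class I ` {\<theta>. \<forall>\<alpha>\<in>A. exp (\<i> * complex_of_real (cast_vec \<alpha> \<bullet> \<theta>)) = 1}"

definition top_group_isomorphic ::
  "('a, 'c) monoid_scheme \<Rightarrow> 'a topology \<Rightarrow> ('b, 'd) monoid_scheme \<Rightarrow> 'b topology \<Rightarrow> bool" where
  "top_group_isomorphic G X H Y \<longleftrightarrow> (\<exists>f. f \<in> iso G H \<and> homeomorphic_map X Y f)"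

definition component_group ::
  "('a, 'c) monoid_scheme \<Rightarrow> 'a topology \<Rightarrow> 'a set monoid" where
  "component_group G X = G Mod connected_component_of_set X \<one>\<^bsub>G\<^esub>"

text \<open>The Pontryagin dual of a discrete group (only the group structure of the dual).\<close>

definition pontryagin_dual :: "('a, 'c) monoid_scheme \<Rightarrow> ('a \<Rightarrow> real set) monoid" where
  "pontryagin_dual G =
     \<lparr>carrier = hom G circle_group \<inter> extensional (carrier G),
      monoid.mult = (\<lambda>f g. \<lambda>x\<in>carrier G. f x \<otimes>\<^bsub>circle_group\<^esub> g x),
      one = (\<lambda>x\<in>carrier G. \<one>\<^bsub>circle_group\<^esub>)\<rparr>"

text \<open>Maps of class \<open>C\<^sup>k\<close>; for a finite-dimensional domain it suffices to test directional derivatives.\<close>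

primrec C_diff :: "nat \<Rightarrow> ('a::euclidean_space \<Rightarrow> 'b::real_normed_vector) \<Rightarrow> bool" where
  "C_diff 0 f \<longleftrightarrow> continuous_on UNIV f"
| "C_diff (Suc k) f \<longleftrightarrow> (\<forall>x. f differentiable at x) \<and>
     (\<forall>v. C_diff k (\<lambda>x. frechet_derivative f (at x) v))"

definition smooth :: "('a::euclidean_space \<Rightarrow> 'b::real_normed_vector) \<Rightarrow> bool" where
  "smooth f \<longleftrightarrow> (\<forall>k. C_diff k f)"

text \<open>
  Smooth embeddings into \<open>X\<close> of the Lie group \<open>torus I Mod K\<close>, \<open>K\<close> a closed subgroup.  The projection
  from the space of angles to \<open>torus I Mod K\<close> is a surjective submersion whose differential has
  as kernel the Lie algebra of \<open>K\<close>, i.e. the directions of the one-parameter subgroups in \<open>K\<close>.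
  So \<open>f\<close> is smooth iff its pullback to angles is, and \<open>f\<close> is an immersion iff the differential
  of the pullback has precisely this kernel everywhere.  Injectivity is part of \<^const>\<open>embedding_map\<close>.
\<close>

definition smooth_quotient_embedding ::
  "'l::finite set \<Rightarrow> ('l \<Rightarrow> real set) set \<Rightarrow> (('l \<Rightarrow> real set) set \<Rightarrow> 'w::real_normed_vector) \<Rightarrow>
     'w set \<Rightarrow> bool" where
  "smooth_quotient_embedding I K f X \<longleftrightarrow>
     (let g = (\<lambda>\<theta>. f (K #>\<^bsub>torus I\<^esub> torus_class I \<theta>)) in
       f ` carrier (torus I Mod K) \<subseteq> X \<and>
       smooth g \<and>
       (\<forall>\<theta> \<xi>. frechet_derivative g (at \<theta>) \<xi> = 0 \<longleftrightarrow> (\<forall>\<tau>. torus_class I (\<tau> *\<^sub>R \<xi>) \<in> K)) \<and>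
       embedding_map (quotient_topology (torus_topology I) (\<lambda>x. K #>\<^bsub>torus I\<^esub> x))
         (top_of_set X) f)"


section \<open>Laurent polynomials, Zariski closure, Smith form\<close>

text \<open>Laurent polynomials in the \<open>s\<^sub>l\<close> are finitely supported functions on exponent vectors.\<close>

definition s_eval :: "'l::finite set \<Rightarrow> ((int^'l) \<Rightarrow>\<^sub>0 complex) \<Rightarrow> ('l \<Rightarrow> complex) \<Rightarrow> complex" where
  "s_eval I p s = (\<Sum>\<alpha>\<in>Poly_Mapping.keys p. Poly_Mapping.lookup p \<alpha> * s_power I s \<alpha>)"

definition newton_polytope :: "((int^'l) \<Rightarrow>\<^sub>0 complex) set \<Rightarrow> (real^'l) set" where
  "newton_polytope F = convex hull (\<Union>p\<in>F. cast_vec ` Poly_Mapping.keys p)"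

definition cstar_group :: "complex monoid" where
  "cstar_group = \<lparr>carrier = - {0}, monoid.mult = (*), one = 1\<rparr>"

definition cstar_power :: "'x set \<Rightarrow> ('x \<Rightarrow> complex) monoid" where
  "cstar_power A = product_group A (\<lambda>_. cstar_group)"

definition cstar_power_topology :: "'x set \<Rightarrow> ('x \<Rightarrow> complex) topology" where
  "cstar_power_topology A = product_topology (\<lambda>_. top_of_set (- {0})) A"

text \<open>
  \<open>\<int>\<^sup>A\<close> is the set of \<open>c :: 'x \<Rightarrow>\<^sub>0 int\<close> supported in \<open>A\<close>; a Laurent polynomial in the
  variables \<open>y\<^sub>x\<close>, \<open>x \<in> A\<close>, is a finitely supported function on it.
\<close>

definition y_power :: "('x \<Rightarrow> complex) \<Rightarrow> ('x \<Rightarrow>\<^sub>0 int) \<Rightarrow> complex" where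
  "y_power y c = (\<Prod>x\<in>Poly_Mapping.keys c. y x powi Poly_Mapping.lookup c x)"

definition laurent_polys :: "'x set \<Rightarrow> (('x \<Rightarrow>\<^sub>0 int) \<Rightarrow>\<^sub>0 complex) set" where
  "laurent_polys A = {p. \<forall>c\<in>Poly_Mapping.keys p. Poly_Mapping.keys c \<subseteq> A}"

definition y_eval :: "(('x \<Rightarrow>\<^sub>0 int) \<Rightarrow>\<^sub>0 complex) \<Rightarrow> ('x \<Rightarrow> complex) \<Rightarrow> complex" where
  "y_eval p y = (\<Sum>c\<in>Poly_Mapping.keys p. Poly_Mapping.lookup p c * y_power y c)"

definition laurent_ring :: "'x set \<Rightarrow> (('x \<Rightarrow>\<^sub>0 int) \<Rightarrow>\<^sub>0 complex) ring" where
  "laurent_ring A = \<lparr>carrier = laurent_polys A, monoid.mult = (*), one = 1, zero = 0, add = (+)\<rparr>"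

definition zero_locus :: "'x set \<Rightarrow> (('x \<Rightarrow>\<^sub>0 int) \<Rightarrow>\<^sub>0 complex) set \<Rightarrow> ('x \<Rightarrow> complex) set" where
  "zero_locus A F = {y \<in> carrier (cstar_power A). \<forall>p\<in>F. y_eval p y = 0}"

definition vanishing_ideal :: "'x set \<Rightarrow> ('x \<Rightarrow> complex) set \<Rightarrow> (('x \<Rightarrow>\<^sub>0 int) \<Rightarrow>\<^sub>0 complex) set" where
  "vanishing_ideal A Z = {p \<in> laurent_polys A. \<forall>y\<in>Z. y_eval p y = 0}"

definition zariski_closure :: "'x set \<Rightarrow> ('x \<Rightarrow> complex) set \<Rightarrow> ('x \<Rightarrow> complex) set" where
  "zariski_closure A S = \<Inter>{zero_locus A F | F. F \<subseteq> laurent_polys A \<and> S \<subseteq> zero_locus A F}"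

definition relation_lattice :: "(int^'l) set \<Rightarrow> ((int^'l) \<Rightarrow>\<^sub>0 int) set" where
  "relation_lattice A = {c. Poly_Mapping.keys c \<subseteq> A \<and> (\<Sum>\<alpha>\<in>A. Poly_Mapping.lookup c \<alpha> *s \<alpha>) = 0}"

definition binomial_torus :: "(int^'l) set \<Rightarrow> (int^'l \<Rightarrow> complex) \<Rightarrow> (int^'l \<Rightarrow> complex) set" where
  "binomial_torus A a =
     {y \<in> carrier (cstar_power A). \<forall>c\<in>relation_lattice A. y_power y c = y_power a c}"

definition lattice_binomial :: "('x \<Rightarrow> complex) \<Rightarrow> ('x \<Rightarrow>\<^sub>0 int) \<Rightarrow> ('x \<Rightarrow>\<^sub>0 int) \<Rightarrow>\<^sub>0 complex" where
  "lattice_binomial a c = Poly_Mapping.single (Poly_Mapping.map (\<lambda>n. max n 0) c) 1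
                - Poly_Mapping.single (Poly_Mapping.map (\<lambda>n. max (- n) 0) c) (y_power a c)"

text \<open>The \<open>\<alpha>\<close>-coordinates of the points of a set of complexified tensors, along the frame \<open>w\<close>.\<close>

definition frame_coords :: "'x set \<Rightarrow> ('x \<Rightarrow> 'w::real_vector cplx) \<Rightarrow> 'w cplx set \<Rightarrow> ('x \<Rightarrow> complex) set" where
  "frame_coords A w S = {y \<in> A \<rightarrow>\<^sub>E UNIV. (\<Sum>x\<in>A. cscale (y x) (w x)) \<in> S}"

definition exponent_matrix :: "(nat \<Rightarrow> 'l::finite) \<Rightarrow> (nat \<Rightarrow> int^'l) \<Rightarrow> 'l set \<Rightarrow> (int^'l) set \<Rightarrow> int mat" where
  "exponent_matrix row_ix col_ix I A = Matrix.mat (card I) (card A) (\<lambda>(i, j). col_ix j $ row_ix i)"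

definition unimodular :: "nat \<Rightarrow> int mat \<Rightarrow> bool" where
  "unimodular n U \<longleftrightarrow> U \<in> carrier_mat n n \<and> (Determinant.det U = 1 \<or> Determinant.det U = -1)"

definition smith_reduction :: "int mat \<Rightarrow> int mat \<Rightarrow> int mat \<Rightarrow> nat \<Rightarrow> (nat \<Rightarrow> nat) \<Rightarrow> bool" where
  "smith_reduction M U W q d \<longleftrightarrow>
     unimodular (dim_row M) U \<and> unimodular (dim_col M) W \<and>
     q \<le> dim_row M \<and> q \<le> dim_col M \<and>
     (\<forall>j<q. d j > 0) \<and> (\<forall>j. Suc j < q \<longrightarrow> d j dvd d (Suc j)) \<and>
     U * M * W = Matrix.mat (dim_row M) (dim_col M) (\<lambda>(i, j). if i = j \<and> i < q then int (d i) else 0)"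

definition column_relation :: "(nat \<Rightarrow> 'x) \<Rightarrow> int mat \<Rightarrow> nat \<Rightarrow> 'x \<Rightarrow>\<^sub>0 int" where
  "column_relation col_ix W k = (\<Sum>j<dim_row W. Poly_Mapping.single (col_ix j) (W $$ (j, k)))"

definition Z_basis :: "nat set \<Rightarrow> (nat \<Rightarrow> 'x \<Rightarrow>\<^sub>0 int) \<Rightarrow> ('x \<Rightarrow>\<^sub>0 int) set \<Rightarrow> bool" where
  "Z_basis K b L \<longleftrightarrow> bij_betw (\<lambda>n. \<Sum>k\<in>K. frag_cmul (n k) (b k)) (K \<rightarrow>\<^sub>E UNIV) L"

end

theory Submission
  imports Defs
begin

text \<open>
  \<^emph>\<open>The angular map is monomial.\<close>  On \<open>T\<^sub>Y\<close> the component \<open>u\<^sub>l\<close>, \<open>l \<in> I\<close>, is \<open>\<surd>t\<^sub>l\<close> times the unit vector at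
  angle \<open>\<theta>\<^sub>l\<close>, so its two eigencoordinates are multiples of \<open>s\<^sub>l\<close> and \<open>s\<^sub>l\<inverse>\<close>.  As \<open>\<mu>\<close> is a sum of terms that are
  bilinear in \<open>u\<^sub>i\<close> and \<open>u\<^sub>j\<close>, its part for the signs \<open>\<epsilon>\<close>, \<open>\<delta>\<close> is \<open>s\<^sub>i\<^sup>\<epsilon> s\<^sub>j\<^sup>\<delta>\<close> times a fixed vector in
  \<open>\<bb> \<and> L\<^sub>i\<^sup>\<epsilon> \<and> L\<^sub>j\<^sup>\<delta>\<close> (\<open>angular_map_laurent\<close>).  Linear functionals separate these summands
  (\<open>direct_family_eigen_summands\<close>).  Hence, in coordinates, the map is \<open>\<theta> \<mapsto> (\<kappa>\<^sub>\<alpha> s\<^sup>\<alpha>)\<close> with nonzero \<open>\<kappa>\<^sub>\<alpha>\<close>, and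
  all that follows depends on the finite set \<open>A\<close> of exponents and on \<open>\<kappa>\<close> only.  Which exponents occur is
  decided by \<open>marker_cancellation\<close>.

  \<^emph>\<open>Lattices.\<close>  There is a basis \<open>v\<close> of \<open>\<int>\<^sup>I\<close> such that the lattice spanned by \<open>A\<close> has the basis \<open>d\<^sub>k v\<^sub>k\<close>, \<open>k < q\<close>
  (\<open>adapted_basis_exists\<close>).  Use the angles \<open>\<langle>v\<^sub>k, \<theta>\<rangle>\<close> on the torus.  The map depends exactly on the \<open>q\<close> angles
  \<open>d\<^sub>k \<langle>v\<^sub>k, \<theta>\<rangle>\<close> modulo \<open>2\<pi>\<close>.  This gives the rank of the differential, the image as a translate of a
  \<open>q\<close>-dimensional torus, and the kernel as a product of an \<open>(n - q)\<close>-dimensional torus with the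
  groups of order \<open>d\<^sub>k\<close>; the saturation modulo the lattice is the product of the same cyclic groups, and
  it pairs perfectly with the components of the kernel (\<open>component_group_dual\<close>).  Since tori are compact,
  the continuous bijections that arise are homeomorphisms.  A Smith reduction of the exponent matrix
  provides an adapted basis whose \<open>d\<^sub>k\<close> are its diagonal entries (\<open>smith_adapted_basis\<close>), so these
  descriptions apply to it.

  \<^emph>\<open>Equations.\<close>  On the image, the monomial \<open>y\<^sup>c\<close> restricts to \<open>\<kappa>\<^sup>c\<close> times the character \<open>\<Sum> c\<^sub>\<alpha> \<alpha>\<close>, and two
  monomials restrict to the same character iff their exponents differ by a relation.  Characters are
  linearly independent, so for a Laurent polynomial that vanishes on the image the coefficients weighted
  by \<open>\<kappa>\<^sup>c\<close> add up to zero over each class of exponents modulo relations (\<open>fibre_sum_zero\<close>).  Therefore it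
  vanishes on the binomial torus (\<open>zariski_closure_translate\<close>); and modulo the binomials of a basis of
  the relations its terms in each class cancel, so it lies in the ideal that they generate
  (\<open>vanishing_ideal_generated\<close>).
\<close>

(* The product of vectors shares this symbol with the inner product, which is meant throughout. *)
no_notation scalar_prod (infix "\<bullet>" 70)

section \<open>Lattices and adapted bases\<close>

definition ipair :: "int^'l \<Rightarrow> int^'l \<Rightarrow> int" where
  "ipair x y = (\<Sum>l\<in>UNIV. x $ l * y $ l)"

lemma ipair_add: "ipair x (y + z) = ipair x y + ipair x z"
  "ipair (x + x') y = ipair x y + ipair x' y"
  by (simp_all add: ipair_def algebra_simps sum.distrib)

lemma ipair_diff: "ipair x (y - z) = ipair x y - ipair x z"
  "ipair (x - x') y = ipair x y - ipair x' y"
  by (simp_all add: ipair_def algebra_simps sum_subtractf)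

lemma ipair_scale: "ipair x (c *s y) = c * ipair x y" "ipair (c *s x) y = c * ipair x y"
  by (simp_all add: ipair_def sum_distrib_left algebra_simps)

lemma ipair_0: "ipair x 0 = 0" "ipair 0 x = 0"
  by (simp_all add: ipair_def)

lemma ipair_sum: "ipair x (\<Sum>k\<in>S. f k) = (\<Sum>k\<in>S. ipair x (f k))"
  "ipair (\<Sum>k\<in>S. f k) x = (\<Sum>k\<in>S. ipair (f k) x)"
  by (induction S rule: infinite_finite_induct) (auto simp: ipair_0 ipair_add)

lemma ipair_axis: "ipair (axis l 1) y = y $ l"
  by (simp add: ipair_def axis_def if_distrib[of "\<lambda>t. t * _"] cong: if_cong)

lemma ipair_minus: "ipair x (- y) = - ipair x y" "ipair (- x) y = - ipair x y"
  by (simp_all add: ipair_def sum_negf)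

lemma cast_vec_nth [simp]: "cast_vec \<alpha> $ l = of_int (\<alpha> $ l)"
  by (simp add: cast_vec_def)

lemma cast_vec_add: "cast_vec (x + y) = cast_vec x + cast_vec y"
  and cast_vec_diff: "cast_vec (x - y) = cast_vec x - cast_vec y"
  and cast_vec_0: "cast_vec 0 = 0"
  and cast_vec_scale: "cast_vec (c *s x) = of_int c *s cast_vec x"
  by (simp_all add: Finite_Cartesian_Product.vec_eq_iff)

lemma cast_vec_sum: "cast_vec (\<Sum>k\<in>S. f k) = (\<Sum>k\<in>S. cast_vec (f k))"
  by (induction S rule: infinite_finite_induct) (auto simp: cast_vec_0 cast_vec_add)

lemma cast_vec_inj: "cast_vec x = (cast_vec y :: 'a::ring_char_0^'l) \<longleftrightarrow> x = y"
  by (simp add: Finite_Cartesian_Product.vec_eq_iff)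

lemma cast_vec_inner: "(cast_vec x :: real^'l) \<bullet> cast_vec y = of_int (ipair x y)"
  by (simp add: inner_vec_def ipair_def)

interpretation zmod: Modules.module "(*s) :: int \<Rightarrow> int^'l \<Rightarrow> int^'l"
  by unfold_locales (auto simp: Finite_Cartesian_Product.vec_eq_iff algebra_simps)

lemma L_lattice_zspan: "L_lattice A = zmod.span A"
  by (simp add: L_lattice_def)

lemma Zpow_add: "\<alpha> \<in> Zpow I \<Longrightarrow> \<beta> \<in> Zpow I \<Longrightarrow> \<alpha> + \<beta> \<in> Zpow I"
  and Zpow_diff: "\<alpha> \<in> Zpow I \<Longrightarrow> \<beta> \<in> Zpow I \<Longrightarrow> \<alpha> - \<beta> \<in> Zpow I"
  and Zpow_scale: "\<alpha> \<in> Zpow I \<Longrightarrow> c *s \<alpha> \<in> Zpow I"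
  and Zpow_0: "0 \<in> Zpow I"
  by (auto simp: Zpow_def)

lemma Zpow_sum: "(\<And>k. k \<in> S \<Longrightarrow> f k \<in> Zpow I) \<Longrightarrow> (\<Sum>k\<in>S. f k) \<in> Zpow I"
  by (auto simp: Zpow_def)

lemma subspace_Zpow: "zmod.subspace (Zpow I)"
  by (simp add: zmod.subspace_def Zpow_0 Zpow_add Zpow_scale)

text \<open>
  \<open>v\<close> and \<open>x\<close> are dual bases of the lattice \<open>\<int>\<^sup>I\<close> and of its dual, chosen such that the sublattice
  spanned by \<open>A\<close> has the basis \<open>d k *s v k\<close>, \<open>k < q\<close>.  This is what a Smith reduction of the matrix
  with columns \<open>A\<close> provides; in these coordinates every invariant of \<open>A\<close> can be read off.
\<close>

locale adapted_basis =
  fixes I :: "'l::finite set" and A :: "(int^'l) set" and n q :: nat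
    and v x :: "nat \<Rightarrow> int^'l" and d :: "nat \<Rightarrow> nat"
  assumes A_sub: "A \<subseteq> Zpow I" and q_le: "q \<le> n"
    and v_Zpow: "\<And>k. k < n \<Longrightarrow> v k \<in> Zpow I" and x_Zpow: "\<And>k. k < n \<Longrightarrow> x k \<in> Zpow I"
    and dual: "\<And>j k. j < n \<Longrightarrow> k < n \<Longrightarrow> ipair (x j) (v k) = (if j = k then 1 else 0)"
    and expand: "\<And>\<alpha>. \<alpha> \<in> Zpow I \<Longrightarrow> \<alpha> = (\<Sum>k<n. ipair (x k) \<alpha> *s v k)"
    and d_pos: "\<And>k. k < q \<Longrightarrow> d k > 0"
    and lattice: "L_lattice A = {\<alpha> \<in> Zpow I. (\<forall>k<q. int (d k) dvd ipair (x k) \<alpha>) \<and>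
                                    (\<forall>k. q \<le> k \<longrightarrow> k < n \<longrightarrow> ipair (x k) \<alpha> = 0)}"

subsection \<open>Existence of adapted bases\<close>

definition biorthogonal :: "'l::finite set \<Rightarrow> nat \<Rightarrow> (nat \<Rightarrow> int^'l) \<Rightarrow> (nat \<Rightarrow> int^'l) \<Rightarrow> bool" where
  "biorthogonal I p v x \<longleftrightarrow> (\<forall>k<p. v k \<in> Zpow I \<and> x k \<in> Zpow I) \<and>
     (\<forall>j<p. \<forall>k<p. ipair (x j) (v k) = (if j = k then 1 else 0))"

lemma biorthogonal_sum:
  assumes "biorthogonal I p v x" "j < p"
  shows "ipair (x j) (\<Sum>k<p. c k *s v k) = c j" "ipair (\<Sum>k<p. c k *s x k) (v j) = c j"
proof -
  have "ipair (x j) (\<Sum>k<p. c k *s v k) = (\<Sum>k<p. if k = j then c j else 0)"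
    unfolding ipair_sum ipair_scale
    by (rule sum.cong) (use assms in \<open>auto simp: biorthogonal_def\<close>)
  then show "ipair (x j) (\<Sum>k<p. c k *s v k) = c j"
    using assms(2) by simp
  have "ipair (\<Sum>k<p. c k *s x k) (v j) = (\<Sum>k<p. if k = j then c j else 0)"
    unfolding ipair_sum ipair_scale
    by (rule sum.cong) (use assms in \<open>auto simp: biorthogonal_def\<close>)
  then show "ipair (\<Sum>k<p. c k *s x k) (v j) = c j"
    using assms(2) by simp
qed

lemma biorthogonal_inj:
  fixes v :: "nat \<Rightarrow> int^'l::finite"
  assumes "biorthogonal I p v x"
  shows "inj_on v {..<p}"
proof (rule inj_onI)
  fix j k assume "j \<in> {..<p}" "k \<in> {..<p}" "v j = v k"
  then show "j = k"
    using assms unfolding biorthogonal_def by (metis lessThan_iff zero_neq_one)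
qed

text \<open>
  Pairing a relation between the \<open>v k\<close> with \<open>x j\<close> isolates its \<open>j\<close>-th coefficient.
\<close>

lemma biorthogonal_independent:
  fixes v :: "nat \<Rightarrow> int^'l::finite"
  assumes "biorthogonal I p v x"
  shows "vec.independent ((\<lambda>k. cast_vec (v k) :: 'a::field_char_0^'l::finite) ` {..<p})"
    and "inj_on (\<lambda>k. cast_vec (v k) :: 'a^'l) {..<p}"
proof -
  show inj: "inj_on (\<lambda>k. cast_vec (v k) :: 'a^'l) {..<p}"
    using biorthogonal_inj[OF assms] by (simp add: inj_on_def cast_vec_inj)
  show "vec.independent ((\<lambda>k. cast_vec (v k) :: 'a^'l) ` {..<p})"
  proof (rule vec.independent_if_scalars_zero)
    show "finite ((\<lambda>k. cast_vec (v k) :: 'a^'l) ` {..<p})"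
      by simp
    fix f :: "'a^'l \<Rightarrow> 'a" and y :: "'a^'l"
    assume 0: "(\<Sum>y\<in>(\<lambda>k. cast_vec (v k)) ` {..<p}. f y *s (y :: 'a^'l)) = 0"
      and "y \<in> (\<lambda>k. cast_vec (v k)) ` {..<p}"
    then obtain j where j: "j < p" "y = cast_vec (v j)"
      by auto
    define g where "g k = f (cast_vec (v k))" for k
    have "(\<Sum>k<p. g k *s (cast_vec (v k) :: 'a^'l)) = 0"
      using 0 unfolding sum.reindex[OF inj] g_def by (simp add: o_def)
    then have "(\<Sum>l\<in>UNIV. of_int (x j $ l) * (\<Sum>k<p. g k *s (cast_vec (v k) :: 'a^'l)) $ l) = 0"
      by simp
    also have "(\<Sum>l\<in>UNIV. of_int (x j $ l) * (\<Sum>k<p. g k *s (cast_vec (v k) :: 'a^'l)) $ l)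
        = (\<Sum>l\<in>UNIV. \<Sum>k<p. g k * of_int (x j $ l * v k $ l))"
      by (simp add: sum_distrib_left algebra_simps)
    also have "\<dots> = (\<Sum>k<p. \<Sum>l\<in>UNIV. g k * of_int (x j $ l * v k $ l))"
      by (rule sum.swap)
    also have "\<dots> = (\<Sum>k<p. g k * of_int (ipair (x j) (v k)))"
      by (simp only: ipair_def of_int_sum sum_distrib_left)
    also have "\<dots> = (\<Sum>k<p. if k = j then g j else 0)"
      by (rule sum.cong) (use assms j in \<open>auto simp: biorthogonal_def\<close>)
    also have "\<dots> = g j"
      using j by simp
    finally show "f y = 0"
      using j by (simp add: g_def)
  qed
qed

text \<open>This bound makes the splitting process of \<open>biorthogonal_step\<close> terminate.\<close>

lemma biorthogonal_bound:
  fixes v :: "nat \<Rightarrow> int^'l::finite"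
  assumes "biorthogonal I p v x"
  shows "p \<le> CARD('l)"
proof -
  let ?B = "(\<lambda>k. cast_vec (v k) :: rat^'l) ` {..<p}"
  have "card ?B = p"
    using biorthogonal_independent(2)[OF assms, where 'a = rat] by (simp add: card_image)
  moreover have "card ?B \<le> CARD('l)"
    using vec.independent_card_le_dim[OF _ biorthogonal_independent(1)[OF assms, where 'a = rat], of UNIV]
    by (simp add: card_cart_basis)
  ultimately show ?thesis
    by simp
qed

text \<open>
  A pair \<open>(f, \<alpha>)\<close> of a functional and an element of \<open>N\<close> with the least positive value \<open>d\<close> splits off
  a summand: by minimality all functionals are divisible by \<open>d\<close> at \<open>\<alpha>\<close>, so \<open>\<alpha> = d w\<close>, and \<open>f\<close> is
  divisible by \<open>d\<close> on \<open>N\<close>.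
\<close>

lemma biorthogonal_step:
  assumes bi: "biorthogonal I p v x" and sub: "zmod.subspace N" "N \<subseteq> Zpow I"
    and ker: "\<And>k \<alpha>. k < p \<Longrightarrow> \<alpha> \<in> N \<Longrightarrow> ipair (x k) \<alpha> = 0"
    and nz: "N \<noteq> {0}"
  obtains w f d where "biorthogonal I (Suc p) (v(p := w)) (x(p := f))" "d > 0"
    "int d *s w \<in> N" "\<And>\<alpha>. \<alpha> \<in> N \<Longrightarrow> int d dvd ipair f \<alpha>"
proof -
  define Q where "Q m \<longleftrightarrow> m > 0 \<and> (\<exists>g\<in>Zpow I. \<exists>\<alpha>\<in>N. ipair g \<alpha> = int m)" for m
  have Nsub: "\<alpha> + \<beta> \<in> N" "c *s \<alpha> \<in> N" "\<alpha> - \<beta> \<in> N" if "\<alpha> \<in> N" "\<beta> \<in> N" for \<alpha> \<beta> c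
    using sub(1) that by (simp_all add: zmod.subspace_add zmod.subspace_scale zmod.subspace_diff)
  have N0: "0 \<in> N"
    using sub(1) by (simp add: zmod.subspace_def)
  have "\<exists>m. Q m"
  proof -
    obtain \<alpha> where \<alpha>: "\<alpha> \<in> N" "\<alpha> \<noteq> 0"
      using nz N0 by auto
    then obtain l where l: "\<alpha> $ l \<noteq> 0"
      by (auto simp: Finite_Cartesian_Product.vec_eq_iff)
    then have "l \<in> I"
      using \<alpha> sub(2) by (auto simp: Zpow_def)
    then have "axis l (sgn (\<alpha> $ l)) \<in> Zpow I"
      by (auto simp: Zpow_def axis_def)
    moreover have "ipair (axis l (sgn (\<alpha> $ l))) \<alpha> = \<bar>\<alpha> $ l\<bar>"
      by (simp add: ipair_def axis_def if_distrib[of "\<lambda>t. t * _"] abs_sgn cong: if_cong)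
    ultimately have "Q (nat \<bar>\<alpha> $ l\<bar>)"
      using l \<alpha> by (auto simp: Q_def)
    then show ?thesis ..
  qed
  define d where "d = (LEAST m. Q m)"
  have "Q d"
    unfolding d_def using \<open>\<exists>m. Q m\<close> by (rule LeastI_ex)
  then obtain g \<alpha> where d: "d > 0" and g: "g \<in> Zpow I" and \<alpha>: "\<alpha> \<in> N" "ipair g \<alpha> = int d"
    by (auto simp: Q_def)
  \<comment> \<open>A remainder modulo \<open>d\<close> that is itself a value must be \<open>0\<close>, by minimality.\<close>
  have min: "int d dvd ipair g' \<beta>" if "g' \<in> Zpow I" "\<beta> \<in> N" "ipair g' \<beta> mod int d = ipair g'' \<gamma>"
    "g'' \<in> Zpow I" "\<gamma> \<in> N" for g' \<beta> g'' \<gamma>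
  proof (rule ccontr)
    define r where "r = ipair g' \<beta> mod int d"
    assume "\<not> int d dvd ipair g' \<beta>"
    then have "r \<noteq> 0"
      by (simp add: r_def dvd_eq_mod_eq_0)
    moreover have "r \<ge> 0" "r < int d"
      using d by (simp_all add: r_def)
    ultimately have "ipair g'' \<gamma> = int (nat r)" "nat r > 0"
      using that(3) by (simp_all add: r_def)
    then have "Q (nat r)"
      using that(4,5) unfolding Q_def by blast
    moreover have "nat r < d"
      using \<open>r < int d\<close> \<open>r \<ge> 0\<close> by linarith
    ultimately show False
      using not_less_Least[of "nat r" Q] by (simp add: d_def)
  qed
  have div_alpha: "int d dvd ipair g' \<alpha>" if "g' \<in> Zpow I" for g'
  proof (rule min[OF that \<alpha>(1)])
    show "ipair g' \<alpha> mod int d = ipair (g' - (ipair g' \<alpha> div int d) *s g) \<alpha>"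
      using \<alpha> by (simp add: ipair_diff ipair_scale minus_div_mult_eq_mod)
  qed (use that g \<alpha> in \<open>auto intro: Zpow_diff Zpow_scale\<close>)
  have div_g: "int d dvd ipair g \<beta>" if "\<beta> \<in> N" for \<beta>
  proof (rule min[OF g that])
    show "ipair g \<beta> mod int d = ipair g (\<beta> - (ipair g \<beta> div int d) *s \<alpha>)"
      using \<alpha> by (simp add: ipair_diff ipair_scale minus_div_mult_eq_mod)
  qed (use that g \<alpha> Nsub in auto)
  define w where "w = (\<chi> l. \<alpha> $ l div int d)"
  have w: "int d *s w = \<alpha>"
  proof -
    have "int d dvd \<alpha> $ l" for l
    proof (cases "l \<in> I")
      case True
      then have "axis l 1 \<in> Zpow I"
        by (auto simp: Zpow_def axis_def)
      then show ?thesis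
        using div_alpha[of "axis l 1"] by (simp add: ipair_axis)
    next
      case False
      then show ?thesis
        using \<alpha>(1) sub(2) by (auto simp: Zpow_def)
    qed
    then show ?thesis
      by (simp add: w_def Finite_Cartesian_Product.vec_eq_iff)
  qed
  have wZ: "w \<in> Zpow I"
    using \<alpha>(1) sub(2) by (auto simp: w_def Zpow_def)
  have xw: "ipair (x k) w = 0" if "k < p" for k
    using ker[OF that \<alpha>(1)] d by (simp add: w[symmetric] ipair_scale)
  have gw: "ipair g w = 1"
    using \<alpha>(2) d by (simp add: w[symmetric] ipair_scale)
  \<comment> \<open>Correct \<open>g\<close> so that it vanishes on the summands already found; on \<open>N\<close> nothing changes.\<close>
  define f where "f = g - (\<Sum>k<p. ipair g (v k) *s x k)"
  have fZ: "f \<in> Zpow I"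
    unfolding f_def by (intro Zpow_diff Zpow_sum Zpow_scale g) (use bi in \<open>auto simp: biorthogonal_def\<close>)
  have fN: "ipair f \<beta> = ipair g \<beta>" if "\<And>k. k < p \<Longrightarrow> ipair (x k) \<beta> = 0" for \<beta>
    using that by (simp add: f_def ipair_diff ipair_sum ipair_scale)
  have fw: "ipair f w = 1"
    using fN[of w] xw gw by simp
  have fv: "ipair f (v k) = 0" if "k < p" for k
    using biorthogonal_sum(2)[OF bi that] by (simp add: f_def ipair_diff)
  show thesis
  proof (rule that)
    show "biorthogonal I (Suc p) (v(p := w)) (x(p := f))"
      unfolding biorthogonal_def
    proof (intro conjI allI impI)
      fix j k assume "j < Suc p" "k < Suc p"
      then show "ipair ((x(p := f)) j) ((v(p := w)) k) = (if j = k then 1 else 0)"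
        using bi xw fv fw by (cases "j = p"; cases "k = p") (simp_all add: biorthogonal_def)
    qed (use bi wZ fZ in \<open>auto simp: biorthogonal_def less_Suc_eq\<close>)
    show "int d *s w \<in> N"
      using \<alpha> w by simp
    show "int d dvd ipair f \<beta>" if "\<beta> \<in> N" for \<beta>
      using div_g[OF that] fN[of \<beta>] ker that by simp
  qed (rule d)
qed

text \<open>
  Splitting off summands must stop, since biorthogonal systems are bounded by the dimension.
  Here \<open>m\<close> counts the summands that are kept fixed.
\<close>

lemma biorthogonal_maximal:
  assumes "Q (0::nat)" and "\<And>p. Q p \<Longrightarrow> \<exists>v x :: nat \<Rightarrow> int^'l::finite. biorthogonal I (m + p) v x"
  obtains p where "Q p" "\<not> Q (Suc p)"
proof -
  have "{p. Q p} \<subseteq> {..CARD('l)}"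
    using assms(2) biorthogonal_bound by fastforce
  then have fin: "finite {p. Q p}"
    by (rule finite_subset) simp
  have "Q (Max {p. Q p})"
    using Max_in[OF fin] assms(1) by blast
  moreover have "\<not> Q (Suc (Max {p. Q p}))"
    using Max_ge[OF fin, of "Suc (Max {p. Q p})"] by auto
  ultimately show thesis
    by (rule that)
qed

text \<open>
  First split off summands that meet \<open>L\<close>, until the functionals found so far have no common zero in
  \<open>L\<close> other than \<open>0\<close>; then \<open>L\<close> is spanned by the vectors \<open>d k *s v k\<close>.  What is left of the lattice
  is split off regardless of \<open>L\<close>: the new functionals vanish on the old \<open>v k\<close>, hence on \<open>L\<close>.
\<close>

theorem adapted_basis_exists:
  fixes A :: "(int^'l::finite) set"
  assumes A: "A \<subseteq> Zpow I"
  obtains n q v x d where "adapted_basis I A n q v x d"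
proof -
  define L where "L = L_lattice A"
  have L: "zmod.subspace L" "L \<subseteq> Zpow I"
    using zmod.subspace_span[of A] zmod.span_minimal[OF A subspace_Zpow]
    by (simp_all add: L_def L_lattice_zspan)
  have Lop: "\<alpha> + \<beta> \<in> L" "c *s \<alpha> \<in> L" "\<alpha> - \<beta> \<in> L" if "\<alpha> \<in> L" "\<beta> \<in> L" for \<alpha> \<beta> c
    using L(1) that by (simp_all add: zmod.subspace_add zmod.subspace_scale zmod.subspace_diff)
  have Ldiffsum: "\<alpha> - (\<Sum>k\<in>S. f k) \<in> L" if "\<alpha> \<in> L" "\<And>k. k \<in> S \<Longrightarrow> f k \<in> L" for \<alpha> f and S :: "nat set"
    using that L(1) by (intro zmod.subspace_diff zmod.subspace_sum) auto
  define P1 where "P1 p v x d \<longleftrightarrow> biorthogonal I p v x \<and>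
      (\<forall>k<p. d k > 0 \<and> int (d k) *s v k \<in> L \<and> (\<forall>\<alpha>\<in>L. int (d k) dvd ipair (x k) \<alpha>))"
    for p v x and d :: "nat \<Rightarrow> nat"
  obtain q where "\<exists>v x d. P1 q v x d" and max1: "\<not> (\<exists>v x d. P1 (Suc q) v x d)"
  proof (rule biorthogonal_maximal[of "\<lambda>p. \<exists>v x d. P1 p v x d" I 0])
    show "\<exists>v x d. P1 0 v x d"
      by (simp add: P1_def biorthogonal_def)
    show "\<exists>v x. biorthogonal I (0 + p) v x" if "\<exists>v x d. P1 p v x d" for p
      using that unfolding P1_def add_0 by blast
  qed
  then obtain v x d where P1: "P1 q v x d"
    by blast
  have bi: "biorthogonal I q v x" and dq: "\<And>k. k < q \<Longrightarrow> d k > 0"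
    and dv: "\<And>k. k < q \<Longrightarrow> int (d k) *s v k \<in> L"
    and dd: "\<And>k \<alpha>. k < q \<Longrightarrow> \<alpha> \<in> L \<Longrightarrow> int (d k) dvd ipair (x k) \<alpha>"
    using P1 by (auto simp: P1_def)
  define N where "N = {\<alpha> \<in> L. \<forall>k<q. ipair (x k) \<alpha> = 0}"
  have remainder: "\<alpha> - (\<Sum>k<q. ipair (x k) \<alpha> *s v k) \<in> N" if \<alpha>: "\<alpha> \<in> L" for \<alpha>
  proof -
    have "ipair (x k) \<alpha> *s v k \<in> L" if "k < q" for k
    proof -
      obtain c where "ipair (x k) \<alpha> = c * int (d k)"
        using dd[OF \<open>k < q\<close> \<alpha>] by (metis dvd_def mult.commute)
      then have "ipair (x k) \<alpha> *s v k = c *s (int (d k) *s v k)"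
        by simp
      then show ?thesis
        using Lop(2) dv[OF that] by metis
    qed
    then have "\<alpha> - (\<Sum>k<q. ipair (x k) \<alpha> *s v k) \<in> L"
      by (intro Ldiffsum[OF \<alpha>]) auto
    then show ?thesis
      using biorthogonal_sum(1)[OF bi] by (simp add: N_def ipair_diff)
  qed
  have L_expand: "\<alpha> = (\<Sum>k<q. ipair (x k) \<alpha> *s v k)" if \<alpha>: "\<alpha> \<in> L" for \<alpha>
  proof -
    have "N = {0}"
    proof (rule ccontr)
      assume "N \<noteq> {0}"
      have "zmod.subspace N"
        using L(1) by (auto simp: N_def zmod.subspace_def ipair_0 ipair_add ipair_scale)
      then obtain w f e where wf: "biorthogonal I (Suc q) (v(q := w)) (x(q := f))" "e > 0"
        "int e *s w \<in> N" "\<And>\<alpha>. \<alpha> \<in> N \<Longrightarrow> int e dvd ipair f \<alpha>"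
        by (rule biorthogonal_step[OF bi _ _ _ \<open>N \<noteq> {0}\<close>]) (use L(2) in \<open>auto simp: N_def\<close>)
      have "int e dvd ipair f \<alpha>" if "\<alpha> \<in> L" for \<alpha>
      proof -
        define \<beta> where "\<beta> = \<alpha> - (\<Sum>k<q. ipair (x k) \<alpha> *s v k)"
        have "\<beta> \<in> N"
          unfolding \<beta>_def by (rule remainder[OF that])
        moreover have "ipair f (v k) = 0" if "k < q" for k
          using wf(1) that unfolding biorthogonal_def
          by (metis fun_upd_other fun_upd_same less_Suc_eq less_irrefl)
        then have "ipair f \<beta> = ipair f \<alpha>"
          by (simp add: \<beta>_def ipair_diff ipair_sum ipair_scale)
        ultimately show ?thesis
          using wf(4) by metis
      qed
      then have "P1 (Suc q) (v(q := w)) (x(q := f)) (d(q := e))"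
        using wf(1-3) dq dv dd by (auto simp: P1_def less_Suc_eq N_def)
      then show False
        using max1 by blast
    qed
    then show ?thesis
      using remainder[OF \<alpha>] by simp
  qed
  define P2 where "P2 p v' x' \<longleftrightarrow> biorthogonal I (q + p) v' x' \<and>
      (\<forall>k<q. v' k = v k \<and> x' k = x k) \<and> (\<forall>\<alpha>\<in>L. \<forall>k. q \<le> k \<longrightarrow> k < q + p \<longrightarrow> ipair (x' k) \<alpha> = 0)" for p v' x'
  obtain p where "\<exists>v' x'. P2 p v' x'" and max2: "\<not> (\<exists>v' x'. P2 (Suc p) v' x')"
  proof (rule biorthogonal_maximal[of "\<lambda>p. \<exists>v' x'. P2 p v' x'" I q])
    have "P2 0 v x"
      using bi by (simp add: P2_def)
    then show "\<exists>v' x'. P2 0 v' x'"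
      by blast
    show "\<exists>v x. biorthogonal I (q + p) v x" if "\<exists>v' x'. P2 p v' x'" for p
      using that unfolding P2_def by blast
  qed
  then obtain v' x' where P2: "P2 p v' x'"
    by blast
  define n where "n = q + p"
  have bi': "biorthogonal I n v' x'" and eq: "\<And>k. k < q \<Longrightarrow> v' k = v k \<and> x' k = x k"
    and zero: "\<And>k \<alpha>. \<alpha> \<in> L \<Longrightarrow> q \<le> k \<Longrightarrow> k < n \<Longrightarrow> ipair (x' k) \<alpha> = 0"
    using P2 by (auto simp: P2_def n_def)
  define M where "M = {\<alpha> \<in> Zpow I. \<forall>k<n. ipair (x' k) \<alpha> = 0}"
  have "M = {0}"
  proof (rule ccontr)
    assume "M \<noteq> {0}"
    have "zmod.subspace M"
      by (auto simp: M_def zmod.subspace_def ipair_0 ipair_add ipair_scale Zpow_0 Zpow_add Zpow_scale)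
    then obtain w f e where wf: "biorthogonal I (Suc n) (v'(n := w)) (x'(n := f))"
      by (rule biorthogonal_step[OF bi' _ _ _ \<open>M \<noteq> {0}\<close>]) (auto simp: M_def)
    have "ipair f (v' k) = 0" if "k < n" for k
      using wf that unfolding biorthogonal_def
      by (metis fun_upd_other fun_upd_same less_Suc_eq less_irrefl)
    then have fv: "ipair f (v k) = 0" if "k < q" for k
      using eq[OF that] that by (metis n_def trans_less_add1)
    have "ipair f \<alpha> = 0" if "\<alpha> \<in> L" for \<alpha>
      by (subst L_expand[OF that]) (simp add: ipair_sum ipair_scale fv)
    then have "P2 (Suc p) (v'(n := w)) (x'(n := f))"
      using wf eq zero by (auto simp: P2_def n_def less_Suc_eq)
    then show False
      using max2 by blast
  qed
  have "adapted_basis I A n q v' x' d"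
  proof
    show expand: "\<alpha> = (\<Sum>k<n. ipair (x' k) \<alpha> *s v' k)" if "\<alpha> \<in> Zpow I" for \<alpha>
    proof -
      have "\<alpha> - (\<Sum>k<n. ipair (x' k) \<alpha> *s v' k) \<in> M"
        using biorthogonal_sum(1)[OF bi'] that bi'
        by (auto simp: M_def ipair_diff biorthogonal_def intro!: Zpow_diff Zpow_sum Zpow_scale)
      then show ?thesis
        using \<open>M = {0}\<close> by simp
    qed
    show "L_lattice A = {\<alpha> \<in> Zpow I. (\<forall>k<q. int (d k) dvd ipair (x' k) \<alpha>) \<and>
        (\<forall>k\<ge>q. k < n \<longrightarrow> ipair (x' k) \<alpha> = 0)}" (is "_ = ?R")
    proof
      show "L_lattice A \<subseteq> ?R"
        using L(2) dd eq zero by (auto simp: L_def[symmetric])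
      show "?R \<subseteq> L_lattice A"
      proof
        fix \<alpha> assume \<alpha>: "\<alpha> \<in> ?R"
        have "ipair (x' k) \<alpha> *s v' k \<in> L" if "k < n" for k
        proof (cases "k < q")
          case True
          then obtain c where "ipair (x' k) \<alpha> = c * int (d k)"
            using \<alpha> by (auto simp: dvd_def mult.commute)
          then have "ipair (x' k) \<alpha> *s v' k = c *s (int (d k) *s v k)"
            using eq[OF True] by simp
          then show ?thesis
            using Lop(2) dv[OF True] by metis
        next
          case False
          then have "ipair (x' k) \<alpha> = 0"
            using \<alpha> \<open>k < n\<close> by simp
          then show ?thesis
            using L(1) by (simp add: zmod.subspace_def)
        qed
        then have "(\<Sum>k<n. ipair (x' k) \<alpha> *s v' k) \<in> L"
          using L(1) by (intro zmod.subspace_sum) auto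
        moreover have "(\<Sum>k<n. ipair (x' k) \<alpha> *s v' k) = \<alpha>"
          by (rule expand[symmetric]) (use \<alpha> in auto)
        ultimately show "\<alpha> \<in> L_lattice A"
          by (simp add: L_def)
      qed
    qed
  qed (use A bi' dq in \<open>auto simp: n_def biorthogonal_def\<close>)
  then show thesis
    by (rule that)
qed

subsection \<open>Rank, saturation and the quotient\<close>

lemma cast_zspan:
  assumes "\<alpha> \<in> zmod.span A"
  shows "(cast_vec \<alpha> :: 'a::field^'l::finite) \<in> vec.span (cast_vec ` A)"
  using assms
proof (induction rule: zmod.span_induct)
  case base
  show ?case
    by (auto simp: zmod.subspace_def cast_vec_0 cast_vec_add cast_vec_scale vec.span_zero
        intro!: vec.span_add vec.span_scale)
qed (auto intro: vec.span_base)

text \<open>Clearing denominators turns a rational relation into an integral one.\<close>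

lemma zindependent_cast:
  assumes ind: "\<not> zmod.dependent B"
  shows "vec.independent (cast_vec ` B :: (rat^'l::finite) set)"
proof
  assume "vec.dependent (cast_vec ` B :: (rat^'l) set)"
  then obtain T u where T: "finite T" "T \<subseteq> (cast_vec ` B :: (rat^'l) set)"
    "(\<Sum>y\<in>T. u y *s y) = 0" "\<exists>y\<in>T. u y \<noteq> 0"
    unfolding vec.dependent_explicit by blast
  obtain S where S: "S \<subseteq> B" "T = cast_vec ` S"
    using T(2) by (meson subset_imageE)
  have injS: "inj_on (cast_vec :: int^'l \<Rightarrow> rat^'l) S"
    by (simp add: inj_on_def cast_vec_inj)
  have finS: "finite S"
    using T(1) S(2) injS by (simp add: finite_image_iff)
  define c where "c b = u (cast_vec b)" for b
  have "\<exists>D>0. \<forall>b\<in>S. \<exists>m. of_int D * c b = of_int m"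
    using finS
  proof (induction S)
    case empty
    then show ?case by (intro exI[of _ 1]) simp
  next
    case (insert b S)
    then obtain D where D: "D > 0" "\<forall>b\<in>S. \<exists>m. of_int D * c b = of_int m"
      by blast
    obtain p q where pq: "c b = of_int p / of_int q" "q > 0"
      by (metis quotient_of_div quotient_of_denom_pos surj_pair)
    have "\<exists>m. of_int (D * q) * c b' = of_int m" if b': "b' \<in> insert b S" for b'
    proof (cases "b' = b")
      case True
      then show ?thesis
        using pq by (intro exI[of _ "D * p"]) simp
    next
      case False
      then obtain m where "of_int D * c b' = of_int m"
        using D b' by blast
      then show ?thesis
        by (intro exI[of _ "q * m"]) (simp add: mult.assoc mult.left_commute)
    qed
    then show ?case
      using D pq by (intro exI[of _ "D * q"]) auto
  qed
  then obtain D m where D: "D > 0" and m: "\<And>b. b \<in> S \<Longrightarrow> of_int D * c b = of_int (m b)"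
    by metis
  have "cast_vec (\<Sum>b\<in>S. m b *s b) = (of_int D :: rat) *s (\<Sum>b\<in>S. c b *s cast_vec b)"
    by (simp add: cast_vec_sum cast_vec_scale m[symmetric] vec.scale_sum_right)
  also have "(\<Sum>b\<in>S. c b *s cast_vec b) = (0 :: rat^'l)"
    using T(3) unfolding S(2) sum.reindex[OF injS] c_def by (simp add: o_def)
  finally have "cast_vec (\<Sum>b\<in>S. m b *s b) = (cast_vec 0 :: rat^'l)"
    by (simp add: cast_vec_0)
  then have "(\<Sum>b\<in>S. m b *s b) = 0"
    by (simp only: cast_vec_inj)
  moreover obtain b where "b \<in> S" "c b \<noteq> 0"
    using T(4) S(2) by (auto simp: c_def)
  then have "m b \<noteq> 0"
    using m[of b] D by auto
  ultimately have "zmod.dependent B"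
    unfolding zmod.dependent_explicit using finS S(1) \<open>b \<in> S\<close> by blast
  then show False
    using ind by simp
qed

context adapted_basis
begin

lemma biorthogonal: "biorthogonal I n v x"
  using v_Zpow x_Zpow dual by (simp add: biorthogonal_def)

lemma A_lattice: "\<alpha> \<in> A \<Longrightarrow> \<alpha> \<in> L_lattice A"
  by (simp add: L_lattice_zspan zmod.span_base)

lemma A_coords: "\<alpha> \<in> A \<Longrightarrow> k < q \<Longrightarrow> int (d k) dvd ipair (x k) \<alpha>"
  "\<alpha> \<in> A \<Longrightarrow> q \<le> k \<Longrightarrow> k < n \<Longrightarrow> ipair (x k) \<alpha> = 0"
  using A_lattice lattice by auto

lemma dv_lattice: "k < q \<Longrightarrow> int (d k) *s v k \<in> L_lattice A"
  using q_le dual unfolding lattice by (auto simp: Zpow_scale v_Zpow ipair_scale)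

lemma expand_low:
  assumes "\<alpha> \<in> Zpow I" "\<And>k. q \<le> k \<Longrightarrow> k < n \<Longrightarrow> ipair (x k) \<alpha> = 0"
  shows "\<alpha> = (\<Sum>k<q. ipair (x k) \<alpha> *s v k)"
proof -
  have "(\<Sum>k<q. ipair (x k) \<alpha> *s v k) = (\<Sum>k<n. ipair (x k) \<alpha> *s v k)"
    by (rule sum.mono_neutral_left) (use q_le assms(2) in auto)
  then show ?thesis
    using expand[OF assms(1)] by simp
qed

lemma cast_span_eq:
  "vec.span (cast_vec ` A) = vec.span ((\<lambda>k. cast_vec (v k) :: 'a::field_char_0^'l) ` {..<q})"
proof (rule subset_antisym; rule vec.span_minimal)
  show "cast_vec ` A \<subseteq> vec.span ((\<lambda>k. cast_vec (v k) :: 'a^'l) ` {..<q})"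
  proof (rule image_subsetI)
    fix \<alpha> assume \<alpha>: "\<alpha> \<in> A"
    have "\<alpha> = (\<Sum>k<q. ipair (x k) \<alpha> *s v k)"
      by (rule expand_low) (use \<alpha> A_sub A_coords in auto)
    then have "cast_vec \<alpha> = (\<Sum>k<q. of_int (ipair (x k) \<alpha>) *s (cast_vec (v k) :: 'a^'l))"
      by (metis (no_types, lifting) cast_vec_scale cast_vec_sum sum.cong)
    also have "\<dots> \<in> vec.span ((\<lambda>k. cast_vec (v k)) ` {..<q})"
      by (intro vec.span_sum vec.span_scale vec.span_base) auto
    finally show "(cast_vec \<alpha> :: 'a^'l) \<in> vec.span ((\<lambda>k. cast_vec (v k)) ` {..<q})" .
  qed
  show "(\<lambda>k. cast_vec (v k) :: 'a^'l) ` {..<q} \<subseteq> vec.span (cast_vec ` A)"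
  proof (rule image_subsetI)
    fix k assume "k \<in> {..<q}"
    then have k: "k < q" by simp
    have "(cast_vec (int (d k) *s v k) :: 'a^'l) \<in> vec.span (cast_vec ` A)"
      using dv_lattice[OF k] by (intro cast_zspan) (simp add: L_lattice_zspan)
    then have "inverse (of_int (int (d k))) *s (cast_vec (int (d k) *s v k) :: 'a^'l) \<in> vec.span (cast_vec ` A)"
      by (rule vec.span_scale)
    then show "(cast_vec (v k) :: 'a^'l) \<in> vec.span (cast_vec ` A)"
      using d_pos[OF k] by (simp add: cast_vec_scale)
  qed
qed simp_all

lemma biorthogonal_q: "biorthogonal I q v x"
  using biorthogonal q_le by (simp add: biorthogonal_def)

lemma card_cast_v: "card ((\<lambda>k. cast_vec (v k) :: 'a::field_char_0^'l) ` {..<q}) = q"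
  using card_image[OF biorthogonal_independent(2)[OF biorthogonal_q, where 'a = 'a]] by simp

lemma rat_dim: "vec.dim (vec.span (cast_vec ` A :: (rat^'l) set)) = q"
  unfolding cast_span_eq vec.dim_span
  using vec.dim_eq_card_independent[OF biorthogonal_independent(1)[OF biorthogonal_q]] card_cast_v
  by metis

text \<open>
  Vectors that are independent over the integers stay so over the rationals, which bounds the rank by
  the rational dimension; the vectors \<open>d k *s v k\<close> attain the bound.
\<close>

lemma zrank_eq: "zrank (L_lattice A) = q"
proof -
  define S where "S = {card B | B. B \<subseteq> L_lattice A \<and> finite B \<and> \<not> zmod.dependent B}"
  have bound: "m \<le> q" if m: "m \<in> S" for m
  proof -
    obtain B where B: "B \<subseteq> L_lattice A" "finite B" "\<not> zmod.dependent B" "m = card B"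
      using m unfolding S_def by blast
    have "(cast_vec ` B :: (rat^'l) set) \<subseteq> vec.span (cast_vec ` A)"
      using B(1) cast_zspan by (auto simp: L_lattice_zspan)
    then have "card (cast_vec ` B :: (rat^'l) set) \<le> vec.dim (vec.span (cast_vec ` A :: (rat^'l) set))"
      by (rule vec.independent_card_le_dim[OF _ zindependent_cast[OF B(3)]])
    moreover have "card (cast_vec ` B :: (rat^'l) set) = m"
      unfolding B(4) by (rule card_image) (simp add: inj_on_def cast_vec_inj)
    ultimately show ?thesis
      by (simp only: rat_dim)
  qed
  define B where "B = (\<lambda>k. int (d k) *s v k) ` {..<q}"
  have coord: "ipair (x j) (int (d k) *s v k) = (if j = k then int (d k) else 0)" if "j < q" "k < q" for j k
    using that q_le dual[of j k] by (simp add: ipair_scale)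
  have inj: "inj_on (\<lambda>k. int (d k) *s v k) {..<q}"
  proof (rule inj_onI)
    fix j k assume jk: "j \<in> {..<q}" "k \<in> {..<q}" "int (d j) *s v j = int (d k) *s v k"
    have "ipair (x j) (int (d k) *s v k) = int (d j)"
      using coord[of j j] jk by simp
    moreover have "d j > 0"
      using jk d_pos by simp
    ultimately show "j = k"
      using jk(1,2) coord[of j k] by (simp split: if_splits)
  qed
  have "\<not> zmod.dependent B"
  proof
    assume "zmod.dependent B"
    then obtain T u b where T: "finite T" "T \<subseteq> B" "(\<Sum>y\<in>T. u y *s y) = 0" "b \<in> T" "u b \<noteq> 0"
      unfolding zmod.dependent_explicit by blast
    then obtain j where j: "j < q" "b = int (d j) *s v j"
      by (auto simp: B_def)
    have "0 = ipair (x j) (\<Sum>y\<in>T. u y *s y)"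
      by (simp add: T(3) ipair_0)
    also have "\<dots> = (\<Sum>y\<in>T. u y * ipair (x j) y)"
      by (simp add: ipair_sum ipair_scale)
    also have "\<dots> = (\<Sum>y\<in>T. if y = b then u b * int (d j) else 0)"
    proof (rule sum.cong)
      fix y assume "y \<in> T"
      then obtain k where k: "k < q" "y = int (d k) *s v k"
        using T(2) by (auto simp: B_def)
      show "u y * ipair (x j) y = (if y = b then u b * int (d j) else 0)"
      proof (cases "j = k")
        case True
        then show ?thesis
          using k j coord[of j k] by simp
      next
        case False
        then have "y \<noteq> b"
          using inj_onD[OF inj, of j k] k(1) j(1) unfolding k(2) j(2) by auto
        then show ?thesis
          using k j False coord[of j k] by simp
      qed
    qed simp
    also have "\<dots> = u b * int (d j)"
      using T by simp
    finally show False
      using T(5) d_pos[OF j(1)] by simp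
  qed
  moreover have "B \<subseteq> L_lattice A"
    using dv_lattice by (auto simp: B_def)
  moreover have "card B = q"
    unfolding B_def using inj by (simp add: card_image)
  ultimately have "q \<in> S"
    unfolding S_def by (intro CollectI exI[of _ B]) (auto simp: B_def)
  moreover have "finite S"
    using bound by (meson finite_nat_set_iff_bounded_le)
  ultimately have "Max S = q"
    using bound by (intro Max_eqI) auto
  then show ?thesis
    by (simp add: zrank_def S_def)
qed

text \<open>
  The functionals \<open>x k\<close> with \<open>k \<ge> q\<close> vanish on \<open>A\<close>, hence on its rational span; and a lattice vector
  on which they vanish is a combination of the \<open>v k\<close> with \<open>k < q\<close>, of which a multiple lies in the
  span of \<open>A\<close>.
\<close>

lemma L_sat_eq: "L_sat I A = {\<alpha> \<in> Zpow I. \<forall>k. q \<le> k \<longrightarrow> k < n \<longrightarrow> ipair (x k) \<alpha> = 0}" (is "_ = ?R")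
proof
  show "L_sat I A \<subseteq> ?R"
  proof
    fix \<alpha> assume "\<alpha> \<in> L_sat I A"
    then have \<alpha>: "\<alpha> \<in> Zpow I" "cast_vec \<alpha> \<in> vec.span (cast_vec ` A :: (rat^'l) set)"
      by (auto simp: L_sat_def)
    have "ipair (x k) \<alpha> = 0" if k: "q \<le> k" "k < n" for k
    proof -
      define p where "p y = (\<Sum>l\<in>UNIV. of_int (x k $ l) * y $ l)" for y :: "rat^'l"
      have p: "p (cast_vec \<beta>) = of_int (ipair (x k) \<beta>)" for \<beta>
        by (simp add: p_def ipair_def)
      have "vec.subspace {y. p y = 0}"
        by (auto simp: vec.subspace_def p_def algebra_simps sum.distrib simp flip: sum_distrib_left)
      moreover have "cast_vec ` A \<subseteq> {y. p y = 0}"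
        using A_coords(2) k by (auto simp: p)
      ultimately have "p (cast_vec \<alpha>) = 0"
        using \<alpha>(2) vec.span_minimal[of "cast_vec ` A" "{y. p y = 0}"] by blast
      then show ?thesis
        by (simp add: p)
    qed
    then show "\<alpha> \<in> ?R"
      using \<alpha> by blast
  qed
  show "?R \<subseteq> L_sat I A"
  proof
    fix \<alpha> assume \<alpha>: "\<alpha> \<in> ?R"
    then have "\<alpha> = (\<Sum>k<q. ipair (x k) \<alpha> *s v k)"
      by (intro expand_low) auto
    then have "cast_vec \<alpha> = (\<Sum>k<q. of_int (ipair (x k) \<alpha>) *s (cast_vec (v k) :: rat^'l))"
      by (metis (no_types, lifting) cast_vec_scale cast_vec_sum sum.cong)
    also have "\<dots> \<in> vec.span ((\<lambda>k. cast_vec (v k)) ` {..<q})"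
      by (intro vec.span_sum vec.span_scale vec.span_base) auto
    finally show "\<alpha> \<in> L_sat I A"
      using \<alpha> by (simp add: L_sat_def cast_span_eq)
  qed
qed

end

lemma comm_group_additive_group:
  assumes "0 \<in> S" "\<And>a b. a \<in> S \<Longrightarrow> b \<in> S \<Longrightarrow> a + b \<in> S" "\<And>a. a \<in> S \<Longrightarrow> - a \<in> S"
  shows "comm_group (additive_group S)"
proof (rule comm_groupI)
  fix a assume "a \<in> carrier (additive_group S)"
  then show "\<exists>b\<in>carrier (additive_group S). b \<otimes>\<^bsub>additive_group S\<^esub> a = \<one>\<^bsub>additive_group S\<^esub>"
    using assms by (intro bexI[of _ "- a"]) (auto simp: additive_group_def)
qed (use assms in \<open>auto simp: additive_group_def algebra_simps\<close>)

lemma additive_group_simps [simp]: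
  "carrier (additive_group S) = S" "a \<otimes>\<^bsub>additive_group S\<^esub> b = a + b" "\<one>\<^bsub>additive_group S\<^esub> = 0"
  by (simp_all add: additive_group_def)

context adapted_basis
begin

lemma comm_group_L_sat: "comm_group (additive_group (L_sat I A))"
  by (rule comm_group_additive_group)
    (auto simp: L_sat_eq ipair_0 ipair_add ipair_minus Zpow_def)

lemma v_L_sat: "k < q \<Longrightarrow> v k \<in> L_sat I A"
  using v_Zpow q_le dual by (auto simp: L_sat_eq)

lemma L_sat_sum: "(\<Sum>k<q. c k *s v k) \<in> L_sat I A"
  using v_L_sat by (auto simp: L_sat_eq ipair_sum ipair_scale intro!: Zpow_sum Zpow_scale)

text \<open>
  Taking the \<open>k\<close>-th coordinate modulo \<open>d k\<close> for all \<open>k < q\<close> is a surjective homomorphism on the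
  saturation, with kernel \<open>L_lattice A\<close>.
\<close>

lemma L_sat_quotient:
  "additive_group (L_sat I A) Mod L_lattice A \<cong> product_group {..<q} (\<lambda>j. integer_mod_group (d j))"
proof -
  let ?G = "additive_group (L_sat I A)" and ?H = "product_group {..<q} (\<lambda>j. integer_mod_group (d j))"
  define h where "h \<alpha> = (\<lambda>k\<in>{..<q}. ipair (x k) \<alpha> mod int (d k))" for \<alpha>
  interpret G: comm_group ?G
    by (rule comm_group_L_sat)
  have H: "group ?H"
    by (rule product_group) simp
  have car: "carrier ?H = (\<Pi>\<^sub>E k\<in>{..<q}. {0..<int (d k)})"
    unfolding carrier_product_group
    by (rule PiE_cong) (use d_pos in \<open>auto simp: carrier_integer_mod_group\<close>)
  have hom: "h \<in> hom ?G ?H"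
  proof (rule homI)
    show "h \<alpha> \<in> carrier ?H" for \<alpha>
      unfolding car using d_pos by (auto simp: h_def)
    show "h (\<alpha> \<otimes>\<^bsub>?G\<^esub> \<beta>) = h \<alpha> \<otimes>\<^bsub>?H\<^esub> h \<beta>" for \<alpha> \<beta>
      by (auto simp: h_def fun_eq_iff ipair_add mod_add_eq)
  qed
  interpret group_hom ?G ?H h
    using hom H by (simp add: group_hom_def group_hom_axioms_def G.group_axioms)
  have surj: "h ` carrier ?G = carrier ?H"
  proof
    show "carrier ?H \<subseteq> h ` carrier ?G"
    proof
      fix m assume m: "m \<in> carrier ?H"
      have "h (\<Sum>k<q. m k *s v k) = m"
      proof
        fix k
        show "h (\<Sum>k<q. m k *s v k) k = m k"
        proof (cases "k < q")
          case True
          then have "m k \<in> {0..<int (d k)}"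
            using m unfolding car by (auto simp: PiE_iff)
          then show ?thesis
            using True biorthogonal_sum(1)[OF biorthogonal_q True, of m] by (simp add: h_def)
        next
          case False
          then show ?thesis
            using PiE_arb[of m "{..<q}" _ k] m unfolding car by (simp add: h_def)
        qed
      qed
      then show "m \<in> h ` carrier ?G"
        using imageI[of "\<Sum>k<q. m k *s v k" "carrier ?G" h] L_sat_sum[of m] by simp
    qed
  qed (use hom in \<open>auto simp: hom_def\<close>)
  have h_one: "h \<alpha> = \<one>\<^bsub>?H\<^esub> \<longleftrightarrow> (\<forall>k<q. int (d k) dvd ipair (x k) \<alpha>)" for \<alpha>
  proof -
    have "(f = g) \<longleftrightarrow> (\<forall>k. f k = g k)" for f g :: "nat \<Rightarrow> int"
      by auto
    then show ?thesis
      unfolding h_def one_product_group one_integer_mod_group restrict_def dvd_eq_mod_eq_0 by simp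
  qed
  have "kernel ?G ?H h = L_lattice A"
    unfolding kernel_def lattice h_one L_sat_eq additive_group_simps by blast
  then show ?thesis
    using FactGroup_iso[OF surj] by simp
qed

end

section \<open>Tori as topological groups\<close>

subsection \<open>The circle\<close>

lemma periods_iff_cis: "x \<in> periods \<longleftrightarrow> cis x = 1"
proof -
  have "cis x = 1 \<longleftrightarrow> (\<exists>n::int. x = of_int (2 * n) * pi)"
    unfolding cis_conv_exp exp_eq_1 by simp
  also have "\<dots> \<longleftrightarrow> x \<in> periods"
    by (simp add: periods_def ac_simps)
  finally show ?thesis ..
qed

lemma periods_of_int: "x \<in> periods \<Longrightarrow> of_int m * x \<in> periods"
  unfolding periods_def by (force intro: exI[of _ "m * _"])

lemma periods_0: "0 \<in> periods" and periods_add: "x \<in> periods \<Longrightarrow> y \<in> periods \<Longrightarrow> x + y \<in> periods"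
  and periods_minus: "x \<in> periods \<Longrightarrow> - x \<in> periods"
  by (simp_all add: periods_iff_cis cis_mult[symmetric] cis_divide[symmetric] flip: cis_inverse)

lemma periods_sum: "(\<And>k. k \<in> S \<Longrightarrow> f k \<in> periods) \<Longrightarrow> (\<Sum>k\<in>S. f k) \<in> periods"
  by (induction S rule: infinite_finite_induct) (auto simp: periods_0 periods_add)

lemma periods_2pi: "2 * pi * of_int m \<in> periods"
  by (auto simp: periods_def)

interpretation reals: comm_group "additive_group (UNIV :: real set)"
  by (rule comm_group_additive_group) auto

lemma normal_periods: "periods \<lhd> additive_group (UNIV :: real set)"
proof (rule reals.subgroup_imp_normal)
  have "inv\<^bsub>additive_group (UNIV :: real set)\<^esub> x = - x" for x
    by (rule reals.inv_equality) auto
  then show "subgroup periods (additive_group (UNIV :: real set))"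
    by (intro reals.subgroupI) (auto intro: periods_0 periods_add periods_minus)
qed

lemma circle_class_eq_image: "circle_class x = (\<lambda>p. p + x) ` periods"
  by (auto simp: circle_class_def r_coset_def)

lemma circle_class_eq_periods: "circle_class x = circle_class y \<longleftrightarrow> x - y \<in> periods"
proof
  assume "circle_class x = circle_class y"
  then have "x \<in> circle_class y"
    using periods_0 by (force simp: circle_class_eq_image)
  then show "x - y \<in> periods"
    by (auto simp: circle_class_eq_image)
next
  have sub: "circle_class x \<subseteq> circle_class y" if "x - y \<in> periods" for x y
  proof
    fix z assume "z \<in> circle_class x"
    then obtain p where "p \<in> periods" "z = p + x"
      by (auto simp: circle_class_eq_image)
    then show "z \<in> circle_class y"
      using periods_add[OF _ that, of p] by (force simp: circle_class_eq_image)
  qed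
  assume "x - y \<in> periods"
  then show "circle_class x = circle_class y"
    using sub[of x y] sub[of y x] periods_minus[of "x - y"] by auto
qed

lemma circle_class_eq_iff: "circle_class x = circle_class y \<longleftrightarrow> cis x = cis y"
  by (simp add: circle_class_eq_periods periods_iff_cis flip: cis_divide)

lemma carrier_circle_group: "carrier circle_group = range circle_class"
  by (auto simp: circle_group_def carrier_FactGroup circle_class_def)

lemma mult_circle_group: "circle_class x \<otimes>\<^bsub>circle_group\<^esub> circle_class y = circle_class (x + y)"
  using normal.rcos_sum[OF normal_periods, of x y]
  by (simp add: circle_group_def circle_class_def)

lemma one_circle_group: "\<one>\<^bsub>circle_group\<^esub> = circle_class 0"
  by (force simp: circle_group_def circle_class_eq_image)

lemma comm_group_circle_group: "comm_group circle_group"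
  unfolding circle_group_def
  by (intro reals.abelian_FactGroup normal_imp_subgroup normal_periods)

interpretation circle: comm_group circle_group
  by (rule comm_group_circle_group)

lemma int_pow_circle_group:
  "circle_class x [^]\<^bsub>circle_group\<^esub> (m :: int) = circle_class (of_int m * x)"
proof -
  have nat: "circle_class x [^]\<^bsub>circle_group\<^esub> k = circle_class (real k * x)" for k :: nat
    by (induction k) (simp_all add: one_circle_group mult_circle_group algebra_simps)
  have inv: "inv\<^bsub>circle_group\<^esub> circle_class y = circle_class (- y)" for y
    by (rule circle.inv_equality) (auto simp: mult_circle_group one_circle_group carrier_circle_group)
  show ?thesis
  proof (cases "m \<ge> 0")
    case True
    then show ?thesis
      unfolding int_pow_def2 nat by simp
  next
    case False
    then show ?thesis
      unfolding int_pow_def2 nat inv by simp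
  qed
qed

text \<open>
  The continuous embedding of the circle group into \<open>\<complex>\<close>; through it the circle inherits the Hausdorff
  property.
\<close>

definition circle_cis :: "real set \<Rightarrow> complex" where
  "circle_cis c = cis (SOME x. circle_class x = c)"

lemma circle_cis [simp]: "circle_cis (circle_class x) = cis x"
proof -
  have "circle_class (SOME y. circle_class y = circle_class x) = circle_class x"
    by (rule someI[of _ x]) simp
  then show ?thesis
    by (simp add: circle_cis_def circle_class_eq_iff)
qed

lemma quotient_map_circle_class: "quotient_map euclideanreal circle_topology circle_class"
  unfolding circle_topology_def by (rule quotient_map_quotient_topology)

lemma topspace_circle: "topspace circle_topology = range circle_class"
  using quotient_imp_surjective_map[OF quotient_map_circle_class] by simp

lemma continuous_circle_class: "continuous_map euclideanreal circle_topology circle_class"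
  by (rule quotient_imp_continuous_map[OF quotient_map_circle_class])

lemma continuous_circle_cis: "continuous_map circle_topology euclidean circle_cis"
proof (rule continuous_compose_quotient_map[OF quotient_map_circle_class])
  have "continuous_on UNIV cis"
    by (intro continuous_intros)
  then show "continuous_map euclideanreal euclidean (circle_cis \<circ> circle_class)"
    by (simp add: o_def)
qed

lemma Hausdorff_circle: "Hausdorff_space circle_topology"
proof (rule Hausdorff_space_injective_preimage[OF _ continuous_circle_cis])
  show "inj_on circle_cis (topspace circle_topology)"
    by (auto simp: inj_on_def topspace_circle circle_class_eq_iff)
qed simp

lemma circle_class_fundamental: "\<exists>y\<in>{0..2*pi}. circle_class x = circle_class y"
proof
  define k where "k = \<lfloor>x / (2 * pi)\<rfloor>"
  have "of_int k \<le> x / (2 * pi)" "x / (2 * pi) \<le> of_int k + 1"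
    unfolding k_def by linarith+
  then show "x - 2 * pi * of_int k \<in> {0..2*pi}"
    by (simp add: field_simps)
  show "circle_class x = circle_class (x - 2 * pi * of_int k)"
    by (simp add: circle_class_eq_periods periods_2pi)
qed

subsection \<open>Products of circles\<close>

text \<open>
  In contrast to \<open>torus_class\<close>, the angles are a family over an arbitrary index set.  This is needed for
  tori such as \<open>torus {..<q}\<close>, whose dimension is only known in the course of a proof.
\<close>

definition tclass :: "'i set \<Rightarrow> ('i \<Rightarrow> real) \<Rightarrow> 'i \<Rightarrow> real set" where
  "tclass S \<phi> = (\<lambda>k\<in>S. circle_class (\<phi> k))"

lemma torus_class_tclass: "torus_class I \<theta> = tclass I (\<lambda>l. \<theta> $ l)"
  by (simp add: torus_class_def tclass_def)

lemma carrier_torus: "carrier (torus S) = range (tclass S)"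
proof
  show "carrier (torus S) \<subseteq> range (tclass S)"
  proof
    fix p assume "p \<in> carrier (torus S)"
    then have p: "p \<in> (\<Pi>\<^sub>E k\<in>S. range circle_class)"
      by (simp add: torus_def carrier_circle_group)
    then have "\<forall>k\<in>S. \<exists>y. p k = circle_class y"
      by (auto simp: PiE_iff)
    then obtain \<phi> where "\<And>k. k \<in> S \<Longrightarrow> p k = circle_class (\<phi> k)"
      by metis
    moreover have "p k = undefined" if "k \<notin> S" for k
      using p that by (rule PiE_arb)
    ultimately have "p = tclass S \<phi>"
      by (auto simp: tclass_def fun_eq_iff)
    then show "p \<in> range (tclass S)"
      by blast
  qed
qed (auto simp: torus_def carrier_circle_group tclass_def)

lemma tclass_eq_iff: "tclass S \<phi> = tclass S \<psi> \<longleftrightarrow> (\<forall>k\<in>S. \<phi> k - \<psi> k \<in> periods)"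
proof -
  have "tclass S \<phi> = tclass S \<psi> \<longleftrightarrow> (\<forall>k\<in>S. circle_class (\<phi> k) = circle_class (\<psi> k))"
    unfolding tclass_def by (auto simp: fun_eq_iff)
  then show ?thesis
    by (simp add: circle_class_eq_periods)
qed

lemma mult_torus: "tclass S \<phi> \<otimes>\<^bsub>torus S\<^esub> tclass S \<psi> = tclass S (\<lambda>k. \<phi> k + \<psi> k)"
  by (auto simp: torus_def tclass_def mult_circle_group fun_eq_iff)

lemma one_torus: "\<one>\<^bsub>torus S\<^esub> = tclass S (\<lambda>k. 0)"
  by (auto simp: torus_def tclass_def one_circle_group)

lemma comm_group_torus: "comm_group (torus S)"
proof (rule group.group_comm_groupI)
  show "group (torus S)"
    unfolding torus_def by (rule product_group) (simp add: circle.is_group)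
  show "p \<otimes>\<^bsub>torus S\<^esub> p' = p' \<otimes>\<^bsub>torus S\<^esub> p" if "p \<in> carrier (torus S)" "p' \<in> carrier (torus S)" for p p'
    using that by (auto simp: carrier_torus mult_torus add.commute)
qed

lemma inv_torus: "inv\<^bsub>torus S\<^esub> tclass S \<phi> = tclass S (\<lambda>k. - \<phi> k)"
proof -
  interpret comm_group "torus S" by (rule comm_group_torus)
  show ?thesis
    by (rule inv_equality) (auto simp: mult_torus one_torus carrier_torus)
qed

lemma topspace_torus: "topspace (torus_topology S) = carrier (torus S)"
  by (simp add: torus_topology_def topspace_circle torus_def carrier_circle_group)

lemma Hausdorff_torus: "Hausdorff_space (torus_topology S)"
  by (simp add: torus_topology_def Hausdorff_space_product_topology Hausdorff_circle)

text \<open>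
  Every angle is congruent to one in \<open>[0, 2\<pi>]\<close>, so a torus is a quotient of a compact cube.
  Hence continuity of a map on the torus can be tested on angles.
\<close>

lemma quotient_map_tclass:
  "quotient_map (subtopology (powertop_real S) (\<Pi>\<^sub>E k\<in>S. {0..2*pi})) (torus_topology S) (tclass S)"
  and compact_torus: "compact_space (torus_topology S)"
proof -
  let ?X = "subtopology (powertop_real S) (\<Pi>\<^sub>E k\<in>S. {0..2*pi})"
  have "compactin (powertop_real S) (\<Pi>\<^sub>E k\<in>S. {0..2*pi})"
    by (simp add: compactin_PiE)
  then have comp: "compact_space ?X"
    by (rule compact_space_subtopology)
  have top: "topspace ?X = (\<Pi>\<^sub>E k\<in>S. {0..2*pi})"
    by (auto simp: PiE_iff)
  have cont: "continuous_map ?X (torus_topology S) (tclass S)"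
    unfolding torus_topology_def continuous_map_componentwise
  proof (intro conjI ballI)
    fix k assume k: "k \<in> S"
    have "continuous_map ?X circle_topology (circle_class \<circ> (\<lambda>x. x k))"
      by (intro continuous_map_compose[OF _ continuous_circle_class] continuous_map_from_subtopology
          continuous_map_product_projection k)
    then show "continuous_map ?X circle_topology (\<lambda>x. tclass S x k)"
      using k by (simp add: tclass_def o_def)
  qed (auto simp: tclass_def)
  have surj: "tclass S ` topspace ?X = topspace (torus_topology S)"
  proof
    show "topspace (torus_topology S) \<subseteq> tclass S ` topspace ?X"
    proof
      fix p assume "p \<in> topspace (torus_topology S)"
      then obtain \<phi> where p: "p = tclass S \<phi>"
        by (auto simp: topspace_torus carrier_torus)
      obtain y where y: "\<And>x. y x \<in> {0..2*pi}" "\<And>x. circle_class x = circle_class (y x)"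
        using circle_class_fundamental by metis
      have "p = tclass S (\<lambda>k\<in>S. y (\<phi> k))"
        using y(2) by (auto simp: p tclass_def fun_eq_iff)
      moreover have "(\<lambda>k\<in>S. y (\<phi> k)) \<in> topspace ?X"
        unfolding top using y(1) by auto
      ultimately show "p \<in> tclass S ` topspace ?X"
        by blast
    qed
  qed (auto simp: topspace_torus carrier_torus)
  show "quotient_map ?X (torus_topology S) (tclass S)"
    by (rule T1_Spaces.continuous_imp_quotient_map[OF cont comp Hausdorff_torus surj])
  show "compact_space (torus_topology S)"
    using image_compactin[of ?X "topspace ?X" "torus_topology S" "tclass S"] comp cont surj
    by (simp add: compact_space_def)
qed

text \<open>
  Only extensional families matter in the second premise, because they are the points of the product
  space \<open>powertop_real S\<close>.
\<close>

lemma continuous_map_from_torus: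
  assumes "continuous_map (powertop_real S) X G"
    and "\<And>\<phi>. \<phi> \<in> extensional S \<Longrightarrow> g (tclass S \<phi>) = G \<phi>"
  shows "continuous_map (torus_topology S) X g"
proof (rule continuous_compose_quotient_map[OF quotient_map_tclass])
  have "continuous_map (subtopology (powertop_real S) (\<Pi>\<^sub>E k\<in>S. {0..2*pi})) X G"
    by (rule continuous_map_from_subtopology[OF assms(1)])
  then show "continuous_map (subtopology (powertop_real S) (\<Pi>\<^sub>E k\<in>S. {0..2*pi})) X (g \<circ> tclass S)"
    by (rule continuous_map_eq) (use assms(2) in \<open>auto simp: PiE_iff\<close>)
qed

lemma carrier_torus_class: "carrier (torus I) = range (torus_class I)"
proof
  show "carrier (torus I) \<subseteq> range (torus_class I)"
  proof
    fix p assume "p \<in> carrier (torus I)"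
    then obtain \<phi> where "p = tclass I \<phi>"
      by (auto simp: carrier_torus)
    then have "p = torus_class I (\<chi> l. \<phi> l)"
      by (simp add: torus_class_tclass)
    then show "p \<in> range (torus_class I)"
      by blast
  qed
qed (auto simp: carrier_torus torus_class_tclass)

lemma torus_class_eq_iff: "torus_class I \<theta> = torus_class I \<theta>' \<longleftrightarrow> (\<forall>l\<in>I. \<theta> $ l - \<theta>' $ l \<in> periods)"
  by (simp add: torus_class_tclass tclass_eq_iff)

lemma mult_torus_class: "torus_class I \<theta> \<otimes>\<^bsub>torus I\<^esub> torus_class I \<theta>' = torus_class I (\<theta> + \<theta>')"
  by (simp add: torus_class_tclass mult_torus)

lemma one_torus_class: "\<one>\<^bsub>torus I\<^esub> = torus_class I 0"
  by (simp add: torus_class_tclass one_torus)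

lemma inv_torus_class: "inv\<^bsub>torus I\<^esub> torus_class I \<theta> = torus_class I (- \<theta>)"
  by (simp add: torus_class_tclass inv_torus)

lemma on_torus_class:
  assumes "\<And>\<theta> \<theta>'. torus_class I \<theta> = torus_class I \<theta>' \<Longrightarrow> g \<theta> = g \<theta>'"
  shows "on_torus I g (torus_class I \<theta>) = g \<theta>"
  unfolding on_torus_def by (rule assms) (rule someI[of _ \<theta>], simp)

lemma continuous_on_torus:
  fixes g :: "real^'l::finite \<Rightarrow> 'a::topological_space"
  assumes "\<And>\<theta> \<theta>'. torus_class I \<theta> = torus_class I \<theta>' \<Longrightarrow> g \<theta> = g \<theta>'" "continuous_on UNIV g"
  shows "continuous_map (torus_topology I) euclidean (on_torus I g)"
proof (rule continuous_map_from_torus)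
  \<comment> \<open>Coordinates outside \<open>I\<close> are no projections of the product space; any constant will do for them.\<close>
  define E where "E \<phi> = (\<chi> l. if l \<in> I then \<phi> l else 0)" for \<phi> :: "'l \<Rightarrow> real"
  have "continuous_map (powertop_real I) euclidean E"
  proof -
    have "continuous_map (powertop_real I) euclidean (\<lambda>\<phi>. \<Sum>l\<in>I. \<phi> l *\<^sub>R (axis l 1 :: real^'l))"
    proof (intro continuous_map_sum)
      fix l assume "l \<in> I"
      have "continuous_on UNIV (\<lambda>c::real. c *\<^sub>R (axis l 1 :: real^'l))"
        by (intro continuous_intros)
      then have "continuous_map euclideanreal euclidean (\<lambda>c::real. c *\<^sub>R (axis l 1 :: real^'l))"
        by simp
      from continuous_map_compose[OF continuous_map_product_projection[OF \<open>l \<in> I\<close>] this]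
      show "continuous_map (powertop_real I) euclidean (\<lambda>\<phi>. \<phi> l *\<^sub>R (axis l 1 :: real^'l))"
        by (simp add: o_def)
    qed simp
    moreover have "(\<Sum>l\<in>I. \<phi> l *\<^sub>R (axis l 1 :: real^'l)) = E \<phi>" for \<phi>
    proof -
      have "(\<Sum>l\<in>I. \<phi> l *\<^sub>R (axis l 1 :: real^'l)) $ j = E \<phi> $ j" for j
      proof -
        have "(\<Sum>l\<in>I. \<phi> l *\<^sub>R (axis l 1 :: real^'l)) $ j = (\<Sum>l\<in>I. if l = j then \<phi> j else 0)"
          unfolding sum_component by (rule sum.cong) (auto simp: axis_def)
        then show ?thesis
          by (simp add: E_def)
      qed
      then show ?thesis
        by (simp add: Finite_Cartesian_Product.vec_eq_iff)
    qed
    ultimately show ?thesis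
      by simp
  qed
  then show "continuous_map (powertop_real I) euclidean (g \<circ> E)"
    by (rule continuous_map_compose) (simp add: assms(2))
  show "on_torus I g (tclass I \<phi>) = (g \<circ> E) \<phi>" for \<phi>
  proof -
    have "tclass I \<phi> = torus_class I (E \<phi>)"
      by (simp add: torus_class_tclass tclass_eq_iff E_def periods_0)
    then show ?thesis
      using on_torus_class[of I g "E \<phi>", OF assms(1)] by (simp only: o_def)
  qed
qed

lemma continuous_torus_class:
  "continuous_map (euclidean :: (real^'l::finite) topology) (torus_topology I) (torus_class I)"
  unfolding torus_topology_def continuous_map_componentwise
proof (intro conjI ballI)
  fix k assume k: "k \<in> I"
  have "continuous_on UNIV (\<lambda>x :: real^'l. x $ k)"
    by (intro continuous_intros)
  then have "continuous_map (euclidean :: (real^'l) topology) euclideanreal (\<lambda>x. x $ k)"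
    by simp
  from continuous_map_compose[OF this continuous_circle_class]
  show "continuous_map (euclidean :: (real^'l) topology) circle_topology (\<lambda>x. torus_class I x k)"
    using k by (simp add: torus_class_def o_def)
qed (auto simp: torus_class_def)

subsection \<open>Isomorphisms of topological groups\<close>

text \<open>
  A continuous injection from a compact space to a Hausdorff space is a homeomorphism onto its image.
  All isomorphisms of topological groups below are obtained from this.
\<close>

lemma compact_group_embedding:
  assumes "f \<in> hom G H" "inj_on f (carrier G)"
    and "topspace X = carrier G" "compact_space X" "Hausdorff_space Y" "continuous_map X Y f"
  shows "top_group_isomorphic G X (H\<lparr>carrier := f ` carrier G\<rparr>) (subtopology Y (f ` carrier G))"
  unfolding top_group_isomorphic_def
proof (intro exI conjI)
  show "f \<in> iso G (H\<lparr>carrier := f ` carrier G\<rparr>)"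
    using assms(1,2) by (auto simp: iso_def hom_def bij_betw_def)
  have "f ` topspace X \<subseteq> topspace Y"
    using assms(6) by (rule continuous_map_image_subset_topspace)
  then show "homeomorphic_map X (subtopology Y (f ` carrier G)) f"
    using assms by (intro T1_Spaces.continuous_imp_homeomorphic_map)
      (auto simp: continuous_map_in_subtopology Hausdorff_space_subtopology)
qed

lemma top_group_isomorphic_sym:
  assumes "group G" "topspace X = carrier G" "topspace Y = carrier H" "top_group_isomorphic G X H Y"
  shows "top_group_isomorphic H Y G X"
proof -
  obtain f where f: "f \<in> iso G H" "homeomorphic_map X Y f"
    using assms(4) by (auto simp: top_group_isomorphic_def)
  then obtain g where g: "homeomorphic_maps X Y f g"
    by (auto simp: homeomorphic_map_maps)
  have "inv_into (carrier G) f \<in> iso H G"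
    by (rule group.iso_set_sym[OF assms(1) f(1)])
  moreover have "homeomorphic_map Y X (inv_into (carrier G) f)"
  proof (rule homeomorphic_map_eq)
    show "homeomorphic_map Y X g"
      using g homeomorphic_maps_imp_map homeomorphic_maps_sym by blast
    fix y assume y: "y \<in> topspace Y"
    then have "g y \<in> carrier G" "f (g y) = y"
      using g assms(2) by (auto simp: homeomorphic_maps_def continuous_map_def)
    moreover have "inj_on f (carrier G)"
      using f(1) by (auto simp: iso_def bij_betw_def)
    ultimately show "g y = inv_into (carrier G) f y"
      by (metis inv_into_f_f)
  qed
  ultimately show ?thesis
    by (auto simp: top_group_isomorphic_def)
qed

lemma continuous_map_prod_discrete:
  assumes "\<And>m. m \<in> M \<Longrightarrow> continuous_map X Y (\<lambda>a. f (a, m))"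
  shows "continuous_map (prod_topology X (discrete_topology M)) Y f"
  unfolding continuous_map_def
proof (intro conjI allI impI)
  show "f \<in> topspace (prod_topology X (discrete_topology M)) \<rightarrow> topspace Y"
    using assms by (auto simp: continuous_map_def Pi_iff)
  fix U assume U: "openin Y U"
  have "{z \<in> topspace (prod_topology X (discrete_topology M)). f z \<in> U}
      = (\<Union>m\<in>M. {a \<in> topspace X. f (a, m) \<in> U} \<times> {m})"
    by auto
  moreover have "openin (prod_topology X (discrete_topology M)) ({a \<in> topspace X. f (a, m) \<in> U} \<times> {m})"
    if "m \<in> M" for m
    using assms[OF that] U that by (simp add: openin_prod_Times_iff continuous_map_def)
  ultimately show "openin (prod_topology X (discrete_topology M))
      {z \<in> topspace (prod_topology X (discrete_topology M)). f z \<in> U}"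
    by (simp only:) (blast intro: openin_Union)
qed

section \<open>The kernel of a family of characters\<close>

lemma inner_cast_vec: "cast_vec \<alpha> \<bullet> \<theta> = (\<Sum>l\<in>UNIV. of_int (\<alpha> $ l) * \<theta> $ l)"
  for \<theta> :: "real^'l::finite"
  by (simp add: inner_vec_def)

lemma inner_cast_periods:
  fixes \<theta> :: "real^'l::finite"
  assumes "\<alpha> \<in> Zpow I" "\<And>l. l \<in> I \<Longrightarrow> \<theta> $ l \<in> periods"
  shows "cast_vec \<alpha> \<bullet> \<theta> \<in> periods"
  unfolding inner_cast_vec
proof (rule periods_sum)
  fix l show "of_int (\<alpha> $ l) * \<theta> $ l \<in> periods"
    using assms by (cases "l \<in> I") (auto simp: Zpow_def periods_0 intro: periods_of_int)
qed

lemma inner_cast_torus_class: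
  assumes "\<alpha> \<in> Zpow I" "torus_class I \<theta> = torus_class I \<theta>'"
  shows "cast_vec \<alpha> \<bullet> \<theta> - cast_vec \<alpha> \<bullet> \<theta>' \<in> periods"
  using inner_cast_periods[OF assms(1), of "\<theta> - \<theta>'"] assms(2)
  by (simp add: torus_class_eq_iff inner_diff_right)

lemma cis_eq_iff_periods: "cis a = cis b \<longleftrightarrow> a - b \<in> periods"
  by (simp add: periods_iff_cis flip: cis_divide)

text \<open>
  The vectors in \<open>A\<close> are integral and supported in \<open>I\<close>, so the angle \<open>cast_vec \<alpha> \<bullet> \<theta>\<close> is determined modulo
  \<open>2\<pi>\<close> by the class of \<open>\<theta>\<close>.
\<close>

lemma K_group_iff:
  fixes A :: "(int^'l::finite) set"
  assumes "A \<subseteq> Zpow I"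
  shows "torus_class I \<theta> \<in> K_group I A \<longleftrightarrow> (\<forall>\<alpha>\<in>A. cast_vec \<alpha> \<bullet> \<theta> \<in> periods)"
proof -
  have K: "K_group I A = torus_class I ` {\<theta>. \<forall>\<alpha>\<in>A. cast_vec \<alpha> \<bullet> \<theta> \<in> periods}"
    by (simp add: K_group_def periods_iff_cis cis_conv_exp mult.commute)
  show ?thesis
  proof
    assume "torus_class I \<theta> \<in> K_group I A"
    then obtain \<theta>' where \<theta>': "torus_class I \<theta> = torus_class I \<theta>'" "\<forall>\<alpha>\<in>A. cast_vec \<alpha> \<bullet> \<theta>' \<in> periods"
      unfolding K by blast
    show "\<forall>\<alpha>\<in>A. cast_vec \<alpha> \<bullet> \<theta> \<in> periods"
    proof
      fix \<alpha> assume "\<alpha> \<in> A"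
      then have "cast_vec \<alpha> \<bullet> \<theta> - cast_vec \<alpha> \<bullet> \<theta>' \<in> periods"
        using assms by (intro inner_cast_torus_class[OF _ \<theta>'(1)]) auto
      then show "cast_vec \<alpha> \<bullet> \<theta> \<in> periods"
        using periods_add[of _ "cast_vec \<alpha> \<bullet> \<theta>'"] \<theta>'(2) \<open>\<alpha> \<in> A\<close> by fastforce
    qed
  qed (use K in blast)
qed

lemma K_group_subset: "K_group I A \<subseteq> carrier (torus I)"
  by (auto simp: K_group_def carrier_torus_class)

lemma K_group_class: "p \<in> K_group I A \<Longrightarrow> \<exists>\<theta>. p = torus_class I \<theta>"
  by (auto simp: K_group_def)

lemma subgroup_K_group:
  fixes A :: "(int^'l::finite) set"
  assumes "A \<subseteq> Zpow I"
  shows "subgroup (K_group I A) (torus I)"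
proof -
  interpret comm_group "torus I" by (rule comm_group_torus)
  show ?thesis
  proof (rule subgroupI)
    show "K_group I A \<subseteq> carrier (torus I)"
      by (rule K_group_subset)
    have "torus_class I 0 \<in> K_group I A"
      by (simp add: K_group_iff[OF assms] periods_0)
    then show "K_group I A \<noteq> {}"
      by blast
  next
    fix p assume p: "p \<in> K_group I A"
    then obtain \<theta> where \<theta>: "p = torus_class I \<theta>"
      using K_group_class by blast
    then show "inv\<^bsub>torus I\<^esub> p \<in> K_group I A"
      using p by (simp add: inv_torus_class K_group_iff[OF assms] periods_minus)
    fix p' assume p': "p' \<in> K_group I A"
    then obtain \<theta>' where "p' = torus_class I \<theta>'"
      using K_group_class by blast
    then show "p \<otimes>\<^bsub>torus I\<^esub> p' \<in> K_group I A"
      using p p' \<theta> by (simp add: mult_torus_class K_group_iff[OF assms] periods_add inner_add_right)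
  qed
qed

context adapted_basis
begin

text \<open>
  New angles on the torus, in which the characters of \<open>L_lattice A\<close> are generated by the multiples
  \<open>d k * coord k\<close>, \<open>k < q\<close>.
\<close>

abbreviation coord :: "nat \<Rightarrow> real^'l \<Rightarrow> real" where
  "coord k \<theta> \<equiv> cast_vec (v k) \<bullet> \<theta>"

lemma pair_expand:
  assumes "\<alpha> \<in> Zpow I"
  shows "cast_vec \<alpha> \<bullet> \<theta> = (\<Sum>k<n. of_int (ipair (x k) \<alpha>) * coord k \<theta>)"
proof -
  have "cast_vec (\<Sum>k<n. ipair (x k) \<alpha> *s v k) \<bullet> \<theta> = (\<Sum>k<n. of_int (ipair (x k) \<alpha>) * coord k \<theta>)"
    by (simp add: cast_vec_sum cast_vec_scale inner_sum_left scalar_mult_eq_scaleR)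
  then show ?thesis
    using expand[OF assms] by simp
qed

lemma pair_expand_low:
  assumes "\<alpha> \<in> L_sat I A"
  shows "cast_vec \<alpha> \<bullet> \<theta> = (\<Sum>k<q. of_int (ipair (x k) \<alpha>) * coord k \<theta>)"
proof -
  have "(\<Sum>k<q. of_int (ipair (x k) \<alpha>) * coord k \<theta>) = (\<Sum>k<n. of_int (ipair (x k) \<alpha>) * coord k \<theta>)"
    by (rule sum.mono_neutral_left) (use q_le assms in \<open>auto simp: L_sat_eq\<close>)
  moreover have "\<alpha> \<in> Zpow I"
    using assms by (simp add: L_sat_eq)
  ultimately show ?thesis
    using pair_expand by simp
qed

lemma A_L_sat: "\<alpha> \<in> A \<Longrightarrow> \<alpha> \<in> L_sat I A"
  using A_sub A_coords(2) by (auto simp: L_sat_eq)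

lemma coord_dual_sum:
  assumes "S \<subseteq> {..<n}" "j < n"
  shows "coord j (\<Sum>k\<in>S. c k *\<^sub>R cast_vec (x k)) = (if j \<in> S then c j else 0)"
proof -
  have fin: "finite S"
    using assms(1) finite_subset by blast
  have "coord j (\<Sum>k\<in>S. c k *\<^sub>R cast_vec (x k)) = (\<Sum>k\<in>S. if k = j then c j else 0)"
    unfolding inner_sum_right inner_scaleR_right
  proof (rule sum.cong)
    fix k assume "k \<in> S"
    then have "ipair (x k) (v j) = (if k = j then 1 else 0)"
      using dual assms by auto
    then show "c k * coord j (cast_vec (x k)) = (if k = j then c j else 0)"
      using cast_vec_inner[of "x k" "v j"] by (simp add: inner_commute)
  qed simp
  then show ?thesis
    using fin by simp
qed

text \<open>
  The standard basis vectors are integral combinations of the \<open>v k\<close>, so the old angles are integral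
  combinations of the new ones.
\<close>

lemma torus_class_eq_coord:
  "torus_class I \<theta> = torus_class I \<theta>' \<longleftrightarrow> (\<forall>k<n. coord k \<theta> - coord k \<theta>' \<in> periods)"
proof
  assume "torus_class I \<theta> = torus_class I \<theta>'"
  then show "\<forall>k<n. coord k \<theta> - coord k \<theta>' \<in> periods"
    using inner_cast_torus_class v_Zpow by blast
next
  assume *: "\<forall>k<n. coord k \<theta> - coord k \<theta>' \<in> periods"
  show "torus_class I \<theta> = torus_class I \<theta>'"
    unfolding torus_class_eq_iff
  proof
    fix l assume "l \<in> I"
    then have ax: "axis l 1 \<in> Zpow I"
      by (auto simp: Zpow_def axis_def)
    have nth: "cast_vec (axis l 1) \<bullet> \<eta> = \<eta> $ l" for \<eta> :: "real^'l"
    proof -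
      have "cast_vec (axis l 1) = (axis l 1 :: real^'l)"
        by (simp add: Finite_Cartesian_Product.vec_eq_iff axis_def)
      then show ?thesis
        by (simp add: inner_axis')
    qed
    have "\<theta> $ l - \<theta>' $ l = (\<Sum>k<n. of_int (ipair (x k) (axis l 1)) * (coord k \<theta> - coord k \<theta>'))"
      using pair_expand[OF ax, of \<theta>] pair_expand[OF ax, of \<theta>'] nth
      by (simp add: sum_subtractf algebra_simps)
    also have "\<dots> \<in> periods"
      using * by (intro periods_sum periods_of_int) auto
    finally show "\<theta> $ l - \<theta>' $ l \<in> periods" .
  qed
qed

text \<open>
  The vectors \<open>d k *s v k\<close> are integral combinations of \<open>A\<close> and vice versa, so the two families of
  characters have the same kernel.
\<close>

lemma K_coord: "torus_class I \<theta> \<in> K_group I A \<longleftrightarrow> (\<forall>k<q. real (d k) * coord k \<theta> \<in> periods)"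
  unfolding K_group_iff[OF A_sub]
proof
  assume *: "\<forall>\<alpha>\<in>A. cast_vec \<alpha> \<bullet> \<theta> \<in> periods"
  have "cast_vec \<alpha> \<bullet> \<theta> \<in> periods" if "\<alpha> \<in> zmod.span A" for \<alpha>
    using that
  proof (induction rule: zmod.span_induct)
    case base
    show ?case
      by (auto simp: zmod.subspace_def cast_vec_0 periods_0 cast_vec_add inner_add_left periods_add
          cast_vec_scale scalar_mult_eq_scaleR periods_of_int)
  qed (use * in blast)
  then have "cast_vec (int (d k) *s v k) \<bullet> \<theta> \<in> periods" if "k < q" for k
    using dv_lattice[OF that] by (simp add: L_lattice_zspan)
  then show "\<forall>k<q. real (d k) * coord k \<theta> \<in> periods"
    by (simp add: cast_vec_scale scalar_mult_eq_scaleR)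
next
  assume *: "\<forall>k<q. real (d k) * coord k \<theta> \<in> periods"
  show "\<forall>\<alpha>\<in>A. cast_vec \<alpha> \<bullet> \<theta> \<in> periods"
  proof
    fix \<alpha> assume \<alpha>: "\<alpha> \<in> A"
    have "of_int (ipair (x k) \<alpha>) * coord k \<theta> \<in> periods" if k: "k < q" for k
    proof -
      obtain c where c: "ipair (x k) \<alpha> = int (d k) * c"
        using A_coords(1)[OF \<alpha> k] by (auto simp: dvd_def)
      have "of_int c * (real (d k) * coord k \<theta>) \<in> periods"
        using * k by (intro periods_of_int) auto
      then show ?thesis
        by (simp add: c mult.assoc mult.left_commute)
    qed
    then show "cast_vec \<alpha> \<bullet> \<theta> \<in> periods"
      unfolding pair_expand_low[OF A_L_sat[OF \<alpha>]] by (intro periods_sum) auto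
  qed
qed

subsection \<open>The structure of the kernel\<close>

text \<open>
  In the new angles the kernel imposes that the \<open>k\<close>-th angle be a multiple of \<open>2\<pi> / d k\<close> for \<open>k < q\<close>, and
  nothing on the remaining ones.  The isomorphism is constructed starting from the product, whose
  compactness makes the inverse continuous.
\<close>

lemma K_isomorphic:
  "top_group_isomorphic ((torus I)\<lparr>carrier := K_group I A\<rparr>) (subtopology (torus_topology I) (K_group I A))
     (torus {..<n - q} \<times>\<times> product_group {..<q} (\<lambda>j. integer_mod_group (d j)))
     (prod_topology (torus_topology {..<n - q})
        (discrete_topology (carrier (product_group {..<q} (\<lambda>j. integer_mod_group (d j))))))"
proof -
  define Z where "Z = product_group {..<q} (\<lambda>j. integer_mod_group (d j))"
  define T where "T = torus {..<n - q}"
  let ?G = "T \<times>\<times> Z"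
  have Z: "carrier Z = (\<Pi>\<^sub>E k\<in>{..<q}. {0..<int (d k)})"
    unfolding Z_def carrier_product_group
    by (rule PiE_cong) (use d_pos in \<open>auto simp: carrier_integer_mod_group\<close>)
  have groupZ: "group Z"
    unfolding Z_def by (rule product_group) simp
  have groupT: "group T"
    unfolding T_def using comm_group_torus comm_group.axioms(2) by blast
  have finZ: "finite (carrier Z)"
    unfolding Z by (rule finite_PiE) auto
  \<comment> \<open>the new angles of the point with parameters \<open>\<phi>\<close> and \<open>m\<close>, and angles that realize them\<close>
  define c where "c \<phi> m k = (if k < q then 2 * pi * of_int (m k) / real (d k) else \<phi> (k - q))"
    for \<phi> :: "nat \<Rightarrow> real" and m :: "nat \<Rightarrow> int" and k
  define \<Theta> where "\<Theta> \<phi> m = (\<Sum>k<n. c \<phi> m k *\<^sub>R (cast_vec (x k) :: real^'l))" for \<phi> m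
  have coord_\<Theta>: "coord k (\<Theta> \<phi> m) = c \<phi> m k" if "k < n" for k \<phi> m
    unfolding \<Theta>_def using that coord_dual_sum[of "{..<n}" k "c \<phi> m"] by simp
  define f where "f z = torus_class I (\<Theta> (SOME \<phi>. tclass {..<n - q} \<phi> = fst z) (snd z))" for z
  have f: "f (tclass {..<n - q} \<phi>, m) = torus_class I (\<Theta> \<phi> m)" for \<phi> m
  proof -
    define \<psi> where "\<psi> = (SOME \<psi>. tclass {..<n - q} \<psi> = tclass {..<n - q} \<phi>)"
    have "tclass {..<n - q} \<psi> = tclass {..<n - q} \<phi>"
      unfolding \<psi>_def by (rule someI[of _ \<phi>]) simp
    then have *: "\<forall>k<n - q. \<psi> k - \<phi> k \<in> periods"
      by (simp add: tclass_eq_iff)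
    have "torus_class I (\<Theta> \<psi> m) = torus_class I (\<Theta> \<phi> m)"
      unfolding torus_class_eq_coord using * by (auto simp: coord_\<Theta> c_def periods_0)
    then show ?thesis
      by (simp add: f_def \<psi>_def)
  qed
  have carG: "\<exists>\<phi> m. z = (tclass {..<n - q} \<phi>, m) \<and> m \<in> carrier Z" if "z \<in> carrier ?G" for z
    using that by (cases z) (auto simp: DirProd_def T_def carrier_torus)
  have div_period: "2 * pi * of_int a / real (d k) \<in> periods \<longleftrightarrow> int (d k) dvd a" if "k < q" for a k
  proof -
    have "2 * pi * of_int a / real (d k) \<in> periods \<longleftrightarrow> (\<exists>j::int. of_int a = (of_int (int (d k) * j) :: real))"
      using d_pos[OF that] by (auto simp: periods_def field_simps)
    then show ?thesis
      unfolding of_int_eq_iff by (auto simp: dvd_def)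
  qed
  have hom: "f \<in> hom ?G (torus I)"
  proof (rule homI)
    show "f z \<in> carrier (torus I)" for z
      by (simp add: f_def carrier_torus_class)
    fix z z' assume "z \<in> carrier ?G" "z' \<in> carrier ?G"
    then obtain \<phi> m \<phi>' m' where z: "z = (tclass {..<n - q} \<phi>, m)" "z' = (tclass {..<n - q} \<phi>', m')"
      using carG by metis
    define m'' where "m'' = (\<lambda>k\<in>{..<q}. (m k + m' k) mod int (d k))"
    have "z \<otimes>\<^bsub>?G\<^esub> z' = (tclass {..<n - q} (\<lambda>k. \<phi> k + \<phi>' k), m'')"
      by (simp add: z DirProd_def T_def mult_torus Z_def m''_def)
    then have "f (z \<otimes>\<^bsub>?G\<^esub> z') = torus_class I (\<Theta> (\<lambda>k. \<phi> k + \<phi>' k) m'')"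
      by (simp only: f)
    also have "\<dots> = torus_class I (\<Theta> \<phi> m + \<Theta> \<phi>' m')"
      unfolding torus_class_eq_coord
    proof (intro allI impI)
      fix k assume k: "k < n"
      show "coord k (\<Theta> (\<lambda>k. \<phi> k + \<phi>' k) m'') - coord k (\<Theta> \<phi> m + \<Theta> \<phi>' m') \<in> periods"
      proof (cases "k < q")
        case True
        have "coord k (\<Theta> (\<lambda>k. \<phi> k + \<phi>' k) m'') - coord k (\<Theta> \<phi> m + \<Theta> \<phi>' m')
            = 2 * pi * of_int (m'' k - (m k + m' k)) / real (d k)"
          unfolding inner_add_right coord_\<Theta>[OF k] using True d_pos[OF True]
          by (simp add: c_def field_simps)
        also have "\<dots> \<in> periods"
          unfolding div_period[OF True] using True
          by (simp add: m''_def mod_eq_dvd_iff[symmetric])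
        finally show ?thesis .
      next
        case False
        then show ?thesis
          unfolding inner_add_right coord_\<Theta>[OF k] by (simp add: c_def periods_0)
      qed
    qed
    also have "\<dots> = f z \<otimes>\<^bsub>torus I\<^esub> f z'"
      by (simp only: z f mult_torus_class)
    finally show "f (z \<otimes>\<^bsub>?G\<^esub> z') = f z \<otimes>\<^bsub>torus I\<^esub> f z'" .
  qed
  have inj: "inj_on f (carrier ?G)"
  proof (rule inj_onI)
    fix z z' assume z: "z \<in> carrier ?G" "z' \<in> carrier ?G" and eq: "f z = f z'"
    obtain \<phi> m where z1: "z = (tclass {..<n - q} \<phi>, m)" "m \<in> carrier Z"
      using carG[OF z(1)] by blast
    obtain \<phi>' m' where z2: "z' = (tclass {..<n - q} \<phi>', m')" "m' \<in> carrier Z"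
      using carG[OF z(2)] by blast
    have c: "c \<phi> m k - c \<phi>' m' k \<in> periods" if "k < n" for k
      using eq that by (simp add: z1 z2 f torus_class_eq_coord coord_\<Theta>)
    have "tclass {..<n - q} \<phi> = tclass {..<n - q} \<phi>'"
      unfolding tclass_eq_iff
    proof
      fix k assume "k \<in> {..<n - q}"
      then show "\<phi> k - \<phi>' k \<in> periods"
        using c[of "q + k"] by (simp add: c_def)
    qed
    moreover have "m = m'"
    proof
      fix k
      show "m k = m' k"
      proof (cases "k < q")
        case True
        then have "c \<phi> m k - c \<phi>' m' k = 2 * pi * of_int (m k - m' k) / real (d k)"
          using d_pos[OF True] by (simp add: c_def field_simps)
        moreover have "c \<phi> m k - c \<phi>' m' k \<in> periods"
          using c True q_le by auto
        ultimately have "int (d k) dvd m k - m' k"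
          using div_period[OF True] by metis
        moreover have "m k \<in> {0..<int (d k)}" "m' k \<in> {0..<int (d k)}"
          using z1(2) z2(2) True unfolding Z by (auto simp: PiE_iff)
        ultimately show ?thesis
          by (simp add: mod_eq_dvd_iff[symmetric])
      next
        case False
        then show ?thesis
          using z1(2) z2(2) unfolding Z by (auto simp: PiE_iff extensional_def)
      qed
    qed
    ultimately show "z = z'"
      by (simp add: z1 z2)
  qed
  have img: "f ` carrier ?G = K_group I A"
  proof
    show "f ` carrier ?G \<subseteq> K_group I A"
    proof
      fix p assume "p \<in> f ` carrier ?G"
      then obtain \<phi> m where p: "p = torus_class I (\<Theta> \<phi> m)"
        using carG f by (metis (no_types, lifting) imageE)
      have "real (d k) * coord k (\<Theta> \<phi> m) \<in> periods" if "k < q" for k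
        using that q_le d_pos[OF that] periods_2pi by (simp add: coord_\<Theta> c_def)
      then show "p \<in> K_group I A"
        unfolding p K_coord by blast
    qed
    show "K_group I A \<subseteq> f ` carrier ?G"
    proof
      fix p assume pK: "p \<in> K_group I A"
      then obtain \<theta> where p: "p = torus_class I \<theta>"
        using K_group_class by blast
      have "\<forall>k<q. \<exists>a. real (d k) * coord k \<theta> = 2 * pi * of_int a"
        using pK unfolding p K_coord by (simp add: periods_def)
      then obtain a where a: "\<And>k. k < q \<Longrightarrow> real (d k) * coord k \<theta> = 2 * pi * of_int (a k)"
        by metis
      define m where "m = (\<lambda>k\<in>{..<q}. a k mod int (d k))"
      have m: "m \<in> carrier Z"
        unfolding Z m_def using d_pos by auto
      have "torus_class I (\<Theta> (\<lambda>k. coord (q + k) \<theta>) m) = p"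
        unfolding p torus_class_eq_coord
      proof (intro allI impI)
        fix k assume k: "k < n"
        show "coord k (\<Theta> (\<lambda>k. coord (q + k) \<theta>) m) - coord k \<theta> \<in> periods"
        proof (cases "k < q")
          case True
          have "coord k (\<Theta> (\<lambda>k. coord (q + k) \<theta>) m) - coord k \<theta> = 2 * pi * of_int (m k - a k) / real (d k)"
            unfolding coord_\<Theta>[OF k] using True d_pos[OF True] a[OF True]
            by (simp add: c_def field_simps)
          also have "\<dots> \<in> periods"
            unfolding div_period[OF True] using True
            by (simp add: m_def mod_eq_dvd_iff[symmetric])
          finally show ?thesis .
        next
          case False
          then show ?thesis
            unfolding coord_\<Theta>[OF k] by (simp add: c_def periods_0)
        qed
      qed
      then have "p = f (tclass {..<n - q} (\<lambda>k. coord (q + k) \<theta>), m)"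
        by (simp only: f)
      moreover have "(tclass {..<n - q} (\<lambda>k. coord (q + k) \<theta>), m) \<in> carrier ?G"
        using m by (simp add: DirProd_def T_def carrier_torus)
      ultimately show "p \<in> f ` carrier ?G"
        by blast
    qed
  qed
  let ?X = "prod_topology (torus_topology {..<n - q}) (discrete_topology (carrier Z))"
  have topX: "topspace ?X = carrier ?G"
    by (simp add: topspace_torus T_def DirProd_def)
  have cont: "continuous_map ?X (torus_topology I) f"
  proof (rule continuous_map_prod_discrete)
    fix m assume "m \<in> carrier Z"
    show "continuous_map (torus_topology {..<n - q}) (torus_topology I) (\<lambda>a. f (a, m))"
    proof (rule continuous_map_from_torus)
      have "continuous_map (powertop_real {..<n - q}) euclidean (\<lambda>\<phi>. c \<phi> m k *\<^sub>R (cast_vec (x k) :: real^'l))"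
        if "k < n" for k
      proof (cases "k < q")
        case False
        then have k: "k - q \<in> {..<n - q}"
          using that by auto
        have "continuous_on UNIV (\<lambda>c::real. c *\<^sub>R (cast_vec (x k) :: real^'l))"
          by (intro continuous_intros)
        then have "continuous_map euclideanreal euclidean (\<lambda>c::real. c *\<^sub>R (cast_vec (x k) :: real^'l))"
          by simp
        from continuous_map_compose[OF continuous_map_product_projection[OF k] this]
        show ?thesis
          using False by (simp add: c_def o_def)
      qed (simp add: c_def)
      then have "continuous_map (powertop_real {..<n - q}) euclidean (\<lambda>\<phi>. \<Theta> \<phi> m)"
        unfolding \<Theta>_def by (intro continuous_map_sum) auto
      from continuous_map_compose[OF this continuous_torus_class]
      show "continuous_map (powertop_real {..<n - q}) (torus_topology I) (\<lambda>\<phi>. torus_class I (\<Theta> \<phi> m))"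
        by (simp add: o_def)
    qed (simp add: f)
  qed
  have "top_group_isomorphic ?G ?X ((torus I)\<lparr>carrier := f ` carrier ?G\<rparr>)
      (subtopology (torus_topology I) (f ` carrier ?G))"
  proof (rule compact_group_embedding[OF hom inj topX _ Hausdorff_torus cont])
    show "compact_space ?X"
      using finZ by (simp add: compact_space_prod_topology compact_torus compact_space_discrete_topology)
  qed
  then have "top_group_isomorphic ((torus I)\<lparr>carrier := K_group I A\<rparr>)
      (subtopology (torus_topology I) (K_group I A)) ?G ?X"
    unfolding img
  proof (rule top_group_isomorphic_sym[rotated 3])
    show "group ?G"
      by (rule DirProd_group[OF groupT groupZ])
    show "topspace (subtopology (torus_topology I) (K_group I A)) = carrier ((torus I)\<lparr>carrier := K_group I A\<rparr>)"
      using K_group_subset by (auto simp: topspace_torus)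
  qed (rule topX)
  then show ?thesis
    by (simp add: Z_def T_def)
qed

end

subsection \<open>The component group and Pontryagin duality\<close>

lemma group_pontryagin_dual:
  assumes "group G"
  shows "group (pontryagin_dual G)"
proof (rule groupI)
  interpret G: group G by fact
  have car: "f \<in> carrier (pontryagin_dual G) \<longleftrightarrow> f \<in> hom G circle_group \<and> f \<in> extensional (carrier G)" for f
    by (auto simp: pontryagin_dual_def)
  have cl: "f a \<in> carrier circle_group" if "f \<in> hom G circle_group" "a \<in> carrier G" for f a
    using that by (auto simp: hom_def)
  show "f \<otimes>\<^bsub>pontryagin_dual G\<^esub> g \<in> carrier (pontryagin_dual G)"
    if "f \<in> carrier (pontryagin_dual G)" "g \<in> carrier (pontryagin_dual G)" for f g
    using that unfolding car
    by (auto simp: pontryagin_dual_def hom_def Pi_iff circle.m_ac)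
  show "\<one>\<^bsub>pontryagin_dual G\<^esub> \<in> carrier (pontryagin_dual G)"
    unfolding car by (auto simp: pontryagin_dual_def hom_def)
  show "f \<otimes>\<^bsub>pontryagin_dual G\<^esub> g \<otimes>\<^bsub>pontryagin_dual G\<^esub> k = f \<otimes>\<^bsub>pontryagin_dual G\<^esub> (g \<otimes>\<^bsub>pontryagin_dual G\<^esub> k)"
    if "f \<in> carrier (pontryagin_dual G)" "g \<in> carrier (pontryagin_dual G)" "k \<in> carrier (pontryagin_dual G)" for f g k
    using that unfolding car
    by (auto simp: pontryagin_dual_def fun_eq_iff restrict_def cl circle.m_assoc)
  show "\<one>\<^bsub>pontryagin_dual G\<^esub> \<otimes>\<^bsub>pontryagin_dual G\<^esub> f = f" if "f \<in> carrier (pontryagin_dual G)" for f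
    using that unfolding car
    by (auto simp: pontryagin_dual_def fun_eq_iff restrict_def cl extensional_def)
  show "\<exists>g\<in>carrier (pontryagin_dual G). g \<otimes>\<^bsub>pontryagin_dual G\<^esub> f = \<one>\<^bsub>pontryagin_dual G\<^esub>"
    if "f \<in> carrier (pontryagin_dual G)" for f
  proof
    have f: "f \<in> hom G circle_group" "f \<in> extensional (carrier G)"
      using that car by auto
    define g where "g = (\<lambda>a\<in>carrier G. inv\<^bsub>circle_group\<^esub> f a)"
    show "g \<in> carrier (pontryagin_dual G)"
      unfolding car g_def hom_def using cl[OF f(1)] f(1)
      by (auto simp: hom_def Pi_iff circle.inv_mult)
    show "g \<otimes>\<^bsub>pontryagin_dual G\<^esub> f = \<one>\<^bsub>pontryagin_dual G\<^esub>"
      using cl[OF f(1)] by (auto simp: pontryagin_dual_def g_def fun_eq_iff restrict_def)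
  qed
qed

context adapted_basis
begin

lemma L_lattice_subgroup: "L_lattice A \<lhd> additive_group (L_sat I A)"
proof -
  interpret comm_group "additive_group (L_sat I A)" by (rule comm_group_L_sat)
  have inv: "inv\<^bsub>additive_group (L_sat I A)\<^esub> \<alpha> = - \<alpha>" if "\<alpha> \<in> L_sat I A" for \<alpha>
    by (rule inv_equality) (use that in \<open>auto simp: L_sat_eq ipair_minus Zpow_def\<close>)
  have sub: "L_lattice A \<subseteq> L_sat I A"
    by (auto simp: lattice L_sat_eq)
  have "subgroup (L_lattice A) (additive_group (L_sat I A))"
  proof (rule subgroupI)
    show "L_lattice A \<noteq> {}"
      using zmod.span_zero by (auto simp: L_lattice_zspan)
    show "inv\<^bsub>additive_group (L_sat I A)\<^esub> \<alpha> \<in> L_lattice A" if "\<alpha> \<in> L_lattice A" for \<alpha>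
      using that sub by (simp add: inv subset_iff L_lattice_zspan zmod.span_neg)
  qed (use sub in \<open>auto simp: L_lattice_zspan intro: zmod.span_add\<close>)
  then show ?thesis
    by (rule subgroup_imp_normal)
qed

lemma L_lattice_inner:
  assumes "torus_class I \<theta> \<in> K_group I A" "\<alpha> \<in> L_lattice A"
  shows "cast_vec \<alpha> \<bullet> \<theta> \<in> periods"
proof -
  have "of_int (ipair (x k) \<alpha>) * coord k \<theta> \<in> periods" if k: "k < q" for k
  proof -
    obtain c where c: "ipair (x k) \<alpha> = int (d k) * c"
      using assms(2) k by (auto simp: lattice dvd_def)
    have "of_int c * (real (d k) * coord k \<theta>) \<in> periods"
      using assms(1) k by (intro periods_of_int) (auto simp: K_coord)
    then show ?thesis
      by (simp add: c mult.assoc mult.left_commute)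
  qed
  moreover have "\<alpha> \<in> L_sat I A"
    using assms(2) unfolding lattice L_sat_eq by blast
  ultimately show ?thesis
    unfolding pair_expand_low[OF \<open>\<alpha> \<in> L_sat I A\<close>] by (intro periods_sum) auto
qed

definition K0 :: "('l \<Rightarrow> real set) set" where
  "K0 = torus_class I ` {\<theta>. \<forall>k<q. coord k \<theta> = 0}"

lemma K0_iff: "torus_class I \<theta> \<in> K0 \<longleftrightarrow> (\<forall>k<q. coord k \<theta> \<in> periods)"
proof
  assume "torus_class I \<theta> \<in> K0"
  then obtain \<theta>' where \<theta>': "torus_class I \<theta> = torus_class I \<theta>'" "\<forall>k<q. coord k \<theta>' = 0"
    by (auto simp: K0_def)
  then have "\<forall>k<n. coord k \<theta> - coord k \<theta>' \<in> periods"
    using torus_class_eq_coord by blast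
  then show "\<forall>k<q. coord k \<theta> \<in> periods"
    using \<theta>'(2) q_le by (metis diff_zero order_less_le_trans)
next
  assume *: "\<forall>k<q. coord k \<theta> \<in> periods"
  define \<theta>' where "\<theta>' = (\<Sum>k\<in>{q..<n}. coord k \<theta> *\<^sub>R (cast_vec (x k) :: real^'l))"
  have c: "coord k \<theta>' = (if k \<in> {q..<n} then coord k \<theta> else 0)" if "k < n" for k
    unfolding \<theta>'_def using that by (intro coord_dual_sum) auto
  have "torus_class I \<theta> = torus_class I \<theta>'"
    unfolding torus_class_eq_coord using * by (auto simp: c periods_0)
  moreover have "\<forall>k<q. coord k \<theta>' = 0"
    using c q_le by auto
  ultimately show "torus_class I \<theta> \<in> K0"
    by (auto simp: K0_def)
qed

text \<open>
  On the kernel, the coordinates \<open>coord k\<close>, \<open>k < q\<close>, take finitely many values modulo \<open>2\<pi>\<close>; so they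
  are constant on connected subsets.  Conversely \<open>K0\<close> is the image of a linear subspace.
\<close>

lemma K_component:
  "connected_component_of_set (subtopology (torus_topology I) (K_group I A)) \<one>\<^bsub>torus I\<^esub> = K0"
proof
  let ?X = "subtopology (torus_topology I) (K_group I A)"
  have K0_K: "K0 \<subseteq> K_group I A"
    by (auto simp: K0_def K_coord periods_0)
  show "K0 \<subseteq> connected_component_of_set ?X \<one>\<^bsub>torus I\<^esub>"
  proof (rule connected_component_of_maximal)
    have "convex {\<theta>. \<forall>k<q. coord k \<theta> = 0}"
      by (auto simp: convex_def inner_add_right)
    then have "connectedin euclidean {\<theta>. \<forall>k<q. coord k \<theta> = 0}"
      by (simp add: convex_connected)
    then have "connectedin (torus_topology I) K0"
      unfolding K0_def by (rule connectedin_continuous_map_image[OF continuous_torus_class])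
    then show "connectedin ?X K0"
      using K0_K by (simp add: connectedin_subtopology)
    show "\<one>\<^bsub>torus I\<^esub> \<in> K0"
      by (simp add: one_torus_class K0_iff periods_0)
  qed
  show "connected_component_of_set ?X \<one>\<^bsub>torus I\<^esub> \<subseteq> K0"
  proof
    fix p assume "p \<in> connected_component_of_set ?X \<one>\<^bsub>torus I\<^esub>"
    then obtain C where C: "connectedin ?X C" "\<one>\<^bsub>torus I\<^esub> \<in> C" "p \<in> C"
      by (auto simp: connected_component_of_def)
    then have CT: "connectedin (torus_topology I) C" and CK: "C \<subseteq> K_group I A"
      by (auto simp: connectedin_subtopology)
    obtain \<theta> where p: "p = torus_class I \<theta>"
      using C CK K_group_class by blast
    have "coord k \<theta> \<in> periods" if k: "k < q" for k
    proof -
      define g where "g = on_torus I (\<lambda>\<theta>. cis (coord k \<theta>))"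
      have inv: "cis (coord k \<theta>) = cis (coord k \<theta>')" if "torus_class I \<theta> = torus_class I \<theta>'" for \<theta> \<theta>'
        using that k q_le by (auto simp: torus_class_eq_coord cis_eq_iff_periods)
      have g: "g (torus_class I \<theta>) = cis (coord k \<theta>)" for \<theta>
        unfolding g_def by (rule on_torus_class) (rule inv)
      have "continuous_map (torus_topology I) euclidean g"
        unfolding g_def by (rule continuous_on_torus[OF inv]) (auto intro!: continuous_intros)
      then have conn: "connected (g ` C)"
        using connectedin_continuous_map_image[OF _ CT] by force
      have "g ` C \<subseteq> {z. z ^ d k = 1}"
      proof (rule image_subsetI)
        fix p' assume "p' \<in> C"
        then obtain \<theta>' where \<theta>': "p' = torus_class I \<theta>'" "torus_class I \<theta>' \<in> K_group I A"
          using CK K_group_class by blast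
        then have "real (d k) * coord k \<theta>' \<in> periods"
          using k by (simp add: K_coord)
        then show "g p' \<in> {z. z ^ d k = 1}"
          by (simp add: \<theta>' g periods_iff_cis Complex.DeMoivre)
      qed
      moreover have "finite {z :: complex. z ^ d k = 1}"
        using d_pos[OF k] by (simp add: finite_roots_unity Suc_leI)
      ultimately have "finite (g ` C)"
        by (rule finite_subset)
      moreover have one: "g \<one>\<^bsub>torus I\<^esub> = 1"
        by (simp add: one_torus_class g)
      ultimately have "g ` C = {1}"
        using conn C(2) connected_finite_iff_sing[of "g ` C"] by (metis empty_iff image_eqI singletonD)
      then have "g p = 1"
        using C(3) by blast
      then show ?thesis
        by (simp add: p g periods_iff_cis)
    qed
    then show "p \<in> K0"
      by (simp add: p K0_iff)
  qed
qed

text \<open>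
  An element \<open>\<theta>\<close> of the kernel defines the character \<open>\<alpha> \<mapsto> \<langle>\<alpha>, \<theta>\<rangle>\<close> of the saturation modulo \<open>2\<pi>\<close>, which is
  trivial on \<open>L_lattice A\<close>.  It is trivial altogether iff \<open>coord k \<theta>\<close> is a period for all \<open>k < q\<close>, that
  is, on the identity component.  Every character arises, since the angles \<open>coord k \<theta>\<close> can be
  prescribed.
\<close>

lemma component_group_dual:
  "component_group ((torus I)\<lparr>carrier := K_group I A\<rparr>) (subtopology (torus_topology I) (K_group I A))
     \<cong> pontryagin_dual (additive_group (L_sat I A) Mod L_lattice A)"
proof -
  let ?S = "additive_group (L_sat I A)"
  let ?L = "L_lattice A"
  let ?Q = "?S Mod ?L"
  let ?D = "pontryagin_dual ?Q"
  let ?K = "(torus I)\<lparr>carrier := K_group I A\<rparr>"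
  interpret S: comm_group ?S by (rule comm_group_L_sat)
  interpret N: normal ?L ?S by (rule L_lattice_subgroup)
  interpret T: comm_group "torus I" by (rule comm_group_torus)
  have groupQ: "group ?Q"
    by (rule N.factorgroup_is_group)
  have groupK: "group ?K"
    by (rule T.subgroup_imp_group[OF subgroup_K_group[OF A_sub]])
  have coset: "?L #>\<^bsub>?S\<^esub> \<alpha> = (\<lambda>\<kappa>. \<kappa> + \<alpha>) ` ?L" for \<alpha>
    by (auto simp: r_coset_def)
  have carQ: "carrier ?Q = (\<lambda>\<alpha>. ?L #>\<^bsub>?S\<^esub> \<alpha>) ` L_sat I A"
    by (simp add: carrier_FactGroup)
  \<comment> \<open>The choice of representatives does not matter, as the kernel pairs trivially with \<open>L\<close>.\<close>
  define rep where "rep c = (SOME \<alpha> :: int^'l. \<alpha> \<in> c)" for c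
  have rep: "rep (?L #>\<^bsub>?S\<^esub> \<alpha>) - \<alpha> \<in> ?L" for \<alpha>
  proof -
    have "\<alpha> \<in> ?L #>\<^bsub>?S\<^esub> \<alpha>"
      unfolding coset using zmod.span_zero[of A] by (force simp: L_lattice_zspan)
    then have "rep (?L #>\<^bsub>?S\<^esub> \<alpha>) \<in> ?L #>\<^bsub>?S\<^esub> \<alpha>"
      unfolding rep_def by (rule someI)
    then show ?thesis
      by (auto simp: coset)
  qed
  define ch where "ch \<theta> = (\<lambda>c\<in>carrier ?Q. circle_class (cast_vec (rep c) \<bullet> \<theta>))" for \<theta> :: "real^'l"
  have ch: "ch \<theta> (?L #>\<^bsub>?S\<^esub> \<alpha>) = circle_class (cast_vec \<alpha> \<bullet> \<theta>)"
    if "torus_class I \<theta> \<in> K_group I A" "\<alpha> \<in> L_sat I A" for \<theta> \<alpha>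
  proof -
    have "cast_vec (rep (?L #>\<^bsub>?S\<^esub> \<alpha>) - \<alpha>) \<bullet> \<theta> \<in> periods"
      by (rule L_lattice_inner[OF that(1) rep])
    then show ?thesis
      using that(2) by (simp add: ch_def carQ circle_class_eq_periods cast_vec_diff inner_diff_left)
  qed
  have ch_hom: "ch \<theta> \<in> carrier ?D" if \<theta>: "torus_class I \<theta> \<in> K_group I A" for \<theta>
  proof -
    have "ch \<theta> \<in> hom ?Q circle_group"
    proof (rule homI)
      show "ch \<theta> c \<in> carrier circle_group" if "c \<in> carrier ?Q" for c
        using that by (simp add: ch_def carrier_circle_group)
      fix c c' assume "c \<in> carrier ?Q" "c' \<in> carrier ?Q"
      then obtain \<alpha> \<alpha>' where c: "c = ?L #>\<^bsub>?S\<^esub> \<alpha>" "c' = ?L #>\<^bsub>?S\<^esub> \<alpha>'" "\<alpha> \<in> L_sat I A" "\<alpha>' \<in> L_sat I A"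
        by (auto simp: carQ)
      have "c \<otimes>\<^bsub>?Q\<^esub> c' = ?L #>\<^bsub>?S\<^esub> (\<alpha> + \<alpha>')"
        using N.rcos_sum[of \<alpha> \<alpha>'] c by simp
      moreover have "\<alpha> + \<alpha>' \<in> L_sat I A"
        using S.m_closed[of \<alpha> \<alpha>'] c by simp
      ultimately show "ch \<theta> (c \<otimes>\<^bsub>?Q\<^esub> c') = ch \<theta> c \<otimes>\<^bsub>circle_group\<^esub> ch \<theta> c'"
        using c by (simp only: ch[OF \<theta>] mult_circle_group cast_vec_add inner_add_left)
    qed
    then show ?thesis
      by (simp add: pontryagin_dual_def ch_def)
  qed
  define ang where "ang p = (SOME \<theta>. torus_class I \<theta> = p)" for p
  have ang: "torus_class I (ang p) = p" if "p \<in> K_group I A" for p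
  proof -
    obtain \<theta> where \<theta>: "p = torus_class I \<theta>"
      using K_group_class \<open>p \<in> K_group I A\<close> by blast
    show ?thesis
      unfolding ang_def by (rule someI[of _ \<theta>]) (rule \<theta>[symmetric])
  qed
  define \<Psi> where "\<Psi> p = ch (ang p)" for p
  have \<Psi>: "\<Psi> (torus_class I \<theta>) (?L #>\<^bsub>?S\<^esub> \<alpha>) = circle_class (cast_vec \<alpha> \<bullet> \<theta>)"
    if "torus_class I \<theta> \<in> K_group I A" "\<alpha> \<in> L_sat I A" for \<theta> \<alpha>
  proof -
    have a: "torus_class I (ang (torus_class I \<theta>)) = torus_class I \<theta>"
      by (rule ang[OF that(1)])
    have "\<alpha> \<in> Zpow I"
      using that(2) by (simp add: L_sat_eq)
    then have "cast_vec \<alpha> \<bullet> ang (torus_class I \<theta>) - cast_vec \<alpha> \<bullet> \<theta> \<in> periods"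
      using a by (rule inner_cast_torus_class)
    then show ?thesis
      unfolding \<Psi>_def using ch[of "ang (torus_class I \<theta>)" \<alpha>] a that by (simp add: circle_class_eq_periods)
  qed
  have \<Psi>_car: "\<Psi> p \<in> carrier ?D" if "p \<in> K_group I A" for p
    unfolding \<Psi>_def using ch_hom ang[OF that] that by metis
  have ext: "f = g" if "f \<in> carrier ?D" "g \<in> carrier ?D"
    "\<And>\<alpha>. \<alpha> \<in> L_sat I A \<Longrightarrow> f (?L #>\<^bsub>?S\<^esub> \<alpha>) = g (?L #>\<^bsub>?S\<^esub> \<alpha>)" for f g
  proof (rule extensionalityI)
    show "f \<in> extensional (carrier ?Q)" "g \<in> extensional (carrier ?Q)"
      using that by (auto simp: pontryagin_dual_def)
  qed (use that(3) in \<open>auto simp: carQ\<close>)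
  have groupD: "group ?D"
    by (rule group_pontryagin_dual[OF groupQ])
  have \<Psi>_hom: "\<Psi> \<in> hom ?K ?D"
  proof (rule homI)
    show "\<Psi> p \<in> carrier ?D" if "p \<in> carrier ?K" for p
      using that \<Psi>_car by simp
    fix p p' assume "p \<in> carrier ?K" "p' \<in> carrier ?K"
    then have pp: "p \<in> K_group I A" "p' \<in> K_group I A"
      by simp_all
    then obtain \<theta> \<theta>' where p: "p = torus_class I \<theta>" "p' = torus_class I \<theta>'"
      using K_group_class by blast
    have prod: "p \<otimes>\<^bsub>?K\<^esub> p' = torus_class I (\<theta> + \<theta>')"
      by (simp add: p mult_torus_class)
    have pK: "torus_class I (\<theta> + \<theta>') \<in> K_group I A"
      using subgroup.m_closed[OF subgroup_K_group[OF A_sub] pp] by (simp add: p mult_torus_class)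
    show "\<Psi> (p \<otimes>\<^bsub>?K\<^esub> p') = \<Psi> p \<otimes>\<^bsub>?D\<^esub> \<Psi> p'"
    proof (rule ext)
      show "\<Psi> (p \<otimes>\<^bsub>?K\<^esub> p') \<in> carrier ?D"
        unfolding prod by (rule \<Psi>_car[OF pK])
      show "\<Psi> p \<otimes>\<^bsub>?D\<^esub> \<Psi> p' \<in> carrier ?D"
        by (intro monoid.m_closed group.is_monoid groupD \<Psi>_car pp)
      fix \<alpha> assume \<alpha>: "\<alpha> \<in> L_sat I A"
      have "(\<Psi> p \<otimes>\<^bsub>?D\<^esub> \<Psi> p') (?L #>\<^bsub>?S\<^esub> \<alpha>)
          = \<Psi> p (?L #>\<^bsub>?S\<^esub> \<alpha>) \<otimes>\<^bsub>circle_group\<^esub> \<Psi> p' (?L #>\<^bsub>?S\<^esub> \<alpha>)"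
        using \<alpha> by (simp add: pontryagin_dual_def carQ)
      also have "\<dots> = circle_class (cast_vec \<alpha> \<bullet> (\<theta> + \<theta>'))"
        using \<Psi>[OF _ \<alpha>] pp by (simp add: p mult_circle_group inner_add_right)
      finally show "\<Psi> (p \<otimes>\<^bsub>?K\<^esub> p') (?L #>\<^bsub>?S\<^esub> \<alpha>) = (\<Psi> p \<otimes>\<^bsub>?D\<^esub> \<Psi> p') (?L #>\<^bsub>?S\<^esub> \<alpha>)"
        unfolding prod using \<Psi>[OF pK \<alpha>] by simp
    qed
  qed
  interpret group_hom ?K ?D \<Psi>
    using \<Psi>_hom groupD groupK by (simp add: group_hom_def group_hom_axioms_def)
  have surj: "\<Psi> ` carrier ?K = carrier ?D"
  proof
    show "\<Psi> ` carrier ?K \<subseteq> carrier ?D"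
      using \<Psi>_car by auto
    show "carrier ?D \<subseteq> \<Psi> ` carrier ?K"
    proof
      fix \<eta> assume \<eta>: "\<eta> \<in> carrier ?D"
      then have \<eta>_hom: "\<eta> \<in> hom ?Q circle_group"
        by (simp add: pontryagin_dual_def)
      define X where "X \<alpha> = \<eta> (?L #>\<^bsub>?S\<^esub> \<alpha>)" for \<alpha>
      have X_add: "X (\<alpha> + \<beta>) = X \<alpha> \<otimes>\<^bsub>circle_group\<^esub> X \<beta>" if "\<alpha> \<in> L_sat I A" "\<beta> \<in> L_sat I A" for \<alpha> \<beta>
      proof -
        have "?L #>\<^bsub>?S\<^esub> (\<alpha> + \<beta>) = (?L #>\<^bsub>?S\<^esub> \<alpha>) \<otimes>\<^bsub>?Q\<^esub> (?L #>\<^bsub>?S\<^esub> \<beta>)"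
          using N.rcos_sum[of \<alpha> \<beta>] that by simp
        moreover have "?L #>\<^bsub>?S\<^esub> \<alpha> \<in> carrier ?Q" "?L #>\<^bsub>?S\<^esub> \<beta> \<in> carrier ?Q"
          using that by (auto simp: carQ)
        ultimately show ?thesis
          unfolding X_def using Group.hom_mult[OF \<eta>_hom] by metis
      qed
      have X_hom: "X \<in> hom ?S circle_group"
      proof (rule homI)
        show "X \<alpha> \<in> carrier circle_group" if "\<alpha> \<in> carrier ?S" for \<alpha>
          unfolding X_def by (rule hom_in_carrier[OF \<eta>_hom]) (use that in \<open>auto simp: carQ\<close>)
      qed (simp add: X_add)
      interpret X: group_hom ?S circle_group X
        using X_hom by (simp add: group_hom_def group_hom_axioms_def S.is_group circle.is_group)
      have X_L: "X \<alpha> = circle_class 0" if "\<alpha> \<in> ?L" for \<alpha>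
      proof -
        have "?L #>\<^bsub>?S\<^esub> \<alpha> = ?L"
          by (rule S.coset_join2) (use that N.subset N.subgroup_axioms in auto)
        then have "?L #>\<^bsub>?S\<^esub> \<alpha> = \<one>\<^bsub>?Q\<^esub>"
          by simp
        then show ?thesis
          unfolding X_def using Group.hom_one[OF \<eta>_hom groupQ circle.is_group] by (simp add: one_circle_group)
      qed
      have X_scale: "X (c *s \<alpha>) = circle_class (of_int c * a)" if \<alpha>: "\<alpha> \<in> L_sat I A" and a: "X \<alpha> = circle_class a"
        for c \<alpha> a
      proof -
        have pow: "\<alpha> [^]\<^bsub>?S\<^esub> k = int k *s \<alpha>" for k :: nat
          by (induction k) (simp_all add: zmod.scale_left_distrib add.commute)
        have inv: "inv\<^bsub>?S\<^esub> \<beta> = - \<beta>" if "\<beta> \<in> L_sat I A" for \<beta>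
          by (rule S.inv_equality) (use that in \<open>auto simp: L_sat_eq ipair_minus Zpow_def\<close>)
        have "(- c) *s \<alpha> \<in> L_sat I A"
          using \<alpha> unfolding L_sat_eq by (auto simp: ipair_scale ipair_minus Zpow_def)
        then have "\<alpha> [^]\<^bsub>?S\<^esub> c = c *s \<alpha>"
          unfolding int_pow_def2 pow using inv[of "(- c) *s \<alpha>"] by auto
        then have "X (c *s \<alpha>) = X \<alpha> [^]\<^bsub>circle_group\<^esub> c"
          using X.hom_int_pow[of \<alpha> c] \<alpha> by simp
        then show ?thesis
          by (simp add: a int_pow_circle_group)
      qed
      have "\<exists>a. X (v k) = circle_class a" if "k < q" for k
        using X.hom_closed[of "v k"] v_L_sat[OF that] by (auto simp: carrier_circle_group)
      then obtain a where a: "\<And>k. k < q \<Longrightarrow> X (v k) = circle_class (a k)"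
        by metis
      \<comment> \<open>The values of the character at the basis vectors \<open>v k\<close> serve as the new angles.\<close>
      define \<theta> where "\<theta> = (\<Sum>k<q. a k *\<^sub>R (cast_vec (x k) :: real^'l))"
      have c: "coord k \<theta> = a k" if "k < q" for k
        unfolding \<theta>_def using coord_dual_sum[of "{..<q}" k a] that q_le by auto
      have \<theta>K: "torus_class I \<theta> \<in> K_group I A"
        unfolding K_coord
      proof (intro allI impI)
        fix k assume k: "k < q"
        have "circle_class (of_int (int (d k)) * a k) = circle_class 0"
          using X_scale[OF v_L_sat[OF k] a[OF k]] X_L[OF dv_lattice[OF k]] by metis
        then show "real (d k) * coord k \<theta> \<in> periods"
          using k by (simp add: c circle_class_eq_periods)
      qed
      have X_sum: "X (\<Sum>k<j. b k *s v k) = circle_class (\<Sum>k<j. of_int (b k) * a k)" if "j \<le> q" for j b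
        using that
      proof (induction j)
        case 0
        have "(0 :: int^'l) \<in> ?L"
          by (simp add: L_lattice_zspan zmod.span_zero)
        then show ?case
          using X_L by simp
      next
        case (Suc j)
        have "(\<Sum>k<j. b k *s v k) \<in> L_sat I A"
          using v_L_sat Suc.prems by (auto simp: L_sat_eq ipair_sum ipair_scale intro!: Zpow_sum Zpow_scale)
        moreover have "b j *s v j \<in> L_sat I A"
          using v_L_sat[of j] Suc.prems by (auto simp: L_sat_eq ipair_scale Zpow_scale)
        ultimately show ?case
          using Suc X_scale[OF v_L_sat a, of j "b j"] by (simp add: X_add mult_circle_group)
      qed
      have "\<eta> = \<Psi> (torus_class I \<theta>)"
      proof (rule ext[OF \<eta> \<Psi>_car[OF \<theta>K]])
        fix \<alpha> assume \<alpha>: "\<alpha> \<in> L_sat I A"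
        have "X \<alpha> = X (\<Sum>k<q. ipair (x k) \<alpha> *s v k)"
          using expand_low[of \<alpha>] \<alpha> by (simp add: L_sat_eq)
        also have "\<dots> = circle_class (\<Sum>k<q. of_int (ipair (x k) \<alpha>) * a k)"
          by (rule X_sum) simp
        also have "(\<Sum>k<q. of_int (ipair (x k) \<alpha>) * a k) = cast_vec \<alpha> \<bullet> \<theta>"
          unfolding pair_expand_low[OF \<alpha>] by (simp add: c)
        finally show "\<eta> (?L #>\<^bsub>?S\<^esub> \<alpha>) = \<Psi> (torus_class I \<theta>) (?L #>\<^bsub>?S\<^esub> \<alpha>)"
          using \<Psi>[OF \<theta>K \<alpha>] by (simp add: X_def)
      qed
      then show "\<eta> \<in> \<Psi> ` carrier ?K"
        using \<theta>K by simp
    qed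
  qed
  have ker: "kernel ?K ?D \<Psi> = K0"
  proof -
    have "p \<in> kernel ?K ?D \<Psi> \<longleftrightarrow> p \<in> K0" if p: "p \<in> K_group I A" for p
    proof -
      obtain \<theta> where \<theta>: "p = torus_class I \<theta>"
        using p K_group_class by blast
      have one: "\<one>\<^bsub>?D\<^esub> (?L #>\<^bsub>?S\<^esub> \<alpha>) = circle_class 0" if "\<alpha> \<in> L_sat I A" for \<alpha>
        using that by (simp add: pontryagin_dual_def carQ one_circle_group)
      have "\<Psi> p = \<one>\<^bsub>?D\<^esub> \<longleftrightarrow> (\<forall>\<alpha>\<in>L_sat I A. cast_vec \<alpha> \<bullet> \<theta> \<in> periods)"
      proof
        assume *: "\<Psi> p = \<one>\<^bsub>?D\<^esub>"
        show "\<forall>\<alpha>\<in>L_sat I A. cast_vec \<alpha> \<bullet> \<theta> \<in> periods"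
        proof
          fix \<alpha> assume \<alpha>: "\<alpha> \<in> L_sat I A"
          then have "circle_class (cast_vec \<alpha> \<bullet> \<theta>) = circle_class 0"
            using \<Psi>[of \<theta> \<alpha>] one[OF \<alpha>] * p \<theta> by simp
          then show "cast_vec \<alpha> \<bullet> \<theta> \<in> periods"
            by (simp add: circle_class_eq_periods)
        qed
      next
        assume *: "\<forall>\<alpha>\<in>L_sat I A. cast_vec \<alpha> \<bullet> \<theta> \<in> periods"
        show "\<Psi> p = \<one>\<^bsub>?D\<^esub>"
        proof (rule ext[OF \<Psi>_car[OF p]])
          show "\<one>\<^bsub>?D\<^esub> \<in> carrier ?D"
            using groupD by (simp add: group.is_monoid monoid.one_closed)
          show "\<Psi> p (?L #>\<^bsub>?S\<^esub> \<alpha>) = \<one>\<^bsub>?D\<^esub> (?L #>\<^bsub>?S\<^esub> \<alpha>)" if \<alpha>: "\<alpha> \<in> L_sat I A" for \<alpha>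
            using \<Psi>[of \<theta> \<alpha>] one[OF \<alpha>] * p \<theta> \<alpha> by (simp add: circle_class_eq_periods)
        qed
      qed
      also have "\<dots> \<longleftrightarrow> (\<forall>k<q. coord k \<theta> \<in> periods)"
      proof
        assume *: "\<forall>k<q. coord k \<theta> \<in> periods"
        show "\<forall>\<alpha>\<in>L_sat I A. cast_vec \<alpha> \<bullet> \<theta> \<in> periods"
        proof
          fix \<alpha> assume "\<alpha> \<in> L_sat I A"
          then show "cast_vec \<alpha> \<bullet> \<theta> \<in> periods"
            unfolding pair_expand_low[OF \<open>\<alpha> \<in> L_sat I A\<close>]
            using * by (intro periods_sum periods_of_int) auto
        qed
      qed (use v_L_sat in blast)
      finally show ?thesis
        using p by (simp add: kernel_def \<theta> K0_iff)
    qed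
    moreover have "kernel ?K ?D \<Psi> \<subseteq> K_group I A"
      by (auto simp: kernel_def)
    moreover have "K0 \<subseteq> K_group I A"
      by (auto simp: K0_def K_coord periods_0)
    ultimately show ?thesis
      by blast
  qed
  have "?K Mod kernel ?K ?D \<Psi> \<cong> ?D"
    by (rule FactGroup_iso[OF surj])
  then show ?thesis
    by (simp add: component_group_def ker K_component)
qed

subsection \<open>The image of the characters\<close>

text \<open>
  The characters in \<open>A\<close> only depend on the \<open>q\<close> angles \<open>d k * coord k \<theta>\<close> modulo \<open>2\<pi>\<close>, and they separate
  them; so these angles parametrize the image by a torus.
\<close>

lemma character_image_torus:
  assumes "finite A"
  obtains C where "C = range (\<lambda>\<theta> :: real^'l. \<lambda>\<alpha>\<in>A. cis (cast_vec \<alpha> \<bullet> \<theta>))"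
    "subgroup C (cstar_power A)"
    "top_group_isomorphic (torus {..<q}) (torus_topology {..<q})
       ((cstar_power A)\<lparr>carrier := C\<rparr>) (subtopology (cstar_power_topology A) C)"
proof -
  define G where "G \<theta> = (\<lambda>\<alpha>\<in>A. cis (cast_vec \<alpha> \<bullet> \<theta>))" for \<theta> :: "real^'l"
  \<comment> \<open>Dividing by \<open>d k\<close> makes \<open>\<phi> k\<close> the value of \<open>d k * coord k\<close>.\<close>
  define E where "E \<phi> = (\<Sum>k<q. (\<phi> k / real (d k)) *\<^sub>R (cast_vec (x k) :: real^'l))" for \<phi>
  have cE: "coord k (E \<phi>) = \<phi> k / real (d k)" if "k < q" for k \<phi>
    unfolding E_def using coord_dual_sum[of "{..<q}" k "\<lambda>k. \<phi> k / real (d k)"] that q_le by auto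
  have G_eq: "G \<theta> = G \<theta>' \<longleftrightarrow> (\<forall>k<q. real (d k) * (coord k \<theta> - coord k \<theta>') \<in> periods)" for \<theta> \<theta>'
  proof -
    have "G \<theta> = G \<theta>' \<longleftrightarrow> (\<forall>\<alpha>\<in>A. cis (cast_vec \<alpha> \<bullet> \<theta>) = cis (cast_vec \<alpha> \<bullet> \<theta>'))"
      unfolding G_def by (auto simp: fun_eq_iff)
    also have "\<dots> \<longleftrightarrow> torus_class I (\<theta> - \<theta>') \<in> K_group I A"
      by (simp add: K_group_iff[OF A_sub] cis_eq_iff_periods inner_diff_right)
    finally show ?thesis
      by (simp add: K_coord inner_diff_right)
  qed
  have G_E: "G \<theta> = G (E (\<lambda>k. real (d k) * coord k \<theta>))" for \<theta>
    unfolding G_eq using d_pos by (auto simp: cE periods_0)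
  define f where "f p = G (E (SOME \<phi>. tclass {..<q} \<phi> = p))" for p
  have f: "f (tclass {..<q} \<phi>) = G (E \<phi>)" for \<phi>
  proof -
    define \<psi> where "\<psi> = (SOME \<psi>. tclass {..<q} \<psi> = tclass {..<q} \<phi>)"
    have "tclass {..<q} \<psi> = tclass {..<q} \<phi>"
      unfolding \<psi>_def by (rule someI[of _ \<phi>]) simp
    then have "\<forall>k<q. \<psi> k - \<phi> k \<in> periods"
      by (simp add: tclass_eq_iff)
    then have "G (E \<psi>) = G (E \<phi>)"
      unfolding G_eq using d_pos by (auto simp: cE right_diff_distrib)
    then show ?thesis
      by (simp add: f_def \<psi>_def)
  qed
  have groupC: "group (cstar_power A)"
  proof -
    have "group cstar_group"
    proof (rule groupI)
      show "\<exists>y\<in>carrier cstar_group. y \<otimes>\<^bsub>cstar_group\<^esub> a = \<one>\<^bsub>cstar_group\<^esub>"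
        if "a \<in> carrier cstar_group" for a
        using that by (intro bexI[of _ "inverse a"]) (auto simp: cstar_group_def)
    qed (auto simp: cstar_group_def)
    then show ?thesis
      unfolding cstar_power_def by (intro product_group)
  qed
  have G_car: "G \<theta> \<in> carrier (cstar_power A)" for \<theta>
    by (auto simp: G_def cstar_power_def cstar_group_def)
  have G_mult: "G (\<theta> + \<theta>') = G \<theta> \<otimes>\<^bsub>cstar_power A\<^esub> G \<theta>'" for \<theta> \<theta>'
    by (auto simp: G_def cstar_power_def cstar_group_def inner_add_right cis_mult fun_eq_iff)
  have hom: "f \<in> hom (torus {..<q}) (cstar_power A)"
  proof (rule homI)
    show "f p \<in> carrier (cstar_power A)" for p
      unfolding f_def by (rule G_car)
    fix p p' assume "p \<in> carrier (torus {..<q})" "p' \<in> carrier (torus {..<q})"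
    then obtain \<phi> \<phi>' where p: "p = tclass {..<q} \<phi>" "p' = tclass {..<q} \<phi>'"
      by (auto simp: carrier_torus)
    have "E (\<lambda>k. \<phi> k + \<phi>' k) = E \<phi> + E \<phi>'"
      by (simp add: E_def add_divide_distrib scaleR_add_left sum.distrib)
    then show "f (p \<otimes>\<^bsub>torus {..<q}\<^esub> p') = f p \<otimes>\<^bsub>cstar_power A\<^esub> f p'"
      by (simp add: p mult_torus f G_mult)
  qed
  have inj: "inj_on f (carrier (torus {..<q}))"
  proof (rule inj_onI)
    fix p p' assume "p \<in> carrier (torus {..<q})" "p' \<in> carrier (torus {..<q})" and eq: "f p = f p'"
    then obtain \<phi> \<phi>' where p: "p = tclass {..<q} \<phi>" "p' = tclass {..<q} \<phi>'"
      by (auto simp: carrier_torus)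
    have "\<forall>k<q. real (d k) * (coord k (E \<phi>) - coord k (E \<phi>')) \<in> periods"
      using eq unfolding p f G_eq .
    then show "p = p'"
      unfolding p tclass_eq_iff using d_pos by (auto simp: cE right_diff_distrib)
  qed
  have img: "f ` carrier (torus {..<q}) = range G"
  proof
    show "range G \<subseteq> f ` carrier (torus {..<q})"
    proof
      fix y assume "y \<in> range G"
      then obtain \<theta> where "y = G \<theta>"
        by blast
      then have "y = f (tclass {..<q} (\<lambda>k. real (d k) * coord k \<theta>))"
        using G_E[of \<theta>] by (simp only: f)
      then show "y \<in> f ` carrier (torus {..<q})"
        by (auto simp: carrier_torus)
    qed
  qed (auto simp: f_def)
  have cont: "continuous_map (torus_topology {..<q}) (cstar_power_topology A) f"
  proof (rule continuous_map_from_torus)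
    have E: "continuous_map (powertop_real {..<q}) euclidean E"
      unfolding E_def
    proof (intro continuous_map_sum)
      fix k assume k: "k \<in> {..<q}"
      have "continuous_on UNIV (\<lambda>c::real. (c / real (d k)) *\<^sub>R (cast_vec (x k) :: real^'l))"
        by (cases "d k = 0") (auto intro!: continuous_intros)
      then have "continuous_map euclideanreal euclidean (\<lambda>c::real. (c / real (d k)) *\<^sub>R (cast_vec (x k) :: real^'l))"
        by simp
      from continuous_map_compose[OF continuous_map_product_projection[OF k] this]
      show "continuous_map (powertop_real {..<q}) euclidean (\<lambda>\<phi>. (\<phi> k / real (d k)) *\<^sub>R (cast_vec (x k) :: real^'l))"
        by (simp add: o_def)
    qed simp
    show "continuous_map (powertop_real {..<q}) (cstar_power_topology A) (G \<circ> E)"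
    proof (rule continuous_map_compose[OF E])
      show "continuous_map euclidean (cstar_power_topology A) G"
        unfolding cstar_power_topology_def continuous_map_componentwise
      proof (intro conjI ballI)
        fix \<alpha> assume "\<alpha> \<in> A"
        moreover have "continuous_on UNIV (\<lambda>\<theta> :: real^'l. cis (cast_vec \<alpha> \<bullet> \<theta>))"
          by (intro continuous_intros)
        ultimately show "continuous_map euclidean (top_of_set (- {0})) (\<lambda>\<theta>. G \<theta> \<alpha>)"
          by (simp add: G_def continuous_map_in_subtopology)
      qed (auto simp: G_def)
    qed
    show "f (tclass {..<q} \<phi>) = (G \<circ> E) \<phi>" for \<phi>
      by (simp add: f)
  qed
  have Haus: "Hausdorff_space (cstar_power_topology A)"
    by (simp add: cstar_power_topology_def Hausdorff_space_product_topology Hausdorff_space_subtopology)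
  have tgi: "top_group_isomorphic (torus {..<q}) (torus_topology {..<q})
       ((cstar_power A)\<lparr>carrier := range G\<rparr>) (subtopology (cstar_power_topology A) (range G))"
    using compact_group_embedding[OF hom inj topspace_torus compact_torus Haus cont] by (simp only: img)
  interpret f: group_hom "torus {..<q}" "cstar_power A" f
    using hom groupC comm_group.axioms(2)[OF comm_group_torus]
    by (simp add: group_hom_def group_hom_axioms_def)
  have "subgroup (range G) (cstar_power A)"
    using f.img_is_subgroup by (simp only: img)
  then show thesis
    using that[OF _ _ tgi] by (simp add: G_def[abs_def])
qed

text \<open>
  The kernel of \<open>D\<close> is the common kernel of \<open>coord k\<close> for \<open>k < q\<close>, so the images of the dual vectors
  \<open>x k\<close>, \<open>k < q\<close>, form a basis of the range.
\<close>

lemma dim_range_characters: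
  fixes D :: "real^'l \<Rightarrow> 'w::real_vector"
  assumes lin: "linear D" and ker: "\<And>\<xi>. D \<xi> = 0 \<longleftrightarrow> (\<forall>\<alpha>\<in>A. cast_vec \<alpha> \<bullet> \<xi> = 0)"
  shows "dim (range D) = q"
proof -
  have ker': "D \<xi> = 0 \<longleftrightarrow> (\<forall>k<q. coord k \<xi> = 0)" for \<xi>
  proof
    assume "D \<xi> = 0"
    then have "\<forall>\<alpha>\<in>A. cast_vec \<alpha> \<bullet> (c *\<^sub>R \<xi>) \<in> periods" for c
      using ker by (simp add: periods_0)
    then have *: "torus_class I (c *\<^sub>R \<xi>) \<in> K_group I A" for c
      by (simp add: K_group_iff[OF A_sub])
    show "\<forall>k<q. coord k \<xi> = 0"
    proof (intro allI impI)
      fix k assume k: "k < q"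
      \<comment> \<open>The line through \<open>\<xi>\<close> lies in the kernel group, but \<open>\<pi>\<close> is not a period.\<close>
      have per: "c * (real (d k) * coord k \<xi>) \<in> periods" for c
        using *[of c] k by (simp add: K_coord mult.left_commute)
      show "coord k \<xi> = 0"
      proof (rule ccontr)
        assume "coord k \<xi> \<noteq> 0"
        then have "pi \<in> periods"
          using per[of "pi / (real (d k) * coord k \<xi>)"] d_pos[OF k] by simp
        then show False
          by (simp add: periods_iff_cis)
      qed
    qed
  next
    assume "\<forall>k<q. coord k \<xi> = 0"
    then show "D \<xi> = 0"
      using ker A_L_sat by (simp add: pair_expand_low)
  qed
  define X where "X k = (cast_vec (x k) :: real^'l)" for k
  have c: "coord j (\<Sum>k<q. a k *\<^sub>R X k) = a j" if "j < q" for j a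
    unfolding X_def using coord_dual_sum[of "{..<q}" j a] that q_le by auto
  have D_sum: "D (\<Sum>k<q. a k *\<^sub>R X k) = (\<Sum>k<q. a k *\<^sub>R D (X k))" for a
    by (simp add: linear_sum[OF lin] linear_cmul[OF lin])
  have zero: "a j = 0" if "(\<Sum>k<q. a k *\<^sub>R D (X k)) = 0" "j < q" for a j
    using that ker'[of "\<Sum>k<q. a k *\<^sub>R X k"] c by (simp add: D_sum)
  have inj: "inj_on (\<lambda>k. D (X k)) {..<q}"
  proof (rule inj_onI)
    fix i j assume ij: "i \<in> {..<q}" "j \<in> {..<q}" "D (X i) = D (X j)"
    show "i = j"
    proof (rule ccontr)
      assume ne: "i \<noteq> j"
      define a where "a k = (if k = i then 1 else if k = j then -1 else 0 :: real)" for k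
      have "(\<Sum>k<q. a k *\<^sub>R D (X k)) = (\<Sum>k\<in>{i, j}. a k *\<^sub>R D (X k))"
        by (rule sum.mono_neutral_right) (use ij in \<open>auto simp: a_def\<close>)
      also have "\<dots> = 0"
        using ne ij(3) by (simp add: a_def)
      finally have "a i = 0"
        using zero[of a i] ij by simp
      then show False
        by (simp add: a_def)
    qed
  qed
  define B where "B = (\<lambda>k. D (X k)) ` {..<q}"
  have "independent B"
  proof (rule independent_if_scalars_zero)
    fix f y assume 0: "(\<Sum>y\<in>B. f y *\<^sub>R y) = 0" and "y \<in> B"
    then obtain j where j: "j < q" "y = D (X j)"
      by (auto simp: B_def)
    have "(\<Sum>k<q. f (D (X k)) *\<^sub>R D (X k)) = 0"
      using 0 unfolding B_def sum.reindex[OF inj] by (simp add: o_def)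
    then show "f y = 0"
      using zero[of "\<lambda>k. f (D (X k))"] j by simp
  qed (simp add: B_def)
  moreover have "span B = span (range D)"
  proof (rule subset_antisym; rule span_minimal)
    show "B \<subseteq> span (range D)"
      by (auto simp: B_def intro: span_base)
    show "range D \<subseteq> span B"
    proof (rule image_subsetI)
      fix \<xi>
      have "D (\<xi> - (\<Sum>k<q. coord k \<xi> *\<^sub>R X k)) = 0"
        unfolding ker' inner_diff_right using c by simp
      then have "D \<xi> = (\<Sum>k<q. coord k \<xi> *\<^sub>R D (X k))"
        by (simp add: linear_diff[OF lin] D_sum)
      also have "\<dots> \<in> span B"
        by (intro span_sum span_scale span_base) (auto simp: B_def)
      finally show "D \<xi> \<in> span B" .
    qed
  qed simp_all
  ultimately have "dim (range D) = card B"
    using dim_eq_card by blast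
  then show ?thesis
    using inj by (simp add: B_def card_image)
qed

end

section \<open>Laurent polynomials on tori\<close>

subsection \<open>Independence of characters\<close>

lemma character_separation:
  fixes \<beta> \<beta>' :: "int^'l::finite"
  assumes "\<beta> \<noteq> \<beta>'"
  obtains \<eta> :: "real^'l" where "cis (cast_vec \<beta> \<bullet> \<eta>) \<noteq> cis (cast_vec \<beta>' \<bullet> \<eta>)"
proof -
  obtain l where l: "\<beta> $ l \<noteq> \<beta>' $ l"
    using assms by (auto simp: Finite_Cartesian_Product.vec_eq_iff)
  define m where "m = \<beta> $ l - \<beta>' $ l"
  \<comment> \<open>At these angles the quotient of the two characters is \<open>cis \<pi> = -1\<close>.\<close>
  define \<eta> :: "real^'l" where "\<eta> = axis l (pi / of_int m)"
  have "cast_vec \<beta> \<bullet> \<eta> - cast_vec \<beta>' \<bullet> \<eta> = of_int m * (pi / of_int m)"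
    by (simp add: \<eta>_def inner_axis m_def left_diff_distrib diff_divide_distrib)
  also have "\<dots> = pi"
    using l by (simp add: m_def)
  finally have "cast_vec \<beta> \<bullet> \<eta> - cast_vec \<beta>' \<bullet> \<eta> \<notin> periods"
    by (simp add: periods_iff_cis)
  then show thesis
    using that by (simp add: cis_eq_iff_periods)
qed

text \<open>
  Comparing the relation with its translate by \<open>\<eta>\<close> eliminates one character; this is the argument
  of Dedekind.
\<close>

lemma characters_independent:
  fixes B :: "(int^'l::finite) set"
  assumes "finite B" "\<And>\<theta> :: real^'l. (\<Sum>\<beta>\<in>B. p \<beta> * cis (cast_vec \<beta> \<bullet> \<theta>)) = 0" "\<beta> \<in> B"
  shows "p \<beta> = 0"
  using assms
proof (induction B arbitrary: p \<beta> rule: finite_induct)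
  case (insert \<gamma> B)
  have zero: "p \<beta> = 0" if \<beta>: "\<beta> \<in> B" for \<beta>
  proof -
    obtain \<eta> :: "real^'l" where \<eta>: "cis (cast_vec \<beta> \<bullet> \<eta>) \<noteq> cis (cast_vec \<gamma> \<bullet> \<eta>)"
      using character_separation[of \<beta> \<gamma>] insert.hyps(2) \<beta> by metis
    have "p \<beta> * (cis (cast_vec \<beta> \<bullet> \<eta>) - cis (cast_vec \<gamma> \<bullet> \<eta>)) = 0"
    proof (rule insert.IH[OF _ \<beta>])
      fix \<theta> :: "real^'l"
      have "(\<Sum>\<beta>\<in>B. p \<beta> * (cis (cast_vec \<beta> \<bullet> \<eta>) - cis (cast_vec \<gamma> \<bullet> \<eta>)) * cis (cast_vec \<beta> \<bullet> \<theta>))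
          = (\<Sum>\<beta>\<in>B. p \<beta> * cis (cast_vec \<beta> \<bullet> (\<theta> + \<eta>)))
            - cis (cast_vec \<gamma> \<bullet> \<eta>) * (\<Sum>\<beta>\<in>B. p \<beta> * cis (cast_vec \<beta> \<bullet> \<theta>))"
        unfolding sum_distrib_left sum_subtractf[symmetric]
        by (rule sum.cong) (simp_all add: inner_add_right algebra_simps flip: cis_mult)
      also have "\<dots> = 0"
        using insert.prems(1)[of "\<theta> + \<eta>"] insert.prems(1)[of \<theta>] insert.hyps
        by (simp add: add_eq_0_iff inner_add_right flip: cis_mult)
      finally show "(\<Sum>\<beta>\<in>B. p \<beta> * (cis (cast_vec \<beta> \<bullet> \<eta>) - cis (cast_vec \<gamma> \<bullet> \<eta>)) * cis (cast_vec \<beta> \<bullet> \<theta>)) = 0" .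
    qed
    then show ?thesis
      using \<eta> by simp
  qed
  moreover have "p \<gamma> = 0"
    using insert.prems(1)[of 0] insert.hyps zero by simp
  ultimately show ?case
    using insert.prems(2) by blast
qed simp

lemma cis_sum: "cis (\<Sum>l\<in>S. f l) = (\<Prod>l\<in>S. cis (f l))"
  by (induction S rule: infinite_finite_induct) (auto simp: cis_mult[symmetric])

lemma s_power_cis:
  fixes \<theta> :: "real^'l::finite"
  assumes "\<alpha> \<in> Zpow I"
  shows "s_power I (\<lambda>l. cis (\<theta> $ l)) \<alpha> = cis (cast_vec \<alpha> \<bullet> \<theta>)"
proof -
  have "cast_vec \<alpha> \<bullet> \<theta> = (\<Sum>l\<in>I. of_int (\<alpha> $ l) * \<theta> $ l)"
    unfolding inner_cast_vec by (rule sum.mono_neutral_right) (use assms in \<open>auto simp: Zpow_def\<close>)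
  then show ?thesis
    by (simp add: s_power_def cis_power_int cis_sum)
qed

text \<open>A Laurent polynomial is determined by its values on the compact torus.\<close>

lemma s_eval_monomial:
  fixes p :: "(int^'l::finite) \<Rightarrow>\<^sub>0 complex"
  assumes "Poly_Mapping.keys p \<subseteq> Zpow I" "\<alpha> \<in> Zpow I"
    and "\<And>\<theta> :: real^'l. s_eval I p (\<lambda>l. cis (\<theta> $ l)) = b * cis (cast_vec \<alpha> \<bullet> \<theta>)"
  shows "p = Poly_Mapping.single \<alpha> b"
proof (rule poly_mapping_eqI)
  fix \<beta>
  define B where "B = insert \<beta> (insert \<alpha> (Poly_Mapping.keys p))"
  define r where "r \<gamma> = Poly_Mapping.lookup p \<gamma> - (if \<gamma> = \<alpha> then b else 0)" for \<gamma>
  have zero: "(\<Sum>\<gamma>\<in>B. r \<gamma> * cis (cast_vec \<gamma> \<bullet> \<theta>)) = 0" for \<theta> :: "real^'l"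
  proof -
    have "(\<Sum>\<gamma>\<in>B. r \<gamma> * cis (cast_vec \<gamma> \<bullet> \<theta>))
        = (\<Sum>\<gamma>\<in>B. Poly_Mapping.lookup p \<gamma> * cis (cast_vec \<gamma> \<bullet> \<theta>))
          - (\<Sum>\<gamma>\<in>B. if \<gamma> = \<alpha> then b * cis (cast_vec \<alpha> \<bullet> \<theta>) else 0)"
      unfolding r_def sum_subtractf[symmetric] by (rule sum.cong) (auto simp: algebra_simps)
    also have "(\<Sum>\<gamma>\<in>B. if \<gamma> = \<alpha> then b * cis (cast_vec \<alpha> \<bullet> \<theta>) else 0) = b * cis (cast_vec \<alpha> \<bullet> \<theta>)"
      by (simp add: B_def)
    also have "(\<Sum>\<gamma>\<in>B. Poly_Mapping.lookup p \<gamma> * cis (cast_vec \<gamma> \<bullet> \<theta>))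
        = (\<Sum>\<gamma>\<in>Poly_Mapping.keys p. Poly_Mapping.lookup p \<gamma> * cis (cast_vec \<gamma> \<bullet> \<theta>))"
      by (rule sum.mono_neutral_right) (auto simp: B_def in_keys_iff)
    also have "\<dots> = s_eval I p (\<lambda>l. cis (\<theta> $ l))"
      unfolding s_eval_def by (rule sum.cong) (use assms(1) in \<open>auto simp: s_power_cis\<close>)
    finally show ?thesis
      by (simp add: assms(3))
  qed
  have "r \<beta> = 0"
    by (rule characters_independent[of B r, OF _ zero]) (simp_all add: B_def)
  then show "Poly_Mapping.lookup p \<beta> = Poly_Mapping.lookup (Poly_Mapping.single \<alpha> b) \<beta>"
    by (auto simp: r_def lookup_single when_def)
qed

subsection \<open>Monomials and the Laurent ring\<close>

lemma y_power_prod: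
  assumes "finite A" "Poly_Mapping.keys c \<subseteq> A"
  shows "y_power y c = (\<Prod>x\<in>A. y x powi Poly_Mapping.lookup c x)"
  unfolding y_power_def
  by (rule prod.mono_neutral_left) (use assms in \<open>auto simp: in_keys_iff\<close>)

lemma cstar_power_nonzero: "y \<in> carrier (cstar_power A) \<Longrightarrow> x \<in> A \<Longrightarrow> y x \<noteq> 0"
  by (auto simp: cstar_power_def cstar_group_def PiE_iff)

lemma keys_add_subset:
  "Poly_Mapping.keys c \<subseteq> A \<Longrightarrow> Poly_Mapping.keys c' \<subseteq> A \<Longrightarrow> Poly_Mapping.keys (c + c') \<subseteq> A"
  using keys_add[of c c'] by blast

lemma keys_diff_subset:
  "Poly_Mapping.keys c \<subseteq> A \<Longrightarrow> Poly_Mapping.keys c' \<subseteq> A \<Longrightarrow> Poly_Mapping.keys (c - c') \<subseteq> A"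
  for c c' :: "'x \<Rightarrow>\<^sub>0 'b::ab_group_add"
  using keys_diff[of c c'] by blast

lemma y_power_0 [simp]: "y_power y 0 = 1"
  by (simp add: y_power_def)

lemma y_power_nonzero:
  assumes "y \<in> carrier (cstar_power A)" "Poly_Mapping.keys c \<subseteq> A"
  shows "y_power y c \<noteq> 0"
  unfolding y_power_def using cstar_power_nonzero[OF assms(1)] assms(2) by auto

lemma y_power_add:
  assumes "finite A" "y \<in> carrier (cstar_power A)" "Poly_Mapping.keys c \<subseteq> A" "Poly_Mapping.keys c' \<subseteq> A"
  shows "y_power y (c + c') = y_power y c * y_power y c'"
proof -
  have "y_power y (c + c') = (\<Prod>x\<in>A. y x powi (Poly_Mapping.lookup c x + Poly_Mapping.lookup c' x))"
    using y_power_prod[OF assms(1) keys_add_subset[OF assms(3,4)], of y] by (simp add: lookup_add)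
  also have "\<dots> = (\<Prod>x\<in>A. y x powi Poly_Mapping.lookup c x * y x powi Poly_Mapping.lookup c' x)"
    by (rule prod.cong) (use cstar_power_nonzero[OF assms(2)] in \<open>auto simp: power_int_add\<close>)
  finally show ?thesis
    using y_power_prod[OF assms(1,3)] y_power_prod[OF assms(1,4)] by (simp add: prod.distrib)
qed

lemma y_power_minus:
  assumes "finite A" "y \<in> carrier (cstar_power A)" "Poly_Mapping.keys c \<subseteq> A"
  shows "y_power y (- c) * y_power y c = 1"
  using y_power_add[of A y "- c" c] assms by simp

lemma y_power_diff:
  assumes "finite A" "y \<in> carrier (cstar_power A)" "Poly_Mapping.keys c \<subseteq> A" "Poly_Mapping.keys c' \<subseteq> A"
  shows "y_power y (c - c') * y_power y c' = y_power y c"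
  using y_power_add[of A y "c - c'" c'] keys_diff_subset[of c A c'] assms by simp

lemma y_eval_sum:
  assumes "finite S" "Poly_Mapping.keys p \<subseteq> S"
  shows "y_eval p y = (\<Sum>c\<in>S. Poly_Mapping.lookup p c * y_power y c)"
  unfolding y_eval_def by (rule sum.mono_neutral_left) (use assms in \<open>auto simp: in_keys_iff\<close>)

lemma y_eval_add: "y_eval (p + p') y = y_eval p y + y_eval p' y"
proof -
  let ?S = "Poly_Mapping.keys p \<union> Poly_Mapping.keys p'"
  have "y_eval (p + p') y = (\<Sum>c\<in>?S. Poly_Mapping.lookup (p + p') c * y_power y c)"
    by (rule y_eval_sum) (auto dest: keys_add[THEN subsetD])
  moreover have "y_eval p y = (\<Sum>c\<in>?S. Poly_Mapping.lookup p c * y_power y c)"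
    "y_eval p' y = (\<Sum>c\<in>?S. Poly_Mapping.lookup p' c * y_power y c)"
    by (auto intro!: y_eval_sum)
  ultimately show ?thesis
    by (simp add: lookup_add algebra_simps sum.distrib)
qed

lemma y_eval_0 [simp]: "y_eval 0 y = 0"
  by (simp add: y_eval_def)

lemma y_eval_uminus: "y_eval (- p) y = - y_eval p y"
  using y_eval_add[of p "- p" y] by (simp add: add_eq_0_iff)

lemma y_eval_diff: "y_eval (p - p') y = y_eval p y - y_eval p' y"
  using y_eval_add[of p "- p'" y] by (simp add: y_eval_uminus)

lemma y_eval_setsum: "y_eval (\<Sum>i\<in>S. f i) y = (\<Sum>i\<in>S. y_eval (f i) y)"
  by (induction S rule: infinite_finite_induct) (auto simp: y_eval_add)

lemma y_eval_single: "y_eval (Poly_Mapping.single c a) y = a * y_power y c"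
  by (simp add: y_eval_def)

lemma sum_of_monomials: "p = (\<Sum>c\<in>Poly_Mapping.keys p. Poly_Mapping.single c (Poly_Mapping.lookup p c))"
proof (rule poly_mapping_eqI)
  fix c
  have "Poly_Mapping.lookup (\<Sum>c\<in>Poly_Mapping.keys p. Poly_Mapping.single c (Poly_Mapping.lookup p c)) c
      = (\<Sum>c'\<in>Poly_Mapping.keys p. if c' = c then Poly_Mapping.lookup p c else 0)"
    unfolding lookup_sum by (rule sum.cong) (auto simp: lookup_single when_def)
  then show "Poly_Mapping.lookup p c
      = Poly_Mapping.lookup (\<Sum>c\<in>Poly_Mapping.keys p. Poly_Mapping.single c (Poly_Mapping.lookup p c)) c"
    by (simp add: in_keys_iff)
qed

lemma y_eval_mult:
  assumes "finite A" "y \<in> carrier (cstar_power A)" "p \<in> laurent_polys A" "p' \<in> laurent_polys A"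
  shows "y_eval (p * p') y = y_eval p y * y_eval p' y"
proof -
  let ?s = "\<lambda>p c. Poly_Mapping.single c (Poly_Mapping.lookup p c)"
  have "p * p' = (\<Sum>c\<in>Poly_Mapping.keys p. \<Sum>c'\<in>Poly_Mapping.keys p'. ?s p c * ?s p' c')"
    unfolding sum_product[symmetric] by (rule arg_cong2[OF sum_of_monomials sum_of_monomials])
  then have "y_eval (p * p') y = (\<Sum>c\<in>Poly_Mapping.keys p. \<Sum>c'\<in>Poly_Mapping.keys p'.
      Poly_Mapping.lookup p c * Poly_Mapping.lookup p' c' * y_power y (c + c'))"
    by (simp add: y_eval_setsum mult_single y_eval_single)
  also have "\<dots> = (\<Sum>c\<in>Poly_Mapping.keys p. \<Sum>c'\<in>Poly_Mapping.keys p'.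
      (Poly_Mapping.lookup p c * y_power y c) * (Poly_Mapping.lookup p' c' * y_power y c'))"
  proof (intro sum.cong refl)
    fix c c' assume "c \<in> Poly_Mapping.keys p" "c' \<in> Poly_Mapping.keys p'"
    then have "y_power y (c + c') = y_power y c * y_power y c'"
      using assms by (intro y_power_add) (auto simp: laurent_polys_def)
    then show "Poly_Mapping.lookup p c * Poly_Mapping.lookup p' c' * y_power y (c + c')
        = (Poly_Mapping.lookup p c * y_power y c) * (Poly_Mapping.lookup p' c' * y_power y c')"
      by simp
  qed
  also have "\<dots> = y_eval p y * y_eval p' y"
    by (simp add: y_eval_def sum_product)
  finally show ?thesis .
qed

lemma laurent_polys_0: "0 \<in> laurent_polys A"
  and laurent_polys_1: "1 \<in> laurent_polys A"
  by (auto simp: laurent_polys_def)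

lemma laurent_polys_add: "p \<in> laurent_polys A \<Longrightarrow> p' \<in> laurent_polys A \<Longrightarrow> p + p' \<in> laurent_polys A"
  by (auto simp: laurent_polys_def dest: keys_add[THEN subsetD])

lemma laurent_polys_uminus: "p \<in> laurent_polys A \<Longrightarrow> - p \<in> laurent_polys A"
  by (auto simp: laurent_polys_def in_keys_iff)

lemma laurent_polys_mult: "p \<in> laurent_polys A \<Longrightarrow> p' \<in> laurent_polys A \<Longrightarrow> p * p' \<in> laurent_polys A"
proof -
  assume p: "p \<in> laurent_polys A" "p' \<in> laurent_polys A"
  show "p * p' \<in> laurent_polys A"
    unfolding laurent_polys_def
  proof safe
    fix c x assume "c \<in> Poly_Mapping.keys (p * p')" "x \<in> Poly_Mapping.keys c"
    moreover obtain a b where "c = a + b" "a \<in> Poly_Mapping.keys p" "b \<in> Poly_Mapping.keys p'"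
      using keys_mult[of p p'] \<open>c \<in> _\<close> by blast
    ultimately show "x \<in> A"
      using p keys_add_subset[of a A b] by (auto simp: laurent_polys_def)
  qed
qed

lemma laurent_polys_single: "Poly_Mapping.keys c \<subseteq> A \<Longrightarrow> Poly_Mapping.single c b \<in> laurent_polys A"
  by (auto simp: laurent_polys_def)

lemma laurent_ring_simps [simp]:
  "carrier (laurent_ring A) = laurent_polys A" "p \<otimes>\<^bsub>laurent_ring A\<^esub> p' = p * p'"
  "\<one>\<^bsub>laurent_ring A\<^esub> = 1" "\<zero>\<^bsub>laurent_ring A\<^esub> = 0" "p \<oplus>\<^bsub>laurent_ring A\<^esub> p' = p + p'"
  by (simp_all add: laurent_ring_def)

lemma cring_laurent_ring: "cring (laurent_ring A)"
proof (rule cringI)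
  show "abelian_group (laurent_ring A)"
  proof (rule abelian_groupI)
    fix p assume "p \<in> carrier (laurent_ring A)"
    then show "\<exists>p'\<in>carrier (laurent_ring A). p' \<oplus>\<^bsub>laurent_ring A\<^esub> p = \<zero>\<^bsub>laurent_ring A\<^esub>"
      by (intro bexI[of _ "- p"]) (auto intro: laurent_polys_uminus)
  qed (auto simp: add_ac intro: laurent_polys_0 laurent_polys_add)
  show "comm_monoid (laurent_ring A)"
    by (rule comm_monoidI) (auto simp: mult_ac intro: laurent_polys_1 laurent_polys_mult)
qed (auto simp: distrib_right)

lemma vanishing_ideal_ideal:
  assumes "finite A" "Z \<subseteq> carrier (cstar_power A)"
  shows "ideal (vanishing_ideal A Z) (laurent_ring A)"
proof -
  interpret cring "laurent_ring A" by (rule cring_laurent_ring)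
  have minus: "\<ominus>\<^bsub>laurent_ring A\<^esub> p = - p" if "p \<in> laurent_polys A" for p
    using that by (intro minus_equality) (auto intro: laurent_polys_uminus)
  have sub: "subgroup (vanishing_ideal A Z) (add_monoid (laurent_ring A))"
  proof (rule add.subgroupI)
    have "0 \<in> vanishing_ideal A Z"
      by (simp add: vanishing_ideal_def laurent_polys_0)
    then show "vanishing_ideal A Z \<noteq> {}"
      by blast
  qed (auto simp: vanishing_ideal_def y_eval_add laurent_polys_add minus y_eval_uminus laurent_polys_uminus)
  have "p' * p \<in> vanishing_ideal A Z" if p: "p \<in> vanishing_ideal A Z" "p' \<in> laurent_polys A" for p p'
  proof -
    have "y_eval (p' * p) y = 0" if "y \<in> Z" for y
      using p that assms(2) y_eval_mult[OF assms(1), of y p' p] by (auto simp: vanishing_ideal_def)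
    then show ?thesis
      using p by (simp add: vanishing_ideal_def laurent_polys_mult)
  qed
  then show ?thesis
    by (intro idealI ring_axioms sub) (simp_all add: mult.commute)
qed

subsection \<open>Binomials\<close>

lemma lookup_pos_part: "Poly_Mapping.lookup (Poly_Mapping.map (\<lambda>n. max n 0) c) x = max (Poly_Mapping.lookup c x) (0::int)"
  by (simp add: map.rep_eq when_def)

lemma lookup_neg_part: "Poly_Mapping.lookup (Poly_Mapping.map (\<lambda>n. max (- n) 0) c) x = max (- Poly_Mapping.lookup c x) (0::int)"
  by (simp add: map.rep_eq when_def)

lemma pos_minus_neg_part:
  "c + Poly_Mapping.map (\<lambda>n. max (- n) 0) c = Poly_Mapping.map (\<lambda>n. max n 0) (c :: 'x \<Rightarrow>\<^sub>0 int)"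
  by (rule poly_mapping_eqI) (simp add: lookup_add lookup_pos_part lookup_neg_part)

lemma keys_neg_part: "Poly_Mapping.keys (Poly_Mapping.map (\<lambda>n. max (- n) 0) (c :: 'x \<Rightarrow>\<^sub>0 int)) \<subseteq> Poly_Mapping.keys c"
  by (auto simp: in_keys_iff lookup_neg_part)

text \<open>Up to the unit \<open>y\<^sup>c\<^sup>-\<close>, the binomial of \<open>c\<close> is \<open>y\<^sup>c - a\<^sup>c\<close>.\<close>

lemma lattice_binomial_factor:
  "lattice_binomial a c = Poly_Mapping.single (Poly_Mapping.map (\<lambda>n. max (- n) 0) c) 1
     * (Poly_Mapping.single c 1 - Poly_Mapping.single 0 (y_power a c))"
  by (simp add: lattice_binomial_def right_diff_distrib mult_single pos_minus_neg_part add.commute)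

lemma lattice_binomial_laurent: "Poly_Mapping.keys c \<subseteq> A \<Longrightarrow> lattice_binomial a c \<in> laurent_polys A"
  unfolding lattice_binomial_factor diff_conv_add_uminus using keys_neg_part[of c]
  by (intro laurent_polys_mult laurent_polys_add laurent_polys_uminus laurent_polys_single) auto

lemma y_eval_lattice_binomial:
  assumes "finite A" "y \<in> carrier (cstar_power A)" "Poly_Mapping.keys c \<subseteq> A"
  shows "y_eval (lattice_binomial a c) y = 0 \<longleftrightarrow> y_power y c = y_power a c"
proof -
  let ?n = "Poly_Mapping.map (\<lambda>n. max (- n) 0) c"
  have n: "Poly_Mapping.keys ?n \<subseteq> A"
    using keys_neg_part[of c] assms(3) by blast
  have "y_eval (lattice_binomial a c) y = y_power y (c + ?n) - y_power a c * y_power y ?n"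
    by (simp add: lattice_binomial_def y_eval_diff y_eval_single pos_minus_neg_part)
  also have "\<dots> = (y_power y c - y_power a c) * y_power y ?n"
    using y_power_add[OF assms n] by (simp add: left_diff_distrib)
  finally show ?thesis
    using y_power_nonzero[OF assms(2) n] by simp
qed

lemma binomial_torus_zero_locus:
  assumes "finite A"
  shows "binomial_torus A a = zero_locus A (lattice_binomial a ` relation_lattice A)"
  unfolding binomial_torus_def zero_locus_def
  using y_eval_lattice_binomial[OF assms] by (auto simp: relation_lattice_def)

subsection \<open>Polynomials vanishing on a translate of the compact torus\<close>

definition exponent_sum :: "(int^'l) set \<Rightarrow> ((int^'l) \<Rightarrow>\<^sub>0 int) \<Rightarrow> int^'l" where
  "exponent_sum A c = (\<Sum>\<alpha>\<in>A. Poly_Mapping.lookup c \<alpha> *s \<alpha>)"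

lemma exponent_sum_diff: "exponent_sum A (c - c') = exponent_sum A c - exponent_sum A c'"
  by (simp add: exponent_sum_def lookup_minus zmod.scale_left_diff_distrib sum_subtractf)

lemma relation_lattice_iff: "c \<in> relation_lattice A \<longleftrightarrow> Poly_Mapping.keys c \<subseteq> A \<and> exponent_sum A c = 0"
  by (simp add: relation_lattice_def exponent_sum_def)

lemma y_power_character:
  fixes A :: "(int^'l::finite) set" and \<theta> :: "real^'l"
  assumes "finite A" "Poly_Mapping.keys c \<subseteq> A"
  shows "y_power (\<lambda>\<alpha>\<in>A. a \<alpha> * cis (cast_vec \<alpha> \<bullet> \<theta>)) c = y_power a c * cis (cast_vec (exponent_sum A c) \<bullet> \<theta>)"
proof -
  have "cast_vec (exponent_sum A c) \<bullet> \<theta> = (\<Sum>\<alpha>\<in>A. of_int (Poly_Mapping.lookup c \<alpha>) * (cast_vec \<alpha> \<bullet> \<theta>))"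
    by (simp add: exponent_sum_def cast_vec_sum cast_vec_scale inner_sum_left scalar_mult_eq_scaleR)
  then have "cis (cast_vec (exponent_sum A c) \<bullet> \<theta>) = (\<Prod>\<alpha>\<in>A. cis (cast_vec \<alpha> \<bullet> \<theta>) powi Poly_Mapping.lookup c \<alpha>)"
    by (simp add: cis_sum cis_power_int)
  then show ?thesis
    unfolding y_power_prod[OF assms] by (simp add: power_int_mult_distrib prod.distrib)
qed

text \<open>
  On the translated compact torus, \<open>y\<^sup>c\<close> restricts to a multiple of the character \<open>exponent_sum A c\<close>.
  By independence of characters, a polynomial vanishes there iff the coefficients along every fibre
  of \<open>exponent_sum A\<close>, weighted by \<open>a\<^sup>c\<close>, add up to zero.
\<close>

lemma fibre_sum_zero:
  fixes A :: "(int^'l::finite) set"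
  assumes "finite A" "p \<in> laurent_polys A"
    and "\<And>\<theta> :: real^'l. y_eval p (\<lambda>\<alpha>\<in>A. a \<alpha> * cis (cast_vec \<alpha> \<bullet> \<theta>)) = 0"
  shows "(\<Sum>c | c \<in> Poly_Mapping.keys p \<and> exponent_sum A c = \<beta>. Poly_Mapping.lookup p c * y_power a c) = 0"
proof -
  let ?S = "Poly_Mapping.keys p" and ?f = "\<lambda>c. Poly_Mapping.lookup p c * y_power a c"
  define r where "r \<beta> = (\<Sum>c | c \<in> ?S \<and> exponent_sum A c = \<beta>. ?f c)" for \<beta>
  have zero: "(\<Sum>\<beta>\<in>exponent_sum A ` ?S. r \<beta> * cis (cast_vec \<beta> \<bullet> \<theta>)) = 0" for \<theta> :: "real^'l"
  proof -
    have "0 = (\<Sum>c\<in>?S. ?f c * cis (cast_vec (exponent_sum A c) \<bullet> \<theta>))"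
      using assms(3)[of \<theta>] assms(2) unfolding y_eval_def
      by (simp add: laurent_polys_def y_power_character[OF assms(1)] mult.assoc)
    also have "\<dots> = (\<Sum>\<beta>\<in>exponent_sum A ` ?S. \<Sum>c | c \<in> ?S \<and> exponent_sum A c = \<beta>.
        ?f c * cis (cast_vec (exponent_sum A c) \<bullet> \<theta>))"
      by (rule sum.image_gen) simp
    also have "\<dots> = (\<Sum>\<beta>\<in>exponent_sum A ` ?S. r \<beta> * cis (cast_vec \<beta> \<bullet> \<theta>))"
      unfolding r_def sum_distrib_right by (intro sum.cong) auto
    finally show ?thesis ..
  qed
  have "r \<beta> = 0" if "\<beta> \<in> exponent_sum A ` ?S"
    by (rule characters_independent[of "exponent_sum A ` ?S" r, OF _ zero that]) simp
  moreover have "r \<beta> = 0" if "\<beta> \<notin> exponent_sum A ` ?S"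
  proof -
    have "{c. c \<in> ?S \<and> exponent_sum A c = \<beta>} = {}"
      using that by auto
    show ?thesis
      unfolding r_def \<open>_ = {}\<close> by simp
  qed
  ultimately show ?thesis
    unfolding r_def by blast
qed

text \<open>
  At a point \<open>y\<close> of the binomial torus, \<open>y\<^sup>c / a\<^sup>c\<close> is constant along the fibres of \<open>exponent_sum A\<close>,
  because two exponents in a fibre differ by a relation.  So the weighted coefficient sums of
  \<open>fibre_sum_zero\<close> control the value at \<open>y\<close>.
\<close>

lemma y_eval_binomial_torus:
  fixes A :: "(int^'l::finite) set"
  assumes A: "finite A" and p: "p \<in> laurent_polys A" and a: "a \<in> carrier (cstar_power A)"
    and van: "\<And>\<theta> :: real^'l. y_eval p (\<lambda>\<alpha>\<in>A. a \<alpha> * cis (cast_vec \<alpha> \<bullet> \<theta>)) = 0"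
    and y: "y \<in> binomial_torus A a"
  shows "y_eval p y = 0"
proof -
  let ?S = "Poly_Mapping.keys p" and ?f = "\<lambda>c. Poly_Mapping.lookup p c * y_power a c"
  have yc: "y \<in> carrier (cstar_power A)" and rel: "\<And>c. c \<in> relation_lattice A \<Longrightarrow> y_power y c = y_power a c"
    using y by (auto simp: binomial_torus_def)
  have keys: "Poly_Mapping.keys c \<subseteq> A" if "c \<in> ?S" for c
    using p that by (auto simp: laurent_polys_def)
  define z where "z c = y_power y c / y_power a c" for c
  have z: "z c = z c'" if "c \<in> ?S" "c' \<in> ?S" "exponent_sum A c = exponent_sum A c'" for c c'
  proof -
    have "c - c' \<in> relation_lattice A"
      using that keys_diff_subset[OF keys keys] by (simp add: relation_lattice_iff exponent_sum_diff)
    then have "y_power y c = y_power a (c - c') * y_power y c'"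
      using y_power_diff[OF A yc keys keys, OF that(1,2)] rel by metis
    moreover have "y_power a c = y_power a (c - c') * y_power a c'"
      using y_power_diff[OF A a keys keys, OF that(1,2)] by simp
    moreover have "y_power a (c - c') \<noteq> 0"
      by (rule y_power_nonzero[OF a keys_diff_subset[OF keys keys]]) (use that in auto)
    ultimately show ?thesis
      by (simp add: z_def)
  qed
  have "y_eval p y = (\<Sum>c\<in>?S. ?f c * z c)"
    unfolding y_eval_def z_def by (rule sum.cong) (use y_power_nonzero[OF a keys] in auto)
  also have "\<dots> = (\<Sum>\<beta>\<in>exponent_sum A ` ?S. \<Sum>c | c \<in> ?S \<and> exponent_sum A c = \<beta>. ?f c * z c)"
    by (rule sum.image_gen) simp
  also have "\<dots> = 0"
  proof (rule sum.neutral, rule ballI)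
    fix \<beta> assume "\<beta> \<in> exponent_sum A ` ?S"
    then obtain c0 where c0: "c0 \<in> ?S" "exponent_sum A c0 = \<beta>"
      by blast
    have "(\<Sum>c | c \<in> ?S \<and> exponent_sum A c = \<beta>. ?f c * z c)
        = (\<Sum>c | c \<in> ?S \<and> exponent_sum A c = \<beta>. ?f c * z c0)"
    proof (intro sum.cong refl)
      fix c assume "c \<in> {c. c \<in> ?S \<and> exponent_sum A c = \<beta>}"
      then have "z c = z c0"
        using c0 by (intro z) auto
      then show "?f c * z c = ?f c * z c0"
        by simp
    qed
    also have "\<dots> = (\<Sum>c | c \<in> ?S \<and> exponent_sum A c = \<beta>. ?f c) * z c0"
      by (simp add: sum_distrib_right)
    also have "\<dots> = 0"
      using fibre_sum_zero[OF A p van] by simp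
    finally show "(\<Sum>c | c \<in> ?S \<and> exponent_sum A c = \<beta>. ?f c * z c) = 0" .
  qed
  finally show ?thesis .
qed

lemma translate_binomial_torus:
  fixes A :: "(int^'l::finite) set" and \<theta> :: "real^'l"
  assumes "finite A" "a \<in> carrier (cstar_power A)"
  shows "(\<lambda>\<alpha>\<in>A. a \<alpha> * cis (cast_vec \<alpha> \<bullet> \<theta>)) \<in> binomial_torus A a"
  unfolding binomial_torus_def
proof (intro CollectI conjI ballI)
  show "(\<lambda>\<alpha>\<in>A. a \<alpha> * cis (cast_vec \<alpha> \<bullet> \<theta>)) \<in> carrier (cstar_power A)"
    using cstar_power_nonzero[OF assms(2)] by (auto simp: cstar_power_def cstar_group_def)
  fix c assume "c \<in> relation_lattice A"
  then show "y_power (\<lambda>\<alpha>\<in>A. a \<alpha> * cis (cast_vec \<alpha> \<bullet> \<theta>)) c = y_power a c"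
    by (simp add: relation_lattice_iff y_power_character[OF assms(1)] cast_vec_0)
qed

lemma zariski_closure_translate:
  fixes A :: "(int^'l::finite) set"
  assumes A: "finite A" and a: "a \<in> carrier (cstar_power A)"
  shows "zariski_closure A (range (\<lambda>\<theta> :: real^'l. \<lambda>\<alpha>\<in>A. a \<alpha> * cis (cast_vec \<alpha> \<bullet> \<theta>))) = binomial_torus A a"
    (is "zariski_closure A ?T = _")
proof
  have "lattice_binomial a ` relation_lattice A \<subseteq> laurent_polys A"
    using lattice_binomial_laurent by (auto simp: relation_lattice_def)
  moreover have "?T \<subseteq> zero_locus A (lattice_binomial a ` relation_lattice A)"
    using translate_binomial_torus[OF A a] by (auto simp: binomial_torus_zero_locus[OF A])
  ultimately show "zariski_closure A ?T \<subseteq> binomial_torus A a"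
    unfolding zariski_closure_def binomial_torus_zero_locus[OF A] by blast
  show "binomial_torus A a \<subseteq> zariski_closure A ?T"
    unfolding zariski_closure_def
  proof (rule Inter_greatest)
    fix X assume "X \<in> {zero_locus A F |F. F \<subseteq> laurent_polys A \<and> ?T \<subseteq> zero_locus A F}"
    then obtain F where F: "X = zero_locus A F" "F \<subseteq> laurent_polys A" "?T \<subseteq> zero_locus A F"
      by blast
    show "binomial_torus A a \<subseteq> X"
    proof
      fix y assume y: "y \<in> binomial_torus A a"
      have "y_eval p y = 0" if "p \<in> F" for p
      proof (rule y_eval_binomial_torus[OF A _ a _ y])
        show "p \<in> laurent_polys A"
          using F(2) that by blast
        show "y_eval p (\<lambda>\<alpha>\<in>A. a \<alpha> * cis (cast_vec \<alpha> \<bullet> \<theta>)) = 0" for \<theta> :: "real^'l"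
          using F(3) that by (auto simp: zero_locus_def)
      qed
      then show "y \<in> X"
        using y by (auto simp: F(1) zero_locus_def binomial_torus_def)
    qed
  qed
qed

text \<open>
  The exponents \<open>c\<close> with \<open>y\<^sup>c \<equiv> a\<^sup>c\<close> modulo an ideal form a group, so a basis of the relation lattice
  suffices.  Modulo these relations every monomial equals a multiple of a fixed one in its fibre.
\<close>

lemma vanishing_ideal_generated:
  fixes A :: "(int^'l::finite) set" and b :: "nat \<Rightarrow> (int^'l) \<Rightarrow>\<^sub>0 int"
  assumes A: "finite A" and a: "a \<in> carrier (cstar_power A)"
    and K: "finite K" and basis: "Z_basis K b (relation_lattice A)"
  shows "vanishing_ideal A (binomial_torus A a) = Idl\<^bsub>laurent_ring A\<^esub> ((\<lambda>k. lattice_binomial a (b k)) ` K)"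
proof
  have img: "(\<lambda>n. \<Sum>k\<in>K. frag_cmul (n k) (b k)) ` (K \<rightarrow>\<^sub>E UNIV) = relation_lattice A"
    using basis by (simp add: Z_basis_def bij_betw_def)
  have b_rel: "b k \<in> relation_lattice A" if "k \<in> K" for k
  proof -
    have "(\<Sum>j\<in>K. frag_cmul ((\<lambda>j\<in>K. if j = k then 1 else 0) j) (b j)) \<in> relation_lattice A"
      unfolding img[symmetric] by (rule imageI) (simp add: PiE_iff extensional_def)
    moreover have "(\<Sum>j\<in>K. frag_cmul ((\<lambda>j\<in>K. if j = k then 1 else 0) j) (b j)) = (\<Sum>j\<in>K. if j = k then b k else 0)"
      by (rule sum.cong) auto
    ultimately show ?thesis
      using that K by simp
  qed
  have b_keys: "Poly_Mapping.keys (b k) \<subseteq> A" if "k \<in> K" for k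
    using b_rel[OF that] by (simp add: relation_lattice_def)
  have subT: "binomial_torus A a \<subseteq> carrier (cstar_power A)"
    by (auto simp: binomial_torus_def)
  show "Idl\<^bsub>laurent_ring A\<^esub> ((\<lambda>k. lattice_binomial a (b k)) ` K) \<subseteq> vanishing_ideal A (binomial_torus A a)"
    unfolding genideal_def
  proof (rule Inter_lower, intro CollectI conjI)
    show "ideal (vanishing_ideal A (binomial_torus A a)) (laurent_ring A)"
      by (rule vanishing_ideal_ideal[OF A subT])
    show "(\<lambda>k. lattice_binomial a (b k)) ` K \<subseteq> vanishing_ideal A (binomial_torus A a)"
    proof (rule image_subsetI)
      fix k assume k: "k \<in> K"
      have "y_eval (lattice_binomial a (b k)) y = 0" if "y \<in> binomial_torus A a" for y
        using that b_rel[OF k] y_eval_lattice_binomial[OF A _ b_keys[OF k]] by (auto simp: binomial_torus_def)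
      then show "lattice_binomial a (b k) \<in> vanishing_ideal A (binomial_torus A a)"
        using lattice_binomial_laurent[OF b_keys[OF k]] by (simp add: vanishing_ideal_def)
    qed
  qed
  show "vanishing_ideal A (binomial_torus A a) \<subseteq> Idl\<^bsub>laurent_ring A\<^esub> ((\<lambda>k. lattice_binomial a (b k)) ` K)"
    unfolding genideal_def
  proof (intro Inter_greatest subsetI)
    fix N p
    assume "N \<in> {N. ideal N (laurent_ring A) \<and> (\<lambda>k. lattice_binomial a (b k)) ` K \<subseteq> N}"
      and pv: "p \<in> vanishing_ideal A (binomial_torus A a)"
    then have N: "ideal N (laurent_ring A)" and gen: "\<And>k. k \<in> K \<Longrightarrow> lattice_binomial a (b k) \<in> N"
      by auto
    interpret ideal N "laurent_ring A" by (rule N)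
    have Nadd: "f + g \<in> N" if "f \<in> N" "g \<in> N" for f g
      using additive_subgroup.a_closed[OF is_additive_subgroup that] by simp
    have N0: "0 \<in> N"
      using additive_subgroup.zero_closed[OF is_additive_subgroup] by simp
    have Nmult: "g * f \<in> N" if "f \<in> N" "g \<in> laurent_polys A" for f g
      using I_l_closed[of f g] that by simp
    have Nsum: "(\<Sum>i\<in>S. f i) \<in> N" if "\<And>i. i \<in> S \<Longrightarrow> f i \<in> N" for S and f :: "'i \<Rightarrow> _"
      using that by (induction S rule: infinite_finite_induct) (auto simp: N0 Nadd)
    \<comment> \<open>\<open>G\<close> consists of the exponents with \<open>y\<^sup>c \<equiv> a\<^sup>c\<close> modulo \<open>N\<close>; it is a group containing the \<open>b k\<close>.\<close>
    define B where "B c = Poly_Mapping.single c (1::complex) - Poly_Mapping.single 0 (y_power a c)" for c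
    define G where "G = {c. Poly_Mapping.keys c \<subseteq> A \<and> B c \<in> N}"
    have G_add: "c + c' \<in> G" if "c \<in> G" "c' \<in> G" for c c'
    proof -
      have c: "Poly_Mapping.keys c \<subseteq> A" "Poly_Mapping.keys c' \<subseteq> A"
        using that by (auto simp: G_def)
      have "B (c + c') = Poly_Mapping.single c 1 * B c' + Poly_Mapping.single 0 (y_power a c') * B c"
        unfolding B_def y_power_add[OF A a c] by (simp add: right_diff_distrib mult_single ac_simps)
      then have "B (c + c') \<in> N"
        using that c unfolding G_def by (auto intro!: Nadd Nmult laurent_polys_single)
      then show ?thesis
        using keys_add_subset[OF c] by (simp add: G_def)
    qed
    have G_0: "0 \<in> G"
      by (simp add: G_def B_def N0)
    have G_uminus: "- c \<in> G" if "c \<in> G" for c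
    proof -
      have c: "Poly_Mapping.keys c \<subseteq> A"
        using that by (auto simp: G_def)
      have "B (- c) = Poly_Mapping.single (- c) (- y_power a (- c)) * B c"
        unfolding B_def using y_power_minus[OF A a c]
        by (simp add: right_diff_distrib mult_single single_uminus)
      then have "B (- c) \<in> N"
        using that c unfolding G_def by (auto intro!: Nmult laurent_polys_single)
      then show ?thesis
        using c by (simp add: G_def)
    qed
    have G_cmul: "frag_cmul m c \<in> G" if "c \<in> G" for c and m :: int
    proof (induction m rule: int_induct[where k = 0])
      case base
      then show ?case
        using G_0 by simp
    next
      case (step1 m)
      have "frag_cmul (m + 1) c = frag_cmul m c + c"
        by (rule poly_mapping_eqI) (simp add: lookup_add algebra_simps)
      then show ?case
        using step1 G_add that by simp
    next
      case (step2 m)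
      have "frag_cmul (m - 1) c = frag_cmul m c + - c"
        by (rule poly_mapping_eqI) (simp add: lookup_minus algebra_simps)
      then show ?case
        using G_add[OF step2(2) G_uminus[OF that]] by simp
    qed
    have G_sum: "(\<Sum>i\<in>S. f i) \<in> G" if "\<And>i. i \<in> S \<Longrightarrow> f i \<in> G" for S and f :: "'i \<Rightarrow> _"
      using that by (induction S rule: infinite_finite_induct) (auto simp: G_0 G_add)
    have G_b: "b k \<in> G" if k: "k \<in> K" for k
    proof -
      let ?n = "Poly_Mapping.map (\<lambda>n. max (- n) 0) (b k)"
      have n: "Poly_Mapping.keys (- ?n) \<subseteq> A"
        using keys_neg_part[of "b k"] b_keys[OF k] by simp
      have "Poly_Mapping.single (- ?n) 1 * lattice_binomial a (b k) = B (b k)"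
        unfolding lattice_binomial_factor B_def mult.assoc[symmetric] by (simp add: mult_single)
      then have "B (b k) \<in> N"
        using Nmult[OF gen[OF k] laurent_polys_single[OF n, of 1]] by simp
      then show ?thesis
        using b_keys[OF k] by (simp add: G_def)
    qed
    have G_rel: "c \<in> G" if "c \<in> relation_lattice A" for c
    proof -
      have "c \<in> (\<lambda>n. \<Sum>k\<in>K. frag_cmul (n k) (b k)) ` (K \<rightarrow>\<^sub>E UNIV)"
        using that img by simp
      then obtain n where "c = (\<Sum>k\<in>K. frag_cmul (n k) (b k))"
        by blast
      then show ?thesis
        using G_sum[of K] G_cmul G_b by simp
    qed
    let ?S = "Poly_Mapping.keys p" and ?l = "Poly_Mapping.lookup p"
    have p: "p \<in> laurent_polys A"
      using pv by (simp add: vanishing_ideal_def)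
    have keys: "Poly_Mapping.keys c \<subseteq> A" if "c \<in> ?S" for c
      using p that by (auto simp: laurent_polys_def)
    have van: "y_eval p (\<lambda>\<alpha>\<in>A. a \<alpha> * cis (cast_vec \<alpha> \<bullet> \<theta>)) = 0" for \<theta> :: "real^'l"
      using pv translate_binomial_torus[OF A a] by (auto simp: vanishing_ideal_def)
    \<comment> \<open>Choose an exponent \<open>\<rho> \<beta>\<close> in each fibre and rewrite the monomials of the fibre in terms of it.\<close>
    define \<rho> where "\<rho> \<beta> = (SOME c. c \<in> ?S \<and> exponent_sum A c = \<beta>)" for \<beta>
    define c0 where "c0 c = \<rho> (exponent_sum A c)" for c
    have \<rho>: "\<rho> \<beta> \<in> ?S \<and> exponent_sum A (\<rho> \<beta>) = \<beta>" if "\<beta> \<in> exponent_sum A ` ?S" for \<beta>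
      unfolding \<rho>_def by (rule someI_ex) (use that in blast)
    then have c0: "c0 c \<in> ?S" "exponent_sum A (c0 c) = exponent_sum A c" if "c \<in> ?S" for c
      using that by (auto simp: c0_def)
    have step: "Poly_Mapping.single c (?l c) = Poly_Mapping.single (c0 c) (?l c) * B (c - c0 c)
        + Poly_Mapping.single (c0 c) (?l c * y_power a (c - c0 c))" for c
      by (simp add: B_def right_diff_distrib mult_single)
    have "p = (\<Sum>c\<in>?S. Poly_Mapping.single (c0 c) (?l c) * B (c - c0 c))
        + (\<Sum>c\<in>?S. Poly_Mapping.single (c0 c) (?l c * y_power a (c - c0 c)))"
      using sum_of_monomials[of p] step by (simp add: sum.distrib)
    moreover have "(\<Sum>c\<in>?S. Poly_Mapping.single (c0 c) (?l c) * B (c - c0 c)) \<in> N"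
    proof (rule Nsum, rule Nmult)
      fix c assume c: "c \<in> ?S"
      have "c - c0 c \<in> relation_lattice A"
        using c0[OF c] keys_diff_subset[OF keys keys, OF c c0(1)[OF c]]
        by (simp add: relation_lattice_iff exponent_sum_diff)
      then show "B (c - c0 c) \<in> N"
        using G_rel by (auto simp: G_def)
      show "Poly_Mapping.single (c0 c) (?l c) \<in> laurent_polys A"
        by (rule laurent_polys_single[OF keys[OF c0(1)[OF c]]])
    qed
    moreover have "(\<Sum>c\<in>?S. Poly_Mapping.single (c0 c) (?l c * y_power a (c - c0 c))) = 0"
    proof -
      have "(\<Sum>c\<in>?S. Poly_Mapping.single (c0 c) (?l c * y_power a (c - c0 c)))
          = (\<Sum>\<beta>\<in>exponent_sum A ` ?S. \<Sum>c | c \<in> ?S \<and> exponent_sum A c = \<beta>.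
              Poly_Mapping.single (c0 c) (?l c * y_power a (c - c0 c)))"
        by (rule sum.image_gen) simp
      also have "\<dots> = 0"
      proof (rule sum.neutral, rule ballI)
        fix \<beta> assume \<beta>: "\<beta> \<in> exponent_sum A ` ?S"
        let ?F = "{c. c \<in> ?S \<and> exponent_sum A c = \<beta>}"
        have \<rho>k: "Poly_Mapping.keys (\<rho> \<beta>) \<subseteq> A"
          using \<rho>[OF \<beta>] keys by blast
        have "(\<Sum>c\<in>?F. Poly_Mapping.single (c0 c) (?l c * y_power a (c - c0 c)))
            = (\<Sum>c\<in>?F. Poly_Mapping.single (\<rho> \<beta>) (?l c * y_power a c * inverse (y_power a (\<rho> \<beta>))))"
        proof (intro sum.cong refl)
          fix c assume c: "c \<in> ?F"
          have "y_power a (c - \<rho> \<beta>) * y_power a (\<rho> \<beta>) = y_power a c"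
            by (rule y_power_diff[OF A a _ \<rho>k]) (use c keys in auto)
          then have "y_power a (c - \<rho> \<beta>) = y_power a c * inverse (y_power a (\<rho> \<beta>))"
            using y_power_nonzero[OF a \<rho>k] by (simp add: field_simps)
          then show "Poly_Mapping.single (c0 c) (?l c * y_power a (c - c0 c))
              = Poly_Mapping.single (\<rho> \<beta>) (?l c * y_power a c * inverse (y_power a (\<rho> \<beta>)))"
            using c by (simp add: c0_def mult.assoc)
        qed
        also have "\<dots> = Poly_Mapping.single (\<rho> \<beta>) (\<Sum>c\<in>?F. ?l c * y_power a c * inverse (y_power a (\<rho> \<beta>)))"
          by (induction rule: infinite_finite_induct) (auto simp: single_add)
        also have "(\<Sum>c\<in>?F. ?l c * y_power a c * inverse (y_power a (\<rho> \<beta>))) = 0"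
          using fibre_sum_zero[OF A p van, of \<beta>] by (simp add: sum_distrib_right[symmetric])
        finally show "(\<Sum>c\<in>?F. Poly_Mapping.single (c0 c) (?l c * y_power a (c - c0 c))) = 0"
          by simp
      qed
      finally show ?thesis .
    qed
    ultimately show "p \<in> N"
      by simp
  qed
qed

section \<open>Smith reductions\<close>

lemma index_mult_mat_sum:
  assumes "A \<in> carrier_mat n m" "B \<in> carrier_mat m p" "i < n" "j < p"
  shows "(A * B) $$ (i, j) = (\<Sum>k<m. A $$ (i, k) * B $$ (k, j))"
  using assms by (simp add: scalar_prod_def atLeast0LessThan)

text \<open>
  A determinant \<open>\<plusminus>1\<close> is its own inverse, so the inverse matrix is \<open>det U\<close> times the adjugate.
\<close>

lemma unimodular_inverse:
  assumes "unimodular n U"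
  obtains V where "V \<in> carrier_mat n n" "U * V = 1\<^sub>m n" "V * U = 1\<^sub>m n"
proof -
  have U: "U \<in> carrier_mat n n" and d: "det U * det U = 1"
    using assms by (auto simp: unimodular_def)
  define V where "V = det U \<cdot>\<^sub>m adj_mat U"
  have V: "V \<in> carrier_mat n n"
    using adj_mat(1)[OF U] by (simp add: V_def)
  have "U * V = det U \<cdot>\<^sub>m (det U \<cdot>\<^sub>m 1\<^sub>m n)"
    unfolding V_def mult_smult_distrib[OF U adj_mat(1)[OF U]] adj_mat(2)[OF U] ..
  moreover have "V * U = det U \<cdot>\<^sub>m (det U \<cdot>\<^sub>m 1\<^sub>m n)"
    unfolding V_def mult_smult_assoc_mat[OF adj_mat(1)[OF U] U] adj_mat(3)[OF U] ..
  moreover have "det U \<cdot>\<^sub>m (det U \<cdot>\<^sub>m 1\<^sub>m n) = 1\<^sub>m n"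
    by (rule eq_matI) (use d in auto)
  ultimately show thesis
    using that V by metis
qed

text \<open>
  With the inverses \<open>V\<close> of \<open>U\<close> and \<open>W'\<close> of \<open>W\<close>, the reduction \<open>U M W = D\<close> splits into \<open>U M = D W'\<close>, on the
  coordinates of the exponents, and \<open>M W = V D\<close>, on combinations of the exponents.
\<close>

locale smith_exponents =
  fixes I :: "'l::finite set" and A :: "(int^'l) set" and row_ix :: "nat \<Rightarrow> 'l" and col_ix :: "nat \<Rightarrow> int^'l"
    and U V W W' :: "int mat" and q :: nat and d :: "nat \<Rightarrow> nat"
  assumes A_sub: "A \<subseteq> Zpow I" and finA: "finite A"
    and row: "bij_betw row_ix {..<card I} I" and col: "bij_betw col_ix {..<card A} A"
    and smith: "smith_reduction (exponent_matrix row_ix col_ix I A) U W q d"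
    and V: "V \<in> carrier_mat (card I) (card I)" "U * V = 1\<^sub>m (card I)" "V * U = 1\<^sub>m (card I)"
    and W': "W' \<in> carrier_mat (card A) (card A)" "W * W' = 1\<^sub>m (card A)" "W' * W = 1\<^sub>m (card A)"
begin

abbreviation "n \<equiv> card I"
abbreviation "N \<equiv> card A"
abbreviation "M \<equiv> exponent_matrix row_ix col_ix I A"

lemma M: "M \<in> carrier_mat n N" and M_index: "i < n \<Longrightarrow> j < N \<Longrightarrow> M $$ (i, j) = col_ix j $ row_ix i"
  by (simp_all add: exponent_matrix_def)

lemma U: "U \<in> carrier_mat n n" and W: "W \<in> carrier_mat N N" and q_le: "q \<le> n" "q \<le> N"
  and d_pos: "k < q \<Longrightarrow> d k > 0"
  using smith M by (auto simp: smith_reduction_def unimodular_def)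

definition D :: "int mat" where
  "D = Matrix.mat n N (\<lambda>(i, j). if i = j \<and> i < q then int (d i) else 0)"

lemma D: "D \<in> carrier_mat n N" and UMW: "U * M * W = D"
  using smith M by (simp_all add: D_def smith_reduction_def)

lemma UM: "U * M = D * W'"
proof -
  have "D * W' = U * M * (W * W')"
    unfolding UMW[symmetric] by (rule assoc_mult_mat) (use U M W W' in auto)
  also have "\<dots> = U * M"
    unfolding W'(2) using U M by (intro right_mult_one_mat) auto
  finally show ?thesis ..
qed

lemma MW: "M * W = V * D"
proof -
  have "V * D = V * (U * (M * W))"
    unfolding UMW[symmetric] using assoc_mult_mat[OF U M W] by simp
  also have "\<dots> = V * U * (M * W)"
    using assoc_mult_mat[OF V(1) U, of "M * W" N] M W by simp
  also have "\<dots> = M * W"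
    unfolding V(3) using M W by (intro left_mult_one_mat) auto
  finally show ?thesis ..
qed

lemma UM_index: "k < n \<Longrightarrow> j < N \<Longrightarrow>
    (\<Sum>i<n. U $$ (k, i) * col_ix j $ row_ix i) = (if k < q then int (d k) * W' $$ (k, j) else 0)"
proof -
  assume k: "k < n" and j: "j < N"
  have "(\<Sum>i<n. U $$ (k, i) * col_ix j $ row_ix i) = (U * M) $$ (k, j)"
    using index_mult_mat_sum[OF U M k j] M_index j by simp
  also have "\<dots> = (\<Sum>i<N. D $$ (k, i) * W' $$ (i, j))"
    unfolding UM by (rule index_mult_mat_sum[OF D W'(1) k j])
  also have "\<dots> = (\<Sum>i<N. if i = k then (if k < q then int (d k) * W' $$ (k, j) else 0) else 0)"
    by (rule sum.cong) (use k in \<open>auto simp: D_def\<close>)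
  also have "\<dots> = (if k < q then int (d k) * W' $$ (k, j) else 0)"
    using q_le by auto
  finally show ?thesis .
qed

lemma MW_index: "i < n \<Longrightarrow> k < N \<Longrightarrow>
    (\<Sum>j<N. col_ix j $ row_ix i * W $$ (j, k)) = (if k < q then V $$ (i, k) * int (d k) else 0)"
proof -
  assume i: "i < n" and k: "k < N"
  have "(\<Sum>j<N. col_ix j $ row_ix i * W $$ (j, k)) = (M * W) $$ (i, k)"
    using index_mult_mat_sum[OF M W i k] M_index i by simp
  also have "\<dots> = (\<Sum>j<n. V $$ (i, j) * D $$ (j, k))"
    unfolding MW by (rule index_mult_mat_sum[OF V(1) D i k])
  also have "\<dots> = (\<Sum>j<n. if j = k then (if k < q then V $$ (i, k) * int (d k) else 0) else 0)"
    by (rule sum.cong) (use k in \<open>auto simp: D_def\<close>)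
  also have "\<dots> = (if k < q then V $$ (i, k) * int (d k) else 0)"
    using q_le by auto
  finally show ?thesis .
qed

lemma inverse_index:
  "j < n \<Longrightarrow> k < n \<Longrightarrow> (\<Sum>i<n. U $$ (j, i) * V $$ (i, k)) = (if j = k then 1 else 0)"
  "j < n \<Longrightarrow> k < n \<Longrightarrow> (\<Sum>i<n. V $$ (j, i) * U $$ (i, k)) = (if j = k then 1 else 0)"
  "j < N \<Longrightarrow> k < N \<Longrightarrow> (\<Sum>i<N. W $$ (j, i) * W' $$ (i, k)) = (if j = k then 1 else 0)"
  "j < N \<Longrightarrow> k < N \<Longrightarrow> (\<Sum>i<N. W' $$ (j, i) * W $$ (i, k)) = (if j = k then 1 else 0)"
  using index_mult_mat_sum[OF U V(1), of j k] index_mult_mat_sum[OF V(1) U, of j k]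
    index_mult_mat_sum[OF W W'(1), of j k] index_mult_mat_sum[OF W'(1) W, of j k] V W' by auto

definition row_vec_of :: "int mat \<Rightarrow> nat \<Rightarrow> int^'l" where
  "row_vec_of B k = (\<chi> l. if l \<in> I then B $$ (k, inv_into {..<n} row_ix l) else 0)"

definition col_vec_of :: "int mat \<Rightarrow> nat \<Rightarrow> int^'l" where
  "col_vec_of B k = (\<chi> l. if l \<in> I then B $$ (inv_into {..<n} row_ix l, k) else 0)"

lemma vec_of_nth:
  assumes "i < n"
  shows "row_vec_of B k $ row_ix i = B $$ (k, i)" "col_vec_of B k $ row_ix i = B $$ (i, k)"
proof -
  have "row_ix i \<in> I" "inv_into {..<n} row_ix (row_ix i) = i"
    using row assms by (auto simp: bij_betw_def)
  then show "row_vec_of B k $ row_ix i = B $$ (k, i)" "col_vec_of B k $ row_ix i = B $$ (i, k)"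
    by (simp_all add: row_vec_of_def col_vec_of_def)
qed

lemma vec_of_Zpow: "row_vec_of B k \<in> Zpow I" "col_vec_of B k \<in> Zpow I"
  by (simp_all add: Zpow_def row_vec_of_def col_vec_of_def)

lemma sum_rows: "(\<And>l. l \<notin> I \<Longrightarrow> g l = 0) \<Longrightarrow> (\<Sum>l\<in>UNIV. g l) = (\<Sum>i<n. g (row_ix i))" for g :: "'l \<Rightarrow> int"
proof -
  assume "\<And>l. l \<notin> I \<Longrightarrow> g l = 0"
  then have "(\<Sum>l\<in>UNIV. g l) = (\<Sum>l\<in>I. g l)"
    by (intro sum.mono_neutral_right) auto
  then show ?thesis
    using sum.reindex_bij_betw[OF row, of g] by simp
qed

lemma ipair_row: "ipair (row_vec_of B k) \<alpha> = (\<Sum>i<n. B $$ (k, i) * \<alpha> $ row_ix i)"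
proof -
  have "ipair (row_vec_of B k) \<alpha> = (\<Sum>i<n. row_vec_of B k $ row_ix i * \<alpha> $ row_ix i)"
    unfolding ipair_def by (rule sum_rows) (simp add: row_vec_of_def)
  then show ?thesis
    by (simp add: vec_of_nth)
qed

lemma Zpow_eqI:
  assumes "\<alpha> \<in> Zpow I" "\<beta> \<in> Zpow I" "\<And>i. i < n \<Longrightarrow> \<alpha> $ row_ix i = \<beta> $ row_ix i"
  shows "\<alpha> = \<beta>"
  unfolding Finite_Cartesian_Product.vec_eq_iff
proof
  fix l show "\<alpha> $ l = \<beta> $ l"
  proof (cases "l \<in> I")
    case True
    then obtain i where "i < n" "l = row_ix i"
      using row by (auto simp: bij_betw_def)
    then show ?thesis
      using assms(3) by simp
  qed (use assms(1,2) in \<open>simp add: Zpow_def\<close>)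
qed

lemma sum_cols: "(\<Sum>\<alpha>\<in>A. g \<alpha>) = (\<Sum>j<N. g (col_ix j))" for g :: "int^'l \<Rightarrow> 'z::comm_monoid_add"
  using sum.reindex_bij_betw[OF col, of g] by simp

lemma col_mem: "j < N \<Longrightarrow> col_ix j \<in> A" and A_col: "\<alpha> \<in> A \<Longrightarrow> \<exists>j<N. \<alpha> = col_ix j"
  using col by (auto simp: bij_betw_def)

text \<open>
  The rows of \<open>U\<close> are the coordinate functionals for the basis formed by the columns of \<open>V\<close>.  By
  \<open>U M = D W'\<close> the \<open>k\<close>-th coordinate of an exponent is divisible by \<open>d k\<close>, and by \<open>M W = V D\<close> the
  multiple \<open>d k\<close> of the \<open>k\<close>-th basis vector is a combination of exponents.
\<close>

theorem smith_adapted_basis: "adapted_basis I A n q (col_vec_of V) (row_vec_of U) d"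
proof
  show "ipair (row_vec_of U j) (col_vec_of V k) = (if j = k then 1 else 0)" if "j < n" "k < n" for j k
    unfolding ipair_row using inverse_index(1)[OF that] by (simp add: vec_of_nth)
  show expand: "\<alpha> = (\<Sum>k<n. ipair (row_vec_of U k) \<alpha> *s col_vec_of V k)" if \<alpha>: "\<alpha> \<in> Zpow I" for \<alpha>
  proof (rule Zpow_eqI[OF \<alpha>])
    show "(\<Sum>k<n. ipair (row_vec_of U k) \<alpha> *s col_vec_of V k) \<in> Zpow I"
      by (intro Zpow_sum Zpow_scale vec_of_Zpow)
    fix i assume i: "i < n"
    have "(\<Sum>k<n. ipair (row_vec_of U k) \<alpha> *s col_vec_of V k) $ row_ix i
        = (\<Sum>k<n. \<Sum>i'<n. V $$ (i, k) * U $$ (k, i') * \<alpha> $ row_ix i')"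
      by (simp add: ipair_row vec_of_nth[OF i] sum_distrib_right sum_distrib_left ac_simps)
    also have "\<dots> = (\<Sum>i'<n. (\<Sum>k<n. V $$ (i, k) * U $$ (k, i')) * \<alpha> $ row_ix i')"
      unfolding sum_distrib_right by (rule sum.swap)
    also have "\<dots> = (\<Sum>i'<n. if i' = i then \<alpha> $ row_ix i else 0)"
      by (rule sum.cong) (use inverse_index(2)[OF i] in auto)
    also have "\<dots> = \<alpha> $ row_ix i"
      using i by simp
    finally show "\<alpha> $ row_ix i = (\<Sum>k<n. ipair (row_vec_of U k) \<alpha> *s col_vec_of V k) $ row_ix i" ..
  qed
  show "L_lattice A = {\<alpha> \<in> Zpow I. (\<forall>k<q. int (d k) dvd ipair (row_vec_of U k) \<alpha>) \<and>
      (\<forall>k\<ge>q. k < n \<longrightarrow> ipair (row_vec_of U k) \<alpha> = 0)}" (is "_ = ?R")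
  proof
    have "zmod.subspace ?R"
      by (auto simp: zmod.subspace_def ipair_0 ipair_add ipair_scale Zpow_0 Zpow_add Zpow_scale)
    moreover have "A \<subseteq> ?R"
    proof
      fix \<alpha> assume "\<alpha> \<in> A"
      then obtain j where j: "j < N" "\<alpha> = col_ix j"
        using A_col by blast
      have "ipair (row_vec_of U k) \<alpha> = (if k < q then int (d k) * W' $$ (k, j) else 0)" if "k < n" for k
        unfolding ipair_row j(2) by (rule UM_index[OF that j(1)])
      then show "\<alpha> \<in> ?R"
        using A_sub \<open>\<alpha> \<in> A\<close> q_le(1) by auto
    qed
    ultimately show "L_lattice A \<subseteq> ?R"
      unfolding L_lattice_zspan by (rule zmod.span_minimal[rotated])
    have dv: "int (d k) *s col_vec_of V k \<in> L_lattice A" if k: "k < q" for k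
    proof -
      have kN: "k < N"
        using k q_le by simp
      have "int (d k) *s col_vec_of V k = (\<Sum>j<N. W $$ (j, k) *s col_ix j)"
      proof (rule Zpow_eqI)
        show "(\<Sum>j<N. W $$ (j, k) *s col_ix j) \<in> Zpow I"
          using A_sub col_mem by (intro Zpow_sum Zpow_scale) auto
        fix i assume i: "i < n"
        show "(int (d k) *s col_vec_of V k) $ row_ix i = (\<Sum>j<N. W $$ (j, k) *s col_ix j) $ row_ix i"
          using MW_index[OF i kN] k by (simp add: vec_of_nth[OF i] mult.commute)
      qed (intro Zpow_scale vec_of_Zpow)
      also have "\<dots> \<in> zmod.span A"
        using col_mem by (intro zmod.span_sum zmod.span_scale zmod.span_base) auto
      finally show ?thesis
        by (simp add: L_lattice_zspan)
    qed
    show "?R \<subseteq> L_lattice A"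
    proof
      fix \<alpha> assume \<alpha>: "\<alpha> \<in> ?R"
      have "ipair (row_vec_of U k) \<alpha> *s col_vec_of V k \<in> L_lattice A" if "k < n" for k
      proof (cases "k < q")
        case True
        then obtain c where c: "ipair (row_vec_of U k) \<alpha> = c * int (d k)"
          using \<alpha> by (auto simp: dvd_def mult.commute)
        have "c *s (int (d k) *s col_vec_of V k) \<in> L_lattice A"
          using dv[OF True] by (simp only: L_lattice_zspan zmod.span_scale)
        then show ?thesis
          by (simp add: c)
      next
        case False
        then show ?thesis
          using \<alpha> \<open>k < n\<close> by (simp add: L_lattice_zspan zmod.span_zero)
      qed
      then have "(\<Sum>k<n. ipair (row_vec_of U k) \<alpha> *s col_vec_of V k) \<in> L_lattice A"
        unfolding L_lattice_zspan by (intro zmod.span_sum) auto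
      moreover have "(\<Sum>k<n. ipair (row_vec_of U k) \<alpha> *s col_vec_of V k) = \<alpha>"
        by (rule expand[symmetric]) (use \<alpha> in auto)
      ultimately show "\<alpha> \<in> L_lattice A"
        by simp
    qed
  qed
qed (use A_sub q_le d_pos vec_of_Zpow in auto)

lemma lookup_column_relation:
  assumes "j < N"
  shows "Poly_Mapping.lookup (column_relation col_ix W k) (col_ix j) = W $$ (j, k)"
proof -
  have "Poly_Mapping.lookup (column_relation col_ix W k) (col_ix j) = (\<Sum>i<N. if i = j then W $$ (j, k) else 0)"
    unfolding column_relation_def lookup_sum
  proof (rule sum.cong)
    show "{..<dim_row W} = {..<N}"
      using W by simp
    fix i assume "i \<in> {..<N}"
    then have "col_ix i = col_ix j \<longleftrightarrow> i = j"
      using col assms by (auto simp: bij_betw_def inj_on_def)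
    then show "Poly_Mapping.lookup (Poly_Mapping.single (col_ix i) (W $$ (i, k))) (col_ix j)
        = (if i = j then W $$ (j, k) else 0)"
      by (auto simp: lookup_single when_def)
  qed
  then show ?thesis
    using assms by simp
qed

lemma lookup_column_relation_outside:
  assumes "\<alpha> \<notin> A"
  shows "Poly_Mapping.lookup (column_relation col_ix W k) \<alpha> = 0"
  unfolding column_relation_def lookup_sum
proof (rule sum.neutral, rule ballI)
  fix j assume "j \<in> {..<dim_row W}"
  then have "col_ix j \<noteq> \<alpha>"
    using W col_mem assms by auto
  then show "Poly_Mapping.lookup (Poly_Mapping.single (col_ix j) (W $$ (j, k))) \<alpha> = 0"
    by (simp add: lookup_single)
qed

lemma relation_lattice_rows:
  "c \<in> relation_lattice A \<longleftrightarrow> Poly_Mapping.keys c \<subseteq> A \<and>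
     (\<forall>i<n. (\<Sum>j<N. col_ix j $ row_ix i * Poly_Mapping.lookup c (col_ix j)) = 0)"
proof -
  define s where "s = (\<Sum>j<N. Poly_Mapping.lookup c (col_ix j) *s col_ix j)"
  have "s \<in> Zpow I"
    unfolding s_def using A_sub col_mem by (intro Zpow_sum Zpow_scale) auto
  then have "s = 0 \<longleftrightarrow> (\<forall>i<n. s $ row_ix i = 0)"
    using Zpow_eqI[of s 0] by (auto simp: Zpow_0)
  then show ?thesis
    unfolding relation_lattice_def sum_cols s_def[symmetric] by (simp add: s_def mult.commute)
qed

text \<open>
  Since \<open>U M = D W'\<close> with \<open>U\<close> invertible, \<open>c\<close> is a relation iff the first \<open>q\<close> entries of \<open>W' c\<close> vanish;
  the others are free, and they are the coefficients of \<open>c\<close> along the columns of \<open>W\<close>.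
\<close>

theorem smith_relation_basis: "Z_basis {q..<N} (column_relation col_ix W) (relation_lattice A)"
  unfolding Z_basis_def
proof (rule bij_betw_byWitness)
  let ?f = "\<lambda>m. \<Sum>k\<in>{q..<N}. frag_cmul (m k) (column_relation col_ix W k)"
  let ?g = "\<lambda>c. \<lambda>k\<in>{q..<N}. \<Sum>j<N. W' $$ (k, j) * Poly_Mapping.lookup c (col_ix j)"
  have f_col: "Poly_Mapping.lookup (?f m) (col_ix j) = (\<Sum>k\<in>{q..<N}. m k * W $$ (j, k))" if "j < N" for m j
    using that by (simp add: lookup_sum lookup_column_relation)
  have f_out: "Poly_Mapping.lookup (?f m) \<alpha> = 0" if "\<alpha> \<notin> A" for m \<alpha>
    using that by (simp add: lookup_sum lookup_column_relation_outside)
  have low: "(\<Sum>j<N. W' $$ (k, j) * Poly_Mapping.lookup c (col_ix j)) = 0"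
    if c: "c \<in> relation_lattice A" and k: "k < q" for c k
  proof -
    have kn: "k < n"
      using k q_le by simp
    have "int (d k) * (\<Sum>j<N. W' $$ (k, j) * Poly_Mapping.lookup c (col_ix j))
        = (\<Sum>j<N. (\<Sum>i<n. U $$ (k, i) * col_ix j $ row_ix i) * Poly_Mapping.lookup c (col_ix j))"
      unfolding sum_distrib_left by (rule sum.cong) (use UM_index[OF kn] k in auto)
    also have "\<dots> = (\<Sum>i<n. U $$ (k, i) * (\<Sum>j<N. col_ix j $ row_ix i * Poly_Mapping.lookup c (col_ix j)))"
      unfolding sum_distrib_left sum_distrib_right mult.assoc by (rule sum.swap)
    also have "\<dots> = 0"
      using c by (simp add: relation_lattice_rows)
    finally show ?thesis
      using d_pos[OF k] by simp
  qed
  show "\<forall>m\<in>{q..<N} \<rightarrow>\<^sub>E UNIV. ?g (?f m) = m"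
  proof
    fix m :: "nat \<Rightarrow> int" assume m: "m \<in> {q..<N} \<rightarrow>\<^sub>E UNIV"
    show "?g (?f m) = m"
    proof (rule extensionalityI)
      show "?g (?f m) \<in> extensional {q..<N}"
        by (rule restrict_extensional)
      show "m \<in> extensional {q..<N}"
        using m by (simp add: PiE_iff)
      fix k assume k: "k \<in> {q..<N}"
      have "?g (?f m) k = (\<Sum>j<N. W' $$ (k, j) * (\<Sum>k'\<in>{q..<N}. m k' * W $$ (j, k')))"
        using k f_col by simp
      also have "\<dots> = (\<Sum>j<N. \<Sum>k'\<in>{q..<N}. W' $$ (k, j) * W $$ (j, k') * m k')"
        by (simp add: sum_distrib_left ac_simps)
      also have "\<dots> = (\<Sum>k'\<in>{q..<N}. (\<Sum>j<N. W' $$ (k, j) * W $$ (j, k')) * m k')"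
        unfolding sum_distrib_right by (rule sum.swap)
      also have "\<dots> = (\<Sum>k'\<in>{q..<N}. if k' = k then m k else 0)"
        by (rule sum.cong) (use inverse_index(4)[of k] k in auto)
      also have "\<dots> = m k"
        using k by simp
      finally show "?g (?f m) k = m k" .
    qed
  qed
  show "\<forall>c\<in>relation_lattice A. ?f (?g c) = c"
  proof
    fix c assume c: "c \<in> relation_lattice A"
    show "?f (?g c) = c"
    proof (rule poly_mapping_eqI)
      fix \<alpha>
      show "Poly_Mapping.lookup (?f (?g c)) \<alpha> = Poly_Mapping.lookup c \<alpha>"
      proof (cases "\<alpha> \<in> A")
        case True
        then obtain j where j: "j < N" "\<alpha> = col_ix j"
          using A_col by blast
        let ?h = "\<lambda>k. \<Sum>j'<N. W' $$ (k, j') * Poly_Mapping.lookup c (col_ix j')"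
        have "Poly_Mapping.lookup (?f (?g c)) \<alpha> = (\<Sum>k\<in>{q..<N}. ?h k * W $$ (j, k))"
          unfolding j(2) f_col[OF j(1)] by (rule sum.cong) auto
        also have "\<dots> = (\<Sum>k<N. ?h k * W $$ (j, k))"
          by (rule sum.mono_neutral_left) (use low[OF c] in auto)
        also have "\<dots> = (\<Sum>k<N. \<Sum>j'<N. W $$ (j, k) * W' $$ (k, j') * Poly_Mapping.lookup c (col_ix j'))"
          by (simp add: sum_distrib_left sum_distrib_right ac_simps)
        also have "\<dots> = (\<Sum>j'<N. (\<Sum>k<N. W $$ (j, k) * W' $$ (k, j')) * Poly_Mapping.lookup c (col_ix j'))"
          unfolding sum_distrib_right by (rule sum.swap)
        also have "\<dots> = (\<Sum>j'<N. if j' = j then Poly_Mapping.lookup c (col_ix j) else 0)"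
          by (rule sum.cong) (use inverse_index(3)[OF j(1)] in auto)
        also have "\<dots> = Poly_Mapping.lookup c \<alpha>"
          using j by simp
        finally show ?thesis .
      next
        case False
        then show ?thesis
          using f_out c by (auto simp: relation_lattice_def in_keys_iff)
      qed
    qed
  qed
  show "?f ` ({q..<N} \<rightarrow>\<^sub>E UNIV) \<subseteq> relation_lattice A"
  proof (rule image_subsetI)
    fix m :: "nat \<Rightarrow> int"
    show "?f m \<in> relation_lattice A"
      unfolding relation_lattice_rows
    proof (intro conjI allI impI)
      show "Poly_Mapping.keys (?f m) \<subseteq> A"
        using f_out by (auto simp: in_keys_iff)
      fix i assume i: "i < n"
      have "(\<Sum>j<N. col_ix j $ row_ix i * Poly_Mapping.lookup (?f m) (col_ix j))
          = (\<Sum>j<N. \<Sum>k\<in>{q..<N}. col_ix j $ row_ix i * W $$ (j, k) * m k)"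
        by (rule sum.cong) (simp_all add: f_col sum_distrib_left ac_simps)
      also have "\<dots> = (\<Sum>k\<in>{q..<N}. (\<Sum>j<N. col_ix j $ row_ix i * W $$ (j, k)) * m k)"
        unfolding sum_distrib_right by (rule sum.swap)
      also have "\<dots> = 0"
        by (rule sum.neutral) (use MW_index[OF i] in auto)
      finally show "(\<Sum>j<N. col_ix j $ row_ix i * Poly_Mapping.lookup (?f m) (col_ix j)) = 0" .
    qed
  qed
  show "?g ` relation_lattice A \<subseteq> {q..<N} \<rightarrow>\<^sub>E UNIV"
    by auto
qed

end

lemma smith_exponents_exist:
  assumes "A \<subseteq> Zpow I" "finite A" "bij_betw row_ix {..<card I} I" "bij_betw col_ix {..<card A} A"
    and "smith_reduction (exponent_matrix row_ix col_ix I A) U W q d"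
  obtains V W' where "smith_exponents I A row_ix col_ix U V W W' q d"
proof -
  have M: "dim_row (exponent_matrix row_ix col_ix I A) = card I"
    "dim_col (exponent_matrix row_ix col_ix I A) = card A"
    by (simp_all add: exponent_matrix_def)
  then have "unimodular (card I) U" "unimodular (card A) W"
    using assms(5) by (auto simp: smith_reduction_def)
  then obtain V W' where "V \<in> carrier_mat (card I) (card I)" "U * V = 1\<^sub>m (card I)" "V * U = 1\<^sub>m (card I)"
    "W' \<in> carrier_mat (card A) (card A)" "W * W' = 1\<^sub>m (card A)" "W' * W = 1\<^sub>m (card A)"
    by (meson unimodular_inverse)
  then show thesis
    using assms by (intro that[of V W']) (simp add: smith_exponents_def)
qed

section \<open>Monomial maps\<close>

subsection \<open>Trigonometric sums\<close>

text \<open>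
  The derivative is written as a trigonometric sum with the same frequencies, so that these sums are
  closed under directional derivatives and thus smooth.
\<close>

lemma trig_sum_has_derivative:
  fixes p r :: "'s \<Rightarrow> 'w::real_normed_vector" and a :: "'s \<Rightarrow> 'x::euclidean_space"
  shows "((\<lambda>x. \<Sum>s\<in>S. cos (a s \<bullet> x) *\<^sub>R p s + sin (a s \<bullet> x) *\<^sub>R r s) has_derivative
     (\<lambda>v. \<Sum>s\<in>S. cos (a s \<bullet> x) *\<^sub>R ((a s \<bullet> v) *\<^sub>R r s) + sin (a s \<bullet> x) *\<^sub>R (- (a s \<bullet> v) *\<^sub>R p s))) (at x)"
proof (rule has_derivative_sum)
  fix s
  have inner: "((\<lambda>x. a s \<bullet> x) has_derivative (\<lambda>v. a s \<bullet> v)) (at x)"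
    by (rule has_derivative_inner_right) (rule has_derivative_ident)
  have "((\<lambda>x. cos (a s \<bullet> x)) has_derivative (\<lambda>v. (a s \<bullet> v) * - sin (a s \<bullet> x))) (at x)"
    by (rule has_derivative_cos[OF inner])
  moreover have "((\<lambda>x. sin (a s \<bullet> x)) has_derivative (\<lambda>v. (a s \<bullet> v) * cos (a s \<bullet> x))) (at x)"
    by (rule has_derivative_sin[OF inner])
  ultimately have "((\<lambda>x. cos (a s \<bullet> x) *\<^sub>R p s + sin (a s \<bullet> x) *\<^sub>R r s) has_derivative
     (\<lambda>v. ((a s \<bullet> v) * - sin (a s \<bullet> x)) *\<^sub>R p s + ((a s \<bullet> v) * cos (a s \<bullet> x)) *\<^sub>R r s)) (at x)"
    by (intro has_derivative_add has_derivative_scaleR_left)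
  then show "((\<lambda>x. cos (a s \<bullet> x) *\<^sub>R p s + sin (a s \<bullet> x) *\<^sub>R r s) has_derivative
     (\<lambda>v. cos (a s \<bullet> x) *\<^sub>R ((a s \<bullet> v) *\<^sub>R r s) + sin (a s \<bullet> x) *\<^sub>R (- (a s \<bullet> v) *\<^sub>R p s))) (at x)"
    by (rule has_derivative_eq_rhs) (auto simp: mult.commute)
qed

lemma C_diff_trig_sum:
  fixes p r :: "'s \<Rightarrow> 'w::real_normed_vector" and a :: "'s \<Rightarrow> 'x::euclidean_space"
  shows "C_diff k (\<lambda>x. \<Sum>s\<in>S. cos (a s \<bullet> x) *\<^sub>R p s + sin (a s \<bullet> x) *\<^sub>R r s)"
proof (induction k arbitrary: p r)
  case 0
  show ?case
    by (auto intro!: continuous_intros)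
next
  case (Suc k)
  let ?g = "\<lambda>x. \<Sum>s\<in>S. cos (a s \<bullet> x) *\<^sub>R p s + sin (a s \<bullet> x) *\<^sub>R r s"
  have "frechet_derivative ?g (at x) v = (\<Sum>s\<in>S. cos (a s \<bullet> x) *\<^sub>R ((a s \<bullet> v) *\<^sub>R r s)
      + sin (a s \<bullet> x) *\<^sub>R (- (a s \<bullet> v) *\<^sub>R p s))" for x v
    by (rule fun_cong[OF frechet_derivative_at[OF trig_sum_has_derivative], symmetric])
  moreover have "?g differentiable at x" for x
    using trig_sum_has_derivative by (rule differentiableI)
  ultimately show ?case
    using Suc[of "\<lambda>s. (a s \<bullet> v) *\<^sub>R r s" "\<lambda>s. - (a s \<bullet> v) *\<^sub>R p s" for v] by simp
qed

subsection \<open>Monomial maps in a frame\<close>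

lemma cscale_simps:
  "cscale 0 p = 0" "cscale 1 p = p" "cscale c (p + p') = cscale c p + cscale c p'"
  "cscale (c + c') p = cscale c p + cscale c' p" "cscale c (cscale c' p) = cscale (c * c') p"
  "cscale c 0 = 0" "cscale (- c) p = - cscale c p" "cscale c (p - p') = cscale c p - cscale c p'"
  by (auto simp: cscale_def prod_eq_iff algebra_simps)

text \<open>
  A real map \<open>F\<close> whose coordinates in an independent family of complex vectors \<open>w \<alpha>\<close> are monomials.
  A pair stands for its real and imaginary part, so \<open>(F \<theta>, 0)\<close> is \<open>F \<theta>\<close> seen in the complexification.
\<close>

locale monomial_map = adapted_basis I A n q v x d
  for I :: "'l::finite set" and A :: "(int^'l) set" and n q :: nat
    and v x :: "nat \<Rightarrow> int^'l" and d :: "nat \<Rightarrow> nat" +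
  fixes w :: "int^'l \<Rightarrow> 'w::real_normed_vector cplx" and \<kappa> :: "int^'l \<Rightarrow> complex" and F :: "real^'l \<Rightarrow> 'w"
  assumes finA: "finite A"
    and frame_independent: "\<And>y \<alpha>. (\<Sum>\<alpha>\<in>A. cscale (y \<alpha>) (w \<alpha>)) = 0 \<Longrightarrow> \<alpha> \<in> A \<Longrightarrow> y \<alpha> = 0"
    and \<kappa>: "\<kappa> \<in> carrier (cstar_power A)"
    and F: "\<And>\<theta>. (F \<theta>, 0) = (\<Sum>\<alpha>\<in>A. cscale (\<kappa> \<alpha> * cis (cast_vec \<alpha> \<bullet> \<theta>)) (w \<alpha>))"
begin

lemma \<kappa>_nz: "\<alpha> \<in> A \<Longrightarrow> \<kappa> \<alpha> \<noteq> 0"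
  by (rule cstar_power_nonzero[OF \<kappa>])

lemma frame_coeffs:
  assumes "(\<Sum>\<alpha>\<in>A. cscale (y \<alpha>) (w \<alpha>)) = (\<Sum>\<alpha>\<in>A. cscale (y' \<alpha>) (w \<alpha>))" "\<alpha> \<in> A"
  shows "y \<alpha> = y' \<alpha>"
proof -
  have "(\<Sum>\<alpha>\<in>A. cscale (y \<alpha> - y' \<alpha>) (w \<alpha>)) = 0"
    using assms(1) by (simp add: cplx.scale_left_diff_distrib sum_subtractf)
  then show ?thesis
    using frame_independent[of "\<lambda>\<alpha>. y \<alpha> - y' \<alpha>"] assms(2) by simp
qed

text \<open>
  By independence of the frame, two values agree iff all characters agree.
\<close>

lemma F_eq_iff: "F \<theta> = F \<theta>' \<longleftrightarrow> torus_class I (\<theta> - \<theta>') \<in> K_group I A"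
proof -
  have "F \<theta> = F \<theta>' \<longleftrightarrow> (\<forall>\<alpha>\<in>A. cis (cast_vec \<alpha> \<bullet> \<theta>) = cis (cast_vec \<alpha> \<bullet> \<theta>'))"
  proof
    assume "F \<theta> = F \<theta>'"
    then have "(\<Sum>\<alpha>\<in>A. cscale (\<kappa> \<alpha> * cis (cast_vec \<alpha> \<bullet> \<theta>)) (w \<alpha>))
        = (\<Sum>\<alpha>\<in>A. cscale (\<kappa> \<alpha> * cis (cast_vec \<alpha> \<bullet> \<theta>')) (w \<alpha>))"
      by (simp flip: F)
    then show "\<forall>\<alpha>\<in>A. cis (cast_vec \<alpha> \<bullet> \<theta>) = cis (cast_vec \<alpha> \<bullet> \<theta>')"
      using frame_coeffs[of "\<lambda>\<alpha>. \<kappa> \<alpha> * cis (cast_vec \<alpha> \<bullet> \<theta>)" "\<lambda>\<alpha>. \<kappa> \<alpha> * cis (cast_vec \<alpha> \<bullet> \<theta>')"] \<kappa>_nz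
      by auto
  next
    assume "\<forall>\<alpha>\<in>A. cis (cast_vec \<alpha> \<bullet> \<theta>) = cis (cast_vec \<alpha> \<bullet> \<theta>')"
    then have "(F \<theta>, 0 :: 'w) = (F \<theta>', 0)"
      unfolding F by (intro sum.cong) auto
    then show "F \<theta> = F \<theta>'"
      by simp
  qed
  then show ?thesis
    by (simp add: K_group_iff[OF A_sub] cis_eq_iff_periods inner_diff_right)
qed

lemma F_periodic: "torus_class I \<theta> = torus_class I \<theta>' \<Longrightarrow> F \<theta> = F \<theta>'"
proof -
  assume "torus_class I \<theta> = torus_class I \<theta>'"
  then have "torus_class I (\<theta> - \<theta>') = torus_class I 0"
    by (simp add: torus_class_eq_iff)
  then show "F \<theta> = F \<theta>'"
    unfolding F_eq_iff by (simp add: K_group_iff[OF A_sub] periods_0)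
qed

lemma on_torus_F: "on_torus I F (torus_class I \<theta>) = F \<theta>"
  by (rule on_torus_class) (rule F_periodic)

lemma K_coset: "K_group I A #>\<^bsub>torus I\<^esub> torus_class I \<theta> = {torus_class I \<theta>' | \<theta>'. F \<theta>' = F \<theta>}"
proof
  show "K_group I A #>\<^bsub>torus I\<^esub> torus_class I \<theta> \<subseteq> {torus_class I \<theta>' | \<theta>'. F \<theta>' = F \<theta>}"
  proof
    fix p assume "p \<in> K_group I A #>\<^bsub>torus I\<^esub> torus_class I \<theta>"
    then obtain k where k: "k \<in> K_group I A" "p = k \<otimes>\<^bsub>torus I\<^esub> torus_class I \<theta>"
      by (auto simp: r_coset_def)
    then obtain \<eta> where \<eta>: "k = torus_class I \<eta>"
      using K_group_class by blast
    have "p = torus_class I (\<eta> + \<theta>)" "F (\<eta> + \<theta>) = F \<theta>"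
      using k \<eta> by (simp_all add: mult_torus_class F_eq_iff)
    then show "p \<in> {torus_class I \<theta>' | \<theta>'. F \<theta>' = F \<theta>}"
      by blast
  qed
  show "{torus_class I \<theta>' | \<theta>'. F \<theta>' = F \<theta>} \<subseteq> K_group I A #>\<^bsub>torus I\<^esub> torus_class I \<theta>"
  proof
    fix p assume "p \<in> {torus_class I \<theta>' | \<theta>'. F \<theta>' = F \<theta>}"
    then obtain \<theta>' where "p = torus_class I \<theta>'" "torus_class I (\<theta>' - \<theta>) \<in> K_group I A"
      using F_eq_iff by blast
    then show "p \<in> K_group I A #>\<^bsub>torus I\<^esub> torus_class I \<theta>"
      using mult_torus_class[of I "\<theta>' - \<theta>" \<theta>] by (force simp: r_coset_def)
  qed
qed

lemma fibres:
  assumes "p \<in> carrier (torus I)"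
  shows "{p' \<in> carrier (torus I). on_torus I F p' = on_torus I F p} = K_group I A #>\<^bsub>torus I\<^esub> p"
proof -
  obtain \<theta> where \<theta>: "p = torus_class I \<theta>"
    using assms by (auto simp: carrier_torus_class)
  show ?thesis
    unfolding \<theta> K_coset by (auto simp: carrier_torus_class on_torus_F)
qed

subsection \<open>The differential\<close>

text \<open>
  The differential of \<open>F\<close> in the complexified frame, where its kernel can be read off.
\<close>

definition tangent :: "real^'l \<Rightarrow> real^'l \<Rightarrow> 'w cplx" where
  "tangent \<theta> \<xi> = (\<Sum>\<alpha>\<in>A. cscale (of_real (cast_vec \<alpha> \<bullet> \<xi>) * (\<i> * \<kappa> \<alpha> * cis (cast_vec \<alpha> \<bullet> \<theta>))) (w \<alpha>))"

lemma trig_form: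
  "(F \<theta>, 0) = (\<Sum>\<alpha>\<in>A. cos (cast_vec \<alpha> \<bullet> \<theta>) *\<^sub>R cscale (\<kappa> \<alpha>) (w \<alpha>)
     + sin (cast_vec \<alpha> \<bullet> \<theta>) *\<^sub>R cscale (\<i> * \<kappa> \<alpha>) (w \<alpha>))"
  unfolding F by (rule sum.cong) (simp_all add: cscale_def algebra_simps)

lemma has_derivative_pair: "((\<lambda>\<theta>. (F \<theta>, 0)) has_derivative tangent \<theta>) (at \<theta>)"
proof -
  have "(\<lambda>\<xi>. \<Sum>\<alpha>\<in>A. cos (cast_vec \<alpha> \<bullet> \<theta>) *\<^sub>R ((cast_vec \<alpha> \<bullet> \<xi>) *\<^sub>R cscale (\<i> * \<kappa> \<alpha>) (w \<alpha>))
      + sin (cast_vec \<alpha> \<bullet> \<theta>) *\<^sub>R (- (cast_vec \<alpha> \<bullet> \<xi>) *\<^sub>R cscale (\<kappa> \<alpha>) (w \<alpha>))) = tangent \<theta>"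
    unfolding tangent_def by (intro ext sum.cong) (simp_all add: cscale_def algebra_simps)
  then show ?thesis
    unfolding trig_form
    using trig_sum_has_derivative[where S = A and a = cast_vec and p = "\<lambda>\<alpha>. cscale (\<kappa> \<alpha>) (w \<alpha>)"
        and r = "\<lambda>\<alpha>. cscale (\<i> * \<kappa> \<alpha>) (w \<alpha>)" and x = \<theta>] by simp
qed

lemma tangent_zero_iff: "tangent \<theta> \<xi> = 0 \<longleftrightarrow> (\<forall>\<alpha>\<in>A. cast_vec \<alpha> \<bullet> \<xi> = 0)"
proof
  assume 0: "tangent \<theta> \<xi> = 0"
  show "\<forall>\<alpha>\<in>A. cast_vec \<alpha> \<bullet> \<xi> = 0"
  proof
    fix \<alpha> assume \<alpha>: "\<alpha> \<in> A"
    have "of_real (cast_vec \<alpha> \<bullet> \<xi>) * (\<i> * \<kappa> \<alpha> * cis (cast_vec \<alpha> \<bullet> \<theta>)) = 0"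
      by (rule frame_independent[OF 0[unfolded tangent_def] \<alpha>])
    then show "cast_vec \<alpha> \<bullet> \<xi> = 0"
      using \<kappa>_nz[OF \<alpha>] by simp
  qed
qed (simp add: tangent_def cscale_simps)

lemma has_derivative_F: "(F has_derivative (\<lambda>\<xi>. fst (tangent \<theta> \<xi>))) (at \<theta>)"
  using has_derivative_fst[OF has_derivative_pair] by simp

lemma snd_tangent: "snd (tangent \<theta> \<xi>) = 0"
proof -
  have "((\<lambda>\<theta>. 0 :: 'w) has_derivative (\<lambda>\<xi>. snd (tangent \<theta> \<xi>))) (at \<theta>)"
    using has_derivative_snd[OF has_derivative_pair[of \<theta>]] by simp
  then have "(\<lambda>\<xi>. snd (tangent \<theta> \<xi>)) = (\<lambda>\<xi>. 0)"
    by (rule has_derivative_unique) (rule has_derivative_const)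
  then show ?thesis
    by metis
qed

lemma rank_derivative:
  "F differentiable at \<theta>" "dim (range (frechet_derivative F (at \<theta>))) = q"
proof -
  show "F differentiable at \<theta>"
    using has_derivative_F by (rule differentiableI)
  have fd: "frechet_derivative F (at \<theta>) = (\<lambda>\<xi>. fst (tangent \<theta> \<xi>))"
    using frechet_derivative_at[OF has_derivative_F] by simp
  show "dim (range (frechet_derivative F (at \<theta>))) = q"
    unfolding fd
  proof (rule dim_range_characters)
    show "linear (\<lambda>\<xi>. fst (tangent \<theta> \<xi>))"
      by (rule has_derivative_linear[OF has_derivative_F])
    show "fst (tangent \<theta> \<xi>) = 0 \<longleftrightarrow> (\<forall>\<alpha>\<in>A. cast_vec \<alpha> \<bullet> \<xi> = 0)" for \<xi>
      using tangent_zero_iff[of \<theta> \<xi>] snd_tangent[of \<theta> \<xi>] by (simp add: prod_eq_iff)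
  qed
qed

subsection \<open>The embedding of the quotient\<close>

text \<open>
  The group of periods contains no line.  This identifies the tangent space of the kernel with the
  kernel of the differential of \<open>F\<close>, which makes the map on the quotient an immersion.
\<close>

lemma line_in_K: "(\<forall>\<tau>. torus_class I (\<tau> *\<^sub>R \<xi>) \<in> K_group I A) \<longleftrightarrow> (\<forall>\<alpha>\<in>A. cast_vec \<alpha> \<bullet> \<xi> = 0)"
proof
  assume *: "\<forall>\<tau>. torus_class I (\<tau> *\<^sub>R \<xi>) \<in> K_group I A"
  show "\<forall>\<alpha>\<in>A. cast_vec \<alpha> \<bullet> \<xi> = 0"
  proof
    fix \<alpha> assume \<alpha>: "\<alpha> \<in> A"
    show "cast_vec \<alpha> \<bullet> \<xi> = 0"
    proof (rule ccontr)
      assume "cast_vec \<alpha> \<bullet> \<xi> \<noteq> 0"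
      have "\<tau> * (cast_vec \<alpha> \<bullet> \<xi>) \<in> periods" for \<tau>
        using * \<alpha> by (simp add: K_group_iff[OF A_sub])
      from this[of "pi / (cast_vec \<alpha> \<bullet> \<xi>)"] have "pi \<in> periods"
        using \<open>cast_vec \<alpha> \<bullet> \<xi> \<noteq> 0\<close> by simp
      then show False
        by (simp add: periods_iff_cis)
    qed
  qed
qed (simp add: K_group_iff[OF A_sub] periods_0)

text \<open>
  The map on the quotient is injective because the fibres of \<open>F\<close> are the cosets, a topological
  embedding because the torus is compact, and an immersion by \<open>line_in_K\<close>.
\<close>

lemma quotient_embedding:
  assumes X: "\<And>\<theta>. F \<theta> \<in> X" "0 \<in> X"
  shows "\<exists>g. (\<forall>p\<in>carrier (torus I). g (K_group I A #>\<^bsub>torus I\<^esub> p) = (on_torus I F p, 0)) \<and>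
    smooth_quotient_embedding I (K_group I A) g (X \<times> X)"
proof -
  let ?K = "K_group I A"
  interpret T: comm_group "torus I" by (rule comm_group_torus)
  define g where "g c = (on_torus I F (SOME p. p \<in> c), 0 :: 'w)" for c
  have g_class: "g (?K #>\<^bsub>torus I\<^esub> torus_class I \<theta>) = (F \<theta>, 0)" for \<theta>
  proof -
    have "(SOME p. p \<in> ?K #>\<^bsub>torus I\<^esub> torus_class I \<theta>) \<in> ?K #>\<^bsub>torus I\<^esub> torus_class I \<theta>"
      by (rule someI[of _ "torus_class I \<theta>"]) (auto simp: K_coset)
    then show ?thesis
      unfolding g_def K_coset by (auto simp: on_torus_F)
  qed
  have g: "g (?K #>\<^bsub>torus I\<^esub> p) = (on_torus I F p, 0)" if "p \<in> carrier (torus I)" for p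
    using that g_class by (auto simp: carrier_torus_class on_torus_F)
  have F_cont: "continuous_on UNIV F"
    by (rule has_derivative_continuous_on) (rule has_derivative_F)
  let ?Q = "quotient_topology (torus_topology I) (\<lambda>p. ?K #>\<^bsub>torus I\<^esub> p)"
  have quo: "quotient_map (torus_topology I) ?Q (\<lambda>p. ?K #>\<^bsub>torus I\<^esub> p)"
    by (rule quotient_map_quotient_topology)
  have topQ: "topspace ?Q = (\<lambda>p. ?K #>\<^bsub>torus I\<^esub> p) ` carrier (torus I)"
    using quotient_imp_surjective_map[OF quo] by (simp add: topspace_torus)
  have emb: "embedding_map ?Q (top_of_set (X \<times> X)) g"
  proof (rule continuous_imp_embedding_map)
    show "continuous_map ?Q (top_of_set (X \<times> X)) g"
    proof (rule continuous_compose_quotient_map[OF quo])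
      have "continuous_map (torus_topology I) euclidean (on_torus I (\<lambda>\<theta>. (F \<theta>, 0 :: 'w)))"
      proof (rule continuous_on_torus)
        show "(F \<theta>, 0 :: 'w) = (F \<theta>', 0)" if "torus_class I \<theta> = torus_class I \<theta>'" for \<theta> \<theta>'
          using F_periodic[OF that] by simp
        show "continuous_on UNIV (\<lambda>\<theta>. (F \<theta>, 0 :: 'w))"
          by (intro continuous_on_Pair F_cont continuous_on_const)
      qed
      moreover have "on_torus I (\<lambda>\<theta>. (F \<theta>, 0 :: 'w)) p = (g \<circ> (\<lambda>p. ?K #>\<^bsub>torus I\<^esub> p)) p"
        if "p \<in> topspace (torus_topology I)" for p
        using that by (simp add: topspace_torus g) (simp add: on_torus_def)
      ultimately have "continuous_map (torus_topology I) euclidean (g \<circ> (\<lambda>p. ?K #>\<^bsub>torus I\<^esub> p))"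
        by (rule continuous_map_eq)
      moreover have "(g \<circ> (\<lambda>p. ?K #>\<^bsub>torus I\<^esub> p)) \<in> topspace (torus_topology I) \<rightarrow> X \<times> X"
        using X g_class by (auto simp: topspace_torus carrier_torus_class)
      ultimately show "continuous_map (torus_topology I) (top_of_set (X \<times> X)) (g \<circ> (\<lambda>p. ?K #>\<^bsub>torus I\<^esub> p))"
        by (simp add: continuous_map_in_subtopology image_subset_iff_funcset)
    qed
    have "compactin ?Q ((\<lambda>p. ?K #>\<^bsub>torus I\<^esub> p) ` topspace (torus_topology I))"
      using compact_torus quotient_imp_continuous_map[OF quo] by (intro image_compactin) (auto simp: compact_space_def)
    then show "compact_space ?Q"
      by (simp add: compact_space_def topQ topspace_torus)
    show "Hausdorff_space (top_of_set (X \<times> X))"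
      by (simp add: Hausdorff_space_subtopology)
    show "inj_on g (topspace ?Q)"
    proof (rule inj_onI)
      fix c c' assume "c \<in> topspace ?Q" "c' \<in> topspace ?Q" and eq: "g c = g c'"
      then obtain \<theta> \<theta>' where c: "c = ?K #>\<^bsub>torus I\<^esub> torus_class I \<theta>" "c' = ?K #>\<^bsub>torus I\<^esub> torus_class I \<theta>'"
        by (auto simp: topQ carrier_torus_class)
      then have "F \<theta> = F \<theta>'"
        using eq by (simp add: g_class)
      then show "c = c'"
        by (simp add: c K_coset)
    qed
  qed
  have smooth: "smooth (\<lambda>\<theta>. (F \<theta>, 0 :: 'w))"
    unfolding smooth_def trig_form by (rule allI) (rule C_diff_trig_sum)
  have "smooth_quotient_embedding I ?K g (X \<times> X)"
    unfolding smooth_quotient_embedding_def Let_def g_class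
  proof (intro conjI allI)
    show "g ` carrier (torus I Mod ?K) \<subseteq> X \<times> X"
      using X g_class by (auto simp: carrier_FactGroup carrier_torus_class)
    show "(frechet_derivative (\<lambda>\<theta>. (F \<theta>, 0 :: 'w)) (at \<theta>) \<xi> = 0) = (\<forall>\<tau>. torus_class I (\<tau> *\<^sub>R \<xi>) \<in> ?K)" for \<theta> \<xi>
      unfolding line_in_K frechet_derivative_at[OF has_derivative_pair, symmetric] by (rule tangent_zero_iff)
  qed (rule smooth, rule emb)
  then show ?thesis
    using g by (intro exI[of _ g]) simp
qed

subsection \<open>The image and the Newton polytope\<close>

lemma frame_coords_image:
  "frame_coords A w (range (\<lambda>\<theta>. (F \<theta>, 0))) = range (\<lambda>\<theta> :: real^'l. \<lambda>\<alpha>\<in>A. \<kappa> \<alpha> * cis (cast_vec \<alpha> \<bullet> \<theta>))"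
proof
  show "frame_coords A w (range (\<lambda>\<theta>. (F \<theta>, 0))) \<subseteq> range (\<lambda>\<theta> :: real^'l. \<lambda>\<alpha>\<in>A. \<kappa> \<alpha> * cis (cast_vec \<alpha> \<bullet> \<theta>))"
  proof
    fix y assume "y \<in> frame_coords A w (range (\<lambda>\<theta>. (F \<theta>, 0)))"
    then obtain \<theta> where y: "y \<in> A \<rightarrow>\<^sub>E UNIV" "(\<Sum>\<alpha>\<in>A. cscale (y \<alpha>) (w \<alpha>)) = (F \<theta>, 0)"
      by (auto simp: frame_coords_def)
    have "y = (\<lambda>\<alpha>\<in>A. \<kappa> \<alpha> * cis (cast_vec \<alpha> \<bullet> \<theta>))"
    proof (rule extensionalityI)
      show "y \<in> extensional A"
        using y(1) by (simp add: PiE_iff)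
      fix \<alpha> assume \<alpha>: "\<alpha> \<in> A"
      show "y \<alpha> = (\<lambda>\<alpha>\<in>A. \<kappa> \<alpha> * cis (cast_vec \<alpha> \<bullet> \<theta>)) \<alpha>"
        using frame_coeffs[OF y(2)[unfolded F] \<alpha>] \<alpha> by simp
    qed (rule restrict_extensional)
    then show "y \<in> range (\<lambda>\<theta> :: real^'l. \<lambda>\<alpha>\<in>A. \<kappa> \<alpha> * cis (cast_vec \<alpha> \<bullet> \<theta>))"
      by blast
  qed
  show "range (\<lambda>\<theta> :: real^'l. \<lambda>\<alpha>\<in>A. \<kappa> \<alpha> * cis (cast_vec \<alpha> \<bullet> \<theta>)) \<subseteq> frame_coords A w (range (\<lambda>\<theta>. (F \<theta>, 0)))"
  proof
    fix y assume "y \<in> range (\<lambda>\<theta> :: real^'l. \<lambda>\<alpha>\<in>A. \<kappa> \<alpha> * cis (cast_vec \<alpha> \<bullet> \<theta>))"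
    then obtain \<theta> :: "real^'l" where y: "y = (\<lambda>\<alpha>\<in>A. \<kappa> \<alpha> * cis (cast_vec \<alpha> \<bullet> \<theta>))"
      by blast
    have "(\<Sum>\<alpha>\<in>A. cscale (y \<alpha>) (w \<alpha>)) = (F \<theta>, 0)"
      unfolding F y by (rule sum.cong) auto
    moreover have "y \<in> A \<rightarrow>\<^sub>E UNIV"
      by (simp add: y)
    ultimately show "y \<in> frame_coords A w (range (\<lambda>\<theta>. (F \<theta>, 0)))"
      by (auto simp: frame_coords_def)
  qed
qed

lemma image_translate:
  "range (\<lambda>\<theta> :: real^'l. \<lambda>\<alpha>\<in>A. \<kappa> \<alpha> * cis (cast_vec \<alpha> \<bullet> \<theta>))
     = \<kappa> <#\<^bsub>cstar_power A\<^esub> range (\<lambda>\<theta> :: real^'l. \<lambda>\<alpha>\<in>A. cis (cast_vec \<alpha> \<bullet> \<theta>))"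
proof -
  have "\<kappa> \<otimes>\<^bsub>cstar_power A\<^esub> (\<lambda>\<alpha>\<in>A. cis (cast_vec \<alpha> \<bullet> \<theta>)) = (\<lambda>\<alpha>\<in>A. \<kappa> \<alpha> * cis (cast_vec \<alpha> \<bullet> \<theta>))" for \<theta> :: "real^'l"
    by (auto simp: cstar_power_def cstar_group_def fun_eq_iff)
  then show ?thesis
    by (auto simp: l_coset_def)
qed

text \<open>
  Laurent polynomials are determined by their values on the compact torus, so the coordinate functions
  of \<open>F\<close> can only be the given monomials.
\<close>

lemma newton_polytope_monomials:
  assumes "\<And>\<alpha>. \<alpha> \<in> A \<Longrightarrow> Poly_Mapping.keys (g \<alpha>) \<subseteq> Zpow I"
    and "\<And>\<theta>. (F \<theta>, 0) = (\<Sum>\<alpha>\<in>A. cscale (s_eval I (g \<alpha>) (\<lambda>l. cis (\<theta> $ l))) (w \<alpha>))"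
  shows "newton_polytope (g ` A) = convex hull (cast_vec ` A)"
proof -
  have "g \<alpha> = Poly_Mapping.single \<alpha> (\<kappa> \<alpha>)" if \<alpha>: "\<alpha> \<in> A" for \<alpha>
  proof (rule s_eval_monomial)
    show "Poly_Mapping.keys (g \<alpha>) \<subseteq> Zpow I"
      by (rule assms(1)[OF \<alpha>])
    show "\<alpha> \<in> Zpow I"
      using A_sub \<alpha> by blast
    show "s_eval I (g \<alpha>) (\<lambda>l. cis (\<theta> $ l)) = \<kappa> \<alpha> * cis (cast_vec \<alpha> \<bullet> \<theta>)" for \<theta>
      using assms(2)[of \<theta>, unfolded F] by (intro frame_coeffs[symmetric, OF _ \<alpha>])
  qed
  then have "(\<Union>p\<in>g ` A. cast_vec ` Poly_Mapping.keys p) = (cast_vec ` A :: (real^'l) set)"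
    using \<kappa>_nz by auto
  then show ?thesis
    by (simp add: newton_polytope_def)
qed

end

section \<open>Evaluation of trivectors\<close>

text \<open>
  Trivectors are distinguished by evaluating them at functionals that live on a single summand of the
  Lie algebra.
\<close>

definition on_b :: "'b::euclidean_space dual \<Rightarrow> ('b, 'v::euclidean_space) lie dual" where
  "on_b \<phi> = \<phi> o\<^sub>L fst_blinfun"

definition on_v :: "'v::euclidean_space \<Rightarrow> ('b::euclidean_space, 'v) lie dual" where
  "on_v X = blinfun_inner_right X o\<^sub>L fst_blinfun o\<^sub>L snd_blinfun"

lemma on_simps [simp]:
  "blinfun_apply (on_b \<phi>) (in_b b) = blinfun_apply \<phi> b" "blinfun_apply (on_b \<phi>) (in_v u) = 0"
  "blinfun_apply (on_v X) (in_b b) = 0" "blinfun_apply (on_v X) (in_v u) = X \<bullet> u"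
  by (simp_all add: on_b_def on_v_def in_b_def in_v_def fst_blinfun.rep_eq snd_blinfun.rep_eq)

lemma wedge2_apply:
  "blinfun_apply (blinfun_apply (wedge2 x y) f) g
     = blinfun_apply f x * blinfun_apply g y - blinfun_apply f y * blinfun_apply g x"
  by (simp add: wedge2_def tensor2_def tensor.rep_eq eval_at.rep_eq blinfun.bilinear_simps)

lemma wedge3_apply:
  "blinfun_apply (blinfun_apply (blinfun_apply (wedge3 x y z) f) g) k
     = blinfun_apply f x * (blinfun_apply g y * blinfun_apply k z - blinfun_apply g z * blinfun_apply k y)
     + blinfun_apply f y * (blinfun_apply g z * blinfun_apply k x - blinfun_apply g x * blinfun_apply k z)
     + blinfun_apply f z * (blinfun_apply g x * blinfun_apply k y - blinfun_apply g y * blinfun_apply k x)"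
  by (simp add: wedge3_def tensor3_def tensor2_def tensor.rep_eq eval_at.rep_eq blinfun.bilinear_simps
      algebra_simps)

definition ev3 :: "'b::euclidean_space dual \<Rightarrow> 'v::euclidean_space \<Rightarrow> 'v \<Rightarrow> ('b, 'v) lie tensor3 \<Rightarrow> real" where
  "ev3 \<phi> X Y T = blinfun_apply (blinfun_apply (blinfun_apply T (on_b \<phi>)) (on_v X)) (on_v Y)"

lemma ev3_linear:
  "ev3 \<phi> X Y (T + T') = ev3 \<phi> X Y T + ev3 \<phi> X Y T'"
  "ev3 \<phi> X Y (T - T') = ev3 \<phi> X Y T - ev3 \<phi> X Y T'"
  "ev3 \<phi> X Y (c *\<^sub>R T) = c * ev3 \<phi> X Y T"
  "ev3 \<phi> X Y 0 = 0"
  by (simp_all add: ev3_def blinfun.bilinear_simps)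

lemma ev3_wedge3: "ev3 \<phi> X Y (wedge3 (in_b b) (in_v u) (in_v w))
    = blinfun_apply \<phi> b * ((X \<bullet> u) * (Y \<bullet> w) - (X \<bullet> w) * (Y \<bullet> u))"
  by (simp add: ev3_def wedge3_apply)

subsection \<open>Complexified trivectors\<close>

lemma cscale_eq_0_iff: "cscale c p = 0 \<longleftrightarrow> c = 0 \<or> p = 0"
  by (rule cplx.scale_eq_0_iff)

lemma wedge3_uminus_diff:
  "wedge3 (x - x') y z = wedge3 x y z - wedge3 x' y z"
  "wedge3 x (y - y') z = wedge3 x y z - wedge3 x y' z"
  "wedge3 x y (z - z') = wedge3 x y z - wedge3 x y z'"
  "wedge3 (- x) y z = - wedge3 x y z" "wedge3 x (- y) z = - wedge3 x y z" "wedge3 x y (- z) = - wedge3 x y z"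
proof -
  show m: "wedge3 (- x) y z = - wedge3 x y z" "wedge3 x (- y) z = - wedge3 x y z"
    "wedge3 x y (- z) = - wedge3 x y z" for x y z :: 'a
    using wedge3_scale[where c = "-1"] by simp_all
  show "wedge3 (x - x') y z = wedge3 x y z - wedge3 x' y z"
    "wedge3 x (y - y') z = wedge3 x y z - wedge3 x y' z"
    "wedge3 x y (z - z') = wedge3 x y z - wedge3 x y z'"
    using wedge3_add(1)[of x "- x'"] wedge3_add(2)[of x y "- y'"] wedge3_add(3)[of x y z "- z'"]
    by (simp_all add: m)
qed

lemma cwedge3_add:
  "cwedge3 (x + x') y z = cwedge3 x y z + cwedge3 x' y z"
  "cwedge3 x (y + y') z = cwedge3 x y z + cwedge3 x y' z"
  "cwedge3 x y (z + z') = cwedge3 x y z + cwedge3 x y z'"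
  by (simp_all add: cwedge3_def wedge3_add)

lemma cwedge3_cscale:
  "cwedge3 (cscale c x) y z = cscale c (cwedge3 x y z)"
  "cwedge3 x (cscale c y) z = cscale c (cwedge3 x y z)"
  "cwedge3 x y (cscale c z) = cscale c (cwedge3 x y z)"
  by (simp_all add: cwedge3_def cscale_def wedge3_add wedge3_scale wedge3_uminus_diff
      scaleR_add_right scaleR_diff_right)

lemma cwedge3_real: "cwedge3 (x, 0) (y, 0) (z, 0) = (wedge3 x y z, 0)"
proof -
  have "wedge3 0 y z = 0" "wedge3 x 0 z = 0" "wedge3 x y 0 = 0" for x y z :: 'a
    using wedge3_scale[where c = 0] by simp_all
  then show ?thesis
    by (simp add: cwedge3_def)
qed

lemma map_prod_in_b:
  "map_prod in_b in_b (cscale c p) = cscale c (map_prod in_b in_b p :: ('b::euclidean_space, 'v::euclidean_space) lie cplx)"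
  "map_prod in_b in_b (p + p') = map_prod in_b in_b p + (map_prod in_b in_b p' :: ('b, 'v) lie cplx)"
  by (simp_all add: prod_eq_iff cscale_def in_b_def fst_map_prod snd_map_prod)

lemma map_prod_in_v:
  "map_prod in_v in_v (cscale c p) = cscale c (map_prod in_v in_v p :: ('b::euclidean_space, 'v::euclidean_space) lie cplx)"
  "map_prod in_v in_v (p + p') = map_prod in_v in_v p + (map_prod in_v in_v p' :: ('b, 'v) lie cplx)"
  by (simp_all add: prod_eq_iff cscale_def in_v_def fst_map_prod snd_map_prod)

text \<open>The tensor \<open>b \<and> x \<and> y\<close> in the complexification.\<close>

abbreviation bvv :: "'b::euclidean_space cplx \<Rightarrow> 'v::euclidean_space cplx \<Rightarrow> 'v cplx \<Rightarrow> ('b, 'v) lie tensor3 cplx" where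
  "bvv b x y \<equiv> cwedge3 (map_prod in_b in_b b) (map_prod in_v in_v x) (map_prod in_v in_v y)"

lemma bvv_add:
  "bvv (b + b') x y = bvv b x y + bvv b' x y" "bvv b (x + x') y = bvv b x y + bvv b x' y"
  "bvv b x (y + y') = bvv b x y + bvv b x y'"
  by (simp_all add: map_prod_in_b map_prod_in_v cwedge3_add)

lemma bvv_cscale:
  "bvv (cscale c b) x y = cscale c (bvv b x y)" "bvv b (cscale c x) y = cscale c (bvv b x y)"
  "bvv b x (cscale c y) = cscale c (bvv b x y)"
  by (simp_all add: map_prod_in_b map_prod_in_v cwedge3_cscale)

text \<open>
  Complex-linear extensions of \<open>ev3\<close>, of the inner product and of evaluation.
\<close>

definition cev3 :: "'b::euclidean_space dual \<Rightarrow> 'v::euclidean_space \<Rightarrow> 'v \<Rightarrow> ('b, 'v) lie tensor3 cplx \<Rightarrow> complex" where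
  "cev3 \<phi> X Y p = Complex (ev3 \<phi> X Y (fst p)) (ev3 \<phi> X Y (snd p))"

definition cpair :: "'v::euclidean_space \<Rightarrow> 'v cplx \<Rightarrow> complex" where
  "cpair X x = Complex (X \<bullet> fst x) (X \<bullet> snd x)"

definition capply :: "'b::euclidean_space dual \<Rightarrow> 'b cplx \<Rightarrow> complex" where
  "capply \<phi> b = Complex (blinfun_apply \<phi> (fst b)) (blinfun_apply \<phi> (snd b))"

lemma cev3_linear: "cev3 \<phi> X Y (p + p') = cev3 \<phi> X Y p + cev3 \<phi> X Y p'"
  "cev3 \<phi> X Y (cscale c p) = c * cev3 \<phi> X Y p" "cev3 \<phi> X Y 0 = 0"
  by (simp_all add: cev3_def complex_eq_iff ev3_linear cscale_def)

lemma cpair_linear: "cpair X (p + p') = cpair X p + cpair X p'" "cpair X (cscale c p) = c * cpair X p"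
  by (simp_all add: cpair_def complex_eq_iff inner_add_right inner_diff_right cscale_def)

lemma cev3_bvv: "cev3 \<phi> X Y (bvv b x y) = capply \<phi> b * (cpair X x * cpair Y y - cpair X y * cpair Y x)"
  by (simp add: cev3_def cwedge3_def ev3_linear ev3_wedge3 capply_def cpair_def complex_eq_iff
      fst_map_prod snd_map_prod algebra_simps)

lemma capply_separates: "(\<And>\<phi>. capply \<phi> b = 0) \<Longrightarrow> b = 0"
proof -
  assume *: "\<And>\<phi>. capply \<phi> b = 0"
  show "b = 0"
    using *[of "blinfun_inner_right (fst b)"] *[of "blinfun_inner_right (snd b)"]
    by (cases b) (simp add: capply_def complex_eq_iff zero_prod_def)
qed

section \<open>The eigenspace decomposition\<close>

locale rotational_frame =
  fixes P :: "'l::{finite,linorder} \<Rightarrow> 'v::euclidean_space set"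
    and J :: "'l \<Rightarrow> 'v \<Rightarrow> 'v"
    and lam :: "'l \<Rightarrow> 'b::euclidean_space dual"
    and e :: "'l \<Rightarrow> 'v" and h :: "'l \<Rightarrow> 'b"
  assumes datum: "rotational_datum P J lam" and frame: "unit_frame P e" and marking: "positive_marking lam h"
begin

definition f :: "'l \<Rightarrow> 'v" where "f l = J l (e l)"

lemma subspace_P: "subspace (P l)"
  and J_mem: "u \<in> P l \<Longrightarrow> J l u \<in> P l"
  and J_add: "u \<in> P l \<Longrightarrow> u' \<in> P l \<Longrightarrow> J l (u + u') = J l u + J l u'"
  and J_scale: "u \<in> P l \<Longrightarrow> J l (c *\<^sub>R u) = c *\<^sub>R J l u"
  and P_orth: "i \<noteq> j \<Longrightarrow> u \<in> P i \<Longrightarrow> u' \<in> P j \<Longrightarrow> u \<bullet> u' = 0"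
  and J_norm: "u \<in> P l \<Longrightarrow> norm (J l u) = norm u"
  and J_orth: "u \<in> P l \<Longrightarrow> u \<bullet> J l u = 0"
  using datum by (auto simp: rotational_datum_def quarter_turn_def)

lemma e_mem: "e l \<in> P l" and e_norm: "norm (e l) = 1"
  using frame by (auto simp: unit_frame_def)

lemma f_mem: "f l \<in> P l" and f_norm: "norm (f l) = 1"
  by (simp_all add: f_def J_mem J_norm e_mem e_norm)

lemma frame_inner: "e k \<bullet> e l = (if k = l then 1 else 0)" "f k \<bullet> f l = (if k = l then 1 else 0)"
  "e k \<bullet> f l = 0" "f k \<bullet> e l = 0"
proof -
  show 1: "e k \<bullet> e l = (if k = l then 1 else 0)"
    using P_orth[OF _ e_mem e_mem] e_norm by (auto simp: norm_eq_1)
  show 2: "f k \<bullet> f l = (if k = l then 1 else 0)"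
    using P_orth[OF _ f_mem f_mem] f_norm by (auto simp: norm_eq_1)
  show 3: "e k \<bullet> f l = 0" for k l
    using P_orth[OF _ e_mem f_mem, of k l] J_orth[OF e_mem[of k]] by (cases "k = l") (auto simp: f_def)
  show "f k \<bullet> e l = 0"
    using 3[of l k] by (simp add: inner_commute)
qed

lemma plane_expand: "u \<in> P l \<Longrightarrow> u = (u \<bullet> e l) *\<^sub>R e l + (u \<bullet> f l) *\<^sub>R f l"
  using plane_part_simps(1)[OF datum frame, of u l] by (simp add: plane_part_def f_def)

lemma plane_mem: "a *\<^sub>R e l + b *\<^sub>R f l \<in> P l"
  using subspace_P e_mem f_mem by (intro subspace_add subspace_scale)

text \<open>
  Polarization: expand \<open>u \<bullet> J u = 0\<close> at \<open>u = e + f\<close>.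
\<close>

lemma J_f: "J l (f l) = - e l"
proof -
  have "(e l + f l) \<bullet> J l (e l + f l) = 0"
    using subspace_P e_mem f_mem by (intro J_orth subspace_add)
  then have "J l (f l) \<bullet> e l = -1"
    using J_add[OF e_mem f_mem, of l] J_orth[OF f_mem[of l]] frame_inner(2)[of l l] frame_inner(3)[of l l]
    by (simp add: f_def[symmetric] inner_add_left inner_add_right inner_commute)
  moreover have "J l (f l) \<bullet> f l = 0"
    using J_orth[OF f_mem[of l]] by (simp add: inner_commute)
  ultimately show ?thesis
    using plane_expand[OF J_mem[OF f_mem[of l]]] by simp
qed

lemma J_expand: "J l (a *\<^sub>R e l + b *\<^sub>R f l) = a *\<^sub>R f l - b *\<^sub>R e l"
  using subspace_P e_mem f_mem by (simp add: J_add J_scale subspace_scale J_f) (simp add: f_def)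

lemma lam_pos: "blinfun_apply (lam l) (h l) > 0"
  using marking by (simp add: positive_marking_def)

lemma eigenvec_eq: "eigenvec J e l \<epsilon> = cscale (1 / sqrt 2) (e l, - of_int \<epsilon> *\<^sub>R f l)"
  by (simp add: eigenvec_def f_def)

lemma eigenvec_mem: "\<epsilon> \<in> {1, -1} \<Longrightarrow> eigenvec J e l \<epsilon> \<in> eigenline P J l \<epsilon>"
proof -
  assume \<epsilon>: "\<epsilon> \<in> {1, -1::int}"
  have r: "1 / complex_of_real (sqrt 2) = complex_of_real (1 / sqrt 2)"
    by simp
  have fst: "fst (eigenvec J e l \<epsilon>) = (1 / sqrt 2) *\<^sub>R e l + 0 *\<^sub>R f l"
    and snd: "snd (eigenvec J e l \<epsilon>) = 0 *\<^sub>R e l + (- of_int \<epsilon> / sqrt 2) *\<^sub>R f l"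
    unfolding eigenvec_eq cscale_def r Re_complex_of_real Im_complex_of_real by simp_all
  have "fst (eigenvec J e l \<epsilon>) \<in> P l" "snd (eigenvec J e l \<epsilon>) \<in> P l"
    unfolding fst snd by (rule plane_mem)+
  moreover have "J l (fst (eigenvec J e l \<epsilon>)) = - of_int \<epsilon> *\<^sub>R snd (eigenvec J e l \<epsilon>)"
    "J l (snd (eigenvec J e l \<epsilon>)) = of_int \<epsilon> *\<^sub>R fst (eigenvec J e l \<epsilon>)"
    unfolding fst snd J_expand using \<epsilon> by auto
  ultimately show ?thesis
    by (simp add: eigenline_def mem_Times_iff cscale_def)
qed

lemma eigenline_multiple:
  assumes \<epsilon>: "\<epsilon> \<in> {1, -1}" and x: "x \<in> eigenline P J l \<epsilon>"
  obtains z where "x = cscale z (eigenvec J e l \<epsilon>)"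
proof -
  obtain a b where ab: "x = (a, b)" "a \<in> P l" "b \<in> P l" "J l a = - of_int \<epsilon> *\<^sub>R b"
    using x by (auto simp: eigenline_def cscale_def)
  define p q where "p = a \<bullet> e l" and "q = a \<bullet> f l"
  have a: "a = p *\<^sub>R e l + q *\<^sub>R f l"
    using plane_expand[OF ab(2)] by (simp add: p_def q_def)
  have "of_int \<epsilon> *\<^sub>R J l a = - b"
    using ab(4) \<epsilon> by auto
  then have b: "b = - of_int \<epsilon> *\<^sub>R (p *\<^sub>R f l - q *\<^sub>R e l)"
    unfolding a J_expand using minus_equation_iff by fastforce
  have "x = cscale (Complex p (of_int \<epsilon> * q)) (e l, - of_int \<epsilon> *\<^sub>R f l)"
    unfolding ab(1) a b using \<epsilon> by (auto simp: cscale_def algebra_simps)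
  also have "\<dots> = cscale (Complex p (of_int \<epsilon> * q) * sqrt 2) (eigenvec J e l \<epsilon>)"
    unfolding eigenvec_eq cscale_simps by simp
  finally show thesis
    using that by blast
qed

text \<open>
  The complex functional dual to the eigenvector \<open>eigenvec J e l \<epsilon>\<close>.
\<close>

definition eigencoord :: "'l \<Rightarrow> int \<Rightarrow> 'v cplx \<Rightarrow> complex" where
  "eigencoord l \<epsilon> x = (cpair (e l) x + \<i> * of_int \<epsilon> * cpair (f l) x) / sqrt 2"

lemma eigencoord_eigenvec:
  assumes "\<epsilon> \<in> {1, -1}" "\<delta> \<in> {1, -1}"
  shows "eigencoord k \<epsilon> (eigenvec J e l \<delta>) = (if k = l \<and> \<epsilon> = \<delta> then 1 else 0)"
proof -
  have s: "complex_of_real (sqrt 2) * complex_of_real (sqrt 2) = 2"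
    by (simp flip: of_real_mult)
  have "cpair (e k) (e l, - of_int \<delta> *\<^sub>R f l) = (if k = l then 1 else 0)"
    "cpair (f k) (e l, - of_int \<delta> *\<^sub>R f l) = (if k = l then - \<i> * of_int \<delta> else 0)"
    by (auto simp: cpair_def frame_inner complex_eq_iff)
  then show ?thesis
    using assms s by (auto simp: eigencoord_def eigenvec_eq cpair_linear field_simps)
qed

text \<open>
  Evaluation at \<open>\<phi> \<otimes> eigencoord i \<epsilon> \<otimes> eigencoord j \<delta>\<close>, expanded into real functionals.
\<close>

definition eigenproj :: "'b dual \<Rightarrow> 'l \<Rightarrow> int \<Rightarrow> 'l \<Rightarrow> int \<Rightarrow> ('b, 'v) lie tensor3 cplx \<Rightarrow> complex" where
  "eigenproj \<phi> i \<epsilon> j \<delta> p = (cev3 \<phi> (e i) (e j) p + \<i> * of_int \<delta> * cev3 \<phi> (e i) (f j) p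
     + \<i> * of_int \<epsilon> * cev3 \<phi> (f i) (e j) p - of_int \<epsilon> * of_int \<delta> * cev3 \<phi> (f i) (f j) p) / 2"

lemma eigenproj_linear: "eigenproj \<phi> i \<epsilon> j \<delta> (p + p') = eigenproj \<phi> i \<epsilon> j \<delta> p + eigenproj \<phi> i \<epsilon> j \<delta> p'"
  "eigenproj \<phi> i \<epsilon> j \<delta> (cscale c p) = c * eigenproj \<phi> i \<epsilon> j \<delta> p" "eigenproj \<phi> i \<epsilon> j \<delta> 0 = 0"
  by (simp_all add: eigenproj_def cev3_linear algebra_simps add_divide_distrib diff_divide_distrib)

lemma eigenproj_sum: "eigenproj \<phi> i \<epsilon> j \<delta> (\<Sum>s\<in>S. g s) = (\<Sum>s\<in>S. eigenproj \<phi> i \<epsilon> j \<delta> (g s))"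
  by (induction S rule: infinite_finite_induct) (auto simp: eigenproj_linear)

lemma eigenproj_bvv:
  "eigenproj \<phi> i \<epsilon> j \<delta> (bvv b x y) = capply \<phi> b *
     (eigencoord i \<epsilon> x * eigencoord j \<delta> y - eigencoord i \<epsilon> y * eigencoord j \<delta> x)"
proof -
  have s: "complex_of_real (sqrt 2) * complex_of_real (sqrt 2) = 2"
    by (simp flip: of_real_mult)
  have *: "eigencoord i \<epsilon> x * eigencoord j \<delta> y
      = (cpair (e i) x + \<i> * of_int \<epsilon> * cpair (f i) x) * (cpair (e j) y + \<i> * of_int \<delta> * cpair (f j) y) / 2" for x y
    unfolding eigencoord_def times_divide_times_eq s ..
  show ?thesis
    unfolding * eigenproj_def cev3_bvv by (simp add: field_simps)
qed

text \<open>
  The antisymmetrized product in \<open>eigenproj_bvv\<close> could also contribute for \<open>i = j'\<close> and \<open>j = i'\<close>, which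
  the order of the indices excludes.
\<close>

lemma eigenproj_eigenvec:
  assumes "(i, \<epsilon>, j, \<delta>) \<in> signed_pairs UNIV" "(i', \<epsilon>', j', \<delta>') \<in> signed_pairs UNIV"
  shows "eigenproj \<phi> i \<epsilon> j \<delta> (bvv b (eigenvec J e i' \<epsilon>') (eigenvec J e j' \<delta>'))
    = (if (i, \<epsilon>, j, \<delta>) = (i', \<epsilon>', j', \<delta>') then capply \<phi> b else 0)"
proof -
  have s: "\<epsilon> \<in> {1, -1}" "\<delta> \<in> {1, -1}" "\<epsilon>' \<in> {1, -1}" "\<delta>' \<in> {1, -1}" and "i < j" "i' < j'"
    using assms by (auto simp: signed_pairs_def)
  then have "\<not> (i = j' \<and> j = i')"
    by auto
  then show ?thesis
    unfolding eigenproj_bvv by (auto simp: eigencoord_eigenvec[OF s(1,3)] eigencoord_eigenvec[OF s(2,4)]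
        eigencoord_eigenvec[OF s(1,4)] eigencoord_eigenvec[OF s(2,3)])
qed

text \<open>
  The eigenlines are one-dimensional, so their scalars can be absorbed into \<open>b\<close>.
\<close>

lemma eigen_summand_eq:
  assumes "\<epsilon> \<in> {1, -1}" "\<delta> \<in> {1, -1}"
  shows "eigen_summand P J i \<epsilon> j \<delta> = range (\<lambda>b :: 'b cplx. bvv b (eigenvec J e i \<epsilon>) (eigenvec J e j \<delta>))"
    (is "_ = range ?g")
proof
  have "cplx.subspace (range ?g)"
    unfolding cplx.subspace_def
  proof (intro conjI ballI allI)
    have "?g (cscale 0 0) = 0"
      unfolding bvv_cscale(1) by (simp add: cscale_simps)
    then show "0 \<in> range ?g"
      by (rule range_eqI[OF sym])
    show "p + p' \<in> range ?g" if "p \<in> range ?g" "p' \<in> range ?g" for p p'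
    proof -
      obtain b b' where "p = ?g b" "p' = ?g b'"
        using \<open>p \<in> range ?g\<close> \<open>p' \<in> range ?g\<close> by blast
      then have "p + p' = ?g (b + b')"
        by (simp only: bvv_add(1))
      then show ?thesis
        by (rule range_eqI)
    qed
    show "cscale c p \<in> range ?g" if "p \<in> range ?g" for p c
    proof -
      obtain b where "p = ?g b"
        using \<open>p \<in> range ?g\<close> by blast
      then have "cscale c p = ?g (cscale c b)"
        by (simp only: bvv_cscale(1))
      then show ?thesis
        by (rule range_eqI)
    qed
  qed
  moreover have "bvv b x y \<in> range ?g" if xy: "x \<in> eigenline P J i \<epsilon>" "y \<in> eigenline P J j \<delta>" for b x y
  proof -
    obtain z where x: "x = cscale z (eigenvec J e i \<epsilon>)"
      using eigenline_multiple[OF assms(1) xy(1)] by blast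
    obtain z' where y: "y = cscale z' (eigenvec J e j \<delta>)"
      using eigenline_multiple[OF assms(2) xy(2)] by blast
    have "bvv b x y = ?g (cscale (z * z') b)"
      unfolding x y bvv_cscale cscale_simps by (simp only: mult.commute)
    then show ?thesis
      by blast
  qed
  ultimately show "eigen_summand P J i \<epsilon> j \<delta> \<subseteq> range ?g"
    unfolding eigen_summand_def by (intro cplx.span_minimal) auto
  show "range ?g \<subseteq> eigen_summand P J i \<epsilon> j \<delta>"
  proof (rule image_subsetI)
    fix b
    show "?g b \<in> eigen_summand P J i \<epsilon> j \<delta>"
      unfolding eigen_summand_def using eigenvec_mem[OF assms(1), of i] eigenvec_mem[OF assms(2), of j]
      by (intro cplx.span_base) blast
  qed
qed

text \<open>The projections \<open>eigenproj\<close> separate the summands from each other.\<close>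

lemma direct_family_eigen_summands:
  "direct_family (signed_pairs UNIV)
     (\<lambda>(i, \<epsilon>, j, \<delta>). eigen_summand P J i \<epsilon> j \<delta> :: ('b, 'v) lie tensor3 cplx set)"
  unfolding direct_family_def
proof (intro allI impI ballI, elim conjE)
  fix x :: "'l \<times> int \<times> 'l \<times> int \<Rightarrow> ('b, 'v) lie tensor3 cplx"
    and s :: "'l \<times> int \<times> 'l \<times> int"
  assume mem: "\<forall>s\<in>signed_pairs UNIV. x s \<in> (case s of (i, \<epsilon>, j, \<delta>) \<Rightarrow> eigen_summand P J i \<epsilon> j \<delta>)"
    and sum: "(\<Sum>s\<in>signed_pairs UNIV. x s) = 0" and s: "s \<in> signed_pairs UNIV"
  have "\<exists>b. x (i, \<epsilon>, j, \<delta>) = bvv b (eigenvec J e i \<epsilon>) (eigenvec J e j \<delta>)"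
    if q: "(i, \<epsilon>, j, \<delta>) \<in> signed_pairs UNIV" for i \<epsilon> j \<delta>
  proof -
    have "x (i, \<epsilon>, j, \<delta>) \<in> eigen_summand P J i \<epsilon> j \<delta>"
      using bspec[OF mem q] by simp
    moreover have "\<epsilon> \<in> {1, -1}" "\<delta> \<in> {1, -1}"
      using q by (auto simp: signed_pairs_def)
    ultimately show ?thesis
      using eigen_summand_eq[of \<epsilon> \<delta> i j] by blast
  qed
  then obtain b where b: "\<And>i \<epsilon> j \<delta>. (i, \<epsilon>, j, \<delta>) \<in> signed_pairs UNIV \<Longrightarrow>
      x (i, \<epsilon>, j, \<delta>) = bvv (b i \<epsilon> j \<delta>) (eigenvec J e i \<epsilon>) (eigenvec J e j \<delta>)"
    by metis
  obtain i \<epsilon> j \<delta> where s_eq: "s = (i, \<epsilon>, j, \<delta>)"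
    by (cases s)
  have fin: "finite (signed_pairs (UNIV :: 'l set))"
    by (rule finite_subset[of _ "UNIV \<times> {1, -1} \<times> UNIV \<times> {1, -1}"]) (auto simp: signed_pairs_def)
  have "capply \<phi> (b i \<epsilon> j \<delta>) = 0" for \<phi>
  proof -
    have "0 = eigenproj \<phi> i \<epsilon> j \<delta> (\<Sum>s\<in>signed_pairs UNIV. x s)"
      by (simp only: sum eigenproj_linear)
    also have "\<dots> = (\<Sum>s'\<in>signed_pairs UNIV. if s' = s then capply \<phi> (b i \<epsilon> j \<delta>) else 0)"
      unfolding eigenproj_sum
    proof (rule sum.cong)
      fix s' assume s': "s' \<in> signed_pairs (UNIV :: 'l set)"
      obtain i' \<epsilon>' j' \<delta>' where s'_eq: "s' = (i', \<epsilon>', j', \<delta>')"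
        by (cases s')
      show "eigenproj \<phi> i \<epsilon> j \<delta> (x s') = (if s' = s then capply \<phi> (b i \<epsilon> j \<delta>) else 0)"
        unfolding s'_eq b[OF s'[unfolded s'_eq]] eigenproj_eigenvec[OF s[unfolded s_eq] s'[unfolded s'_eq]]
        by (auto simp: s_eq)
    qed simp
    also have "\<dots> = capply \<phi> (b i \<epsilon> j \<delta>)"
      using fin s by simp
    finally show ?thesis ..
  qed
  then have "b i \<epsilon> j \<delta> = 0"
    by (rule capply_separates)
  then have "x s = bvv (cscale 0 0) (eigenvec J e i \<epsilon>) (eigenvec J e j \<delta>)"
    using s b by (simp add: s_eq cscale_simps)
  then show "x s = 0"
    unfolding bvv_cscale by (simp add: cscale_simps)
qed

end

section \<open>Exponents and marker cancellation\<close>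

lemma pair_exp_nth: "i \<noteq> j \<Longrightarrow> pair_exp i \<epsilon> j \<delta> $ l = (if l = i then \<epsilon> else if l = j then \<delta> else 0)"
  by (auto simp: pair_exp_def axis_def)

lemma pair_exp_inner:
  "cast_vec (pair_exp i \<epsilon> j \<delta>) \<bullet> \<theta> = of_int \<epsilon> * \<theta> $ i + of_int \<delta> * \<theta> $ j" for \<theta> :: "real^'l::finite"
proof -
  have "(cast_vec (pair_exp i \<epsilon> j \<delta>) :: real^'l) = axis i (of_int \<epsilon>) + axis j (of_int \<delta>)"
    by (simp add: Finite_Cartesian_Product.vec_eq_iff pair_exp_def axis_def)
  then show ?thesis
    by (simp add: inner_add_left inner_axis')
qed

abbreviation exponent_of :: "'l \<times> int \<times> 'l \<times> int \<Rightarrow> int^'l::finite" where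
  "exponent_of \<equiv> \<lambda>(i, \<epsilon>, j, \<delta>). pair_exp i \<epsilon> j \<delta>"

lemma inj_on_exponent: "inj_on exponent_of (signed_pairs (UNIV :: 'l::{finite,linorder} set))"
proof (rule inj_onI)
  fix s s' :: "'l \<times> int \<times> 'l \<times> int"
  assume s: "s \<in> signed_pairs UNIV" "s' \<in> signed_pairs UNIV" "exponent_of s = exponent_of s'"
  obtain i \<epsilon> j \<delta> where s1: "s = (i, \<epsilon>, j, \<delta>)" by (cases s)
  obtain i' \<epsilon>' j' \<delta>' where s2: "s' = (i', \<epsilon>', j', \<delta>')" by (cases s')
  have lt: "i < j" "i' < j'" and nz: "\<epsilon> \<noteq> 0" "\<delta> \<noteq> 0" "\<epsilon>' \<noteq> 0" "\<delta>' \<noteq> 0"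
    using s(1,2) by (auto simp: signed_pairs_def s1 s2)
  have eq: "(if l = i then \<epsilon> else if l = j then \<delta> else 0) = (if l = i' then \<epsilon>' else if l = j' then \<delta>' else 0)" for l
    using s(3) pair_exp_nth[of i j \<epsilon> \<delta> l] pair_exp_nth[of i' j' \<epsilon>' \<delta>' l] lt by (simp add: s1 s2)
  have "i = i' \<or> i = j'" "j = i' \<or> j = j'" "i' = i \<or> i' = j" "j' = i \<or> j' = j"
    using eq[of i] eq[of j] eq[of i'] eq[of j'] nz by (auto split: if_splits)
  then have ij: "i = i'" "j = j'"
    using lt by auto
  then show "s = s'"
    using eq[of i] eq[of j] lt by (auto simp: s1 s2 split: if_splits)
qed

lemma signed_pairs_mono: "signed_pairs I \<subseteq> signed_pairs UNIV"
  by (auto simp: signed_pairs_def)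

lemma finite_signed_pairs: "finite (signed_pairs (I :: 'l::{finite,linorder} set))"
  by (rule finite_subset[of _ "UNIV \<times> {1, -1} \<times> UNIV \<times> {1, -1}"]) (auto simp: signed_pairs_def)

lemma exponent_of_Zpow: "s \<in> signed_pairs I \<Longrightarrow> exponent_of s \<in> Zpow I"
  by (auto simp: signed_pairs_def Zpow_def pair_exp_def axis_def)

lemma sum_signs: "(\<Sum>\<epsilon>\<in>{1, -1::int}. g \<epsilon>) = g 1 + g (-1)" for g :: "int \<Rightarrow> 'z::comm_monoid_add"
  by simp

lemma sum_signed_pairs:
  "(\<Sum>(i, j)\<in>{(i, j). i < j}. \<Sum>\<epsilon>\<in>{1, -1}. \<Sum>\<delta>\<in>{1, -1}. g (i, \<epsilon>, j, \<delta>)) = (\<Sum>s\<in>signed_pairs UNIV. g s)"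
  for g :: "'l::{finite,linorder} \<times> int \<times> 'l \<times> int \<Rightarrow> 'z::comm_monoid_add"
proof -
  have "(\<Sum>(i, j)\<in>{(i, j). i < j}. \<Sum>\<epsilon>\<in>{1, -1}. \<Sum>\<delta>\<in>{1, -1}. g (i, \<epsilon>, j, \<delta>))
      = (\<Sum>(p, r)\<in>{(i :: 'l, j). i < j} \<times> ({1, -1} \<times> {1, -1}). g (fst p, fst r, snd p, snd r))"
    unfolding sum.cartesian_product by (simp add: sum.cartesian_product' case_prod_unfold)
  also have "\<dots> = (\<Sum>s\<in>signed_pairs UNIV. g s)"
    by (rule sum.reindex_bij_witness[of _ "\<lambda>(i, \<epsilon>, j, \<delta>). ((i, j), (\<epsilon>, \<delta>))" "\<lambda>((i, j), (\<epsilon>, \<delta>)). (i, \<epsilon>, j, \<delta>)"])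
      (auto simp: signed_pairs_def)
  finally show ?thesis .
qed

context rotational_frame
begin

lemma marked_bivector_eval:
  assumes "\<And>l. u l \<in> P l" and X: "X \<in> P k"
  shows "blinfun_apply (blinfun_apply (marked_bivector h u) (on_b \<phi>)) (on_v X)
    = blinfun_apply \<phi> (h k) * (X \<bullet> u k)"
proof -
  have "blinfun_apply (blinfun_apply (marked_bivector h u) (on_b \<phi>)) (on_v X)
      = (\<Sum>l\<in>UNIV. blinfun_apply \<phi> (h l) * (X \<bullet> u l))"
    by (simp add: marked_bivector_def blinfun.sum_left wedge2_apply)
  also have "\<dots> = (\<Sum>l\<in>UNIV. if l = k then blinfun_apply \<phi> (h k) * (X \<bullet> u k) else 0)"
    by (rule sum.cong) (use P_orth[OF _ X assms(1)] in auto)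
  finally show ?thesis
    by simp
qed

text \<open>
  A positive marking has \<open>lam k (h k) \<noteq> 0\<close>, so evaluation at \<open>lam k\<close> recovers \<open>u k\<close>.
\<close>

lemma marked_bivector_inj:
  assumes "\<And>l. u l \<in> P l" "\<And>l. u' l \<in> P l" "marked_bivector h u = (marked_bivector h u' :: ('b, 'v) lie tensor2)"
  shows "u = u'"
proof
  fix k
  have "X \<bullet> u k = X \<bullet> u' k" if X: "X \<in> P k" for X
    using marked_bivector_eval[OF assms(1) X, of "lam k"] marked_bivector_eval[OF assms(2) X, of "lam k"]
      assms(3) lam_pos[of k] by simp
  from this[OF e_mem] this[OF f_mem] show "u k = u' k"
    using plane_expand[OF assms(1), of k] plane_expand[OF assms(2), of k] by (metis inner_commute)
qed

lemma components_marked: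
  assumes "\<And>l. u l \<in> P l"
  shows "components P h (marked_bivector h u) = u"
  unfolding components_def
  by (rule the_equality) (use assms marked_bivector_inj in blast)+

lemma E_vec_eval:
  "ev3 (lam k) (e k) (f k) (E_vec J lam e h l)
    = (if l = k then 2 * (blinfun_apply (lam k) (h k))\<^sup>2 else 0)"
  by (simp add: E_vec_def ev3_linear ev3_wedge3 f_def[symmetric] frame_inner power2_eq_square)

lemma E_vec_independent:
  assumes "(\<Sum>l\<in>UNIV. a l *\<^sub>R E_vec J lam e h l) = (\<Sum>l\<in>UNIV. b l *\<^sub>R E_vec J lam e h l)"
  shows "a k = b k"
proof -
  have sum: "ev3 \<phi> X X' (\<Sum>l\<in>S. g l) = (\<Sum>l\<in>S. ev3 \<phi> X X' (g l))" for \<phi> X X' g and S :: "'l set"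
    by (induction S rule: infinite_finite_induct) (auto simp: ev3_linear)
  have *: "ev3 (lam k) (e k) (f k) (\<Sum>l\<in>UNIV. c l *\<^sub>R E_vec J lam e h l) = c k * (2 * (blinfun_apply (lam k) (h k))\<^sup>2)" for c
  proof -
    have "ev3 (lam k) (e k) (f k) (\<Sum>l\<in>UNIV. c l *\<^sub>R E_vec J lam e h l)
        = (\<Sum>l\<in>UNIV. if l = k then c k * (2 * (blinfun_apply (lam k) (h k))\<^sup>2) else 0)"
      unfolding sum ev3_linear E_vec_eval by (rule sum.cong) auto
    then show ?thesis
      by simp
  qed
  show ?thesis
    using *[of a] *[of b] assms lam_pos[of k] by simp
qed

text \<open>
  With \<open>s = \<epsilon>\<delta>\<close>, the coefficient vanishes iff \<open>s \<lambda>\<^sub>j(h\<^sub>i) h\<^sub>j = \<lambda>\<^sub>i(h\<^sub>j) h\<^sub>i\<close>.  Applying \<open>\<lambda>\<^sub>i\<close> and \<open>\<lambda>\<^sub>j\<close> to this equation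
  determines its coefficients: either both vanish, so that there is no edge, or
  \<open>s \<lambda>\<^sub>j(h\<^sub>i) = \<lambda>\<^sub>i(h\<^sub>i)\<close> and \<open>\<lambda>\<^sub>i(h\<^sub>j) = s \<lambda>\<^sub>j(h\<^sub>j)\<close>, and the equation is the proportionality of the
  normalized markers.
\<close>

lemma marker_cancellation:
  assumes ij: "i < j" and \<epsilon>: "\<epsilon> \<in> {1, -1}" and \<delta>: "\<delta> \<in> {1, -1}"
  shows "c_coeff lam h i \<epsilon> j \<delta> \<noteq> 0 \<longleftrightarrow> {i, j} \<in> marker_graph lam h \<and>
     (1 / lam j (h j)) *\<^sub>R h j \<noteq> of_int (\<epsilon> * \<delta>) *\<^sub>R ((1 / lam i (h i)) *\<^sub>R h i)"
proof -
  define p r where "p = lam j (h i)" and "r = lam i (h j)"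
  define li lj where "li = lam i (h i)" and "lj = lam j (h j)"
  define s :: real where "s = of_int \<epsilon> * of_int \<delta>"
  have s: "s * s = 1" "of_int \<delta> = of_int \<epsilon> * s" "of_int (\<epsilon> * \<delta>) = s" "s \<noteq> 0"
    using \<epsilon> \<delta> by (auto simp: s_def)
  have \<epsilon>\<epsilon>: "real_of_int \<epsilon> * real_of_int \<epsilon> = 1" "real_of_int \<epsilon> \<noteq> 0"
    using \<epsilon> by auto
  have pos: "li > 0" "lj > 0"
    using lam_pos by (auto simp: li_def lj_def)
  have c0: "c_coeff lam h i \<epsilon> j \<delta> = 0 \<longleftrightarrow> (s * p) *\<^sub>R h j = r *\<^sub>R h i"
  proof -
    have "c_coeff lam h i \<epsilon> j \<delta> = 0 \<longleftrightarrow> (of_int \<delta> * p) *\<^sub>R h j - (of_int \<epsilon> * r) *\<^sub>R h i = 0"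
      unfolding c_coeff_def cscale_eq_0_iff by (simp add: zero_prod_def p_def r_def)
    also have "(of_int \<delta> * p) *\<^sub>R h j - (of_int \<epsilon> * r) *\<^sub>R h i = of_int \<epsilon> *\<^sub>R ((s * p) *\<^sub>R h j - r *\<^sub>R h i)"
      by (simp add: s(2) scaleR_diff_right mult.assoc)
    finally show ?thesis
      using \<epsilon>\<epsilon> by simp
  qed
  have edge: "{i, j} \<in> marker_graph lam h \<longleftrightarrow> p \<noteq> 0 \<or> r \<noteq> 0"
    using ij by (auto simp: marker_graph_def doubleton_eq_iff p_def r_def)
  have parallel: "(1 / lj) *\<^sub>R h j = s *\<^sub>R ((1 / li) *\<^sub>R h i) \<longleftrightarrow> li *\<^sub>R h j = (s * lj) *\<^sub>R h i"
  proof -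
    have "(li * lj) *\<^sub>R ((1 / lj) *\<^sub>R h j) = li *\<^sub>R h j"
      "(li * lj) *\<^sub>R (s *\<^sub>R ((1 / li) *\<^sub>R h i)) = (s * lj) *\<^sub>R h i"
      using pos by (simp_all add: mult.commute)
    then show ?thesis
      using scaleR_cancel_left[of "li * lj" "(1 / lj) *\<^sub>R h j" "s *\<^sub>R ((1 / li) *\<^sub>R h i)"] pos by auto
  qed
  have "(s * p) *\<^sub>R h j = r *\<^sub>R h i \<longleftrightarrow> (p = 0 \<and> r = 0) \<or> li *\<^sub>R h j = (s * lj) *\<^sub>R h i"
  proof
    assume eq: "(s * p) *\<^sub>R h j = r *\<^sub>R h i"
    have 1: "s * p * lj = r * p" and 2: "s * p * r = r * li"
      using arg_cong[OF eq, of "blinfun_apply (lam j)"] arg_cong[OF eq, of "blinfun_apply (lam i)"]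
      by (simp_all add: blinfun.scaleR_right p_def r_def li_def lj_def)
    show "(p = 0 \<and> r = 0) \<or> li *\<^sub>R h j = (s * lj) *\<^sub>R h i"
    proof (cases "p = 0")
      case True
      then show ?thesis
        using 2 pos by simp
    next
      case False
      then have r: "r = s * lj"
        using 1 by simp
      then have "r \<noteq> 0"
        using pos s(4) by simp
      then have "s * p = li"
        using 2 by (metis mult.commute mult_cancel_left)
      then show ?thesis
        using eq r by simp
    qed
  next
    assume "(p = 0 \<and> r = 0) \<or> li *\<^sub>R h j = (s * lj) *\<^sub>R h i"
    then show "(s * p) *\<^sub>R h j = r *\<^sub>R h i"
    proof
      assume eq: "li *\<^sub>R h j = (s * lj) *\<^sub>R h i"
      have 1: "li * lj = s * lj * p" and 2: "li * r = s * lj * li"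
        using arg_cong[OF eq, of "blinfun_apply (lam j)"] arg_cong[OF eq, of "blinfun_apply (lam i)"]
        by (simp_all add: blinfun.scaleR_right p_def r_def li_def lj_def)
      have "lj * li = lj * (s * p)" "li * r = li * (s * lj)"
        using 1 2 by (simp_all add: ac_simps)
      then have "li = s * p" "r = s * lj"
        using pos by (metis less_irrefl mult_cancel_left)+
      then show ?thesis
        using eq by simp
    qed simp
  qed
  then show ?thesis
    unfolding c0 edge s(3) li_def[symmetric] lj_def[symmetric] parallel by blast
qed

subsection \<open>The angular map in eigenvectors\<close>

abbreviation eigen_term :: "'l \<times> int \<times> 'l \<times> int \<Rightarrow> ('b, 'v) lie tensor3 cplx" where
  "eigen_term \<equiv> \<lambda>(i, \<epsilon>, j, \<delta>). bvv (c_coeff lam h i \<epsilon> j \<delta>) (eigenvec J e i \<epsilon>) (eigenvec J e j \<delta>)"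

text \<open>
  The second decomposition follows the first, as \<open>J\<close> acts on the eigenvectors by \<open>\<epsilon> \<i>\<close>.
\<close>

lemma real_in_eigenvecs:
  fixes a b :: real
  defines "z \<epsilon> \<equiv> Complex a (of_int \<epsilon> * b) / sqrt 2"
  shows "(a *\<^sub>R e l + b *\<^sub>R f l, 0) = cscale (z 1) (eigenvec J e l 1) + cscale (z (-1)) (eigenvec J e l (-1))"
    and "(J l (a *\<^sub>R e l + b *\<^sub>R f l), 0)
      = cscale (\<i> * z 1) (eigenvec J e l 1) + cscale (- \<i> * z (-1)) (eigenvec J e l (-1))"
proof -
  have s: "complex_of_real (sqrt 2) * complex_of_real (sqrt 2) = 2"
    by (simp flip: of_real_mult)
  have z: "z \<epsilon> * (1 / sqrt 2) = Complex (a / 2) (of_int \<epsilon> * b / 2)" for \<epsilon>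
    unfolding z_def times_divide_times_eq s by (simp add: complex_eq_iff)
  have v: "cscale (y * z \<epsilon>) (eigenvec J e l \<epsilon>) = cscale (y * Complex (a / 2) (of_int \<epsilon> * b / 2)) (e l, - of_int \<epsilon> *\<^sub>R f l)" for y \<epsilon>
    unfolding eigenvec_eq cscale_simps mult.assoc z ..
  have half: "c *\<^sub>R x = (c / 2) *\<^sub>R x + (c / 2) *\<^sub>R x" for x :: 'v and c :: real
    by (simp flip: scaleR_add_left)
  show "(a *\<^sub>R e l + b *\<^sub>R f l, 0) = cscale (z 1) (eigenvec J e l 1) + cscale (z (-1)) (eigenvec J e l (-1))"
    unfolding v[of 1 1, unfolded mult_1] v[of 1 "-1", unfolded mult_1] half[of a "e l"] half[of b "f l"]
    by (simp add: cscale_def algebra_simps)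
  show "(J l (a *\<^sub>R e l + b *\<^sub>R f l), 0)
      = cscale (\<i> * z 1) (eigenvec J e l 1) + cscale (- \<i> * z (-1)) (eigenvec J e l (-1))"
    unfolding v[of \<i> 1] v[of "- \<i>" "-1"] J_expand half[of a "f l"] half[of b "e l"]
    by (simp add: cscale_def algebra_simps)
qed

text \<open>
  Expand both arguments of each summand of \<open>\<mu>\<close> in eigenvectors.  In the term with signs \<open>\<epsilon>\<close>, \<open>\<delta>\<close> the
  quarter-turns contribute the factors \<open>\<delta> \<i>\<close> and \<open>\<epsilon> \<i>\<close>, which assemble into \<open>c_coeff\<close>.
\<close>

lemma mu_of_eigen_terms:
  fixes a b :: "'l \<Rightarrow> real"
  defines "z l \<epsilon> \<equiv> Complex (a l) (of_int \<epsilon> * b l) / sqrt 2"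
  shows "(mu_of J lam h (\<lambda>l. a l *\<^sub>R e l + b l *\<^sub>R f l), 0)
    = (\<Sum>s\<in>signed_pairs UNIV. case s of (i, \<epsilon>, j, \<delta>) \<Rightarrow> cscale (z i \<epsilon> * z j \<delta>) (eigen_term (i, \<epsilon>, j, \<delta>)))"
proof -
  define u where "u l = a l *\<^sub>R e l + b l *\<^sub>R f l" for l
  define B where "B i = (h i, 0 :: 'b)" for i
  have u: "(u l, 0) = cscale (z l 1) (eigenvec J e l 1) + cscale (z l (-1)) (eigenvec J e l (-1))"
    and Ju: "(J l (u l), 0) = cscale (\<i> * z l 1) (eigenvec J e l 1) + cscale (- \<i> * z l (-1)) (eigenvec J e l (-1))" for l
    unfolding u_def z_def by (rule real_in_eigenvecs)+
  have real: "(wedge3 (in_b b) (in_v x) (in_v y), 0) = bvv (b, 0) (x, 0) (y, 0)" for b :: 'b and x y :: 'v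
    by (simp add: cwedge3_real[symmetric] in_b_def in_v_def zero_prod_def)
  have rs: "(c *\<^sub>R x, 0) = cscale (complex_of_real c) (x, 0 :: 'w)" for c and x :: "'w::real_vector"
    by (simp add: cscale_def)
  have c: "c_coeff lam h i \<epsilon> j \<delta> = cscale (2 * \<i> * of_int \<delta> * lam j (h i)) (B j)
      + cscale (- (2 * \<i> * of_int \<epsilon> * lam i (h j))) (B i)" for i j \<epsilon> \<delta>
    by (simp add: c_coeff_def B_def cscale_def algebra_simps)
  have pair: "(2 *\<^sub>R (lam j (h i) *\<^sub>R wedge3 (in_b (h j)) (in_v (u i)) (in_v (J j (u j)))
      - lam i (h j) *\<^sub>R wedge3 (in_b (h i)) (in_v (J i (u i))) (in_v (u j))), 0)
    = (\<Sum>\<epsilon>\<in>{1, -1}. \<Sum>\<delta>\<in>{1, -1}. cscale (z i \<epsilon> * z j \<delta>) (eigen_term (i, \<epsilon>, j, \<delta>)))" for i j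
  proof -
    have eq: "(2 *\<^sub>R (lam j (h i) *\<^sub>R wedge3 (in_b (h j)) (in_v (u i)) (in_v (J j (u j)))
        - lam i (h j) *\<^sub>R wedge3 (in_b (h i)) (in_v (J i (u i))) (in_v (u j))), 0 :: ('b, 'v) lie tensor3)
      = cscale (2 * lam j (h i)) (bvv (B j) (u i, 0) (J j (u j), 0))
        + cscale (- (2 * lam i (h j))) (bvv (B i) (J i (u i), 0) (u j, 0))"
      unfolding B_def real[symmetric] by (simp add: cscale_def scaleR_diff_right)
    show ?thesis
      unfolding eq u Ju sum_signs prod.case c bvv_add bvv_cscale cscale_simps(3,5)
      by (simp add: cscale_simps(7) algebra_simps)
  qed
  have "(mu_of J lam h u, 0) = (\<Sum>(i, j)\<in>{(i, j). i < j}.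
      (2 *\<^sub>R (lam j (h i) *\<^sub>R wedge3 (in_b (h j)) (in_v (u i)) (in_v (J j (u j)))
      - lam i (h j) *\<^sub>R wedge3 (in_b (h i)) (in_v (J i (u i))) (in_v (u j))), 0))"
    unfolding mu_of_def by (simp add: prod_eq_iff fst_sum snd_sum case_prod_unfold scaleR_sum_right)
  also have "\<dots> = (\<Sum>(i, j)\<in>{(i, j). i < j}. \<Sum>\<epsilon>\<in>{1, -1}. \<Sum>\<delta>\<in>{1, -1}.
      (case (i, \<epsilon>, j, \<delta>) of (i, \<epsilon>, j, \<delta>) \<Rightarrow> cscale (z i \<epsilon> * z j \<delta>) (eigen_term (i, \<epsilon>, j, \<delta>))))"
    unfolding pair by (simp add: case_prod_unfold)
  also have "\<dots> = (\<Sum>s\<in>signed_pairs UNIV. case s of (i, \<epsilon>, j, \<delta>) \<Rightarrow> cscale (z i \<epsilon> * z j \<delta>) (eigen_term (i, \<epsilon>, j, \<delta>)))"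
    by (rule sum_signed_pairs)
  finally show ?thesis
    unfolding u_def .
qed

end

section \<open>The Laurent form of the angular map\<close>

lemma wedge2_linear:
  "wedge2 x (y + y') = wedge2 x y + wedge2 x y'" "wedge2 x (c *\<^sub>R y) = c *\<^sub>R wedge2 x y"
  by (simp_all add: wedge2_def tensor2_def eval_at_simps tensor_simps scaleR_diff_right)

context rotational_frame
begin

definition re_part :: "'l set \<Rightarrow> ('l \<Rightarrow> real) \<Rightarrow> real^('l::{finite,linorder}) \<Rightarrow> 'l \<Rightarrow> real" where
  "re_part I t \<theta> l = (if l \<in> I then sqrt (t l) * cos (\<theta> $ l) else 0)"

definition im_part :: "'l set \<Rightarrow> ('l \<Rightarrow> real) \<Rightarrow> real^('l::{finite,linorder}) \<Rightarrow> 'l \<Rightarrow> real" where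
  "im_part I t \<theta> l = (if l \<in> I then sqrt (t l) * sin (\<theta> $ l) else 0)"

lemma angle_point_marked:
  "angle_point J e h I t \<theta> = marked_bivector h (\<lambda>l. re_part I t \<theta> l *\<^sub>R e l + im_part I t \<theta> l *\<^sub>R f l)"
  unfolding angle_point_def
  by (rule arg_cong[of _ _ "marked_bivector h"]) (auto simp: re_part_def im_part_def f_def scaleR_add_right)

lemma components_angle_point:
  "components P h (angle_point J e h I t \<theta>) = (\<lambda>l. re_part I t \<theta> l *\<^sub>R e l + im_part I t \<theta> l *\<^sub>R f l)"
  unfolding angle_point_marked by (rule components_marked) (rule plane_mem)

lemma angle_point_continuous:
  "continuous_on UNIV (angle_point J e h I t :: _ \<Rightarrow> ('b, 'v) lie tensor2)"
proof -
  have "angle_point J e h I t \<theta> = (\<Sum>l\<in>UNIV. re_part I t \<theta> l *\<^sub>R wedge2 (in_b (h l)) (in_v (e l))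
      + im_part I t \<theta> l *\<^sub>R wedge2 (in_b (h l)) (in_v (f l)))" for \<theta>
  proof -
    have "in_v (a *\<^sub>R x + b *\<^sub>R y) = a *\<^sub>R in_v x + (b *\<^sub>R in_v y :: ('b, 'v) lie)" for a b and x y :: 'v
      by (simp add: in_v_def)
    then show ?thesis
      by (simp add: angle_point_marked marked_bivector_def wedge2_linear)
  qed
  moreover have "continuous_on UNIV (\<lambda>\<theta>. re_part I t \<theta> l)" "continuous_on UNIV (\<lambda>\<theta>. im_part I t \<theta> l)" for l
    by (cases "l \<in> I"; simp add: re_part_def im_part_def; intro continuous_intros)+
  ultimately show ?thesis
    by (simp add: continuous_intros)
qed

lemma plane_norm: "(norm (a *\<^sub>R e l + b *\<^sub>R f l))\<^sup>2 = a\<^sup>2 + b\<^sup>2"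
  unfolding power2_norm_eq_inner using frame_inner[of l l]
  by (simp add: inner_add_left inner_add_right power2_eq_square)

lemma polar_norm: "t l > 0 \<or> l \<notin> I \<Longrightarrow> (re_part I t \<theta> l)\<^sup>2 + (im_part I t \<theta> l)\<^sup>2 = (if l \<in> I then t l else 0)"
  by (auto simp: re_part_def im_part_def power_mult_distrib simp flip: distrib_left)

text \<open>
  The trivectors \<open>E\<^sub>l\<close> are independent, so \<open>\<Phi>(r) = Y\<close> prescribes the norm of each \<open>u\<^sub>l\<close> and leaves its
  angle free.
\<close>

lemma T_space_eq:
  assumes t: "\<And>l. l \<in> I \<Longrightarrow> t l > 0"
  shows "T_space P J lam e h (\<Sum>l\<in>I. t l *\<^sub>R E_vec J lam e h l) = range (angle_point J e h I t)"
proof -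
  have Y: "(\<Sum>l\<in>I. t l *\<^sub>R E_vec J lam e h l) = (\<Sum>l\<in>UNIV. (if l \<in> I then t l else 0) *\<^sub>R E_vec J lam e h l)"
    by (rule sum.mono_neutral_cong_left) auto
  show ?thesis
  proof
    show "range (angle_point J e h I t) \<subseteq> T_space P J lam e h (\<Sum>l\<in>I. t l *\<^sub>R E_vec J lam e h l)"
    proof (rule image_subsetI)
      fix \<theta>
      have "angle_point J e h I t \<theta> \<in> S_space P h"
        unfolding angle_point_marked S_space_def using plane_mem by blast
      moreover have "Phi P J lam e h (angle_point J e h I t \<theta>) = (\<Sum>l\<in>I. t l *\<^sub>R E_vec J lam e h l)"
        unfolding Phi_def components_angle_point Phi_of_def plane_norm Y
        by (rule sum.cong) (use t in \<open>auto simp: polar_norm\<close>)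
      ultimately show "angle_point J e h I t \<theta> \<in> T_space P J lam e h (\<Sum>l\<in>I. t l *\<^sub>R E_vec J lam e h l)"
        by (simp add: T_space_def)
    qed
    show "T_space P J lam e h (\<Sum>l\<in>I. t l *\<^sub>R E_vec J lam e h l) \<subseteq> range (angle_point J e h I t)"
    proof
      fix p assume "p \<in> T_space P J lam e h (\<Sum>l\<in>I. t l *\<^sub>R E_vec J lam e h l)"
      then obtain u where p: "p = marked_bivector h u" "\<And>l. u l \<in> P l"
        and Phi: "Phi P J lam e h p = (\<Sum>l\<in>I. t l *\<^sub>R E_vec J lam e h l)"
        by (auto simp: T_space_def S_space_def)
      define a b where "a l = u l \<bullet> e l" and "b l = u l \<bullet> f l" for l
      have u: "u l = a l *\<^sub>R e l + b l *\<^sub>R f l" for l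
        using plane_expand[OF p(2)] by (simp add: a_def b_def)
      have comp: "components P h p = u"
        unfolding p(1) by (rule components_marked[OF p(2)])
      have "(norm (u l))\<^sup>2 = (if l \<in> I then t l else 0)" for l
        by (rule E_vec_independent) (use Phi in \<open>simp add: Phi_def comp Phi_of_def Y\<close>)
      then have ab: "(a l)\<^sup>2 + (b l)\<^sup>2 = (if l \<in> I then t l else 0)" for l
        by (simp only: u plane_norm)
      have "\<exists>\<phi>. a l = sqrt (t l) * cos \<phi> \<and> b l = sqrt (t l) * sin \<phi>" if l: "l \<in> I" for l
      proof -
        have "(a l / sqrt (t l))\<^sup>2 + (b l / sqrt (t l))\<^sup>2 = 1"
          using ab[of l] t[OF l] l by (simp add: power_divide flip: add_divide_distrib)
        then obtain \<phi> where "a l / sqrt (t l) = cos \<phi>" "b l / sqrt (t l) = sin \<phi>"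
          using sincos_total_2pi by metis
        then show ?thesis
          using t[OF l] by (intro exI[of _ \<phi>]) (simp add: field_simps)
      qed
      then obtain \<phi> where \<phi>: "\<And>l. l \<in> I \<Longrightarrow> a l = sqrt (t l) * cos (\<phi> l) \<and> b l = sqrt (t l) * sin (\<phi> l)"
        by metis
      have "a l = re_part I t (\<chi> l. \<phi> l) l" "b l = im_part I t (\<chi> l. \<phi> l) l" for l
        using \<phi>[of l] ab[of l] by (auto simp: re_part_def im_part_def sum_power2_eq_zero_iff)
      then have "p = angle_point J e h I t (\<chi> l. \<phi> l)"
        unfolding p(1) angle_point_marked by (simp add: u[abs_def])
      then show "p \<in> range (angle_point J e h I t)"
        by blast
    qed
  qed
qed

lemma angle_point_eq_iff:
  assumes t: "\<And>l. l \<in> I \<Longrightarrow> t l > 0"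
  shows "angle_point J e h I t \<theta> = (angle_point J e h I t \<theta>' :: ('b, 'v) lie tensor2)
    \<longleftrightarrow> torus_class I \<theta> = torus_class I \<theta>'"
proof -
  have cis: "torus_class I \<theta> = torus_class I \<theta>' \<longleftrightarrow> (\<forall>l\<in>I. cis (\<theta> $ l) = cis (\<theta>' $ l))"
    by (simp add: torus_class_eq_iff cis_eq_iff_periods)
  show ?thesis
  proof
    assume eq: "angle_point J e h I t \<theta> = (angle_point J e h I t \<theta>' :: ('b, 'v) lie tensor2)"
    have "(\<lambda>l. re_part I t \<theta> l *\<^sub>R e l + im_part I t \<theta> l *\<^sub>R f l)
        = (\<lambda>l. re_part I t \<theta>' l *\<^sub>R e l + im_part I t \<theta>' l *\<^sub>R f l)"
      using eq by (simp flip: components_angle_point)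
    then have u: "re_part I t \<theta> l *\<^sub>R e l + im_part I t \<theta> l *\<^sub>R f l
        = re_part I t \<theta>' l *\<^sub>R e l + im_part I t \<theta>' l *\<^sub>R f l" for l
      by (rule fun_cong)
    have "re_part I t \<theta> l = re_part I t \<theta>' l" "im_part I t \<theta> l = im_part I t \<theta>' l" for l
      using arg_cong[OF u[of l], of "inner (e l)"] arg_cong[OF u[of l], of "inner (f l)"] frame_inner[of l l]
      by (simp_all add: inner_add_right)
    then have "cos (\<theta> $ l) = cos (\<theta>' $ l) \<and> sin (\<theta> $ l) = sin (\<theta>' $ l)" if "l \<in> I" for l
      using t[OF that] that unfolding re_part_def im_part_def
      by (metis less_irrefl mult_cancel_left real_sqrt_eq_zero_cancel_iff)
    then show "torus_class I \<theta> = torus_class I \<theta>'"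
      unfolding cis by (simp add: complex_eq_iff)
  next
    assume "torus_class I \<theta> = torus_class I \<theta>'"
    then have "cos (\<theta> $ l) = cos (\<theta>' $ l)" "sin (\<theta> $ l) = sin (\<theta>' $ l)" if "l \<in> I" for l
      using that unfolding cis by (auto simp: complex_eq_iff)
    then have "re_part I t \<theta> = re_part I t \<theta>'" "im_part I t \<theta> = im_part I t \<theta>'"
      by (auto simp: re_part_def im_part_def fun_eq_iff)
    then show "angle_point J e h I t \<theta> = (angle_point J e h I t \<theta>' :: ('b, 'v) lie tensor2)"
      by (simp add: angle_point_marked)
  qed
qed

lemma T_space_homeomorphism:
  assumes t: "\<And>l. l \<in> I \<Longrightarrow> t l > 0"
  shows "homeomorphic_map (torus_topology I)
      (top_of_set (T_space P J lam e h (\<Sum>l\<in>I. t l *\<^sub>R E_vec J lam e h l)))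
      (on_torus I (angle_point J e h I t))"
    and "on_torus I (angle_point J e h I t :: _ \<Rightarrow> ('b, 'v) lie tensor2) (torus_class I \<theta>) = angle_point J e h I t \<theta>"
proof -
  let ?r = "angle_point J e h I t :: real^('l::{finite,linorder}) \<Rightarrow> ('b, 'v) lie tensor2"
  have eq_iff: "?r \<theta> = ?r \<theta>' \<longleftrightarrow> torus_class I \<theta> = torus_class I \<theta>'" for \<theta> \<theta>'
    by (rule angle_point_eq_iff) (rule t)
  then have per: "?r \<theta> = ?r \<theta>'" if "torus_class I \<theta> = torus_class I \<theta>'" for \<theta> \<theta>'
    using that by blast
  have T: "T_space P J lam e h (\<Sum>l\<in>I. t l *\<^sub>R E_vec J lam e h l) = range ?r"
    by (rule T_space_eq) (rule t)
  have r: "on_torus I ?r (torus_class I \<theta>) = ?r \<theta>" for \<theta>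
    by (rule on_torus_class) (rule per)
  then show "on_torus I ?r (torus_class I \<theta>) = ?r \<theta>" .
  have cont: "continuous_map (torus_topology I) euclidean (on_torus I ?r)"
    by (rule continuous_on_torus[OF per angle_point_continuous])
  have img: "on_torus I ?r ` topspace (torus_topology I) = range ?r"
    by (auto simp: topspace_torus carrier_torus_class r image_image)
  show "homeomorphic_map (torus_topology I)
      (top_of_set (T_space P J lam e h (\<Sum>l\<in>I. t l *\<^sub>R E_vec J lam e h l))) (on_torus I ?r)"
    unfolding T
  proof (rule T1_Spaces.continuous_imp_homeomorphic_map[OF _ compact_torus])
    show "continuous_map (torus_topology I) (top_of_set (range ?r)) (on_torus I ?r)"
      using cont img by (simp add: continuous_map_in_subtopology flip: image_subset_iff_funcset)
    show "Hausdorff_space (top_of_set (range ?r))"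
      by (simp add: Hausdorff_space_subtopology)
    show "on_torus I ?r ` topspace (torus_topology I) = topspace (top_of_set (range ?r))"
      by (simp add: img)
    show "inj_on (on_torus I ?r) (topspace (torus_topology I))"
      by (rule inj_onI) (auto simp: topspace_torus carrier_torus_class r eq_iff)
  qed
qed

lemma mu_X_space:
  assumes "\<And>l. u l \<in> P l"
  shows "mu_of J lam h u \<in> X_space P"
proof -
  have base: "wedge3 (in_b b) (in_v x) (in_v y) \<in> X_space P" if "i < j" "x \<in> P i" "y \<in> P j" for b :: 'b and x y i j
    unfolding X_space_def using that by (intro span_base) blast
  have "2 *\<^sub>R (\<Sum>(i, j)\<in>{(i, j). i < j}.
      lam j (h i) *\<^sub>R wedge3 (in_b (h j)) (in_v (u i)) (in_v (J j (u j)))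
    - lam i (h j) *\<^sub>R wedge3 (in_b (h i)) (in_v (J i (u i))) (in_v (u j))) \<in> span (X_space P :: ('b, 'v) lie tensor3 set)"
  proof (intro span_scale span_sum)
    fix ij assume "ij \<in> {(i :: 'l, j). i < j}"
    then obtain i j where ij: "ij = (i, j)" "i < j"
      by auto
    show "(case ij of (i, j) \<Rightarrow> lam j (h i) *\<^sub>R wedge3 (in_b (h j)) (in_v (u i)) (in_v (J j (u j)))
      - lam i (h j) *\<^sub>R wedge3 (in_b (h i)) (in_v (J i (u i))) (in_v (u j))) \<in> span (X_space P :: ('b, 'v) lie tensor3 set)"
      unfolding ij(1) prod.case
      by (intro span_diff span_scale span_base base[OF ij(2)] assms J_mem)
  qed
  then show ?thesis
    by (simp add: mu_of_def X_space_def span_span)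
qed

text \<open>
  The index quadruples that contribute an exponent; \<open>pair_of\<close> recovers the quadruple from the exponent.
\<close>

definition active :: "'l set \<Rightarrow> ('l \<times> int \<times> 'l \<times> int) set" where
  "active I = {s \<in> signed_pairs I. case s of (i, \<epsilon>, j, \<delta>) \<Rightarrow> c_coeff lam h i \<epsilon> j \<delta> \<noteq> 0}"

definition pair_of :: "'l set \<Rightarrow> int^('l::{finite,linorder}) \<Rightarrow> 'l \<times> int \<times> 'l \<times> int" where
  "pair_of I = inv_into (active I) exponent_of"

text \<open>
  The factor \<open>1/2\<close> is the product of the two factors \<open>1/\<surd>2\<close> that normalize the eigenvectors.
\<close>

definition amplitude :: "('l \<Rightarrow> real) \<Rightarrow> 'l \<times> int \<times> 'l \<times> int \<Rightarrow> complex" where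
  "amplitude t = (\<lambda>(i, \<epsilon>, j, \<delta>). of_real (sqrt (t i) * sqrt (t j) / 2))"

lemma active_sub: "active I \<subseteq> signed_pairs UNIV"
  by (auto simp: active_def signed_pairs_def)

lemma inj_active: "inj_on exponent_of (active I)"
  using inj_on_exponent active_sub by (rule inj_on_subset)

lemma exponents_active: "exponents lam h I = exponent_of ` active I"
  by (force simp: exponents_def active_def)

lemma pair_of: "s \<in> active I \<Longrightarrow> pair_of I (exponent_of s) = s"
  unfolding pair_of_def by (rule inv_into_f_f[OF inj_active])

lemma pair_of_mem:
  assumes "\<alpha> \<in> exponents lam h I"
  shows "pair_of I \<alpha> \<in> active I" "exponent_of (pair_of I \<alpha>) = \<alpha>"
proof -
  obtain s where "s \<in> active I" "\<alpha> = exponent_of s"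
    using assms by (auto simp: exponents_active)
  then show "pair_of I \<alpha> \<in> active I" "exponent_of (pair_of I \<alpha>) = \<alpha>"
    using pair_of by metis+
qed

lemma pair_exp_mem:
  assumes "(i, \<epsilon>, j, \<delta>) \<in> signed_pairs I"
  shows "pair_exp i \<epsilon> j \<delta> \<in> exponents lam h I \<longleftrightarrow> c_coeff lam h i \<epsilon> j \<delta> \<noteq> 0"
proof
  assume "pair_exp i \<epsilon> j \<delta> \<in> exponents lam h I"
  then obtain s where s: "s \<in> active I" "exponent_of (i, \<epsilon>, j, \<delta>) = exponent_of s"
    by (auto simp: exponents_active)
  then have "(i, \<epsilon>, j, \<delta>) = s"
    using assms signed_pairs_mono active_sub by (intro inj_onD[OF inj_on_exponent]) auto
  then show "c_coeff lam h i \<epsilon> j \<delta> \<noteq> 0"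
    using s(1) by (auto simp: active_def)
qed (use assms in \<open>force simp: exponents_def\<close>)

lemma exponents_Zpow: "exponents lam h I \<subseteq> Zpow I"
  unfolding exponents_active using exponent_of_Zpow by (force simp: active_def)

lemma finite_exponents: "finite (exponents lam h I)"
  unfolding exponents_active using finite_subset[OF active_sub finite_signed_pairs] by simp

lemma eigen_term_summand:
  fixes i j :: 'l
  assumes "(i, \<epsilon>, j, \<delta>) \<in> signed_pairs UNIV"
  shows "cscale c (eigen_term (i, \<epsilon>, j, \<delta>)) \<in> eigen_summand P J i \<epsilon> j \<delta>"
proof -
  have "\<epsilon> \<in> {1, -1}" "\<delta> \<in> {1, -1}"
    using assms by (auto simp: signed_pairs_def)
  then have "eigen_term (i, \<epsilon>, j, \<delta>) \<in> eigen_summand P J i \<epsilon> j \<delta>"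
    by (simp add: eigen_summand_eq)
  then show ?thesis
    unfolding eigen_summand_def by (rule cplx.span_scale)
qed

lemma eigen_term_nonzero:
  assumes "s \<in> active I"
  shows "eigen_term s \<noteq> 0"
proof
  assume 0: "eigen_term s = 0"
  obtain i \<epsilon> j \<delta> where s: "s = (i, \<epsilon>, j, \<delta>)" by (cases s)
  have mem: "(i, \<epsilon>, j, \<delta>) \<in> signed_pairs UNIV"
    using assms active_sub s by blast
  have "capply \<phi> (c_coeff lam h i \<epsilon> j \<delta>) = eigenproj \<phi> i \<epsilon> j \<delta> (eigen_term s)" for \<phi>
    using eigenproj_eigenvec[OF mem mem, of \<phi>] by (simp add: s)
  then have "capply \<phi> (c_coeff lam h i \<epsilon> j \<delta>) = 0" for \<phi>
    by (simp only: 0 eigenproj_linear)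
  then have "c_coeff lam h i \<epsilon> j \<delta> = 0"
    by (rule capply_separates)
  then show False
    using assms by (simp add: active_def s)
qed

text \<open>
  On \<open>T\<^sub>Y\<close> the eigencoordinate of \<open>u\<^sub>l\<close> for the sign \<open>\<epsilon>\<close> is \<open>\<surd>(t\<^sub>l/2)\<close> times the character \<open>\<epsilon> \<theta>\<^sub>l\<close>, and it
  vanishes for \<open>l \<notin> I\<close>.  So each eigen term comes with a character, and the terms that survive are
  those whose exponent occurs.
\<close>

lemma angular_map_laurent:
  "(mu P J lam h (angle_point J e h I t \<theta>), 0)
    = (\<Sum>\<alpha>\<in>exponents lam h I. cscale (amplitude t (pair_of I \<alpha>) * cis (cast_vec \<alpha> \<bullet> \<theta>)) (eigen_term (pair_of I \<alpha>)))"
proof -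
  define z where "z l \<epsilon> = Complex (re_part I t \<theta> l) (of_int \<epsilon> * im_part I t \<theta> l) / sqrt 2" for l and \<epsilon> :: int
  define T where "T s = (case s of (i :: 'l, \<epsilon>, j, \<delta>) \<Rightarrow> cscale (z i \<epsilon> * z j \<delta>) (eigen_term (i, \<epsilon>, j, \<delta>)))" for s
  have z_in: "z l \<epsilon> = of_real (sqrt (t l)) * cis (of_int \<epsilon> * \<theta> $ l) / sqrt 2" if "l \<in> I" "\<epsilon> \<in> {1, -1}" for l \<epsilon>
    using that by (auto simp: z_def re_part_def im_part_def complex_eq_iff)
  have z_out: "z l \<epsilon> = 0" if "l \<notin> I" for l \<epsilon>
    using that by (simp add: z_def re_part_def im_part_def complex_eq_iff)
  have s2: "complex_of_real (sqrt 2) * complex_of_real (sqrt 2) = 2"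
    by (simp flip: of_real_mult)
  have "(mu P J lam h (angle_point J e h I t \<theta>), 0) = (\<Sum>s\<in>signed_pairs UNIV. T s)"
    unfolding mu_def components_angle_point T_def z_def by (rule mu_of_eigen_terms)
  also have "\<dots> = (\<Sum>s\<in>active I. T s)"
  proof (rule sum.mono_neutral_right[OF finite_signed_pairs active_sub], rule ballI)
    fix s :: "'l \<times> int \<times> 'l \<times> int" assume s: "s \<in> signed_pairs UNIV - active I"
    obtain i \<epsilon> j \<delta> where s_eq: "s = (i, \<epsilon>, j, \<delta>)" by (cases s)
    then have "i \<notin> I \<or> j \<notin> I \<or> c_coeff lam h i \<epsilon> j \<delta> = 0"
      using s by (auto simp: active_def signed_pairs_def)
    moreover have "bvv 0 (eigenvec J e i \<epsilon>) (eigenvec J e j \<delta>) = (0 :: ('b, 'v) lie tensor3 cplx)"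
      using bvv_cscale(1)[of 0 0 "eigenvec J e i \<epsilon>" "eigenvec J e j \<delta>"] by (simp add: cscale_simps)
    ultimately show "T s = 0"
      unfolding T_def s_eq prod.case by (elim disjE) (simp_all add: z_out cscale_simps)
  qed
  also have "\<dots> = (\<Sum>s\<in>active I. cscale (amplitude t s * cis (cast_vec (exponent_of s) \<bullet> \<theta>)) (eigen_term s))"
  proof (rule sum.cong)
    fix s assume s: "s \<in> active I"
    obtain i \<epsilon> j \<delta> where s_eq: "s = (i, \<epsilon>, j, \<delta>)" by (cases s)
    have mem: "i \<in> I" "j \<in> I" "\<epsilon> \<in> {1, -1}" "\<delta> \<in> {1, -1}"
      using s by (auto simp: s_eq active_def signed_pairs_def)
    have "z i \<epsilon> * z j \<delta> = amplitude t s * cis (cast_vec (exponent_of s) \<bullet> \<theta>)"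
      unfolding z_in[OF mem(1,3)] z_in[OF mem(2,4)] times_divide_times_eq s2
      by (simp add: s_eq amplitude_def pair_exp_inner cis_mult[symmetric])
    then show "T s = cscale (amplitude t s * cis (cast_vec (exponent_of s) \<bullet> \<theta>)) (eigen_term s)"
      by (simp add: T_def s_eq)
  qed simp
  also have "\<dots> = (\<Sum>s\<in>active I. cscale (amplitude t (pair_of I (exponent_of s)) * cis (cast_vec (exponent_of s) \<bullet> \<theta>))
      (eigen_term (pair_of I (exponent_of s))))"
    by (rule sum.cong) (simp_all add: pair_of)
  also have "\<dots> = (\<Sum>\<alpha>\<in>exponents lam h I.
      cscale (amplitude t (pair_of I \<alpha>) * cis (cast_vec \<alpha> \<bullet> \<theta>)) (eigen_term (pair_of I \<alpha>)))"
    unfolding exponents_active sum.reindex[OF inj_active] by (simp add: o_def)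
  finally show ?thesis .
qed

text \<open>
  Nonzero vectors from the distinct summands of a direct family.
\<close>

lemma eigen_terms_independent:
  assumes "(\<Sum>\<alpha>\<in>exponents lam h I. cscale (y \<alpha>) (eigen_term (pair_of I \<alpha>))) = 0" "\<alpha> \<in> exponents lam h I"
  shows "y \<alpha> = 0"
proof -
  define X where "X s = (if s \<in> active I then cscale (y (exponent_of s)) (eigen_term s) else 0)" for s
  have mem: "\<forall>s\<in>signed_pairs UNIV. X s \<in> (case s of (i, \<epsilon>, j, \<delta>) \<Rightarrow> eigen_summand P J i \<epsilon> j \<delta>)"
  proof
    fix s :: "'l \<times> int \<times> 'l \<times> int" assume s: "s \<in> signed_pairs UNIV"
    obtain i \<epsilon> j \<delta> where s_eq: "s = (i, \<epsilon>, j, \<delta>)" by (cases s)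
    have "0 \<in> (eigen_summand P J i \<epsilon> j \<delta> :: ('b, 'v) lie tensor3 cplx set)"
      unfolding eigen_summand_def by (rule cplx.span_zero)
    then show "X s \<in> (case s of (i, \<epsilon>, j, \<delta>) \<Rightarrow> eigen_summand P J i \<epsilon> j \<delta>)"
      using eigen_term_summand[of i \<epsilon> j \<delta>] s by (simp add: X_def s_eq)
  qed
  have "(\<Sum>s\<in>signed_pairs UNIV. X s) = (\<Sum>s\<in>active I. cscale (y (exponent_of s)) (eigen_term s))"
    by (rule sum.mono_neutral_cong_right[OF finite_signed_pairs active_sub]) (auto simp: X_def)
  also have "\<dots> = (\<Sum>s\<in>active I. cscale (y (exponent_of s)) (eigen_term (pair_of I (exponent_of s))))"
    by (rule sum.cong) (simp_all add: pair_of)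
  also have "\<dots> = 0"
    using assms(1) unfolding exponents_active sum.reindex[OF inj_active] by (simp add: o_def)
  finally have "\<forall>s\<in>signed_pairs UNIV. X s = 0"
    using direct_family_eigen_summands mem unfolding direct_family_def by blast
  moreover have s: "pair_of I \<alpha> \<in> active I" "exponent_of (pair_of I \<alpha>) = \<alpha>"
    using pair_of_mem[OF assms(2)] by auto
  ultimately have "X (pair_of I \<alpha>) = 0"
    using active_sub by blast
  then have "cscale (y \<alpha>) (eigen_term (pair_of I \<alpha>)) = 0"
    unfolding X_def using s by simp
  then show ?thesis
    using eigen_term_nonzero[OF s(1)] by (simp add: cscale_eq_0_iff)
qed

end

section \<open>The toric structure of the angular map\<close>

text \<open>
  The vectors \<open>w \<alpha>\<close> span the same lines as the eigen terms, so passing to them only rescales the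
  coefficients.  Two adapted bases enter: one that always exists, for the invariants as such, and for
  each Smith reduction the one that it provides.  The rank formula holds for both, so both have the
  same \<open>q\<close>.
\<close>

theorem theoremB:
  fixes P :: "'l::{finite,linorder} \<Rightarrow> 'v::euclidean_space set"
    and J :: "'l \<Rightarrow> 'v \<Rightarrow> 'v"
    and lam :: "'l \<Rightarrow> 'b::euclidean_space dual"
    and e :: "'l \<Rightarrow> 'v"
    and h :: "'l \<Rightarrow> 'b"
    and I :: "'l set"
    and t :: "'l \<Rightarrow> real"
    and Y :: "('b, 'v) lie tensor3"
    and A L :: "(int^('l::{finite,linorder})) set"
    and K :: "('l \<Rightarrow> real set) set"
    and r :: "real^('l::{finite,linorder}) \<Rightarrow> ('b, 'v) lie tensor2"
    and F :: "real^('l::{finite,linorder}) \<Rightarrow> ('b, 'v) lie tensor3"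
    and w :: "int^('l::{finite,linorder}) \<Rightarrow> ('b, 'v) lie tensor3 cplx"
    and img :: "(int^('l::{finite,linorder}) \<Rightarrow> complex) set"
  assumes datum: "rotational_datum P J lam"
    and frame: "unit_frame P e"
    and marking: "positive_marking lam h"
    and t_pos: "\<And>l. l \<in> I \<Longrightarrow> t l > 0"
    and Y_def: "Y = (\<Sum>l\<in>I. t l *\<^sub>R E_vec J lam e h l)"
    and A_def: "A = exponents lam h I"
    and L_def: "L = L_lattice A"
    and K_def: "K = K_group I A"
    and r_def: "r = angle_point J e h I t"
    and F_def: "F = (\<lambda>\<theta>. mu P J lam h (r \<theta>))"
    and w: "scalar_frame J lam e h I w"
    and img_def: "img = frame_coords A w ((\<lambda>x. (mu P J lam h x, 0)) ` T_space P J lam e h Y)"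
  shows
    \<comment> \<open>identification of \<open>T\<^sub>Y\<close> with the torus\<close>
    "homeomorphic_map (torus_topology I) (top_of_set (T_space P J lam e h Y)) (on_torus I r) \<and>
     (\<forall>\<theta>. on_torus I r (torus_class I \<theta>) = r \<theta>) \<and>

     \<comment> \<open>marker-cancellation criterion\<close>
     (\<forall>i\<in>I. \<forall>j\<in>I. \<forall>\<epsilon>\<in>{1, -1}. \<forall>\<delta>\<in>{1, -1}. i < j \<longrightarrow>
        (pair_exp i \<epsilon> j \<delta> \<in> A \<longleftrightarrow>
           {i, j} \<in> marker_graph lam h \<and>
           (1 / lam j (h j)) *\<^sub>R h j \<noteq> of_int (\<epsilon> * \<delta>) *\<^sub>R ((1 / lam i (h i)) *\<^sub>R h i))) \<and>

     \<comment> \<open>Laurent monomial form\<close>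
     inj_on (\<lambda>(i, \<epsilon>, j, \<delta>). pair_exp i \<epsilon> j \<delta>) (signed_pairs (UNIV :: 'l set)) \<and>
     direct_family (signed_pairs UNIV)
       (\<lambda>(i, \<epsilon>, j, \<delta>). eigen_summand P J i \<epsilon> j \<delta> :: ('b, 'v) lie tensor3 cplx set) \<and>
     (\<exists>a.
        (\<forall>(i, \<epsilon>, j, \<delta>)\<in>signed_pairs I. pair_exp i \<epsilon> j \<delta> \<in> A \<longrightarrow>
           a (pair_exp i \<epsilon> j \<delta>) \<noteq> 0 \<and> a (pair_exp i \<epsilon> j \<delta>) \<in> eigen_summand P J i \<epsilon> j \<delta>) \<and>
        (\<forall>\<theta>. (F \<theta>, 0) = (\<Sum>\<alpha>\<in>A. cscale (s_power I (\<lambda>l. cis (\<theta> $ l)) \<alpha>) (a \<alpha>)))) \<and>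

     \<comment> \<open>(a)\<close>
     (\<forall>\<theta>. F differentiable at \<theta> \<and>
        dim (range (frechet_derivative F (at \<theta>))) = zrank L) \<and>
     vec.dim (vec.span (cast_vec ` A :: (rat^('l::{finite,linorder})) set)) = zrank L \<and>

     \<comment> \<open>(b), except for the shape of the image\<close>
     subgroup K (torus I) \<and>
     (\<forall>x\<in>carrier (torus I).
        {y \<in> carrier (torus I). on_torus I F y = on_torus I F x} = K #>\<^bsub>torus I\<^esub> x) \<and>
     (\<exists>f :: ('l \<Rightarrow> real set) set \<Rightarrow> ('b, 'v) lie tensor3 cplx.
        (\<forall>x\<in>carrier (torus I). f (K #>\<^bsub>torus I\<^esub> x) = (on_torus I F x, 0)) \<and>
        smooth_quotient_embedding I K f (X_space P \<times> X_space P)) \<and>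
     component_group ((torus I)\<lparr>carrier := K\<rparr>) (subtopology (torus_topology I) K)
       \<cong> pontryagin_dual (additive_group (L_sat I A) Mod L) \<and>

     (\<exists>\<kappa>.
        \<comment> \<open>the monomial form in scalar eigencoordinates\<close>
        \<kappa> \<in> carrier (cstar_power A) \<and>
        (\<forall>\<theta>. (F \<theta>, 0) = (\<Sum>\<alpha>\<in>A. cscale (\<kappa> \<alpha> * s_power I (\<lambda>l. cis (\<theta> $ l)) \<alpha>) (w \<alpha>))) \<and>

        \<comment> \<open>(b), shape of the image\<close>
        (\<exists>C. subgroup C (cstar_power A) \<and>
           top_group_isomorphic
             (torus {..<zrank L}) (torus_topology {..<zrank L})
             ((cstar_power A)\<lparr>carrier := C\<rparr>) (subtopology (cstar_power_topology A) C) \<and>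
           img = \<kappa> <#\<^bsub>cstar_power A\<^esub> C) \<and>

        \<comment> \<open>(c)\<close>
        (\<forall>f. (\<forall>\<alpha>\<in>A. Poly_Mapping.keys (f \<alpha>) \<subseteq> Zpow I) \<and>
             (\<forall>\<theta>. (F \<theta>, 0) =
                (\<Sum>\<alpha>\<in>A. cscale (s_eval I (f \<alpha>) (\<lambda>l. cis (\<theta> $ l))) (w \<alpha>))) \<longrightarrow>
             newton_polytope (f ` A) = convex hull (cast_vec ` A)) \<and>

        \<comment> \<open>(d)\<close>
        zariski_closure A img = binomial_torus A \<kappa> \<and>
        binomial_torus A \<kappa> = zero_locus A (lattice_binomial \<kappa> ` relation_lattice A) \<and>

        \<comment> \<open>(e)\<close>
        (\<forall>row_ix col_ix U W q d.
           bij_betw row_ix {..<card I} I \<and> bij_betw col_ix {..<card A} A \<and>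
           smith_reduction (exponent_matrix row_ix col_ix I A) U W q d \<longrightarrow>
             q = zrank L \<and>
             additive_group (L_sat I A) Mod L
               \<cong> product_group {..<q} (\<lambda>j. integer_mod_group (d j)) \<and>
             top_group_isomorphic
               ((torus I)\<lparr>carrier := K\<rparr>) (subtopology (torus_topology I) K)
               (torus {..<card I - q} \<times>\<times> product_group {..<q} (\<lambda>j. integer_mod_group (d j)))
               (prod_topology (torus_topology {..<card I - q})
                 (discrete_topology (carrier (product_group {..<q} (\<lambda>j. integer_mod_group (d j)))))) \<and>
             Z_basis {q..<card A} (column_relation col_ix W) (relation_lattice A) \<and>
             vanishing_ideal A (binomial_torus A \<kappa>) =
               Idl\<^bsub>laurent_ring A\<^esub> ((\<lambda>k. lattice_binomial \<kappa> (column_relation col_ix W k)) ` {q..<card A})))"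
proof -
  interpret rotational_frame P J lam e h
    using datum frame marking by (simp add: rotational_frame_def)
  have A_Zpow: "A \<subseteq> Zpow I" and finA: "finite A"
    using exponents_Zpow finite_exponents by (auto simp: A_def)
  define g where "g \<alpha> = eigen_term (pair_of I \<alpha>)" for \<alpha>
  define amp where "amp \<alpha> = amplitude t (pair_of I \<alpha>)" for \<alpha>
  have F_laurent: "(F \<theta>, 0) = (\<Sum>\<alpha>\<in>A. cscale (amp \<alpha> * cis (cast_vec \<alpha> \<bullet> \<theta>)) (g \<alpha>))" for \<theta>
    unfolding F_def r_def A_def amp_def g_def by (rule angular_map_laurent)
  have amp_nz: "amp \<alpha> \<noteq> 0" if "\<alpha> \<in> A" for \<alpha>
  proof -
    obtain i \<epsilon> j \<delta> where p: "pair_of I \<alpha> = (i, \<epsilon>, j, \<delta>)" by (cases "pair_of I \<alpha>")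
    have "i \<in> I" "j \<in> I"
      using pair_of_mem(1)[of \<alpha> I] that by (auto simp: A_def p active_def signed_pairs_def)
    then show ?thesis
      using t_pos by (fastforce simp: amp_def amplitude_def p)
  qed
  have "\<exists>z. z \<noteq> 0 \<and> w \<alpha> = cscale z (g \<alpha>)" if \<alpha>: "\<alpha> \<in> A" for \<alpha>
  proof -
    obtain i \<epsilon> j \<delta> where p: "pair_of I \<alpha> = (i, \<epsilon>, j, \<delta>)" by (cases "pair_of I \<alpha>")
    have mem: "(i, \<epsilon>, j, \<delta>) \<in> signed_pairs I" "c_coeff lam h i \<epsilon> j \<delta> \<noteq> 0" and \<alpha>_eq: "pair_exp i \<epsilon> j \<delta> = \<alpha>"
      using pair_of_mem[of \<alpha> I] \<alpha> by (auto simp: A_def p active_def)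
    show ?thesis
      using bspec[OF w[unfolded scalar_frame_def] mem(1)] mem(2) by (simp add: g_def p \<alpha>_eq)
  qed
  then obtain z where z: "\<And>\<alpha>. \<alpha> \<in> A \<Longrightarrow> z \<alpha> \<noteq> 0" "\<And>\<alpha>. \<alpha> \<in> A \<Longrightarrow> w \<alpha> = cscale (z \<alpha>) (g \<alpha>)"
    by metis
  \<comment> \<open>Rescale from the eigen terms to the prescribed vectors \<open>w \<alpha>\<close>.\<close>
  define \<kappa> where "\<kappa> = (\<lambda>\<alpha>\<in>A. amp \<alpha> / z \<alpha>)"
  have \<kappa>_mem: "\<kappa> \<in> carrier (cstar_power A)"
    using amp_nz z(1) by (auto simp: \<kappa>_def cstar_power_def cstar_group_def)
  have F_w: "(F \<theta>, 0) = (\<Sum>\<alpha>\<in>A. cscale (\<kappa> \<alpha> * cis (cast_vec \<alpha> \<bullet> \<theta>)) (w \<alpha>))" for \<theta>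
    unfolding F_laurent by (rule sum.cong) (simp_all add: \<kappa>_def z cscale_simps)
  have indep: "y \<alpha> = 0" if "(\<Sum>\<alpha>\<in>A. cscale (y \<alpha>) (w \<alpha>)) = 0" "\<alpha> \<in> A" for y \<alpha>
  proof -
    have "(\<Sum>\<alpha>\<in>A. cscale (y \<alpha> * z \<alpha>) (g \<alpha>)) = (\<Sum>\<alpha>\<in>A. cscale (y \<alpha>) (w \<alpha>))"
      by (rule sum.cong) (simp_all add: z cscale_simps)
    then have "y \<alpha> * z \<alpha> = 0"
      using eigen_terms_independent[of "\<lambda>\<alpha>. y \<alpha> * z \<alpha>" I \<alpha>] that by (simp add: A_def g_def)
    then show ?thesis
      using z(1)[OF that(2)] by simp
  qed
  obtain n q v x d where basis: "adapted_basis I A n q v x d"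
    using adapted_basis_exists[OF A_Zpow] .
  interpret monomial_map I A n q v x d w \<kappa> F
    unfolding monomial_map_def monomial_map_axioms_def
    using basis finA indep \<kappa>_mem F_w by blast
  have rank: "zrank L = q"
    unfolding L_def by (rule zrank_eq)
  have T: "T_space P J lam e h Y = range r"
    unfolding Y_def r_def by (rule T_space_eq) (rule t_pos)
  have s_pow: "s_power I (\<lambda>l. cis (\<theta> $ l)) \<alpha> = cis (cast_vec \<alpha> \<bullet> \<theta>)" if "\<alpha> \<in> A" for \<theta> \<alpha>
    using A_Zpow that by (intro s_power_cis) auto
  have F_X: "F \<theta> \<in> X_space P" for \<theta>
    unfolding F_def r_def mu_def components_angle_point by (rule mu_X_space) (rule plane_mem)
  have img: "img = range (\<lambda>\<theta> :: real^('l::{finite,linorder}). \<lambda>\<alpha>\<in>A. \<kappa> \<alpha> * cis (cast_vec \<alpha> \<bullet> \<theta>))"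
    unfolding img_def T image_image F_def[symmetric] using frame_coords_image by (simp add: F_def)

  have identification: "homeomorphic_map (torus_topology I) (top_of_set (T_space P J lam e h Y)) (on_torus I r)"
    "\<forall>\<theta>. on_torus I r (torus_class I \<theta>) = r \<theta>"
    unfolding Y_def r_def using T_space_homeomorphism[of I t] t_pos by simp_all
  have cancellation: "\<forall>i\<in>I. \<forall>j\<in>I. \<forall>\<epsilon>\<in>{1, -1}. \<forall>\<delta>\<in>{1, -1}. i < j \<longrightarrow>
      (pair_exp i \<epsilon> j \<delta> \<in> A \<longleftrightarrow>
         {i, j} \<in> marker_graph lam h \<and>
         (1 / lam j (h j)) *\<^sub>R h j \<noteq> of_int (\<epsilon> * \<delta>) *\<^sub>R ((1 / lam i (h i)) *\<^sub>R h i))"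
  proof (intro ballI impI)
    fix i j \<epsilon> \<delta> assume ij: "i \<in> I" "j \<in> I" "\<epsilon> \<in> {1, -1::int}" "\<delta> \<in> {1, -1::int}" "i < j"
    then have "(i, \<epsilon>, j, \<delta>) \<in> signed_pairs I"
      by (simp add: signed_pairs_def)
    from pair_exp_mem[OF this] marker_cancellation[OF ij(5,3,4)]
    show "pair_exp i \<epsilon> j \<delta> \<in> A \<longleftrightarrow> {i, j} \<in> marker_graph lam h \<and>
         (1 / lam j (h j)) *\<^sub>R h j \<noteq> of_int (\<epsilon> * \<delta>) *\<^sub>R ((1 / lam i (h i)) *\<^sub>R h i)"
      unfolding A_def by (rule trans)
  qed
  have laurent: "\<exists>a.
      (\<forall>(i, \<epsilon>, j, \<delta>)\<in>signed_pairs I. pair_exp i \<epsilon> j \<delta> \<in> A \<longrightarrow>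
         a (pair_exp i \<epsilon> j \<delta>) \<noteq> 0 \<and> a (pair_exp i \<epsilon> j \<delta>) \<in> eigen_summand P J i \<epsilon> j \<delta>) \<and>
      (\<forall>\<theta>. (F \<theta>, 0) = (\<Sum>\<alpha>\<in>A. cscale (s_power I (\<lambda>l. cis (\<theta> $ l)) \<alpha>) (a \<alpha>)))"
  proof (intro exI[of _ "\<lambda>\<alpha>. cscale (amp \<alpha>) (g \<alpha>)"] conjI allI)
    show "(F \<theta>, 0) = (\<Sum>\<alpha>\<in>A. cscale (s_power I (\<lambda>l. cis (\<theta> $ l)) \<alpha>) (cscale (amp \<alpha>) (g \<alpha>)))" for \<theta>
      unfolding F_laurent by (rule sum.cong) (simp_all add: s_pow cscale_simps mult.commute)
    have "cscale (amp (pair_exp i \<epsilon> j \<delta>)) (g (pair_exp i \<epsilon> j \<delta>)) \<noteq> 0 \<and>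
        cscale (amp (pair_exp i \<epsilon> j \<delta>)) (g (pair_exp i \<epsilon> j \<delta>)) \<in> eigen_summand P J i \<epsilon> j \<delta>"
      if s: "(i, \<epsilon>, j, \<delta>) \<in> signed_pairs I" and \<alpha>: "pair_exp i \<epsilon> j \<delta> \<in> A" for i j :: 'l and \<epsilon> \<delta>
    proof -
      have act: "(i, \<epsilon>, j, \<delta>) \<in> active I"
        using s \<alpha> pair_exp_mem[OF s] by (simp add: A_def active_def)
      then have "g (pair_exp i \<epsilon> j \<delta>) = eigen_term (i, \<epsilon>, j, \<delta>)"
        using pair_of[OF act] by (simp add: g_def)
      then show ?thesis
        using eigen_term_nonzero[OF act] amp_nz[OF \<alpha>] eigen_term_summand[of i \<epsilon> j \<delta>] act active_sub
        by (auto simp: cscale_eq_0_iff)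
    qed
    then show "\<forall>(i, \<epsilon>, j, \<delta>)\<in>signed_pairs I. pair_exp i \<epsilon> j \<delta> \<in> A \<longrightarrow>
         cscale (amp (pair_exp i \<epsilon> j \<delta>)) (g (pair_exp i \<epsilon> j \<delta>)) \<noteq> 0 \<and>
         cscale (amp (pair_exp i \<epsilon> j \<delta>)) (g (pair_exp i \<epsilon> j \<delta>)) \<in> eigen_summand P J i \<epsilon> j \<delta>"
      by blast
  qed
  have embedding: "\<exists>f :: ('l \<Rightarrow> real set) set \<Rightarrow> ('b, 'v) lie tensor3 cplx.
        (\<forall>x\<in>carrier (torus I). f (K #>\<^bsub>torus I\<^esub> x) = (on_torus I F x, 0)) \<and>
        smooth_quotient_embedding I K f (X_space P \<times> X_space P)"
  proof -
    have zero: "0 \<in> (X_space P :: ('b, 'v) lie tensor3 set)"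
      unfolding X_space_def by (rule span_zero)
    show ?thesis
      unfolding K_def by (rule quotient_embedding[OF F_X zero])
  qed
  have image: "\<exists>C. subgroup C (cstar_power A) \<and>
      top_group_isomorphic (torus {..<zrank L}) (torus_topology {..<zrank L})
        ((cstar_power A)\<lparr>carrier := C\<rparr>) (subtopology (cstar_power_topology A) C) \<and>
      img = \<kappa> <#\<^bsub>cstar_power A\<^esub> C"
    using character_image_torus[OF finA] image_translate unfolding img rank by metis
  have newton: "\<forall>f. (\<forall>\<alpha>\<in>A. Poly_Mapping.keys (f \<alpha>) \<subseteq> Zpow I) \<and>
      (\<forall>\<theta>. (F \<theta>, 0) = (\<Sum>\<alpha>\<in>A. cscale (s_eval I (f \<alpha>) (\<lambda>l. cis (\<theta> $ l))) (w \<alpha>))) \<longrightarrow>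
      newton_polytope (f ` A) = convex hull (cast_vec ` A)"
    using newton_polytope_monomials by blast
  have smith: "q' = zrank L \<and>
      additive_group (L_sat I A) Mod L \<cong> product_group {..<q'} (\<lambda>j. integer_mod_group (d' j)) \<and>
      top_group_isomorphic
        ((torus I)\<lparr>carrier := K\<rparr>) (subtopology (torus_topology I) K)
        (torus {..<card I - q'} \<times>\<times> product_group {..<q'} (\<lambda>j. integer_mod_group (d' j)))
        (prod_topology (torus_topology {..<card I - q'})
          (discrete_topology (carrier (product_group {..<q'} (\<lambda>j. integer_mod_group (d' j)))))) \<and>
      Z_basis {q'..<card A} (column_relation col_ix W) (relation_lattice A) \<and>
      vanishing_ideal A (binomial_torus A \<kappa>) =
        Idl\<^bsub>laurent_ring A\<^esub> ((\<lambda>k. lattice_binomial \<kappa> (column_relation col_ix W k)) ` {q'..<card A})"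
    if ix: "bij_betw row_ix {..<card I} I" "bij_betw col_ix {..<card A} A"
      and red: "smith_reduction (exponent_matrix row_ix col_ix I A) U W q' d'" for row_ix col_ix U W q' d'
  proof -
    obtain V W' where "smith_exponents I A row_ix col_ix U V W W' q' d'"
      using smith_exponents_exist[OF A_Zpow finA ix red] .
    then interpret S: smith_exponents I A row_ix col_ix U V W W' q' d' .
    interpret B: adapted_basis I A "card I" q' "S.col_vec_of V" "S.row_vec_of U" d'
      by (rule S.smith_adapted_basis)
    show ?thesis
      using B.zrank_eq B.L_sat_quotient B.K_isomorphic S.smith_relation_basis
        vanishing_ideal_generated[OF finA \<kappa>_mem _ S.smith_relation_basis]
      by (simp add: L_def K_def)
  qed
  show ?thesis
  proof (intro conjI)
    show "\<forall>\<theta>. F differentiable at \<theta> \<and> dim (range (frechet_derivative F (at \<theta>))) = zrank L"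
      using rank_derivative by (simp add: rank)
    show "vec.dim (vec.span (cast_vec ` A :: (rat^('l::{finite,linorder})) set)) = zrank L"
      by (simp only: rat_dim rank)
    show "subgroup K (torus I)"
      unfolding K_def by (rule subgroup_K_group[OF A_Zpow])
    show "\<forall>x\<in>carrier (torus I).
        {y \<in> carrier (torus I). on_torus I F y = on_torus I F x} = K #>\<^bsub>torus I\<^esub> x"
      unfolding K_def using fibres by blast
    show "component_group ((torus I)\<lparr>carrier := K\<rparr>) (subtopology (torus_topology I) K)
        \<cong> pontryagin_dual (additive_group (L_sat I A) Mod L)"
      unfolding K_def L_def by (rule component_group_dual)
    show "\<exists>\<kappa>. \<kappa> \<in> carrier (cstar_power A) \<and>
        (\<forall>\<theta>. (F \<theta>, 0) = (\<Sum>\<alpha>\<in>A. cscale (\<kappa> \<alpha> * s_power I (\<lambda>l. cis (\<theta> $ l)) \<alpha>) (w \<alpha>))) \<and>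
        (\<exists>C. subgroup C (cstar_power A) \<and>
           top_group_isomorphic
             (torus {..<zrank L}) (torus_topology {..<zrank L})
             ((cstar_power A)\<lparr>carrier := C\<rparr>) (subtopology (cstar_power_topology A) C) \<and>
           img = \<kappa> <#\<^bsub>cstar_power A\<^esub> C) \<and>
        (\<forall>f. (\<forall>\<alpha>\<in>A. Poly_Mapping.keys (f \<alpha>) \<subseteq> Zpow I) \<and>
             (\<forall>\<theta>. (F \<theta>, 0) =
                (\<Sum>\<alpha>\<in>A. cscale (s_eval I (f \<alpha>) (\<lambda>l. cis (\<theta> $ l))) (w \<alpha>))) \<longrightarrow>
             newton_polytope (f ` A) = convex hull (cast_vec ` A)) \<and>
        zariski_closure A img = binomial_torus A \<kappa> \<and>
        binomial_torus A \<kappa> = zero_locus A (lattice_binomial \<kappa> ` relation_lattice A) \<and>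
        (\<forall>row_ix col_ix U W q d.
           bij_betw row_ix {..<card I} I \<and> bij_betw col_ix {..<card A} A \<and>
           smith_reduction (exponent_matrix row_ix col_ix I A) U W q d \<longrightarrow>
             q = zrank L \<and>
             additive_group (L_sat I A) Mod L
               \<cong> product_group {..<q} (\<lambda>j. integer_mod_group (d j)) \<and>
             top_group_isomorphic
               ((torus I)\<lparr>carrier := K\<rparr>) (subtopology (torus_topology I) K)
               (torus {..<card I - q} \<times>\<times> product_group {..<q} (\<lambda>j. integer_mod_group (d j)))
               (prod_topology (torus_topology {..<card I - q})
                 (discrete_topology (carrier (product_group {..<q} (\<lambda>j. integer_mod_group (d j)))))) \<and>
             Z_basis {q..<card A} (column_relation col_ix W) (relation_lattice A) \<and>
             vanishing_ideal A (binomial_torus A \<kappa>) =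
               Idl\<^bsub>laurent_ring A\<^esub> ((\<lambda>k. lattice_binomial \<kappa> (column_relation col_ix W k)) ` {q..<card A}))"
    proof (intro exI[of _ \<kappa>] conjI allI impI)
      show "(F \<theta>, 0) = (\<Sum>\<alpha>\<in>A. cscale (\<kappa> \<alpha> * s_power I (\<lambda>l. cis (\<theta> $ l)) \<alpha>) (w \<alpha>))" for \<theta>
        unfolding F_w by (rule sum.cong) (simp_all add: s_pow)
      show "zariski_closure A img = binomial_torus A \<kappa>"
        unfolding img by (rule zariski_closure_translate[OF finA \<kappa>_mem])
      show "binomial_torus A \<kappa> = zero_locus A (lattice_binomial \<kappa> ` relation_lattice A)"
        by (rule binomial_torus_zero_locus[OF finA])
    qed (use \<kappa>_mem image newton smith in blast)+
  qed (fact identification cancellation inj_on_exponent direct_family_eigen_summands laurent embedding)+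
qed

end
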